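(* Let $d\in\{2,3\}$ and $Q=(0,1)^d$. Let $\mathcal{C}=\{c\}$ where $c$ is one of the corners of $Q$; let $\mathcal{E}$ be the set of edges of $Q$ adjacent to $c$ if $d=3$, and $\mathcal{E}=\emptyset$ if $d=2$. Let $C_f,A_f>0$ and let $\underline{\gamma}=\{\gamma_c\}$ with $\gamma_c>1$ if $d=2$, respectively $\underline{\gamma}=\{\gamma_c,\gamma_e:e\in\mathcal{E}\}$ with $\gamma_c>3/2$ and $\gamma_e>1$ for all $e\in\mathcal{E}$ if $d=3$. Then for every $f\in\mathcal{J}^\varpi_{\underline{\gamma}}(Q;\mathcal{C},\mathcal{E};C_f,A_f)$ and every $0<\epsilon<1$ there exists a ReLU neural network $\Phi_{\epsilon,f}$ such that $\|f-\mathrm{R}(\Phi_{\epsilon,f})\|_{H^1(Q)}\le\epsilon$. In addition, as $\epsilon\to0$: $\|\mathrm{R}(\Phi_{\epsilon,f})\|_{L^\infty(Q)}=\mathcal{O}(|\log\epsilon|^{2d})$, $\mathrm{size}(\Phi_{\epsilon,f})=\mathcal{O}(|\log\epsilon|^{2d+1})$ and $\mathrm{depth}(\Phi_{\epsilon,f})=\mathcal{O}(|\log\epsilon|\log(|\log\epsilon|))$.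
   Context: Neural networks: a NN $\Phi$ with input dimension $d$ and $L$ layers is $((A_1,b_1),\dots,(A_L,b_L))$, $A_\ell\in\mathbb{R}^{N_\ell\times N_{\ell-1}}$, $b_\ell\in\mathbb{R}^{N_\ell}$, $N_0=d$; its realization $\mathrm{R}(\Phi)$ maps $x$ to $x_L$ with $x_0=x$, $x_\ell=\varrho(A_\ell x_{\ell-1}+b_\ell)$ ($\ell<L$), $x_L=A_Lx_{L-1}+b_L$, $\varrho(t)=\max\{0,t\}$ componentwise; $\mathrm{depth}(\Phi)=L$, $\mathrm{size}(\Phi)$ = number of nonzero entries of all $A_\ell,b_\ell$. Weighted analytic class: for $c\in\mathcal{C}$, $e\in\mathcal{E}$ let $r_c(x)=|x-c|$, $r_e(x)=\mathrm{dist}(x,e)$, $\rho_{ce}=r_e/r_c$. Fix small $\hat\varepsilon>0$. If $d=3$: $\Omega_e=\{x\in Q:r_e<\hat\varepsilon, r_c>\hat\varepsilon\ \forall c\}$, $\Omega_c=\{x\in Q:r_c<\hat\varepsilon,\rho_{ce}>\hat\varepsilon\ \forall e\}$, $\Omega_{ce}=\{x\in Q:r_c<\hat\varepsilon,\rho_{ce}<\hat\varepsilon\}$; if $d=2$: $\Omega_c=\{x\in Q:r_c<\hat\varepsilon\}$. $\Omega_0=Q$ minus the closure of the union of all these sets. For an edge $e$ and $\alpha\in\mathbb{N}_0^3$, $\alpha_\parallel$ keeps only the component in the direction of $e$, $\alpha_\perp=\alpha-\alpha_\parallel$; $(x)_+=\max\{0,x\}$. $\mathcal{J}^\varpi_{\underline{\gamma}}(Q;\mathcal{C},\mathcal{E};C,A)$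 is the set of $v\in L^2(Q)$ such that for all $k\in\mathbb{N}_0$: $\sum_{|\alpha|=k}\|\partial^\alpha v\|_{L^2(\Omega_0)}\le CA^kk!$, $\sum_{|\alpha|=k}\|r_c^{(|\alpha|-\gamma_c)_+}\partial^\alpha v\|_{L^2(\Omega_c)}\le CA^kk!$ ($c\in\mathcal{C}$), $\sum_{|\alpha|=k}\|r_e^{(|\alpha_\perp|-\gamma_e)_+}\partial^\alpha v\|_{L^2(\Omega_e)}\le CA^kk!$ ($e\in\mathcal{E}$), $\sum_{|\alpha|=k}\|r_c^{(|\alpha|-\gamma_c)_+}\rho_{ce}^{(|\alpha_\perp|-\gamma_e)_+}\partial^\alpha v\|_{L^2(\Omega_{ce})}\le CA^kk!$ ($c\in\mathcal{C}$, $e\in\mathcal{E}$ abutting $c$). *)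

theory Defs
  imports "HOL-Analysis.Analysis" "HOL-Library.Landau_Symbols"
begin

definition cube :: "(real ^ 'n::finite) set" where
  "cube = {x. \<forall>i. 0 < x $ i \<and> x $ i < 1}"

definition is_corner :: "real ^ 'n::finite \<Rightarrow> bool" where
  "is_corner c \<longleftrightarrow> (\<forall>i. c $ i = 0 \<or> c $ i = 1)"

definition edge :: "real ^ 'n::finite \<Rightarrow> 'n \<Rightarrow> (real ^ 'n) set" where
  "edge c k = {y. (\<forall>j. j \<noteq> k \<longrightarrow> y $ j = c $ j) \<and> 0 \<le> y $ k \<and> y $ k \<le> 1}"

text \<open>Edges abutting the corner (indexed by their direction): all directions if d = 3,
  none if d = 2.\<close>
definition edge_dirs :: "'n::finite set" where
  "edge_dirs = (if CARD('n) = 3 then UNIV else {})"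

definition r_c :: "real ^ 'n::finite \<Rightarrow> real ^ 'n \<Rightarrow> real" where
  "r_c c x = dist x c"

definition r_e :: "real ^ 'n::finite \<Rightarrow> 'n \<Rightarrow> real ^ 'n \<Rightarrow> real" where
  "r_e c k x = infdist x (edge c k)"

definition rho_ce :: "real ^ 'n::finite \<Rightarrow> 'n \<Rightarrow> real ^ 'n \<Rightarrow> real" where
  "rho_ce c k x = r_e c k x / r_c c x"

definition Omega_e :: "real \<Rightarrow> real ^ 'n::finite \<Rightarrow> 'n \<Rightarrow> (real ^ 'n) set" where
  "Omega_e eh c k = {x \<in> cube. r_e c k x < eh \<and> r_c c x > eh}"

definition Omega_c :: "real \<Rightarrow> real ^ 'n::finite \<Rightarrow> (real ^ 'n) set" where
  "Omega_c eh c = (if CARD('n) = 3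
     then {x \<in> cube. r_c c x < eh \<and> (\<forall>k\<in>edge_dirs. rho_ce c k x > eh)}
     else {x \<in> cube. r_c c x < eh})"

definition Omega_ce :: "real \<Rightarrow> real ^ 'n::finite \<Rightarrow> 'n \<Rightarrow> (real ^ 'n) set" where
  "Omega_ce eh c k = {x \<in> cube. r_c c x < eh \<and> rho_ce c k x < eh}"

definition Omega_0 :: "real \<Rightarrow> real ^ 'n::finite \<Rightarrow> (real ^ 'n) set" where
  "Omega_0 eh c = cube - closure (Omega_c eh c \<union> (\<Union>k\<in>edge_dirs. Omega_e eh c k \<union> Omega_ce eh c k))"

definition dpart :: "'n::finite \<Rightarrow> (real ^ 'n \<Rightarrow> real) \<Rightarrow> real ^ 'n \<Rightarrow> real" where
  "dpart i f x = deriv (\<lambda>t. f (x + t *\<^sub>R axis i 1)) 0"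

fun dparts :: "'n::finite list \<Rightarrow> (real ^ 'n \<Rightarrow> real) \<Rightarrow> real ^ 'n \<Rightarrow> real" where
  "dparts [] f = f"
| "dparts (i # ds) f = dpart i (dparts ds f)"

text \<open>Multi-indices are functions \<open>'n \<Rightarrow> nat\<close>; their order is the sum of the entries.\<close>
definition mi_abs :: "('n::finite \<Rightarrow> nat) \<Rightarrow> nat" where
  "mi_abs \<alpha> = (\<Sum>i\<in>UNIV. \<alpha> i)"

definition unit_mi :: "'n::finite \<Rightarrow> 'n \<Rightarrow> nat" where
  "unit_mi i = (\<lambda>j. if j = i then 1 else 0)"

definition test_fun :: "(real ^ 'n::finite) set \<Rightarrow> (real ^ 'n \<Rightarrow> real) \<Rightarrow> bool" where
  "test_fun U \<phi> \<longleftrightarrow> (\<forall>ds x. dparts ds \<phi> differentiable (at x))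
      \<and> compact (closure {x. \<phi> x \<noteq> 0}) \<and> closure {x. \<phi> x \<noteq> 0} \<subseteq> U"

definition loc_int :: "(real ^ 'n::finite) set \<Rightarrow> (real ^ 'n \<Rightarrow> real) \<Rightarrow> bool" where
  "loc_int U g \<longleftrightarrow> g \<in> borel_measurable lborel
      \<and> (\<forall>K. compact K \<and> K \<subseteq> U \<longrightarrow> set_integrable lborel K g)"

definition weak_deriv :: "(real ^ 'n::finite) set \<Rightarrow> ('n \<Rightarrow> nat) \<Rightarrow> (real ^ 'n \<Rightarrow> real)
    \<Rightarrow> (real ^ 'n \<Rightarrow> real) \<Rightarrow> bool" where
  "weak_deriv U \<alpha> v g \<longleftrightarrow> loc_int U v \<and> loc_int U g \<and>
     (\<forall>\<phi> ds. test_fun U \<phi> \<and> (\<forall>i. count (mset ds) i = \<alpha> i) \<longrightarrow>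
        (LINT x:U|lborel. v x * dparts ds \<phi> x) = (-1) ^ mi_abs \<alpha> * (LINT x:U|lborel. g x * \<phi> x))"

definition sqL2 :: "(real ^ 'n::finite) set \<Rightarrow> (real ^ 'n \<Rightarrow> real) \<Rightarrow> ennreal" where
  "sqL2 \<Omega> g = (\<integral>\<^sup>+ x. indicator \<Omega> x * ennreal ((g x)\<^sup>2) \<partial>lborel)"

definition L2n :: "(real ^ 'n::finite) set \<Rightarrow> (real ^ 'n \<Rightarrow> real) \<Rightarrow> real" where
  "L2n \<Omega> g = sqrt (enn2real (sqL2 \<Omega> g))"

definition wbound :: "real \<Rightarrow> real \<Rightarrow> (real ^ 'n::finite) set \<Rightarrow> (('n \<Rightarrow> nat) \<Rightarrow> real ^ 'n \<Rightarrow> real)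
    \<Rightarrow> (('n \<Rightarrow> nat) \<Rightarrow> real ^ 'n \<Rightarrow> real) \<Rightarrow> bool" where
  "wbound C A \<Omega> w D \<longleftrightarrow> (\<forall>k::nat.
     (\<forall>\<alpha>. mi_abs \<alpha> = k \<longrightarrow> sqL2 \<Omega> (\<lambda>x. w \<alpha> x * D \<alpha> x) < \<infinity>) \<and>
     (\<Sum>\<alpha>\<in>{\<alpha>. mi_abs \<alpha> = k}. L2n \<Omega> (\<lambda>x. w \<alpha> x * D \<alpha> x)) \<le> C * A ^ k * fact k)"

definition J_class :: "real \<Rightarrow> real ^ 'n::finite \<Rightarrow> real \<Rightarrow> ('n \<Rightarrow> real) \<Rightarrow> real \<Rightarrow> real
    \<Rightarrow> (real ^ 'n \<Rightarrow> real) set" where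
  "J_class eh c \<gamma>c \<gamma>e C A = {v.
     v \<in> borel_measurable lborel \<and> sqL2 cube v < \<infinity> \<and>
     (\<exists>D. (\<forall>\<alpha>. weak_deriv cube \<alpha> v (D \<alpha>)) \<and>
        wbound C A (Omega_0 eh c) (\<lambda>\<alpha> x. 1) D \<and>
        wbound C A (Omega_c eh c) (\<lambda>\<alpha> x. r_c c x powr max 0 (real (mi_abs \<alpha>) - \<gamma>c)) D \<and>
        (\<forall>k\<in>edge_dirs.
           wbound C A (Omega_e eh c k)
             (\<lambda>\<alpha> x. r_e c k x powr max 0 (real (mi_abs \<alpha> - \<alpha> k) - \<gamma>e k)) D \<and>
           wbound C A (Omega_ce eh c k)
             (\<lambda>\<alpha> x. r_c c x powr max 0 (real (mi_abs \<alpha>) - \<gamma>c)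
                    * rho_ce c k x powr max 0 (real (mi_abs \<alpha> - \<alpha> k) - \<gamma>e k)) D))}"

definition H1_le :: "(real ^ 'n::finite \<Rightarrow> real) \<Rightarrow> real \<Rightarrow> bool" where
  "H1_le u \<epsilon> \<longleftrightarrow> (\<exists>g. (\<forall>i. weak_deriv cube (unit_mi i) u (g i)) \<and>
      sqL2 cube u + (\<Sum>i\<in>UNIV. sqL2 cube (g i)) \<le> ennreal (\<epsilon>\<^sup>2))"

text \<open>A network is a list of layers (A_l, b_l), A_l given as a list of rows.\<close>
type_synonym nn = "(real list list \<times> real list) list"

definition relu :: "real \<Rightarrow> real" where
  "relu t = max 0 t"

definition matvec :: "real list list \<Rightarrow> real list \<Rightarrow> real list" where
  "matvec A x = map (\<lambda>row. sum_list (map2 (*) row x)) A"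

fun nn_wf_from :: "nat \<Rightarrow> nn \<Rightarrow> bool" where
  "nn_wf_from n [] = False"
| "nn_wf_from n [(A, b)] = (length A = 1 \<and> length b = 1 \<and> (\<forall>row\<in>set A. length row = n))"
| "nn_wf_from n ((A, b) # L) = (length b = length A \<and> (\<forall>row\<in>set A. length row = n)
      \<and> nn_wf_from (length A) L)"

definition nn_wf :: "nat \<Rightarrow> nn \<Rightarrow> bool" where
  "nn_wf d \<Phi> = nn_wf_from d \<Phi>"

fun nn_eval :: "nn \<Rightarrow> real list \<Rightarrow> real list" where
  "nn_eval [] x = x"
| "nn_eval [(A, b)] x = map2 (+) (matvec A x) b"
| "nn_eval ((A, b) # L) x = nn_eval L (map relu (map2 (+) (matvec A x) b))"

definition coord_enum :: "nat \<Rightarrow> 'n::finite" where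
  "coord_enum = (SOME e. bij_betw e {..<CARD('n)} UNIV)"

definition vec_to_list :: "real ^ 'n::finite \<Rightarrow> real list" where
  "vec_to_list x = map (\<lambda>k. x $ coord_enum k) [0..<CARD('n)]"

definition nn_real :: "nn \<Rightarrow> real ^ 'n::finite \<Rightarrow> real" where
  "nn_real \<Phi> x = hd (nn_eval \<Phi> (vec_to_list x))"

definition nn_depth :: "nn \<Rightarrow> nat" where
  "nn_depth \<Phi> = length \<Phi>"

definition nn_size :: "nn \<Rightarrow> nat" where
  "nn_size \<Phi> = (\<Sum>(A, b)\<leftarrow>\<Phi>. length (filter (\<lambda>a. a \<noteq> 0) (concat A))
                               + length (filter (\<lambda>a. a \<noteq> 0) b))"

end

theory Submission
 imports Defs "HOL-Computational_Algebra.Polynomial"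
begin

text \<open>The weighted bounds turn \<open>f\<close> into a smooth function \<open>H\<close> of the distances \<open>y $ j\<close> to the faces
 through \<open>c\<close>: Sobolev embeddings on boxes of size comparable to these distances give derivatives of order
 \<open>k\<close> bounded by \<open>C * A ^ k * fact k\<close> times \<open>\<Prod>j. (1 / y $ j) ^ (al j + 1)\<close>, and a gradient with an integrable
 singularity. On geometric meshes \<open>sg ^ m\<close> a partition of unity times Taylor polynomials then
 converges exponentially. The resulting products of hats and ramps are emulated by networks built from the
 sawtooth squaring unit, applied to the clamped distances \<open>max (y $ j) (sg ^ l)\<close>; the clamping only costs
 an exponentially small error, as the singular weight is square integrable. Size and depth come from
 computing all univariate powers by repeated doubling before forming the tensor products.\<close>

text \<open>Two regularity bounds of different quality are needed. The crude one, for all orders,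
  loses a full power of every distance; on a mesh reaching down to \<open>sg ^ l\<close> this costs
  only \<open>(1 / sg) ^ (l * d)\<close> in dimension d, which a Taylor degree proportional to l
  beats. The layer below \<open>sg ^ l\<close>, where nothing is approximated, needs a sharp one:
  second derivatives are bounded with the exponents \<gamma>, and integrating them along rays to the
  centre of the cube leaves a gradient of size (y_a y_b)^(-s) with s < 1/2. All approximation errors
  are measured in the sup norm and the Lipschitz seminorm together, since this pair passes through
  products and through the clamping; the Sobolev norm enters only at the end, through difference
  quotients. With N of order |log \<epsilon>| there are of order N mesh levels and N degrees per
  coordinate, hence N^(2d) tensor products, and an approximate multiplication takes of order N
  weights and layers; about log N doubling stages then give the depth.\<close>

section \<open>Smooth bumps and functions with vanishing box integrals\<close>

definition expinv :: "real poly => real => real" where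
 "expinv p t = (if t > 0 then poly p (1 / t) * exp (- (1 / t)) else 0)"

lemma poly_times_exp_minus_tendsto_0:
 fixes p :: "real poly"
 shows "((%z. poly p z * exp (- z)) \<longlongrightarrow> 0) at_top"
proof -
 have "((%z. \<Sum>i\<le>degree p. coeff p i * (z ^ i / exp z)) \<longlongrightarrow> (\<Sum>i\<le>degree p. coeff p i * 0)) at_top"
  by (intro tendsto_sum tendsto_mult tendsto_const tendsto_power_div_exp_0)
 moreover have "(%z. \<Sum>i\<le>degree p. coeff p i * (z ^ i / exp z)) = (%z. poly p z * exp (- z))"
  by (auto simp: poly_altdef sum_divide_distrib exp_minus field_simps)
 ultimately show ?thesis by simp
qed

text \<open>With z = 1/t one has d/dt = - z^2 d/dz, so p(z) exp(-z) turns into a function of the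
  same form with polynomial z^2 (p - p'). At t = 0 the exponential beats every polynomial, and both
  one-sided quotients tend to 0.\<close>

lemma expinv_has_derivative:
 "(expinv p has_real_derivative expinv ([:0,0,1:] * (p - pderiv p)) t) (at t)"
proof -
 consider "t > 0" | "t < 0" | "t = 0" by linarith
 then show ?thesis
 proof cases
  case 1
  have "((%t. poly p (1 / t) * exp (- (1 / t))) has_real_derivative
  expinv ([:0,0,1:] * (p - pderiv p)) t) (at t)"
  using 1 by (auto intro!: derivative_eq_intros DERIV_chain2[OF poly_DERIV]
  simp: expinv_def field_simps power2_eq_square)
  then show ?thesis
  apply (rule has_field_derivative_transform_within_open[where S="{0<..}"])
  using 1 by (auto simp: expinv_def)
 next
  case 2
  have "((%t. 0) has_real_derivative expinv ([:0,0,1:] * (p - pderiv p)) t) (at t)"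
  using 2 by (simp add: expinv_def)
  then show ?thesis
  apply (rule has_field_derivative_transform_within_open[where S="{..<0}"])
  using 2 by (auto simp: expinv_def)
 next
  case 3
  have "((%h. expinv p h / h) \<longlongrightarrow> 0) (at_right 0)"
  proof -
  have "((%z. poly ([:0,1:] * p) z * exp (- z)) \<longlongrightarrow> 0) at_top"
  by (rule poly_times_exp_minus_tendsto_0)
  then have "((%h. poly ([:0,1:] * p) (inverse h) * exp (- inverse h)) \<longlongrightarrow> 0) (at_right 0)"
  by (rule filterlim_compose[OF _ filterlim_inverse_at_top_right])
  moreover have "eventually (%h::real. poly ([:0,1:] * p) (inverse h) * exp (- inverse h) = expinv p h / h) (at_right 0)"
  by (rule eventually_at_right_less[THEN eventually_mono])
  (simp add: expinv_def divide_simps)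
  ultimately show ?thesis by (simp add: filterlim_cong)
  qed
  moreover have "((%h. expinv p h / h) \<longlongrightarrow> 0) (at_left 0)"
  by (rule tendsto_eventually) (auto simp: eventually_at_filter expinv_def)
  ultimately have "((%h. expinv p h / h) \<longlongrightarrow> 0) (at 0)"
  by (simp add: filterlim_split_at)
  then show ?thesis using 3 by (simp add: DERIV_def expinv_def)
 qed
qed

text \<open>Phrased through iterates of \<open>deriv\<close> because \<open>dpart\<close> is itself
  a \<open>deriv\<close>; iterated partial derivatives of tensor products then come out
  literally.\<close>

definition smooth1 :: "(real => real) => bool" where
 "smooth1 f \<longleftrightarrow> (ALL k t. ((deriv ^^ k) f has_real_derivative (deriv ^^ Suc k) f t) (at t))"

text \<open>Avoids formulas for the k-th derivative: it is enough to exhibit a set of functions that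
  is closed under differentiation.\<close>

lemma smooth1I:
 assumes "f \<in> S" "!!g. g \<in> S ==> \<exists>g'\<in>S. ALL t. (g has_real_derivative g' t) (at t)"
 shows "smooth1 f"
proof -
 have *: "deriv g \<in> S & (ALL t. (g has_real_derivative deriv g t) (at t))" if "g \<in> S" for g
 proof -
  from assms(2)[OF that] obtain g' where g': "g' \<in> S" "ALL t. (g has_real_derivative g' t) (at t)"
  by blast
  then have "deriv g = g'" by (auto intro: DERIV_imp_deriv)
  then show ?thesis using g' by simp
 qed
 have "(deriv ^^ k) f \<in> S" for k
  by (induction k) (use assms(1) * in auto)
 with * show ?thesis unfolding smooth1_def by auto
qed

text \<open>\<open>n\<close> is a steepness: for fixed t strictly between a and b both factors tend
  to 1 as n grows, so the bumps converge to the indicator of the open interval while staying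
  smooth.\<close>

definition bump1 :: "real => real => real => real => real" where
 "bump1 n a b t = expinv 1 (n * (t - a)) * expinv 1 (n * (b - t))"

lemma smooth1_bump1: "smooth1 (bump1 n a b)"
proof (rule smooth1I)
 \<comment> \<open>Sums over lists of triples (p, q, c): the product rule turns each term into two
   terms of the same kind, so the range of \<open>?F\<close> is closed under
   differentiation.\<close>
 let ?F = "%L t. \<Sum>(p,q,c)\<leftarrow>L. c * expinv p (n * (t - a)) * expinv q (n * (b - t))"
 have "bump1 n a b = ?F [(1,1,1)]" by (auto simp: bump1_def)
 then show "bump1 n a b \<in> range ?F" by blast
 fix g assume "g \<in> range ?F"
 then obtain L where g: "g = ?F L" by auto
 define d where "d p = [:0,0,1:] * (p - pderiv p)" for p :: "real poly"
 define L' where "L' = concat (map (%(p,q,c). [(d p, q, c * n), (p, d q, - (c * n))]) L)"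
 have "(?F L has_real_derivative ?F L' t) (at t)" for t
  unfolding L'_def
 proof (induction L)
  case Nil
  then show ?case by simp
 next
  case (Cons x L)
  obtain p q c where x: "x = (p,q,c)" by (cases x) auto
  have "((%t. expinv p (n * (t - a))) has_real_derivative expinv (d p) (n * (t - a)) * n) (at t)"
  unfolding d_def by (rule DERIV_chain2[OF expinv_has_derivative]) (auto intro!: derivative_eq_intros)
  moreover have "((%t. expinv q (n * (b - t))) has_real_derivative expinv (d q) (n * (b - t)) * (- n)) (at t)"
  unfolding d_def by (rule DERIV_chain2[OF expinv_has_derivative]) (auto intro!: derivative_eq_intros)
  ultimately show ?case using Cons
  by (auto simp: x intro!: derivative_eq_intros)
 qed
 then show "\<exists>g'\<in>range ?F. ALL t. (g has_real_derivative g' t) (at t)"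
  unfolding g by (intro bexI[of _ "?F L'"]) auto
qed

lemma bump1_bounds: "0 <= bump1 n a b t" "bump1 n a b t <= 1"
proof -
 have *: "0 <= expinv 1 s & expinv 1 s <= 1" for s by (auto simp: expinv_def)
 show "0 <= bump1 n a b t" "bump1 n a b t <= 1"
  unfolding bump1_def using * by (auto intro!: mult_le_one)
qed

lemma bump1_eq_0: "n > 0 ==> \<not> (a < t & t < b) ==> bump1 n a b t = 0"
 by (auto simp: bump1_def expinv_def zero_less_mult_iff)

lemma bump1_tendsto:
 "(%n. bump1 (real (Suc n)) a b t) \<longlonglongrightarrow> indicator {a<..<b} t"
proof (cases "a < t & t < b")
 case True
 have "(%n. exp (- (1 / (t - a)) * (1 / real (Suc n))) * exp (- (1 / (b - t)) * (1 / real (Suc n))))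
  \<longlonglongrightarrow> exp (- (1 / (t - a)) * 0) * exp (- (1 / (b - t)) * 0)"
  using LIMSEQ_inverse_real_of_nat unfolding inverse_eq_divide by (intro tendsto_intros)
 moreover have "(%n. exp (- (1 / (t - a)) * (1 / real (Suc n))) * exp (- (1 / (b - t)) * (1 / real (Suc n))))
  = (%n. bump1 (real (Suc n)) a b t)"
  using True by (auto simp: bump1_def expinv_def zero_less_mult_iff mult.commute)
 ultimately show ?thesis using True by simp
next
 case False
 then have "bump1 (real (Suc n)) a b t = 0" for n by (intro bump1_eq_0) auto
 then show ?thesis using False by (auto simp: indicator_def)
qed

lemma prod_remove_axis:
 fixes g :: "'n::finite => real => real" and x :: "real ^ 'n"
 shows "(\<Prod>j\<in>UNIV. g j ((x + t *\<^sub>R axis i 1) $ j)) = g i (x $ i + t) * (\<Prod>j\<in>UNIV - {i}. g j (x $ j))"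
 by (subst prod.remove[of _ i]) (auto simp: axis_def intro!: prod.cong)

text \<open>Each \<open>dpart i\<close> acts on the i-th factor alone, so only the multiplicities in
  \<open>ds\<close> matter, not its order.\<close>

lemma dparts_tensor:
 fixes f :: "'n::finite => real => real"
 assumes "!!i. smooth1 (f i)"
 shows "dparts ds (%x. \<Prod>i\<in>UNIV. f i (x $ i)) = (%x. \<Prod>i\<in>UNIV. (deriv ^^ count_list ds i) (f i) (x $ i))"
proof (induction ds)
 case Nil
 then show ?case by simp
next
 case (Cons i ds)
 show ?case
 proof (rule ext)
  fix x :: "real ^ 'n"
  let ?g = "%j. (deriv ^^ count_list ds j) (f j)"
  have "((%t. ?g i (x $ i + t)) has_real_derivative (deriv ^^ Suc (count_list ds i)) (f i) (x $ i) * 1) (at 0)"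
  proof (rule DERIV_chain2[where g = "%t. x $ i + t" and f = "?g i" and x = 0])
  show "(?g i has_real_derivative (deriv ^^ Suc (count_list ds i)) (f i) (x $ i)) (at (x $ i + 0))"
  using assms unfolding smooth1_def by simp
  qed (auto intro!: derivative_eq_intros)
  then have "((%t. ?g i (x $ i + t) * (\<Prod>j\<in>UNIV - {i}. ?g j (x $ j))) has_real_derivative
  (deriv ^^ Suc (count_list ds i)) (f i) (x $ i) * 1 * (\<Prod>j\<in>UNIV - {i}. ?g j (x $ j))) (at 0)"
  by (rule DERIV_cmult_right)
  then have "((%t. \<Prod>j\<in>UNIV. ?g j ((x + t *\<^sub>R axis i 1) $ j)) has_real_derivative
  (deriv ^^ Suc (count_list ds i)) (f i) (x $ i) * (\<Prod>j\<in>UNIV - {i}. ?g j (x $ j))) (at 0)"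
  unfolding prod_remove_axis[where g = ?g] mult_1_right .
  then have "dparts (i # ds) (%x. \<Prod>i\<in>UNIV. f i (x $ i)) x =
  (deriv ^^ Suc (count_list ds i)) (f i) (x $ i) * (\<Prod>j\<in>UNIV - {i}. ?g j (x $ j))"
  unfolding dparts.simps dpart_def Cons by (rule DERIV_imp_deriv)
  also have "... = (\<Prod>j\<in>UNIV. (deriv ^^ count_list (i # ds) j) (f j) (x $ j))"
  by (subst (2) prod.remove[of _ i]) (auto intro!: prod.cong)
  finally show "dparts (i # ds) (%x. \<Prod>i\<in>UNIV. f i (x $ i)) x = (\<Prod>j\<in>UNIV. (deriv ^^ count_list (i # ds) j) (f j) (x $ j))" .
 qed
qed

definition bump :: "real => real ^ 'n::finite => real ^ 'n => real ^ 'n => real" where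
 "bump n a b x = (\<Prod>i\<in>UNIV. bump1 n (a $ i) (b $ i) (x $ i))"

lemma differentiable_prod_finite:
 fixes f :: "'i => 'a::real_normed_vector => real"
 assumes "finite I" "!!i. i \<in> I ==> f i differentiable (at x)"
 shows "(%x. \<Prod>i\<in>I. f i x) differentiable (at x)"
 using assms
proof (induction I rule: finite_induct)
 case empty
 then show ?case by simp
next
 case (insert i I)
 then have "(%x. f i x * (\<Prod>i\<in>I. f i x)) differentiable (at x)"
  by (intro differentiable_mult) auto
 then show ?case using insert by simp
qed

lemma bump_bounds: "0 <= bump n a b x" "bump n a b x <= 1"
 unfolding bump_def by (auto intro!: prod_nonneg prod_le_1 simp: bump1_bounds)

lemma bump_eq_0: "n > 0 ==> x ~: box a b ==> bump n a b x = 0"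
 unfolding bump_def by (auto simp: mem_box_cart intro: bump1_eq_0)

lemma test_fun_bump:
 fixes a b :: "real ^ 'n::finite"
 assumes "n > 0" "cbox a b <= U"
 shows "test_fun U (bump n a b)"
proof -
 have d: "dparts ds (bump n a b) differentiable (at x)" for ds x
 proof -
  have "dparts ds (bump n a b) = (%x. \<Prod>i\<in>UNIV. (deriv ^^ count_list ds i) (bump1 n (a $ i) (b $ i)) (x $ i))"
  unfolding bump_def by (rule dparts_tensor) (rule smooth1_bump1)
  moreover have "(%x. \<Prod>i\<in>UNIV. (deriv ^^ count_list ds i) (bump1 n (a $ i) (b $ i)) (x $ i)) differentiable (at x)"
  proof (rule differentiable_prod_finite)
  fix i :: 'n
  have "(deriv ^^ count_list ds i) (bump1 n (a $ i) (b $ i)) differentiable (at (x $ i))"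
  using smooth1_bump1[of n "a $ i" "b $ i"] unfolding smooth1_def
  by (meson real_differentiable_def)
  moreover have "(%x. x $ i) differentiable (at x)"
  by (intro bounded_linear_imp_differentiable bounded_linear_vec_nth)
  ultimately show "(%x. (deriv ^^ count_list ds i) (bump1 n (a $ i) (b $ i)) (x $ i)) differentiable (at x)"
  using differentiable_chain_at[of "%x. x $ i" x] by (simp add: o_def)
  qed auto
  ultimately show ?thesis by simp
 qed
 have "{x. bump n a b x ~= 0} <= cbox a b"
  using bump_eq_0[OF assms(1)] box_subset_cbox by blast
 then have s: "closure {x. bump n a b x ~= 0} <= cbox a b"
  by (intro closure_minimal closed_cbox)
 then have "compact (closure {x. bump n a b x ~= 0})"
  using compact_cbox closed_closure by (metis compact_Int_closed inf.absorb_iff2)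
 with d s assms show ?thesis unfolding test_fun_def by blast
qed

lemma bump_tendsto:
 fixes a b :: "real ^ 'n::finite"
 shows "(%n. bump (real (Suc n)) a b x) \<longlonglongrightarrow> indicator (box a b) x"
proof -
 have "(%n. bump (real (Suc n)) a b x) \<longlonglongrightarrow> (\<Prod>i\<in>UNIV. indicator {a $ i<..<b $ i} (x $ i))"
  unfolding bump_def by (intro tendsto_prod bump1_tendsto)
 moreover have "(\<Prod>i\<in>UNIV. indicator {a $ i<..<b $ i} (x $ i) :: real) = indicator (box a b) x"
  by (auto simp: indicator_def mem_box_cart)
 ultimately show ?thesis by simp
qed

text \<open>Boxes form an intersection-stable generator of the Borel sets, so vanishing integrals of
  the truncated function spread from boxes to all Borel sets; densities are unique almost
  everywhere.\<close>

lemma AE_zero_if_box_integrals_zero: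
 fixes g :: "real ^ 'n::finite => real"
 assumes g: "integrable lborel g"
  and z: "!!c d. cbox c d <= cbox a b ==> (LINT x:box c d|lborel. g x) = 0"
 shows "AE x in lborel. x \<in> box a b --> g x = 0"
proof -
 let ?g = "%x. indicator (box a b) x * g x"
 have gi: "integrable lborel ?g"
  using integrable_mult_indicator[OF _ g, of "box a b"] by simp
 have zz: "(LINT x:A|lborel. ?g x) = 0" if "A \<in> sets lborel" for A
 proof -
  have gA: "set_integrable lborel A ?g" if "A \<in> sets lborel" for A
  unfolding set_integrable_def using integrable_mult_indicator[OF that gi] .
  have boxc: "(LINT x:box c d|lborel. ?g x) = 0" for c d
  proof -
  define c' d' where "c' = (\<chi> i. max (c $ i) (a $ i))" and "d' = (\<chi> i. min (d $ i) (b $ i))"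
  have eq: "box c d Int box a b = box c' d'"
  by (auto simp: c'_def d'_def mem_box_cart)
  have sub: "cbox c' d' <= cbox a b"
  by (auto simp: c'_def d'_def mem_box_cart)
  have "(LINT x:box c d|lborel. ?g x) = (LINT x:box c' d'|lborel. g x)"
  unfolding set_lebesgue_integral_def eq[symmetric]
  by (intro Bochner_Integration.integral_cong) (auto simp: indicator_def)
  then show ?thesis using z[OF sub] by simp
  qed
  have "Int_stable (range (%(a, b). box a b :: (real^'n) set))"
  by (auto simp: Int_stable_def box_Int_box)
  moreover have "range (%(a, b). box a b :: (real^'n) set) <= Pow UNIV" by simp
  moreover have "A \<in> sigma_sets UNIV (range (%(a, b). box a b))"
  using that by (simp add: borel_eq_box)
  ultimately show ?thesis
  proof (induction rule: sigma_sets_induct_disjoint)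
  fix A assume "A \<in> range (%(a, b). box a b :: (real^'n) set)"
  then show "(LINT x:A|lborel. ?g x) = 0" using boxc by auto
  next
  show "(LINT x:{}|lborel. ?g x) = 0" by (simp add: set_lebesgue_integral_def)
  next
  fix A assume A: "A \<in> sigma_sets UNIV (range (%(a, b). box a b :: (real^'n) set))" "(LINT x:A|lborel. ?g x) = 0"
  then have Am: "A \<in> sets lborel" by (simp add: borel_eq_box)
  have "(LINT x:A Un (UNIV - A)|lborel. ?g x) = (LINT x:A|lborel. ?g x) + (LINT x:UNIV - A|lborel. ?g x)"
  by (rule set_integral_Un) (use Am in \<open>auto intro!: gA\<close>)
  moreover have "(LINT x:A Un (UNIV - A)|lborel. ?g x) = (LINT x:box a b|lborel. ?g x)"
  unfolding set_lebesgue_integral_def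
  by (intro Bochner_Integration.integral_cong) (auto simp: indicator_def)
  ultimately show "(LINT x:UNIV - A|lborel. ?g x) = 0" using A boxc by simp
  next
  fix A :: "nat => (real^'n) set"
  assume A: "disjoint_family A" "range A <= sigma_sets UNIV (range (%(a, b). box a b))"
  "!!i. (LINT x:A i|lborel. ?g x) = 0"
  then have Am: "A i \<in> sets lborel" for i by (auto simp: borel_eq_box)
  have "(LINT x:(\<Union>i. A i)|lborel. ?g x) = (\<Sum>i. (LINT x:(A i)|lborel. ?g x))"
  by (rule lebesgue_integral_countable_add)
  (use A Am in \<open>auto simp: disjoint_family_on_def intro!: gA sets.countable_UN\<close>)
  then show "(LINT x:(\<Union>i. A i)|lborel. ?g x) = 0" using A by simp
  qed
 qed
 have "AE x in lborel. ?g x = 0"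
  by (rule density_unique_real[of lborel ?g "%_. 0"]) (use gi zz in \<open>auto simp: set_lebesgue_integral_def\<close>)
 then show ?thesis by eventually_elim (auto simp: indicator_def)
qed

text \<open>The fundamental lemma of the calculus of variations with bumps as the only test
  functions: they converge to box indicators, and |g| dominates.\<close>

lemma AE_zero_if_bump_integrals_zero:
 fixes g :: "real ^ 'n::finite => real"
 assumes g: "integrable lborel g"
  and z: "!!c d n. cbox c d <= cbox a b ==> n > 0 ==> (LINT x|lborel. bump n c d x * g x) = 0"
 shows "AE x in lborel. x \<in> box a b --> g x = 0"
proof (rule AE_zero_if_box_integrals_zero[OF g])
 fix c d :: "real ^ 'n" assume cd: "cbox c d <= cbox a b"
 have bm[measurable]: "bump n c d \<in> borel_measurable borel" for n
 proof -
  have "bump1 n u v \<in> borel_measurable borel" for u v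
  using smooth1_bump1[of n u v] unfolding smooth1_def
  by (intro borel_measurable_continuous_onI continuous_at_imp_continuous_on ballI)
  (metis DERIV_isCont funpow_0)
  then show ?thesis unfolding bump_def by measurable
 qed
 have "(%n. LINT x|lborel. bump (real (Suc n)) c d x * g x) \<longlonglongrightarrow> (LINT x|lborel. indicator (box c d) x * g x)"
 proof (rule integral_dominated_convergence[where w="%x. \<bar>g x\<bar>"])
  show "AE x in lborel. (%n. bump (real (Suc n)) c d x * g x) \<longlonglongrightarrow> indicator (box c d) x * g x"
  by (intro AE_I2 tendsto_mult bump_tendsto tendsto_const)
  show "AE x in lborel. norm (bump (real (Suc n)) c d x * g x) <= \<bar>g x\<bar>" for n
  proof (intro AE_I2)
  fix x
  have "\<bar>bump (real (Suc n)) c d x\<bar> <= 1" using bump_bounds[of "real (Suc n)" c d x] by simp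
  then show "norm (bump (real (Suc n)) c d x * g x) <= \<bar>g x\<bar>"
  by (simp add: abs_mult mult_left_le_one_le)
  qed
 qed (use g in auto)
 then have "(%n. 0) \<longlonglongrightarrow> (LINT x|lborel. indicator (box c d) x * g x)"
  using z[OF cd] by simp
 then show "(LINT x:box c d|lborel. g x) = 0"
  using LIMSEQ_unique[OF _ tendsto_const] by (simp add: set_lebesgue_integral_def LIMSEQ_const_iff)
qed

section \<open>Test functions under differentiation and translation\<close>

lemma differentiable_line:
 fixes f :: "real ^ 'n::finite => real"
 assumes "f differentiable (at (x + t *\<^sub>R axis i 1))"
 shows "((%s. f (x + s *\<^sub>R axis i 1)) has_real_derivative dpart i f (x + t *\<^sub>R axis i 1)) (at t)"
proof -
 let ?e = "axis i 1 :: real ^ 'n"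
 obtain f' where f': "(f has_derivative f') (at (x + t *\<^sub>R ?e))"
  using assms unfolding differentiable_def by blast
 have lin: "linear f'" using f' has_derivative_linear by blast
 have 1: "((%s. f (y + s *\<^sub>R ?e)) has_real_derivative f' ?e) (at r)" if "y + r *\<^sub>R ?e = x + t *\<^sub>R ?e" for y r
 proof -
  have "((%s. y + s *\<^sub>R ?e) has_derivative (%s. s *\<^sub>R ?e)) (at r)"
  by (auto intro!: derivative_eq_intros)
  moreover have "(f has_derivative f') (at (y + r *\<^sub>R ?e))" using f' that by simp
  ultimately have "((%s. f (y + s *\<^sub>R ?e)) has_derivative (%s. f' (s *\<^sub>R ?e))) (at r)"
  by (rule has_derivative_compose)
  moreover have "(%s. f' (s *\<^sub>R ?e)) = (*) (f' ?e)"
  by (auto simp: linear_scale[OF lin])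
  ultimately show ?thesis by (simp add: has_field_derivative_def)
 qed
 have "dpart i f (x + t *\<^sub>R ?e) = f' ?e"
  unfolding dpart_def by (rule DERIV_imp_deriv) (rule 1, simp)
 then show ?thesis using 1[of x t] by simp
qed

lemma test_fun_differentiable: "test_fun U ph ==> ph differentiable (at x)"
 unfolding test_fun_def by (metis dparts.simps(1))

lemma dparts_append: "dparts (ds @ [i]) f = dparts ds (dpart i f)"
 by (induction ds) auto

lemma dpart_eq_0_outside:
 fixes ph :: "real ^ 'n::finite => real"
 assumes "x ~: closure {x. ph x ~= 0}"
 shows "dpart i ph x = 0"
proof -
 let ?S = "(%t. x + t *\<^sub>R axis i 1) -` (- closure {x. ph x ~= 0})"
 have "open ?S" by (intro open_vimage open_Compl closed_closure continuous_intros)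
 then have "((%t. ph (x + t *\<^sub>R axis i 1)) has_real_derivative 0) (at 0)"
  using has_field_derivative_transform_within_open[of "%_. 0" 0 0 ?S "%t. ph (x + t *\<^sub>R axis i 1)"]
  assms closure_subset[of "{x. ph x ~= 0}"] by force
 then show ?thesis unfolding dpart_def by (rule DERIV_imp_deriv)
qed

lemma test_fun_dpart:
 fixes ph :: "real ^ 'n::finite => real"
 assumes "test_fun U ph"
 shows "test_fun U (dpart i ph)"
proof -
 have "{x. dpart i ph x ~= 0} <= closure {x. ph x ~= 0}"
  using dpart_eq_0_outside[of _ ph i] by blast
 then have s: "closure {x. dpart i ph x ~= 0} <= closure {x. ph x ~= 0}"
  by (intro closure_minimal closed_closure)
 moreover have "compact (closure {x. dpart i ph x ~= 0})"
  using s assms unfolding test_fun_def by (metis closed_closure compact_Int_closed inf.absorb_iff2)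
 ultimately show ?thesis using assms unfolding test_fun_def
  by (metis (no_types, lifting) dparts_append order_trans)
qed

lemma dparts_shift:
 fixes ph :: "real ^ 'n::finite => real"
 shows "dparts ds (%x. ph (x - w)) = (%x. dparts ds ph (x - w))"
proof (induction ds)
 case (Cons i ds)
 show ?case by (simp add: Cons dpart_def fun_eq_iff diff_add_eq)
qed simp

lemma test_fun_shift:
 fixes ph :: "real ^ 'n::finite => real"
 assumes "test_fun UNIV ph" "{x. ph x ~= 0} <= cbox a b" "cbox (a + w) (b + w) <= U"
 shows "test_fun U (%x. ph (x - w))"
proof -
 have "{x. ph (x - w) ~= 0} <= cbox (a + w) (b + w)"
 proof
  fix x assume "x \<in> {x. ph (x - w) ~= 0}"
  then have "x - w \<in> cbox a b" using assms(2) by auto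
  then show "x \<in> cbox (a + w) (b + w)" by (auto simp: mem_box_cart algebra_simps)
 qed
 then have s: "closure {x. ph (x - w) ~= 0} <= cbox (a + w) (b + w)"
  by (intro closure_minimal closed_cbox)
 then have "compact (closure {x. ph (x - w) ~= 0})"
  by (metis closed_closure compact_Int_closed compact_cbox inf.absorb_iff2)
 moreover have "dparts ds (%x. ph (x - w)) differentiable (at x)" for ds x
 proof -
  have "dparts ds ph differentiable (at (x - w))" using assms(1) by (simp add: test_fun_def)
  moreover have "(%x. x - w) differentiable (at x)" by simp
  ultimately show ?thesis unfolding dparts_shift
  using differentiable_chain_at[of "%x. x - w" x "dparts ds ph"] by (simp add: o_def)
 qed
 ultimately show ?thesis using s assms(3) unfolding test_fun_def by blast
qed

lemma test_fun_bounded: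
 fixes ph :: "real ^ 'n::finite => real"
 assumes "test_fun U ph"
 obtains B where "B > 0" "!!x. \<bar>ph x\<bar> <= B"
proof -
 have "continuous_on (closure {x. ph x ~= 0}) ph"
  using test_fun_differentiable[OF assms] differentiable_imp_continuous_within
  by (meson continuous_at_imp_continuous_on)
 then have "bounded (ph ` closure {x. ph x ~= 0})"
  using assms unfolding test_fun_def by (blast intro: compact_imp_bounded compact_continuous_image)
 then obtain B where B: "B > 0" "!!y. y \<in> ph ` closure {x. ph x ~= 0} ==> norm y <= B"
  unfolding bounded_pos by blast
 have "\<bar>ph x\<bar> <= B" for x
 proof (cases "ph x = 0")
  case False
  then have "x \<in> closure {x. ph x ~= 0}" by (simp add: closure_subset[THEN subsetD])
  then show ?thesis using B(2) by fastforce
 qed (use B in auto)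
 then show thesis using that B by blast
qed

lemma test_fun_measurable:
 fixes ph :: "real ^ 'n::finite => real"
 assumes "test_fun U ph" shows "ph \<in> borel_measurable borel"
 using test_fun_differentiable[OF assms] differentiable_imp_continuous_within
 by (intro borel_measurable_continuous_onI continuous_at_imp_continuous_on) blast

section \<open>Weak derivatives and increments along coordinate axes\<close>

text \<open>v is the weak i-th partial derivative of u. The class supplies weak derivatives of f of
  every order; such pairs make each of them a function with weak first derivatives of its
  own.\<close>

definition weak_pair :: "'n::finite => (real ^ 'n => real) => (real ^ 'n => real) => bool" where
 "weak_pair i u v \<longleftrightarrow> loc_int cube u & loc_int cube v \<and>
  (ALL ph. test_fun cube ph --> (LINT x:cube|lborel. u x * dpart i ph x) = - (LINT x:cube|lborel. v x * ph x))"

lemma ex_list_count: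
 fixes al :: "'n::finite => nat"
 shows "EX ds. ALL i. count (mset ds) i = al i"
proof -
 obtain ds where ds: "mset ds = (\<Sum>i\<in>UNIV. replicate_mset (al i) i)" using ex_mset by blast
 have "count (mset ds) i = al i" for i
  by (simp add: ds count_sum if_distrib sum.delta cong: if_cong)
 then show ?thesis by blast
qed

lemma weak_pair_weak_deriv:
 fixes f :: "real ^ 'n::finite => real"
 assumes "weak_deriv cube al f u" "weak_deriv cube (al(i := Suc (al i))) f v"
 shows "weak_pair i u v"
 unfolding weak_pair_def
proof (intro conjI allI impI)
 show "loc_int cube u" "loc_int cube v" using assms by (auto simp: weak_deriv_def)
 fix ph :: "real ^ 'n => real" assume ph: "test_fun cube ph"
 obtain ds where ds: "!!i. count (mset ds) i = al i" using ex_list_count[of al] by blast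
 \<comment> \<open>f is tested with the partial derivative of \<open>ph\<close> in place of
   \<open>ph\<close>; appending i to \<open>ds\<close> differentiates \<open>ph\<close> in direction
   i first.\<close>
 have 1: "(LINT x:cube|lborel. f x * dparts ds (dpart i ph) x) = (-1) ^ mi_abs al * (LINT x:cube|lborel. u x * dpart i ph x)"
  using assms(1) test_fun_dpart[OF ph] ds unfolding weak_deriv_def by blast
 have "ALL j. count (mset (ds @ [i])) j = (al(i := Suc (al i))) j" using ds by auto
 then have 2: "(LINT x:cube|lborel. f x * dparts (ds @ [i]) ph x) = (-1) ^ mi_abs (al(i := Suc (al i))) * (LINT x:cube|lborel. v x * ph x)"
  using assms(2) ph unfolding weak_deriv_def by blast
 have "mi_abs (al(i := Suc (al i))) = Suc (mi_abs al)"
  unfolding mi_abs_def by (subst (1 2) sum.remove[of UNIV i]) auto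
 then show "(LINT x:cube|lborel. u x * dpart i ph x) = - (LINT x:cube|lborel. v x * ph x)"
  using 1 2 unfolding dparts_append
  by (cases "even (mi_abs al)") (simp_all add: minus_equation_iff)
qed

lemma integrable_shift:
 fixes g :: "real ^ 'n::finite => real"
 assumes "integrable lborel g" shows "integrable lborel (%x. g (x + w))"
proof -
 have "integrable (distr lborel borel ((+) w)) g" using assms by (simp add: lborel_distr_plus)
 then have "integrable lborel (%x. g (w + x))" by (rule integrable_distr[rotated]) simp
 then show ?thesis by (simp add: add.commute)
qed

lemma integral_shift:
 fixes g :: "real ^ 'n::finite => real"
 assumes "g \<in> borel_measurable borel" shows "(LINT x|lborel. g (x + w)) = (LINT x|lborel. g x)"
proof -
 have "(LINT x|lborel. g x) = (LINT x|distr lborel borel ((+) w). g x)" by (simp add: lborel_distr_plus)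
 also have "... = (LINT x|lborel. g (w + x))" by (rule integral_distr) (use assms in auto)
 finally show ?thesis by (simp add: add.commute)
qed

lemma nn_integral_shift:
 fixes g :: "real ^ 'n::finite => ennreal"
 assumes "g \<in> borel_measurable borel" shows "(\<integral>\<^sup>+x. g (x + w) \<partial>lborel) = (\<integral>\<^sup>+x. g x \<partial>lborel)"
proof -
 have "(\<integral>\<^sup>+x. g x \<partial>lborel) = (\<integral>\<^sup>+x. g x \<partial>distr lborel borel ((+) w))" by (simp add: lborel_distr_plus)
 also have "... = (\<integral>\<^sup>+x. g (w + x) \<partial>lborel)" by (rule nn_integral_distr) (use assms in auto)
 finally show ?thesis by (simp add: add.commute)
qed

text \<open>The fundamental theorem of calculus for u in direction i, proved by duality: it holds
  for bumps, and Fubini together with a translation moves it to u. The constant \<open>ka\<close> is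
  used later with the value 0 or with the value of v at a point, which then yields a classical
  derivative there.\<close>

lemma weak_pair_increment_box:
 fixes u v :: "real ^ 'n::finite => real"
 assumes wp: "weak_pair i u v" and t: "0 <= t"
  and K: "cbox a (b + t *\<^sub>R axis i 1) <= cube"
 shows "AE x in lborel. x \<in> box a b -->
  ennreal \<bar>u (x + t *\<^sub>R axis i 1) - u x - t * ka\<bar> <= (\<integral>\<^sup>+s. indicator {0..t} s * ennreal \<bar>v (x + s *\<^sub>R axis i 1) - ka\<bar> \<partial>lborel)"
proof -
 let ?e = "axis i 1 :: real ^ 'n"
 \<comment> \<open>A compact box that contains all translates of \<open>cbox a b\<close> by s
   between 0 and t; cutting off outside it makes u and v integrable on the whole space.\<close>
 define K where "K = cbox a (b + t *\<^sub>R ?e)"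
 have Kc: "K <= cube" "compact K" using K by (auto simp: K_def)
 define uu where "uu x = indicator K x * u x" for x
 define vv where "vv x = indicator K x * v x" for x
 have ui: "integrable lborel uu" and vi: "integrable lborel vv"
  using wp Kc unfolding weak_pair_def loc_int_def uu_def vv_def set_integrable_def by auto
 have [measurable]: "uu \<in> borel_measurable borel" "vv \<in> borel_measurable borel"
  using borel_measurable_integrable[OF ui] borel_measurable_integrable[OF vi] by auto
 have inK: "x + s *\<^sub>R ?e \<in> K" if "x \<in> cbox a b" "0 <= s" "s <= t" for x s
  using that by (auto simp: K_def mem_box_cart axis_def add_increasing2 add_mono)
 have shift_sub: "cbox (c + s *\<^sub>R ?e) (d + s *\<^sub>R ?e) <= K"
  if "cbox c d <= cbox a b" "0 <= s" "s <= t" for c d s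
 proof
  fix x assume "x \<in> cbox (c + s *\<^sub>R ?e) (d + s *\<^sub>R ?e)"
  then have "x - s *\<^sub>R ?e \<in> cbox c d" by (auto simp: mem_box_cart algebra_simps)
  then have "x - s *\<^sub>R ?e \<in> cbox a b" using that by auto
  from inK[OF this that(2,3)] show "x \<in> K" by simp
 qed
 have ind: "integrable lborel (%s. indicator {0..t} s * (C::real))" for C
 proof -
  have "emeasure lborel {0..t} < \<infinity>" using t by simp
  then have "integrable lborel (indicator {0..t} :: real => real)" by (intro integrable_real_indicator) auto
  then show ?thesis by simp
 qed
 have f3: "integrable (lborel \<Otimes>\<^sub>M lborel) (%(s, x). indicator {0..t} s * vv (x + s *\<^sub>R ?e))"
 proof (rule lborel_pair.Fubini_integrable)
  have "(LINT x|lborel. norm (case (s, x) of (s, x) => indicator {0..t} s * vv (x + s *\<^sub>R ?e))) =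
  indicator {0..t} s * (LINT x|lborel. \<bar>vv x\<bar>)" for s
  using integral_shift[of "%x. \<bar>vv x\<bar>" "s *\<^sub>R ?e"] by (simp add: abs_mult)
  moreover have "integrable lborel (%s. indicator {0..t} s * (LINT x|lborel. \<bar>vv x\<bar>))"
  by (rule ind)
  ultimately show "integrable lborel (%s. LINT x|lborel. norm (case (s, x) of (s, x) => indicator {0..t} s * vv (x + s *\<^sub>R ?e)))"
  by simp
  show "AE s in lborel. integrable lborel (%x. case (s, x) of (s, x) => indicator {0..t} s * vv (x + s *\<^sub>R ?e))"
  using integrable_shift[OF vi] by auto
 qed measurable
 \<comment> \<open>The defect in the fundamental theorem of calculus. It vanishes almost everywhere
   because all its integrals against bumps do.\<close>
 define W where "W x = uu (x + t *\<^sub>R ?e) - uu x - (LINT s|lborel. indicator {0..t} s * vv (x + s *\<^sub>R ?e))" for x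
 have Wi: "integrable lborel W"
  unfolding W_def using lborel_pair.integrable_snd[OF f3] integrable_shift[OF ui] ui by auto
 have "AE x in lborel. x \<in> box a b --> W x = 0"
 proof (rule AE_zero_if_bump_integrals_zero[OF Wi])
  fix c d :: "real ^ 'n" and n :: real
  assume cd: "cbox c d <= cbox a b" and n: "n > 0"
  define ph where "ph = bump n c d"
  have tf: "test_fun UNIV ph" unfolding ph_def by (rule test_fun_bump[OF n]) simp
  have tfd: "test_fun UNIV (dpart i ph)" by (rule test_fun_dpart[OF tf])
  have [measurable]: "ph \<in> borel_measurable borel" "dpart i ph \<in> borel_measurable borel"
  using test_fun_measurable[OF tf] test_fun_measurable[OF tfd] by auto
  have supp: "{x. ph x ~= 0} <= cbox c d"
  using bump_eq_0[OF n] box_subset_cbox unfolding ph_def by blast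
  have suppd: "{x. dpart i ph x ~= 0} <= cbox c d"
  using dpart_eq_0_outside[of _ ph i] closure_minimal[OF supp closed_cbox] by blast
  obtain B where B: "B > 0" "!!x. \<bar>ph x\<bar> <= B" using test_fun_bounded[OF tf] by blast
  obtain B' where B': "B' > 0" "!!x. \<bar>dpart i ph x\<bar> <= B'" using test_fun_bounded[OF tfd] by blast
  have ub: "integrable lborel (%x. g x * uu x)"
  if "g \<in> borel_measurable borel" "!!x. \<bar>g x\<bar> <= C" for g C
  proof (rule Bochner_Integration.integrable_bound[of lborel "%x. C * uu x"])
  show "AE x in lborel. norm (g x * uu x) <= norm (C * uu x)"
  using that(2) by (intro AE_I2) (auto simp: abs_mult intro!: mult_right_mono order_trans[OF that(2)])
  qed (use that(1) ui in auto)

  have FTC: "ph (y - t *\<^sub>R ?e) - ph y = - (LINT s|lborel. indicator {0..t} s * dpart i ph (y - s *\<^sub>R ?e))" for y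
  proof -
  have der: "((%s. ph (y - s *\<^sub>R ?e)) has_real_derivative - dpart i ph (y - s *\<^sub>R ?e)) (at s)" for s
  proof -
  have "((%r. ph (y + r *\<^sub>R ?e)) has_real_derivative dpart i ph (y + (-s) *\<^sub>R ?e)) (at (-s))"
  by (intro differentiable_line test_fun_differentiable[OF tf])
  then have "((%s. ph (y + (-s) *\<^sub>R ?e)) has_real_derivative dpart i ph (y + (-s) *\<^sub>R ?e) * (-1)) (at s)"
  by (intro DERIV_chain2[where f = "%r. ph (y + r *\<^sub>R ?e)" and g = uminus]) (auto intro!: derivative_eq_intros)
  then show ?thesis by simp
  qed
  have "(LINT s|lborel. indicator {0..t} s *\<^sub>R (- dpart i ph (y - s *\<^sub>R ?e))) = ph (y - t *\<^sub>R ?e) - ph (y - 0 *\<^sub>R ?e)"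
  proof (rule integral_FTC_Icc[where F = "%s. ph (y - s *\<^sub>R ?e)" and a = 0 and b = t])
  show "0 <= t" by (rule t)
  show "((%s. ph (y - s *\<^sub>R ?e)) has_vector_derivative - dpart i ph (y - x *\<^sub>R ?e)) (at x within {0..t})"
  if "0 <= x" "x <= t" for x
  by (rule has_vector_derivative_at_within[OF has_real_derivative_iff_has_vector_derivative[THEN iffD1, OF der]])
  have "isCont (dpart i ph) z" for z
  by (rule differentiable_imp_continuous_within[OF test_fun_differentiable[OF tfd]])
  then have "continuous_on UNIV (dpart i ph)" by (simp add: continuous_at_imp_continuous_on)
  then show "continuous_on {0..t} (%s. - dpart i ph (y - s *\<^sub>R ?e))"
  by (rule continuous_on_minus[OF continuous_on_compose2[where t = UNIV]])
  (auto intro!: continuous_intros)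
  qed
  then show ?thesis by simp
  qed
  have f1: "integrable (lborel \<Otimes>\<^sub>M lborel) (%(s, y). indicator {0..t} s * (dpart i ph (y - s *\<^sub>R ?e) * uu y))"
  proof (rule lborel_pair.Fubini_integrable)
  show "AE s in lborel. integrable lborel (%y. case (s, y) of (s, y) => indicator {0..t} s * (dpart i ph (y - s *\<^sub>R ?e) * uu y))"
  using ub[of "%y. dpart i ph (y - _ *\<^sub>R ?e)" B'] B' by auto
  show "integrable lborel (%s. LINT y|lborel. norm (case (s, y) of (s, y) => indicator {0..t} s * (dpart i ph (y - s *\<^sub>R ?e) * uu y)))"
  proof (rule Bochner_Integration.integrable_bound[of lborel "%s. indicator {0..t} s * (B' * (LINT y|lborel. \<bar>uu y\<bar>))"])
  show "integrable lborel (%s. indicator {0..t} s * (B' * (LINT y|lborel. \<bar>uu y\<bar>)))"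
  by (rule ind)
  show "AE s in lborel. norm (LINT y|lborel. norm (case (s, y) of (s, y) => indicator {0..t} s * (dpart i ph (y - s *\<^sub>R ?e) * uu y)))
  <= norm (indicator {0..t} s * (B' * (LINT y|lborel. \<bar>uu y\<bar>)))"
  proof (intro AE_I2)
  fix s :: real
  have "(LINT y|lborel. \<bar>dpart i ph (y - s *\<^sub>R ?e) * uu y\<bar>) <= (LINT y|lborel. B' * \<bar>uu y\<bar>)"
  by (intro integral_mono integrable_abs ub[where C = B'] integrable_mult_right ui B')
  (auto simp: abs_mult B' intro!: mult_right_mono)
  moreover have "0 <= (LINT y|lborel. \<bar>dpart i ph (y - s *\<^sub>R ?e) * uu y\<bar>)" by simp
  ultimately show "norm (LINT y|lborel. norm (case (s, y) of (s, y) => indicator {0..t} s * (dpart i ph (y - s *\<^sub>R ?e) * uu y)))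
  <= norm (indicator {0..t} s * (B' * (LINT y|lborel. \<bar>uu y\<bar>)))"
  using B'(1) by (auto simp: indicator_def abs_mult)
  qed
  qed measurable
  qed measurable
  have f2: "integrable (lborel \<Otimes>\<^sub>M lborel) (%(s, x). indicator {0..t} s * (ph x * vv (x + s *\<^sub>R ?e)))"
  proof (rule Bochner_Integration.integrable_bound[of _ "%z. B * (case z of (s, x) => indicator {0..t} s * vv (x + s *\<^sub>R ?e))"])
  show "AE z in lborel \<Otimes>\<^sub>M lborel. norm (case z of (s, x) => indicator {0..t} s * (ph x * vv (x + s *\<^sub>R ?e)))
  <= norm (B * (case z of (s, x) => indicator {0..t} s * vv (x + s *\<^sub>R ?e)))"
  using B by (intro AE_I2) (auto simp: abs_mult indicator_def intro!: mult_right_mono)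
  qed (use f3 in auto)
  \<comment> \<open>For s in [0, t] the translated bump is still supported in the cube, so the weak
    derivative may be tested with it; for all other s both sides are 0.\<close>
  have key: "(LINT y|lborel. indicator {0..t} s * (dpart i ph (y - s *\<^sub>R ?e) * uu y)) =
  - (LINT x|lborel. indicator {0..t} s * (ph x * vv (x + s *\<^sub>R ?e)))" for s
  proof (cases "0 <= s & s <= t")
  case True
  have sub: "cbox (c + s *\<^sub>R ?e) (d + s *\<^sub>R ?e) <= K" using shift_sub[OF cd] True by auto
  have tfs: "test_fun cube (%x. ph (x - s *\<^sub>R ?e))"
  by (rule test_fun_shift[OF tf supp]) (use sub Kc in auto)
  have dp: "dpart i (%x. ph (x - s *\<^sub>R ?e)) = (%x. dpart i ph (x - s *\<^sub>R ?e))"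
  using dparts_shift[of "[i]" ph "s *\<^sub>R ?e"] by simp
  have out: "ph (x - s *\<^sub>R ?e) = 0 & dpart i ph (x - s *\<^sub>R ?e) = 0" if "x ~: K" for x
  proof -
  have "x - s *\<^sub>R ?e ~: cbox c d" using that inK[of "x - s *\<^sub>R ?e" s] cd True by auto
  then show ?thesis using supp suppd by blast
  qed
  have e1: "(LINT y|lborel. dpart i ph (y - s *\<^sub>R ?e) * uu y) = (LINT x:cube|lborel. u x * dpart i (%x. ph (x - s *\<^sub>R ?e)) x)"
  unfolding set_lebesgue_integral_def dp using Kc(1) out
  by (intro Bochner_Integration.integral_cong) (auto simp: uu_def indicator_def)
  have e2: "(LINT x|lborel. ph (x - s *\<^sub>R ?e) * vv x) = (LINT x:cube|lborel. v x * ph (x - s *\<^sub>R ?e))"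
  unfolding set_lebesgue_integral_def using Kc(1) out
  by (intro Bochner_Integration.integral_cong) (auto simp: vv_def indicator_def)
  have e3: "(LINT x|lborel. ph x * vv (x + s *\<^sub>R ?e)) = (LINT x|lborel. ph (x - s *\<^sub>R ?e) * vv x)"
  using integral_shift[of "%x. ph (x - s *\<^sub>R ?e) * vv x" "s *\<^sub>R ?e"] by simp
  show ?thesis using True e1 e2 e3 wp tfs unfolding weak_pair_def by simp
  qed auto
  have "(LINT x|lborel. ph x * (uu (x + t *\<^sub>R ?e) - uu x)) = (LINT y|lborel. (ph (y - t *\<^sub>R ?e) - ph y) * uu y)"
  proof -
  have i1: "integrable lborel (%y. ph (y - t *\<^sub>R ?e) * uu y)" by (rule ub[where C = B]) (use B in auto)
  have i2: "integrable lborel (%y. ph y * uu y)" by (rule ub[where C = B]) (use B in auto)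
  have i3: "integrable lborel (%y. ph y * uu (y + t *\<^sub>R ?e))" using integrable_shift[OF i1, of "t *\<^sub>R ?e"] by simp
  have "(LINT x|lborel. ph x * uu (x + t *\<^sub>R ?e)) = (LINT y|lborel. ph (y - t *\<^sub>R ?e) * uu y)"
  using integral_shift[of "%y. ph (y - t *\<^sub>R ?e) * uu y" "t *\<^sub>R ?e"] by simp
  then show ?thesis using i1 i2 i3 by (simp add: algebra_simps)
  qed
  also have "... = - (LINT y|lborel. LINT s|lborel. indicator {0..t} s * (dpart i ph (y - s *\<^sub>R ?e) * uu y))"
  proof -
  have "(ph (y - t *\<^sub>R ?e) - ph y) * uu y = - (LINT s|lborel. indicator {0..t} s * (dpart i ph (y - s *\<^sub>R ?e) * uu y))" for y
  using FTC[of y] by (simp flip: mult.assoc)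
  then show ?thesis by simp
  qed
  also have "... = - (LINT s|lborel. LINT y|lborel. indicator {0..t} s * (dpart i ph (y - s *\<^sub>R ?e) * uu y))"
  using lborel_pair.Fubini_integral[OF f1] by simp
  also have "... = (LINT s|lborel. LINT x|lborel. indicator {0..t} s * (ph x * vv (x + s *\<^sub>R ?e)))"
  unfolding key by simp
  also have "... = (LINT x|lborel. LINT s|lborel. indicator {0..t} s * (ph x * vv (x + s *\<^sub>R ?e)))"
  using lborel_pair.Fubini_integral[OF f2] by simp
  also have "... = (LINT x|lborel. ph x * (LINT s|lborel. indicator {0..t} s * vv (x + s *\<^sub>R ?e)))"
  by (simp flip: integral_mult_right_zero add: mult.left_commute)
  finally have eq: "(LINT x|lborel. ph x * (uu (x + t *\<^sub>R ?e) - uu x)) = (LINT x|lborel. ph x * (LINT s|lborel. indicator {0..t} s * vv (x + s *\<^sub>R ?e)))" .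
  have pb: "integrable lborel (%x. ph x * g x)" if "integrable lborel g" for g
  by (rule Bochner_Integration.integrable_bound[of lborel "%x. B * g x"])
  (use that B in \<open>auto simp: abs_mult intro!: mult_right_mono\<close>)
  have "(LINT x|lborel. ph x * W x) = (LINT x|lborel. ph x * (uu (x + t *\<^sub>R ?e) - uu x) - ph x * (LINT s|lborel. indicator {0..t} s * vv (x + s *\<^sub>R ?e)))"
  unfolding W_def by (simp add: right_diff_distrib)
  also have "... = 0"
  using eq by (subst Bochner_Integration.integral_diff)
  (auto intro!: pb lborel_pair.integrable_snd[OF f3, simplified] Bochner_Integration.integrable_diff integrable_shift ui)
  finally show "(LINT x|lborel. bump n c d x * W x) = 0" unfolding ph_def .
 qed
 moreover have "AE x in lborel. integrable lborel (%s. indicator {0..t} s * vv (x + s *\<^sub>R ?e))"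
  using lborel_pair.AE_integrable_snd[OF f3] by simp
 ultimately show ?thesis
 proof eventually_elim
  case (elim x)
  show ?case
  proof
  assume x: "x \<in> box a b"
  then have xc: "x \<in> cbox a b" using box_subset_cbox by blast
  have "x \<in> K" using inK[OF xc, of 0] t by simp
  moreover have "x + t *\<^sub>R ?e \<in> K" using inK[OF xc, of t] t by simp
  ultimately have "u (x + t *\<^sub>R ?e) - u x = (LINT s|lborel. indicator {0..t} s * vv (x + s *\<^sub>R ?e))"
  using elim(1) x by (simp add: W_def uu_def)
  moreover have "t * ka = (LINT s|lborel. indicator {0..t} s * ka)" using t by simp
  moreover have ik: "integrable lborel (%s. indicator {0..t} s * ka)" by (rule ind)
  ultimately have "u (x + t *\<^sub>R ?e) - u x - t * ka = (LINT s|lborel. indicator {0..t} s * vv (x + s *\<^sub>R ?e) - indicator {0..t} s * ka)"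
  using elim(2) by simp
  then have "ennreal \<bar>u (x + t *\<^sub>R ?e) - u x - t * ka\<bar> <= (\<integral>\<^sup>+s. norm (indicator {0..t} s * vv (x + s *\<^sub>R ?e) - indicator {0..t} s * ka) \<partial>lborel)"
  using integral_norm_bound_ennreal[OF Bochner_Integration.integrable_diff[OF elim(2) ik]] by simp
  also have "... = (\<integral>\<^sup>+s. indicator {0..t} s * ennreal \<bar>v (x + s *\<^sub>R ?e) - ka\<bar> \<partial>lborel)"
  using inK[OF xc] by (intro nn_integral_cong) (auto simp: indicator_def vv_def)
  finally show "ennreal \<bar>u (x + t *\<^sub>R ?e) - u x - t * ka\<bar> <= (\<integral>\<^sup>+s. indicator {0..t} s * ennreal \<bar>v (x + s *\<^sub>R ?e) - ka\<bar> \<partial>lborel)" .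
  qed
 qed
qed

lemma cube_eq_box: "(cube :: (real ^ 'n::finite) set) = box 0 1"
 by (auto simp: cube_def mem_box_cart)

lemma open_cube: "open (cube :: (real ^ 'n::finite) set)"
 by (simp add: cube_eq_box open_box)

lemma cube_measurable [measurable]: "(cube :: (real ^ 'n::finite) set) \<in> sets borel"
 by (simp add: open_cube)

lemma weak_pair_measurable:
 assumes "weak_pair i u v" shows "u \<in> borel_measurable borel" "v \<in> borel_measurable borel"
 using assms by (auto simp: weak_pair_def loc_int_def)

lemma AE_shift:
 fixes P :: "real ^ 'n::finite => bool"
 assumes "AE x in lborel. P x" shows "AE x in lborel. P (x + w)"
proof -
 obtain N where N: "N \<in> null_sets lborel" "{x. \<not> P x} <= N"
  using assms unfolding eventually_ae_filter by auto
 have m [measurable]: "N \<in> sets borel" using N by auto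
 have "emeasure lborel {x. x + w \<in> N} = (\<integral>\<^sup>+x. indicator N (x + w) \<partial>lborel)"
 proof -
  have "{x. x + w \<in> N} \<in> sets lborel" by measurable
  then have "emeasure lborel {x. x + w \<in> N} = (\<integral>\<^sup>+x. indicator {x. x + w \<in> N} x \<partial>lborel)" by simp
  then show ?thesis by (simp add: indicator_def)
 qed
 also have "... = (\<integral>\<^sup>+x. indicator N x \<partial>lborel)"
  by (rule nn_integral_shift) simp
 also have "... = 0" using N by auto
 finally have "{x. x + w \<in> N} \<in> null_sets lborel" by (auto simp: null_sets_def)
 then have "AE x in lborel. x ~: {x. x + w \<in> N}" by (rule AE_not_in)
 then show ?thesis by eventually_elim (use N in auto)
qed

text \<open>Every translate of the exceptional null set is null, and exchanging the quantifiers by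
  Fubini makes almost every line in direction w meet it in a null set of parameters.\<close>

lemma AE_AE_line:
 fixes P :: "real ^ 'n::finite => bool"
 assumes "AE x in lborel. P x" shows "AE x in lborel. AE t in lborel. P (x + t *\<^sub>R w)"
proof -
 obtain N where N: "N \<in> null_sets lborel" "{x. \<not> P x} <= N"
  using assms unfolding eventually_ae_filter by auto
 have m [measurable]: "N \<in> sets borel" using N by auto
 have "AE x in lborel. x ~: N" using N by (simp add: AE_not_in)
 then have "AE t in lborel. AE x in lborel. x + t *\<^sub>R w ~: N"
  using AE_shift[of "%x. x ~: N"] by simp
 moreover have "{z \<in> space (lborel \<Otimes>\<^sub>M lborel). fst z + snd z *\<^sub>R w ~: N} \<in> sets (lborel \<Otimes>\<^sub>M lborel)"
  by measurable
 ultimately have "AE x in lborel. AE t in lborel. x + t *\<^sub>R w ~: N"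
  by (subst lborel_pair.AE_commute)
 then show ?thesis
 proof eventually_elim
  case (elim x)
  then show ?case by eventually_elim (use N in auto)
 qed
qed

lemma weak_pair_increment:
 fixes u v :: "real ^ 'n::finite => real"
 assumes wp: "weak_pair i u v" and t: "0 <= t"
 shows "AE x in lborel. x \<in> cube & x + t *\<^sub>R axis i 1 \<in> cube -->
  ennreal \<bar>u (x + t *\<^sub>R axis i 1) - u x - t * ka\<bar> <= (\<integral>\<^sup>+s. indicator {0..t} s * ennreal \<bar>v (x + s *\<^sub>R axis i 1) - ka\<bar> \<partial>lborel)"
proof -
 let ?e = "axis i 1 :: real ^ 'n"
 \<comment> \<open>These boxes exhaust the points x for which x and x + t e both lie in the cube:
   there is a margin 1/(n+1) on every side, and the upper face in direction i is lowered by
   t.\<close>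
 define a where "a n = (\<chi> j. 1 / real (Suc n) :: real ^ 'n)" for n
 define b where "b n = (\<chi> j. (if j = i then 1 - t else 1) - 1 / real (Suc n) :: real ^ 'n)" for n
 let ?P = "%x. ennreal \<bar>u (x + t *\<^sub>R ?e) - u x - t * ka\<bar> <= (\<integral>\<^sup>+s. indicator {0..t} s * ennreal \<bar>v (x + s *\<^sub>R ?e) - ka\<bar> \<partial>lborel)"
 have "AE x in lborel. x \<in> box (a n) (b n) --> ?P x" for n
 proof (rule weak_pair_increment_box[OF wp t])
  show "cbox (a n) (b n + t *\<^sub>R ?e) <= cube"
  proof
  fix x assume x: "x \<in> cbox (a n) (b n + t *\<^sub>R ?e)"
  have "0 < x $ j & x $ j < 1" for j
  proof -
  have "1 / real (Suc n) <= x $ j" "x $ j <= b n $ j + t * ?e $ j"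
  using x by (auto simp: mem_box_cart a_def)
  moreover have "b n $ j + t * ?e $ j = 1 - 1 / real (Suc n)" by (simp add: b_def axis_def)
  moreover have "0 < 1 / real (Suc n)" by simp
  ultimately show ?thesis by linarith
  qed
  then show "x \<in> cube" by (simp add: cube_def)
  qed
 qed
 then have "AE x in lborel. ALL n. x \<in> box (a n) (b n) --> ?P x" unfolding AE_all_countable by blast
 then show ?thesis
 proof eventually_elim
  case (elim x)
  show ?case
  proof
  assume x: "x \<in> cube & x + t *\<^sub>R ?e \<in> cube"
  have lim: "(%n. 1 / real (Suc n)) \<longlonglongrightarrow> 0" using LIMSEQ_inverse_real_of_nat by (simp add: inverse_eq_divide)
  have "eventually (%n. ALL j. a n $ j < x $ j & x $ j < b n $ j) sequentially"
  proof (rule eventually_all_finite)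
  fix j
  have "0 < x $ j" "0 < (if j = i then 1 - t else 1) - x $ j"
  using x by (auto simp: cube_def axis_def dest!: spec[of _ j])
  then have "eventually (%n. 1 / real (Suc n) < x $ j & 1 / real (Suc n) < (if j = i then 1 - t else 1) - x $ j) sequentially"
  by (intro eventually_conj order_tendstoD(2)[OF lim])
  then show "eventually (%n. a n $ j < x $ j & x $ j < b n $ j) sequentially"
  by eventually_elim (simp add: a_def b_def)
  qed
  then obtain n where "x \<in> box (a n) (b n)"
  unfolding eventually_sequentially mem_box_cart by blast
  then show "?P x" using elim by blast
  qed
 qed
qed

lemma weak_pair_increment_signed:
 fixes u v :: "real ^ 'n::finite => real"
 assumes wp: "weak_pair i u v" and t: "0 <= t" and g: "sg = 1 | sg = -1"
 shows "AE x in lborel. x \<in> cube & x + t *\<^sub>R (sg *\<^sub>R axis i 1) \<in> cube -->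
  ennreal \<bar>u (x + t *\<^sub>R (sg *\<^sub>R axis i 1)) - u x - sg * t * ka\<bar> <= (\<integral>\<^sup>+s. indicator {0..t} s * ennreal \<bar>v (x + s *\<^sub>R (sg *\<^sub>R axis i 1)) - ka\<bar> \<partial>lborel)"
 using g
proof
 assume "sg = 1" then show ?thesis using weak_pair_increment[OF wp t, of ka] by simp
next
 assume s: "sg = -1"
 let ?e = "axis i 1 :: real ^ 'n"
 have [measurable]: "v \<in> borel_measurable borel" by (rule weak_pair_measurable[OF wp])
 \<comment> \<open>The forward increment from x - t e to x; replacing s by t - s traverses the same
   segment backwards.\<close>
 from AE_shift[OF weak_pair_increment[OF wp t, of ka], of "- (t *\<^sub>R ?e)"]
 show ?thesis
 proof eventually_elim
  case (elim x)
  have "(\<integral>\<^sup>+s. indicator {0..t} s * ennreal \<bar>v (x + - (t *\<^sub>R ?e) + s *\<^sub>R ?e) - ka\<bar> \<partial>lborel) =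
  (\<integral>\<^sup>+s. indicator {0..t} (t + (-1) * s) * ennreal \<bar>v (x + - (t *\<^sub>R ?e) + (t + (-1) * s) *\<^sub>R ?e) - ka\<bar> \<partial>lborel)"
  by (subst nn_integral_real_affine[where c = "-1" and t = t]) auto
  also have "... = (\<integral>\<^sup>+s. indicator {0..t} s * ennreal \<bar>v (x - s *\<^sub>R ?e) - ka\<bar> \<partial>lborel)"
  by (intro nn_integral_cong) (auto simp: indicator_def algebra_simps)
  finally show ?case using elim s by (simp add: abs_minus_commute algebra_simps)
 qed
qed

section \<open>Sobolev estimates on boxes, one direction at a time\<close>

definition line_nn :: "real => real ^ 'n::finite => (real ^ 'n => ennreal) => real ^ 'n => ennreal" where
 "line_nn h w g x = (\<integral>\<^sup>+t. indicator {0..h} t * g (x + t *\<^sub>R w) \<partial>lborel)"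

lemma line_nn_measurable [measurable]:
 assumes [measurable]: "g \<in> borel_measurable borel"
 shows "line_nn h w g \<in> borel_measurable borel"
proof -
 have "(%x. \<integral>\<^sup>+t. indicator {0..h} t * g (x + t *\<^sub>R w) \<partial>lborel) \<in> borel_measurable lborel"
  by measurable
 then show ?thesis unfolding line_nn_def[abs_def] by simp
qed

lemma cube_segment:
 fixes x :: "real ^ 'n::finite"
 assumes "x \<in> cube" "x + h *\<^sub>R w \<in> cube" "0 <= t" "t <= h"
 shows "x + t *\<^sub>R w \<in> cube"
proof (cases "h = 0")
 case False
 have "convex (cube :: (real ^ 'n) set)" by (simp add: cube_eq_box convex_box)
 then have "(1 - t / h) *\<^sub>R x + (t / h) *\<^sub>R (x + h *\<^sub>R w) \<in> cube"
  using assms False by (intro convexD) auto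
 also have "(1 - t / h) *\<^sub>R x + (t / h) *\<^sub>R (x + h *\<^sub>R w) = x + t *\<^sub>R w"
  using False by (simp add: algebra_simps)
 finally show ?thesis .
qed (use assms in auto)

text \<open>Averages over t in [0, h] the inequality |u(x)| <= |u(x + t w)| + (integral of |v| along
  the segment).\<close>

lemma weak_pair_sobolev_line:
 fixes u v :: "real ^ 'n::finite => real"
 assumes wp: "weak_pair i u v" and h: "0 < h" and g: "sg = 1 | sg = -1"
 defines "w \<equiv> sg *\<^sub>R axis i 1"
 shows "AE x in lborel. x \<in> cube & x + h *\<^sub>R w \<in> cube -->
  ennreal \<bar>u x\<bar> <= ennreal (1 / h) * line_nn h w (%x. ennreal \<bar>u x\<bar>) x + line_nn h w (%x. ennreal \<bar>v x\<bar>) x"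
proof -
 have [measurable]: "u \<in> borel_measurable borel" "v \<in> borel_measurable borel"
  by (rule weak_pair_measurable[OF wp])+
 let ?V = "line_nn h w (%x. ennreal \<bar>v x\<bar>)"
 define P where "P x t \<longleftrightarrow> (x \<in> cube & x + h *\<^sub>R w \<in> cube & t \<in> {0..h} --> ennreal \<bar>u x\<bar> <= ennreal \<bar>u (x + t *\<^sub>R w)\<bar> + ?V x)" for x t
 \<comment> \<open>Increments are controlled for each t and almost every x, whereas averaging at a
   fixed x needs the quantifiers in the other order.\<close>
 have "AE t in lborel. AE x in lborel. P x t"
 proof (rule AE_I2)
  fix t :: real
  show "AE x in lborel. P x t"
  proof (cases "t \<in> {0..h}")
  case True
  then have t: "0 <= t" by simp
  from weak_pair_increment_signed[OF wp t g, of 0] show ?thesis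
  proof eventually_elim
  case (elim x)
  show ?case unfolding P_def
  proof
  assume x: "x \<in> cube & x + h *\<^sub>R w \<in> cube & t \<in> {0..h}"
  then have "x + t *\<^sub>R w \<in> cube" using cube_segment[of x h w t] by auto
  then have "ennreal \<bar>u (x + t *\<^sub>R w) - u x\<bar> <= (\<integral>\<^sup>+s. indicator {0..t} s * ennreal \<bar>v (x + s *\<^sub>R w)\<bar> \<partial>lborel)"
  using elim x by (simp add: w_def)
  also have "... <= ?V x"
  unfolding line_nn_def using x by (intro nn_integral_mono) (auto simp: indicator_def)
  finally have a: "ennreal \<bar>u (x + t *\<^sub>R w) - u x\<bar> <= ?V x" .
  have "ennreal \<bar>u x\<bar> <= ennreal (\<bar>u (x + t *\<^sub>R w)\<bar> + \<bar>u (x + t *\<^sub>R w) - u x\<bar>)"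
  by (intro ennreal_leI) linarith
  also have "... = ennreal \<bar>u (x + t *\<^sub>R w)\<bar> + ennreal \<bar>u (x + t *\<^sub>R w) - u x\<bar>"
  by (rule ennreal_plus) auto
  also have "... <= ennreal \<bar>u (x + t *\<^sub>R w)\<bar> + ?V x" by (intro add_left_mono a)
  finally show "ennreal \<bar>u x\<bar> <= ennreal \<bar>u (x + t *\<^sub>R w)\<bar> + ?V x" .
  qed
  qed
  qed (auto simp: P_def)
 qed
 moreover have "{z \<in> space (lborel \<Otimes>\<^sub>M lborel). P (fst z) (snd z)} \<in> sets (lborel \<Otimes>\<^sub>M lborel)"
  unfolding P_def by measurable
 ultimately have "AE x in lborel. AE t in lborel. P x t" by (subst lborel_pair.AE_commute)
 then show ?thesis
 proof eventually_elim
  case (elim x)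
  show ?case
  proof
  assume x: "x \<in> cube & x + h *\<^sub>R w \<in> cube"
  have "ennreal h * ennreal \<bar>u x\<bar> = (\<integral>\<^sup>+t. indicator {0..h} t * ennreal \<bar>u x\<bar> \<partial>lborel)"
  using h by (subst nn_integral_multc) auto
  also have "... <= (\<integral>\<^sup>+t. indicator {0..h} t * ennreal \<bar>u (x + t *\<^sub>R w)\<bar> + indicator {0..h} t * ?V x \<partial>lborel)"
  by (intro nn_integral_mono_AE, use elim in eventually_elim) (use x in \<open>auto simp: P_def indicator_def\<close>)
  also have "... = line_nn h w (%x. ennreal \<bar>u x\<bar>) x + ennreal h * ?V x"
  using h by (subst nn_integral_add) (auto simp: line_nn_def nn_integral_multc)
  finally have "ennreal (1 / h) * (ennreal h * ennreal \<bar>u x\<bar>) <= ennreal (1 / h) * (line_nn h w (%x. ennreal \<bar>u x\<bar>) x + ennreal h * ?V x)"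
  by (intro mult_left_mono) auto
  moreover have "ennreal (1 / h) * (ennreal h * y) = y" for y
  using h by (simp flip: mult.assoc ennreal_mult)
  ultimately show "ennreal \<bar>u x\<bar> <= ennreal (1 / h) * line_nn h w (%x. ennreal \<bar>u x\<bar>) x + ?V x"
  by (simp add: distrib_left)
  qed
 qed
qed

text \<open>The integral of g over the box with vertex x that is spanned by the signed axes in I.
  The product measure over I lets single directions be split off as a
  \<open>line_nn\<close>.\<close>

definition box_nn :: "'n::finite set => ('n => real) => ('n => real) => (real ^ 'n => ennreal) => real ^ 'n => ennreal" where
 "box_nn I sg h g x = (\<integral>\<^sup>+f. (\<Prod>i\<in>I. indicator {0..h i} (f i)) * g (x + (\<Sum>i\<in>I. f i *\<^sub>R (sg i *\<^sub>R axis i 1))) \<partial>PiM I (%_. lborel))"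

interpretation lborel_product: product_sigma_finite "%_::'n::finite. lborel :: real measure" ..

lemma box_nn_empty: "box_nn {} sg h g = g"
 by (simp add: box_nn_def space_PiM_empty fun_eq_iff)

lemma box_nn_insert:
 fixes g :: "real ^ 'n::finite => ennreal"
 assumes "j ~: I" and [measurable]: "g \<in> borel_measurable borel"
 shows "box_nn (insert j I) sg h g x = line_nn (h j) (sg j *\<^sub>R axis j 1) (box_nn I sg h g) x"
proof -
 have "box_nn (insert j I) sg h g x = (\<integral>\<^sup>+y. \<integral>\<^sup>+f. (\<Prod>i\<in>insert j I. indicator {0..h i} ((f(j:=y)) i)) *
  g (x + (\<Sum>i\<in>insert j I. (f(j:=y)) i *\<^sub>R (sg i *\<^sub>R axis i 1))) \<partial>PiM I (%_. lborel) \<partial>lborel)"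
  unfolding box_nn_def
 proof (rule lborel_product.product_nn_integral_insert_rev)
  show "(%f. (\<Prod>i\<in>insert j I. indicator {0..h i} (f i)) * g (x + (\<Sum>i\<in>insert j I. f i *\<^sub>R (sg i *\<^sub>R axis i 1))))
  \<in> borel_measurable (PiM (insert j I) (%_. lborel))"
  by measurable
 qed (use assms in auto)
 also have "... = (\<integral>\<^sup>+y. \<integral>\<^sup>+f. indicator {0..h j} y * ((\<Prod>i\<in>I. indicator {0..h i} (f i)) *
  g (x + y *\<^sub>R (sg j *\<^sub>R axis j 1) + (\<Sum>i\<in>I. f i *\<^sub>R (sg i *\<^sub>R axis i 1)))) \<partial>PiM I (%_. lborel) \<partial>lborel)"
 proof (intro nn_integral_cong)
  fix y :: real and f :: "'n => real"
  have 1: "(\<Prod>i\<in>insert j I. indicator {0..h i} ((f(j:=y)) i) :: ennreal) = indicator {0..h j} y * (\<Prod>i\<in>I. indicator {0..h i} (f i))"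
  using assms(1) by (subst prod.insert) (auto intro!: arg_cong2[where f = "(*)"] prod.cong)
  have 2: "(\<Sum>i\<in>insert j I. (f(j:=y)) i *\<^sub>R (sg i *\<^sub>R axis i 1)) = y *\<^sub>R (sg j *\<^sub>R axis j 1) + (\<Sum>i\<in>I. f i *\<^sub>R (sg i *\<^sub>R axis i 1 :: real ^ 'n))"
  using assms(1) by (subst sum.insert) (auto intro!: arg_cong2[where f = "(+)"] sum.cong)
  show "(\<Prod>i\<in>insert j I. indicator {0..h i} ((f(j:=y)) i)) * g (x + (\<Sum>i\<in>insert j I. (f(j:=y)) i *\<^sub>R (sg i *\<^sub>R axis i 1)))
  = indicator {0..h j} y * ((\<Prod>i\<in>I. indicator {0..h i} (f i)) * g (x + y *\<^sub>R (sg j *\<^sub>R axis j 1) + (\<Sum>i\<in>I. f i *\<^sub>R (sg i *\<^sub>R axis i 1))))"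
  unfolding 1 2 by (simp add: mult.assoc add.assoc)
 qed
 also have "... = line_nn (h j) (sg j *\<^sub>R axis j 1) (box_nn I sg h g) x"
  unfolding line_nn_def box_nn_def by (intro nn_integral_cong nn_integral_cmult) measurable
 finally show ?thesis .
qed

lemma box_nn_measurable [measurable]:
 fixes g :: "real ^ 'n::finite => ennreal"
 assumes [measurable]: "g \<in> borel_measurable borel"
 shows "box_nn I sg h g \<in> borel_measurable borel"
 using finite[of I]
proof (induction I rule: finite_induct)
 case (insert j I)
 have "box_nn (insert j I) sg h g = line_nn (h j) (sg j *\<^sub>R axis j 1) (box_nn I sg h g)"
  using box_nn_insert[OF insert(2) assms] by (simp add: fun_eq_iff)
 then show ?case using insert by simp
qed (simp_all add: box_nn_empty)

lemma line_nn_add: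
 assumes [measurable]: "f \<in> borel_measurable borel" "g \<in> borel_measurable borel"
 shows "line_nn h w (%x. f x + g x) x = line_nn h w f x + line_nn h w g x"
 unfolding line_nn_def distrib_left by (rule nn_integral_add) measurable

lemma line_nn_cmult:
 assumes [measurable]: "f \<in> borel_measurable borel"
 shows "line_nn h w (%x. c * f x) x = c * line_nn h w f x"
proof -
 have "line_nn h w (%x. c * f x) x = (\<integral>\<^sup>+t. c * (indicator {0..h} t * f (x + t *\<^sub>R w)) \<partial>lborel)"
  unfolding line_nn_def by (simp add: mult.left_commute)
 then show ?thesis unfolding line_nn_def by (simp add: nn_integral_cmult)
qed

lemma line_nn_sum:
 assumes "finite S" "!!s. s \<in> S ==> f s \<in> borel_measurable borel"
 shows "line_nn h w (%x. \<Sum>s\<in>S. f s x) x = (\<Sum>s\<in>S. line_nn h w (f s) x)"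
 using assms
proof (induction S rule: finite_induct)
 case empty
 then show ?case by (simp add: line_nn_def)
next
 case (insert s S)
 then show ?case by (simp add: line_nn_add)
qed

definition mi_plus :: "('n::finite => nat) => 'n set => 'n => nat" where
 "mi_plus al S = (%i. al i + (if i \<in> S then 1 else 0))"

text \<open>The one-dimensional inequality used in each direction of I: a direction is either
  averaged, at the price 1 / h i, or differentiated once, and S collects the latter. Lengths and
  signs are free in each direction, so that the box can be adapted to the singular set.\<close>

lemma sobolev_AE:
 fixes D :: "('n::finite => nat) => real ^ 'n => real"
 assumes wp: "!!al i. weak_pair i (D al) (D (al(i := Suc (al i))))"
  and h: "!!i. 0 < h i" and g: "!!i. sg i = 1 | sg i = (-1::real)"
 shows "AE x in lborel. x \<in> cube & x + (\<Sum>i\<in>I. h i *\<^sub>R (sg i *\<^sub>R axis i 1)) \<in> cube -->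
  ennreal \<bar>D al x\<bar> <= (\<Sum>S\<in>Pow I. ennreal (\<Prod>i\<in>I - S. 1 / h i) * box_nn I sg h (%x. ennreal \<bar>D (mi_plus al S) x\<bar>) x)"
 using finite[of I]
proof (induction I arbitrary: al rule: finite_induct)
 case empty
 have "mi_plus al {} = al" by (simp add: mi_plus_def)
 then show ?case by (simp add: box_nn_empty)
next
 case (insert j I)
 have [measurable]: "D al \<in> borel_measurable borel" for al by (rule weak_pair_measurable(1)[OF wp])
 let ?w = "%i. sg i *\<^sub>R axis i 1 :: real ^ 'n"
 let ?H = "\<Sum>i\<in>I. h i *\<^sub>R ?w i"
 define al' where "al' = al(j := Suc (al j))"
 define T where "T be x = (\<Sum>S\<in>Pow I. ennreal (\<Prod>i\<in>I - S. 1 / h i) * box_nn I sg h (%x. ennreal \<bar>D (mi_plus be S) x\<bar>) x)" for be x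
 have [measurable]: "T be \<in> borel_measurable borel" for be unfolding T_def[abs_def] by measurable
 have IH: "AE x in lborel. AE t in lborel. x + t *\<^sub>R ?w j \<in> cube & x + t *\<^sub>R ?w j + ?H \<in> cube --> ennreal \<bar>D be (x + t *\<^sub>R ?w j)\<bar> <= T be (x + t *\<^sub>R ?w j)" for be
  using AE_AE_line[OF insert.IH[of be], of "?w j"] unfolding T_def .
 have Tsum: "line_nn (h j) (?w j) (T be) x = (\<Sum>S\<in>Pow I. ennreal (\<Prod>i\<in>I - S. 1 / h i) * box_nn (insert j I) sg h (%x. ennreal \<bar>D (mi_plus be S) x\<bar>) x)" for be x
  unfolding T_def[abs_def] by (subst line_nn_sum) (auto simp: line_nn_cmult box_nn_insert[OF insert(2)])
 from weak_pair_sobolev_line[OF wp[of j al] h[of j] g[of j]] IH[of al] IH[of al']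
 show ?case
 proof eventually_elim
  case (elim x)
  show ?case
  proof
  assume x: "x \<in> cube & x + (\<Sum>i\<in>insert j I. h i *\<^sub>R ?w i) \<in> cube"
  have hI: "?H $ k = (if k \<in> I then h k * sg k else 0)" for k
  by (simp add: axis_def if_distrib cong: if_cong)
  have hj: "(\<Sum>i\<in>insert j I. h i *\<^sub>R ?w i) $ k = (if k \<in> insert j I then h k * sg k else 0)" for k
  by (simp add: axis_def if_distrib cong: if_cong del: sum.insert)
  \<comment> \<open>Both end points lie in the cube, which is a product; hence so does every mixture
    of moved and unmoved coordinates.\<close>
  have inc: "x + t *\<^sub>R ?w j \<in> cube & x + t *\<^sub>R ?w j + ?H \<in> cube" if t: "0 <= t" "t <= h j" for t
  proof -
  have ex: "0 < x $ k & x $ k < 1 & 0 < x $ k + (if k \<in> insert j I then h k * sg k else 0) &  x $ k + (if k \<in> insert j I then h k * sg k else 0) < 1" for k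
  using x hj unfolding cube_def by auto
  have tj: "0 < x $ j + t * sg j & x $ j + t * sg j < 1"
  proof (cases "sg j = 1")
  case True then show ?thesis using ex[of j] t by auto
  next
  case False then have "sg j = -1" using g by blast
  then show ?thesis using ex[of j] t by auto
  qed
  have "(x + t *\<^sub>R ?w j) $ k = x $ k + (if k = j then t * sg j else 0)" for k
  by (simp add: axis_def)
  then have "0 < (x + t *\<^sub>R ?w j) $ k & (x + t *\<^sub>R ?w j) $ k < 1 & 0 < (x + t *\<^sub>R ?w j) $ k + ?H $ k & (x + t *\<^sub>R ?w j) $ k + ?H $ k < 1" for k
  using ex[of k] tj hI[of k] insert(2) by (cases "k = j"; cases "k \<in> I") simp_all
  then show ?thesis unfolding cube_def by simp
  qed
  have line: "line_nn (h j) (?w j) (%x. ennreal \<bar>D be x\<bar>) x <= line_nn (h j) (?w j) (T be) x"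
  if "AE t in lborel. x + t *\<^sub>R ?w j \<in> cube & x + t *\<^sub>R ?w j + ?H \<in> cube --> ennreal \<bar>D be (x + t *\<^sub>R ?w j)\<bar> <= T be (x + t *\<^sub>R ?w j)" for be
  unfolding line_nn_def
  by (intro nn_integral_mono_AE, use that in eventually_elim) (use inc in \<open>auto simp: indicator_def\<close>)
  have "x + h j *\<^sub>R ?w j \<in> cube" using inc[of "h j"] h[of j] by auto
  then have "ennreal \<bar>D al x\<bar> <= ennreal (1 / h j) * line_nn (h j) (?w j) (%x. ennreal \<bar>D al x\<bar>) x + line_nn (h j) (?w j) (%x. ennreal \<bar>D al' x\<bar>) x"
  using elim(1) x by (simp add: al'_def)
  also have "... <= ennreal (1 / h j) * line_nn (h j) (?w j) (T al) x + line_nn (h j) (?w j) (T al') x"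
  by (intro add_mono mult_left_mono line elim) auto
  \<comment> \<open>Subsets of \<open>insert j I\<close> without j come from averaging in direction
    j, those containing j from differentiating in it.\<close>
  also have "... = (\<Sum>S\<in>Pow I. ennreal (\<Prod>i\<in>insert j I - S. 1 / h i) * box_nn (insert j I) sg h (%x. ennreal \<bar>D (mi_plus al S) x\<bar>) x)
  + (\<Sum>S\<in>insert j ` Pow I. ennreal (\<Prod>i\<in>insert j I - S. 1 / h i) * box_nn (insert j I) sg h (%x. ennreal \<bar>D (mi_plus al S) x\<bar>) x)"
  proof -
  have 1: "ennreal (1 / h j) * line_nn (h j) (?w j) (T al) x = (\<Sum>S\<in>Pow I. ennreal (\<Prod>i\<in>insert j I - S. 1 / h i) * box_nn (insert j I) sg h (%x. ennreal \<bar>D (mi_plus al S) x\<bar>) x)"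
  unfolding Tsum sum_distrib_left
  proof (intro sum.cong refl)
  fix S assume S: "S \<in> Pow I"
  have "insert j I - S = insert j (I - S)" using S insert(2) by auto
  then have "(\<Prod>i\<in>insert j I - S. 1 / h i) = 1 / h j * (\<Prod>i\<in>I - S. 1 / h i)"
  using insert(2) by (simp add: prod.insert)
  then have "ennreal (\<Prod>i\<in>insert j I - S. 1 / h i) = ennreal (1 / h j) * ennreal (\<Prod>i\<in>I - S. 1 / h i)"
  using h by (simp only:) (intro ennreal_mult, auto intro!: prod_nonneg simp: less_imp_le)
  then show "ennreal (1 / h j) * (ennreal (\<Prod>i\<in>I - S. 1 / h i) * box_nn (insert j I) sg h (%x. ennreal \<bar>D (mi_plus al S) x\<bar>) x) =
  ennreal (\<Prod>i\<in>insert j I - S. 1 / h i) * box_nn (insert j I) sg h (%x. ennreal \<bar>D (mi_plus al S) x\<bar>) x"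
  by (simp only: mult.assoc)
  qed
  have inj: "inj_on (insert j) (Pow I)" using insert(2) by (auto simp: inj_on_def)
  have 2: "line_nn (h j) (?w j) (T al') x = (\<Sum>S\<in>insert j ` Pow I. ennreal (\<Prod>i\<in>insert j I - S. 1 / h i) * box_nn (insert j I) sg h (%x. ennreal \<bar>D (mi_plus al S) x\<bar>) x)"
  unfolding Tsum sum.reindex[OF inj] o_def
  proof (intro sum.cong refl)
  fix S assume S: "S \<in> Pow I"
  have "insert j I - insert j S = I - S" using S insert(2) by auto
  moreover have "mi_plus al' S = mi_plus al (insert j S)"
  using S insert(2) by (auto simp: mi_plus_def al'_def fun_eq_iff)
  ultimately show "ennreal (\<Prod>i\<in>I - S. 1 / h i) * box_nn (insert j I) sg h (%x. ennreal \<bar>D (mi_plus al' S) x\<bar>) x =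
  ennreal (\<Prod>i\<in>insert j I - insert j S. 1 / h i) * box_nn (insert j I) sg h (%x. ennreal \<bar>D (mi_plus al (insert j S)) x\<bar>) x"
  by simp
  qed
  show ?thesis unfolding 1 2 ..
  qed
  also have "... = (\<Sum>S\<in>Pow (insert j I). ennreal (\<Prod>i\<in>insert j I - S. 1 / h i) * box_nn (insert j I) sg h (%x. ennreal \<bar>D (mi_plus al S) x\<bar>) x)"
  unfolding Pow_insert using insert(2) by (intro sum.union_disjoint[symmetric]) auto
  finally show "ennreal \<bar>D al x\<bar> <= (\<Sum>S\<in>Pow (insert j I). ennreal (\<Prod>i\<in>insert j I - S. 1 / h i) * box_nn (insert j I) sg h (%x. ennreal \<bar>D (mi_plus al S) x\<bar>) x)" .
  qed
 qed
qed

text \<open>Translating and flipping axes preserves Lebesgue measure; it suffices to check this on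
  boxes.\<close>

lemma lborel_eq_distr_signed:
 fixes x :: "real ^ 'n::finite"
 assumes g: "!!i. sg i = 1 | sg i = (-1::real)"
 shows "lborel = distr (PiM UNIV (%_. lborel)) borel (%f. x + (\<Sum>i\<in>UNIV. f i *\<^sub>R (sg i *\<^sub>R axis i 1)))"
proof -
 define F where "F f = x + (\<Sum>i\<in>UNIV. f i *\<^sub>R (sg i *\<^sub>R axis i 1))" for f
 have F: "F f $ k = x $ k + f k * sg k" for f k
  by (simp add: F_def axis_def if_distrib cong: if_cong)
 have [measurable]: "F \<in> borel_measurable (PiM UNIV (%_. lborel))"
  unfolding F_def[abs_def] by measurable
 have "lborel = distr (PiM UNIV (%_. lborel)) borel F"
proof (rule lborel_eqI)
 fix l u :: "real ^ 'n" assume lu: "!!b. b \<in> Basis ==> l \<bullet> b <= u \<bullet> b"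
 then have lu': "l $ i <= u $ i" for i by (metis axis_in_Basis_iff cart_eq_inner_axis inner_commute insertI1 Basis_real_def)
 define J where "J i = (if sg i = 1 then {l $ i - x $ i <..< u $ i - x $ i} else {x $ i - u $ i <..< x $ i - l $ i})" for i
 have "F -` box l u Int space (PiM UNIV (%_. lborel)) = PiE UNIV J"
 proof -
  have "(l $ i < x $ i + f i * sg i & x $ i + f i * sg i < u $ i) \<longleftrightarrow> f i \<in> J i" for f i
  proof (cases "sg i = 1")
  case False
  then have "sg i = -1" using g by blast
  then show ?thesis by (auto simp: J_def)
  qed (auto simp: J_def)
  then show ?thesis by (auto simp: space_PiM mem_box_cart F PiE_iff)
 qed
 moreover have "emeasure (distr (PiM UNIV (%_. lborel)) borel F) (box l u) = emeasure (PiM UNIV (%_. lborel)) (F -` box l u Int space (PiM UNIV (%_. lborel)))"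
  by (rule emeasure_distr) auto
 moreover have "emeasure (PiM UNIV (%_. lborel)) (PiE UNIV J) = (\<Prod>i\<in>UNIV. emeasure lborel (J i))"
  by (rule lborel_product.emeasure_PiM) (auto simp: J_def)
 moreover have "emeasure lborel (J i) = ennreal (u $ i - l $ i)" for i
  using lu'[of i] by (auto simp: J_def)
 moreover have "(\<Prod>b\<in>Basis. (u - l) \<bullet> b) = (\<Prod>i\<in>UNIV. u $ i - l $ i)"
 proof -
  have B: "(Basis :: (real ^ 'n) set) = range (%i. axis i 1)" by (auto simp: Basis_vec_def)
  have inj: "inj (%i. axis i 1 :: real ^ 'n)" by (auto simp: inj_def axis_eq_axis)
  have "(\<Prod>b\<in>Basis. (u - l) \<bullet> b) = (\<Prod>i\<in>UNIV. (u - l) \<bullet> axis i 1)"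
  unfolding B by (subst prod.reindex[OF inj]) simp
  then show ?thesis by (simp add: inner_axis)
 qed
 ultimately show "emeasure (distr (PiM UNIV (%_. lborel)) borel F) (box l u) = (\<Prod>b\<in>Basis. (u - l) \<bullet> b)"
  using lu' by (simp add: prod_ennreal)
qed auto
 then show ?thesis unfolding F_def[abs_def] .
qed

lemma box_nn_UNIV_le:
 fixes x :: "real ^ 'n::finite"
 assumes g: "!!i. sg i = 1 | sg i = (-1::real)" and [measurable]: "g \<in> borel_measurable borel" "B \<in> sets borel"
  and B: "!!y. (!!i. \<exists>t\<in>{0..h i}. y $ i = x $ i + t * sg i) ==> y \<in> B"
 shows "box_nn UNIV sg h g x <= (\<integral>\<^sup>+y. indicator B y * g y \<partial>lborel)"
proof -
 define F where "F f = x + (\<Sum>i\<in>UNIV. f i *\<^sub>R (sg i *\<^sub>R axis i 1))" for f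
 have F: "F f $ k = x $ k + f k * sg k" for f k
  by (simp add: F_def axis_def if_distrib cong: if_cong)
 have [measurable]: "F \<in> borel_measurable (PiM UNIV (%_. lborel))"
  unfolding F_def[abs_def] by measurable
 have "(\<Prod>i\<in>UNIV. indicator {0..h i} (f i)) * g (F f) <= indicator B (F f) * g (F f)" for f
 proof (cases "ALL i. f i \<in> {0..h i}")
  case True
  then have "F f \<in> B" by (intro B) (auto simp: F)
  then show ?thesis using True by simp
 next
  case False
  then obtain i where "f i ~: {0..h i}" by blast
  then have "(\<Prod>i\<in>UNIV. indicator {0..h i} (f i) :: ennreal) = 0"
  by (intro prod_zero bexI[of _ i]) auto
  then show ?thesis by (simp only: mult_zero_left zero_le)
 qed
 then have "box_nn UNIV sg h g x <= (\<integral>\<^sup>+f. indicator B (F f) * g (F f) \<partial>PiM UNIV (%_. lborel))"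
  unfolding box_nn_def F_def[symmetric] by (intro nn_integral_mono) blast
 also have "... = (\<integral>\<^sup>+y. indicator B y * g y \<partial>distr (PiM UNIV (%_. lborel)) borel F)"
  by (rule nn_integral_distr[symmetric]) auto
 also have "... = (\<integral>\<^sup>+y. indicator B y * g y \<partial>lborel)"
  using lborel_eq_distr_signed[of sg x] g unfolding F_def[symmetric, abs_def] by simp
 finally show ?thesis .
qed

lemma AE_open_ex:
 fixes U :: "(real ^ 'n::finite) set"
 assumes "AE x in lborel. P x" "open U" "U ~= {}"
 shows "\<exists>x\<in>U. P x"
proof (rule ccontr)
 assume a: "\<not> (\<exists>x\<in>U. P x)"
 obtain N where N: "N \<in> null_sets lborel" "{x. \<not> P x} <= N"
  using assms(1) unfolding eventually_ae_filter by auto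
 have "U <= N" using a N by auto
 moreover have "negligible N" using N(1) by (simp add: negligible_iff_null_sets null_sets_completionI)
 ultimately show False using assms open_not_negligible negligible_subset by blast
qed

text \<open>If the inequality failed somewhere, it would fail on a nonempty open set, and such a set
  is not null.\<close>

lemma AE_le_continuous_imp_le:
 fixes F :: "real ^ 'n::finite => real"
 assumes "AE x in lborel. x \<in> U --> F x <= c" "open U" "continuous_on U F" "x \<in> U"
 shows "F x <= c"
proof (rule ccontr)
 assume "\<not> F x <= c"
 then have "U Int F -` {c<..} ~= {}" using assms by auto
 moreover have "open (U Int F -` {c<..})"
  using assms by (intro continuous_open_preimage) auto
 ultimately obtain y where "y \<in> U Int F -` {c<..}" "y \<in> U --> F y <= c"
  using AE_open_ex[OF assms(1)] by blast
 then show False by auto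
qed

text \<open>V consists of base points whose boxes all lie in K, which makes the right-hand side
  independent of x.\<close>

lemma sobolev_AE_bound:
 fixes D :: "('n::finite => nat) => real ^ 'n => real"
 assumes wp: "!!al i. weak_pair i (D al) (D (al(i := Suc (al i))))"
  and h: "!!i. 0 < h i" and g: "!!i. sg i = 1 | sg i = (-1::real)"
  and K: "K \<in> sets borel" "K <= cube"
  and V: "!!x y. x \<in> V ==> (!!i. \<exists>t\<in>{0..h i}. y $ i = x $ i + t * sg i) ==> y \<in> K"
 shows "AE x in lborel. x \<in> V --> ennreal \<bar>D al x\<bar> \<le>
  (\<Sum>S\<in>UNIV. ennreal (\<Prod>i\<in>-S. 1 / h i) * (\<integral>\<^sup>+y. indicator K y * ennreal \<bar>D (mi_plus al S) y\<bar> \<partial>lborel))"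
 using sobolev_AE[where D = D and h = h and sg = sg and I = UNIV and al = al, OF wp h g]
proof eventually_elim
 case (elim x)
 have [measurable]: "D al \<in> borel_measurable borel" for al by (rule weak_pair_measurable(1)[OF wp])
 show ?case
 proof
  assume x: "x \<in> V"
  have "x \<in> K" by (rule V[OF x]) (use h in \<open>auto intro!: bexI[of _ 0] less_imp_le\<close>)
  moreover have "x + (\<Sum>i\<in>UNIV. h i *\<^sub>R (sg i *\<^sub>R axis i 1)) \<in> K"
  proof (rule V[OF x])
  fix k
  have "(x + (\<Sum>i\<in>UNIV. h i *\<^sub>R (sg i *\<^sub>R axis i 1))) $ k = x $ k + h k * sg k"
  by (simp add: axis_def if_distrib cong: if_cong)
  then show "\<exists>t\<in>{0..h k}. (x + (\<Sum>i\<in>UNIV. h i *\<^sub>R (sg i *\<^sub>R axis i 1))) $ k = x $ k + t * sg k"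
  using h[of k] by (intro bexI[of _ "h k"]) auto
  qed
  ultimately have "ennreal \<bar>D al x\<bar> <= (\<Sum>S\<in>Pow UNIV. ennreal (\<Prod>i\<in>UNIV - S. 1 / h i) * box_nn UNIV sg h (%x. ennreal \<bar>D (mi_plus al S) x\<bar>) x)"
  using elim K by blast
  also have "... <= (\<Sum>S\<in>UNIV. ennreal (\<Prod>i\<in>-S. 1 / h i) * (\<integral>\<^sup>+y. indicator K y * ennreal \<bar>D (mi_plus al S) y\<bar> \<partial>lborel))"
  unfolding Pow_UNIV Compl_eq_Diff_UNIV
  by (intro sum_mono mult_left_mono box_nn_UNIV_le g K(1) V[OF x]) auto
  finally show "ennreal \<bar>D al x\<bar> <= (\<Sum>S\<in>UNIV. ennreal (\<Prod>i\<in>-S. 1 / h i) * (\<integral>\<^sup>+y. indicator K y * ennreal \<bar>D (mi_plus al S) y\<bar> \<partial>lborel))" .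
 qed
qed

section \<open>Continuous and smooth representatives of the weak derivatives\<close>

lemma cbox_subset_cubeD:
 fixes a b :: "real ^ 'n::finite"
 assumes "cbox a b <= cube" "box a b ~= {}" shows "0 < a $ i" "b $ i < 1" "a $ i < b $ i"
proof -
 obtain z where z: "z \<in> box a b" using assms by blast
 then have lt: "a $ j < b $ j" for j by (simp add: mem_box_cart) (meson order_less_trans)
 then have "a \<in> cbox a b" "b \<in> cbox a b" by (auto simp: mem_box_cart less_imp_le)
 then have "a \<in> cube" "b \<in> cube" using assms by auto
 then show "0 < a $ i" "b $ i < 1" "a $ i < b $ i" using lt by (auto simp: cube_def)
qed

lemma weak_family_AE_bounded:
 fixes D :: "('n::finite => nat) => real ^ 'n => real"
 assumes wp: "!!al i. weak_pair i (D al) (D (al(i := Suc (al i))))"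
  and ab: "cbox a b <= cube" "box a b ~= {}"
 shows "\<exists>B\<ge>0. AE x in lborel. x \<in> box a b --> \<bar>D al x\<bar> <= B"
proof -
 note lim = cbox_subset_cubeD[OF ab]
 \<comment> \<open>Half the distance from the box to the upper face keeps all Sobolev boxes in a
   compact part K of the cube, where the derivatives are integrable.\<close>
 define h where "h i = (1 - b $ i) / 2" for i
 define K where "K = cbox a (\<chi> i. (1 + b $ i) / 2)"
 have Kc: "K <= cube"
 proof
  fix x assume x: "x \<in> K"
  have "0 < x $ i & x $ i < 1" for i
  proof -
  have "a $ i <= x $ i" "x $ i <= (1 + b $ i) / 2" using x by (auto simp: K_def mem_box_cart)
  then show ?thesis using lim[of i] by auto
  qed
  then show "x \<in> cube" by (auto simp: cube_def)
 qed
 let ?R = "\<Sum>S\<in>UNIV. ennreal (\<Prod>i\<in>-S. 1 / h i) * (\<integral>\<^sup>+y. indicator K y * ennreal \<bar>D (mi_plus al S) y\<bar> \<partial>lborel)"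
 have "AE x in lborel. x \<in> box a b --> ennreal \<bar>D al x\<bar> <= ?R"
 proof (rule sobolev_AE_bound[OF wp, where sg = "%_. 1"])
  show "0 < h i" for i using lim[of i] by (simp add: h_def)
  fix x y assume x: "x \<in> box a b" and y: "!!i. \<exists>t\<in>{0..h i}. y $ i = x $ i + t * 1"
  have "a $ i <= y $ i & y $ i <= (1 + b $ i) / 2" for i
  proof -
  have "a $ i < x $ i" "x $ i < b $ i" using x by (auto simp: mem_box_cart)
  moreover obtain t where "0 <= t" "t <= (1 - b $ i) / 2" "y $ i = x $ i + t" using y[of i] by (auto simp: h_def)
  ultimately show ?thesis by (auto simp: field_simps)
  qed
  then show "y \<in> K" by (auto simp: K_def mem_box_cart)
 qed (use Kc in \<open>auto simp: K_def\<close>)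
 moreover have "?R < \<infinity>"
 proof -
  have "(\<integral>\<^sup>+y. indicator K y * ennreal \<bar>D be y\<bar> \<partial>lborel) < \<infinity>" for be
  proof -
  have "set_integrable lborel K (D be)"
  using wp[of undefined be] Kc unfolding weak_pair_def loc_int_def by (auto simp: K_def)
  then have "(\<integral>\<^sup>+y. norm (indicator K y *\<^sub>R D be y) \<partial>lborel) < \<infinity>"
  unfolding set_integrable_def integrable_iff_bounded by simp
  also have "(\<integral>\<^sup>+y. norm (indicator K y *\<^sub>R D be y) \<partial>lborel) = (\<integral>\<^sup>+y. indicator K y * ennreal \<bar>D be y\<bar> \<partial>lborel)"
  by (intro nn_integral_cong) (auto simp: indicator_def)
  finally show ?thesis .
  qed
  then show ?thesis by (auto simp: ennreal_mult_less_top)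
 qed
 then have R: "?R = ennreal (enn2real ?R)" by simp
 ultimately have "AE x in lborel. x \<in> box a b --> ennreal \<bar>D al x\<bar> <= ennreal (enn2real ?R)"
  by simp
 then have "AE x in lborel. x \<in> box a b --> \<bar>D al x\<bar> <= enn2real ?R"
  by eventually_elim (simp add: ennreal_le_iff)
 then show ?thesis by (intro exI[of _ "enn2real ?R"]) auto
qed

lemma box_segment:
 fixes x :: "real ^ 'n::finite"
 assumes "x \<in> box a b" "x + h *\<^sub>R w \<in> box a b" "0 <= t" "t <= h"
 shows "x + t *\<^sub>R w \<in> box a b"
proof (cases "h = 0")
 case False
 have "(1 - t / h) *\<^sub>R x + (t / h) *\<^sub>R (x + h *\<^sub>R w) \<in> box a b"
  using assms False by (intro convexD convex_box) auto
 also have "(1 - t / h) *\<^sub>R x + (t / h) *\<^sub>R (x + h *\<^sub>R w) = x + t *\<^sub>R w"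
  using False by (simp add: algebra_simps)
 finally show ?thesis .
qed (use assms in auto)

lemma weak_pair_AE_lipschitz_axis:
 fixes u v :: "real ^ 'n::finite => real"
 assumes wp: "weak_pair i u v" and ab: "box a b <= cube" and B: "0 <= B"
  and v: "AE x in lborel. x \<in> box a b --> \<bar>v x\<bar> <= B"
 shows "AE x in lborel. x \<in> box a b & x + t *\<^sub>R axis i 1 \<in> box a b --> \<bar>u (x + t *\<^sub>R axis i 1) - u x\<bar> <= B * \<bar>t\<bar>"
proof -
 define sg :: real where "sg = (if t \<ge> 0 then 1 else -1)"
 have s: "sg = 1 | sg = -1" "\<bar>t\<bar> *\<^sub>R (sg *\<^sub>R axis i 1) = t *\<^sub>R (axis i 1 :: real ^ 'n)" by (auto simp: sg_def)
 from weak_pair_increment_signed[OF wp abs_ge_zero[of t] s(1), of 0] AE_AE_line[OF v, of "sg *\<^sub>R axis i 1"]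
 show ?thesis
 proof eventually_elim
  case (elim x)
  show ?case
  proof
  assume x: "x \<in> box a b & x + t *\<^sub>R axis i 1 \<in> box a b"
  then have "ennreal \<bar>u (x + t *\<^sub>R axis i 1) - u x\<bar> <= (\<integral>\<^sup>+r. indicator {0..\<bar>t\<bar>} r * ennreal \<bar>v (x + r *\<^sub>R (sg *\<^sub>R axis i 1))\<bar> \<partial>lborel)"
  using elim(1) ab unfolding s(2) by auto
  also have "... <= (\<integral>\<^sup>+r. indicator {0..\<bar>t\<bar>} r * ennreal B \<partial>lborel)"
  proof (intro nn_integral_mono_AE, use elim(2) in eventually_elim)
  case (elim r)
  have "x + r *\<^sub>R (sg *\<^sub>R axis i 1) \<in> box a b" if "0 <= r" "r <= \<bar>t\<bar>"
  by (rule box_segment[where h = "\<bar>t\<bar>"]) (use x that s(2) in auto)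
  then show ?case using elim by (auto simp: indicator_def intro!: ennreal_leI)
  qed
  also have "... = ennreal (B * \<bar>t\<bar>)"
  using B by (subst nn_integral_multc) (auto simp: ennreal_mult mult.commute)
  finally show "\<bar>u (x + t *\<^sub>R axis i 1) - u x\<bar> <= B * \<bar>t\<bar>" using B by simp
  qed
 qed
qed

text \<open>Coordinates are changed one at a time; the intermediate points stay in the box because
  it is a product.\<close>

lemma AE_lipschitz_shift:
 fixes u :: "real ^ 'n::finite => real"
 assumes B: "0 <= B" and ax: "!!i t. AE x in lborel. x \<in> box a b & x + t *\<^sub>R axis i 1 \<in> box a b --> \<bar>u (x + t *\<^sub>R axis i 1) - u x\<bar> <= B * \<bar>t\<bar>"
 shows "AE x in lborel. x \<in> box a b & x + (\<Sum>i\<in>I. s i *\<^sub>R axis i 1) \<in> box a b --> \<bar>u (x + (\<Sum>i\<in>I. s i *\<^sub>R axis i 1)) - u x\<bar> <= B * (\<Sum>i\<in>I. \<bar>s i\<bar>)"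
 using finite[of I]
proof (induction I rule: finite_induct)
 case (insert j I)
 let ?H = "\<Sum>i\<in>I. s i *\<^sub>R axis i 1 :: real ^ 'n"
 from ax[of "s j" j] AE_shift[OF insert.IH, of "s j *\<^sub>R axis j 1"]
 show ?case
 proof eventually_elim
  case (elim x)
  show ?case
  proof
  assume x: "x \<in> box a b & x + (\<Sum>i\<in>insert j I. s i *\<^sub>R axis i 1) \<in> box a b"
  have H: "?H $ k = (if k \<in> I then s k else 0)" for k
  by (simp add: axis_def if_distrib cong: if_cong)
  have eq: "x + (\<Sum>i\<in>insert j I. s i *\<^sub>R axis i 1) = x + s j *\<^sub>R axis j 1 + ?H"
  using insert by (simp add: add.assoc)
  have "x + s j *\<^sub>R axis j 1 \<in> box a b"
  proof -
  have "a $ k < x $ k + s j * axis j 1 $ k & x $ k + s j * axis j 1 $ k < b $ k" for k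
  proof -
  have 1: "a $ k < x $ k & x $ k < b $ k" "a $ k < x $ k + s j * axis j 1 $ k + ?H $ k & x $ k + s j * axis j 1 $ k + ?H $ k < b $ k"
  using x unfolding eq by (auto simp: mem_box_cart)
  then show ?thesis unfolding H using insert(2) by (cases "k = j") (auto simp: axis_def)
  qed
  then show ?thesis by (simp add: mem_box_cart)
  qed
  then have "\<bar>u (x + s j *\<^sub>R axis j 1 + ?H) - u (x + s j *\<^sub>R axis j 1)\<bar> <= B * (\<Sum>i\<in>I. \<bar>s i\<bar>)"
  "\<bar>u (x + s j *\<^sub>R axis j 1) - u x\<bar> <= B * \<bar>s j\<bar>" using elim x unfolding eq by auto
  then show "\<bar>u (x + (\<Sum>i\<in>insert j I. s i *\<^sub>R axis i 1)) - u x\<bar> <= B * (\<Sum>i\<in>insert j I. \<bar>s i\<bar>)"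
  unfolding eq using insert by (simp add: distrib_left)
  qed
 qed
qed simp

text \<open>Call x good if the Lipschitz estimate holds between x and almost every y. Two good
  points are compared through points y close to one of them, so u is Lipschitz on the good points;
  these are dense in the box, and u extends continuously from them.\<close>

lemma continuous_rep_box:
 fixes u :: "real ^ 'n::finite => real"
 assumes B: "0 <= B" and um [measurable]: "u \<in> borel_measurable borel"
  and ax: "!!i t. AE x in lborel. x \<in> box a b & x + t *\<^sub>R axis i 1 \<in> box a b --> \<bar>u (x + t *\<^sub>R axis i 1) - u x\<bar> <= B * \<bar>t\<bar>"
 shows "EX g. continuous_on (box a b) g & (AE x in lborel. x \<in> box a b --> u x = g x)"
proof -
 let ?V = "box a b"
 define n1 where "n1 x = (\<Sum>i\<in>UNIV. \<bar>x $ i\<bar>)" for x :: "real ^ 'n"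
 have [measurable]: "n1 \<in> borel_measurable borel" unfolding n1_def[abs_def] by measurable
 have n1c: "continuous_on UNIV n1" unfolding n1_def by (intro continuous_intros)
 have n10: "n1 0 = 0" by (simp add: n1_def)
 have tri: "n1 (x + y) <= n1 x + n1 y" for x y unfolding n1_def by (simp add: sum.distrib[symmetric] sum_mono abs_triangle_ineq)
 define P where "P x y \<longleftrightarrow> (x \<in> ?V & y \<in> ?V --> \<bar>u y - u x\<bar> <= B * n1 (y - x))" for x y
 have "AE x in lborel. P x (x + s)" for s
 proof -
  have s: "(\<Sum>i\<in>UNIV. s $ i *\<^sub>R axis i 1) = s"
  by (simp add: vec_eq_iff axis_def if_distrib cong: if_cong)
  show ?thesis using AE_lipschitz_shift[OF B ax, where I = UNIV and s = "%i. s $ i"] unfolding s P_def n1_def by simp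
 qed
 then have "AE s in lborel. AE x in lborel. P x (x + s)" by simp
 moreover have "{z \<in> space (lborel \<Otimes>\<^sub>M lborel). P (fst z) (fst z + snd z)} \<in> sets (lborel \<Otimes>\<^sub>M lborel)"
  unfolding P_def by measurable
 ultimately have "AE x in lborel. AE s in lborel. P x (x + s)"
  by (subst lborel_pair.AE_commute)
 then have AEP: "AE x in lborel. AE y in lborel. P x y"
 proof eventually_elim
  case (elim x)
  show ?case using AE_shift[OF elim, of "- x"] by simp
 qed
 define Z where "Z = {x \<in> ?V. AE y in lborel. P x y}"
 have AEZ: "AE x in lborel. x \<in> ?V --> x \<in> Z"
  using AEP by eventually_elim (auto simp: Z_def)
 have lip: "\<bar>u x - u x'\<bar> <= B * n1 (x - x')" if "x \<in> Z" "x' \<in> Z" for x x'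
 proof -
  \<comment> \<open>A continuous majorant of the difference of u at x and x', valid at almost every
    y and hence also at y = x, where its first term vanishes.\<close>
  define F where "F y = B * n1 (y - x) + B * n1 (y - x')" for y
  have cF: "continuous_on ?V F" unfolding F_def
  by (intro continuous_intros continuous_on_compose2[OF n1c]) auto
  have "AE y in lborel. y \<in> ?V --> - F y <= - \<bar>u x - u x'\<bar>"
  proof -
  have "AE y in lborel. P x y" "AE y in lborel. P x' y" using that by (auto simp: Z_def)
  then show ?thesis
  proof eventually_elim
  case (elim y)
  show ?case
  proof
  assume "y \<in> ?V"
  then have "\<bar>u y - u x\<bar> <= B * n1 (y - x)" "\<bar>u y - u x'\<bar> <= B * n1 (y - x')"
  using elim that by (auto simp: P_def Z_def)
  then show "- F y <= - \<bar>u x - u x'\<bar>" unfolding F_def by linarith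
  qed
  qed
  qed
  then have "- F x <= - \<bar>u x - u x'\<bar>"
  by (rule AE_le_continuous_imp_le[where F = "%y. - F y"]) (use that cF in \<open>auto simp: Z_def open_box intro: continuous_on_minus\<close>)
  then show ?thesis by (simp add: F_def n10)
 qed
 have "uniformly_continuous_on Z u"
  unfolding uniformly_continuous_on_def
 proof (intro allI impI)
  fix e :: real assume e: "e > 0"
  define d where "d = e / ((B + 1) * real CARD('n))"
  have d: "d > 0" using e B by (simp add: d_def)
  have "dist (u x') (u x) < e" if "x \<in> Z" "x' \<in> Z" "dist x' x < d" for x x'
  proof -
  have "n1 (x' - x) <= (\<Sum>i\<in>(UNIV::'n set). dist x' x)"
  unfolding n1_def dist_norm by (intro sum_mono component_le_norm_cart)
  also have "... = real CARD('n) * dist x' x" by simp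
  finally have "B * n1 (x' - x) <= B * (real CARD('n) * dist x' x)" using B by (rule mult_left_mono)
  also have "... <= (B + 1) * (real CARD('n) * dist x' x)" by (intro mult_right_mono) auto
  also have "... < (B + 1) * (real CARD('n) * d)"
  using that B by (intro mult_strict_left_mono) auto
  also have "... = e"
  proof -
  have "(B + 1) * real CARD('n) ~= 0" using B by simp
  then show ?thesis unfolding d_def mult.assoc[symmetric] by simp
  qed
  finally show ?thesis using lip[OF that(2,1)] by (simp add: dist_real_def)
  qed
  then show "\<exists>d>0. \<forall>x\<in>Z. \<forall>x'\<in>Z. dist x' x < d --> dist (u x') (u x) < e" using d by blast
 qed
 then obtain g where g: "uniformly_continuous_on (closure Z) g" "!!x. x \<in> Z ==> u x = g x"
  using uniformly_continuous_on_extension_on_closure by metis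
 have "?V <= closure Z"
 proof (rule ccontr)
  assume "\<not> ?V <= closure Z"
  then have "?V - closure Z ~= {}" by blast
  moreover have "open (?V - closure Z)" by (intro open_Diff open_box closed_closure)
  ultimately obtain x where "x \<in> ?V - closure Z" "x \<in> ?V --> x \<in> Z" using AE_open_ex[OF AEZ] by blast
  then show False using closure_subset by blast
 qed
 then have "continuous_on ?V g" using g(1) uniformly_continuous_imp_continuous continuous_on_subset by blast
 moreover have "AE x in lborel. x \<in> ?V --> u x = g x" using AEZ by eventually_elim (use g in auto)
 ultimately show ?thesis by blast
qed

text \<open>Continuous functions that agree with u almost everywhere on an open set agree with each
  other everywhere on it, so the local representatives are consistent and can be glued.\<close>

lemma continuous_rep_cube:
 fixes u :: "real ^ 'n::finite => real"
 assumes loc: "!!a b. cbox a b <= cube ==> box a b ~= {} ==> EX g. continuous_on (box a b) g & (AE x in lborel. x \<in> box a b --> u x = g x)"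
 shows "EX G. continuous_on cube G & (AE x in lborel. x \<in> cube --> u x = G x)"
proof -
 \<comment> \<open>The offset 3 makes 1/(n+3) less than 1/2, so that every box is nonempty.\<close>
 define V :: "nat => (real ^ 'n) set" where "V n = box (\<chi> i. 1 / real (n + 3)) (\<chi> i. 1 - 1 / real (n + 3))" for n
 have memV: "x \<in> V n \<longleftrightarrow> (ALL i. 1 / real (n + 3) < x $ i & x $ i < 1 - 1 / real (n + 3))" for x n
  by (simp add: V_def mem_box_cart)
 have "EX g. continuous_on (V n) g & (AE x in lborel. x \<in> V n --> u x = g x)" for n
 proof -
  have p: "0 < 1 / real (n + 3)" "1 / real (n + 3) < 1 / 2" by (auto simp: field_simps)
  show ?thesis unfolding V_def
  proof (rule loc)
  show "cbox (\<chi> i. 1 / real (n + 3)) (\<chi> i. 1 - 1 / real (n + 3)) <= (cube :: (real ^ 'n) set)"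
  unfolding subset_eq
  proof
  fix x :: "real ^ 'n" assume "x \<in> cbox (\<chi> i. 1 / real (n + 3)) (\<chi> i. 1 - 1 / real (n + 3))"
  then have "1 / real (n + 3) <= x $ i & x $ i <= 1 - 1 / real (n + 3)" for i by (simp add: mem_box_cart)
  then have "0 < x $ i & x $ i < 1" for i
  using p(1) \<open>1 / real (n + 3) <= x $ i & x $ i <= 1 - 1 / real (n + 3)\<close> by linarith
  then show "x \<in> cube" by (simp add: cube_def)
  qed
  have "(\<chi> i. 1 / 2) \<in> V n" using p by (simp add: memV)
  then show "box (\<chi> i. 1 / real (n + 3)) (\<chi> i. 1 - 1 / real (n + 3)) ~= ({} :: (real ^ 'n) set)"
  unfolding V_def by blast
  qed
 qed
 then obtain g where g: "!!n. continuous_on (V n) (g n)" "!!n. AE x in lborel. x \<in> V n --> u x = g n x" by metis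
 have mono: "V n <= V m" if "n <= m" for n m
 proof -
  have "1 / real (m + 3) <= 1 / real (n + 3)" using that by (simp add: frac_le)
  then have "1 / real (m + 3) < x $ i & x $ i < 1 - 1 / real (m + 3)" if "x \<in> V n" for x i
  proof -
  have "1 / real (n + 3) < x $ i & x $ i < 1 - 1 / real (n + 3)" using that by (simp only: memV)
  then show ?thesis using \<open>1 / real (m + 3) <= 1 / real (n + 3)\<close> by linarith
  qed
  then show ?thesis using memV[of _ m] by blast
 qed
 have oV: "open (V n)" for n by (simp add: V_def open_box)
 have cons: "g n x = g m x" if "n <= m" "x \<in> V n" for n m x
 proof -
  have "\<bar>g n x - g m x\<bar> <= 0"
  proof (rule AE_le_continuous_imp_le[where U = "V n" and F = "%x. \<bar>g n x - g m x\<bar>"])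
  from g(2)[of n] g(2)[of m] show "AE x in lborel. x \<in> V n --> \<bar>g n x - g m x\<bar> <= 0"
  by eventually_elim (use mono[OF that(1)] in auto)
  have "continuous_on (V n) (g m)" using g(1) mono[OF that(1)] continuous_on_subset by blast
  then show "continuous_on (V n) (%x. \<bar>g n x - g m x\<bar>)" using g(1)[of n] by (intro continuous_intros)
  qed (use that oV in auto)
  then show ?thesis by simp
 qed
 have ex: "EX n. x \<in> V n" if "x \<in> cube" for x
 proof -
  have lim: "(%n. 1 / real (n + 3)) \<longlonglongrightarrow> 0"
  using LIMSEQ_ignore_initial_segment[OF lim_1_over_n, of 3] by simp
  have "eventually (%n. ALL i. 1 / real (n + 3) < x $ i & x $ i < 1 - 1 / real (n + 3)) sequentially"
  proof (rule eventually_all_finite)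
  fix i
  have "0 < x $ i" "0 < 1 - x $ i" using that by (auto simp: cube_def)
  then have "eventually (%n. 1 / real (n + 3) < x $ i & 1 / real (n + 3) < 1 - x $ i) sequentially"
  by (intro eventually_conj order_tendstoD(2)[OF lim])
  then show "eventually (%n. 1 / real (n + 3) < x $ i & x $ i < 1 - 1 / real (n + 3)) sequentially"
  by eventually_elim auto
  qed
  then show ?thesis unfolding memV eventually_sequentially by blast
 qed
 define G where "G x = g (LEAST n. x \<in> V n) x" for x
 have GV: "G x = g n x" if "x \<in> V n" for x n
 proof -
  have "x \<in> V (LEAST n. x \<in> V n)" "(LEAST n. x \<in> V n) <= n" using that by (auto intro: LeastI Least_le)
  then show ?thesis unfolding G_def using cons by blast
 qed
 have "continuous_on cube G"
 proof (rule continuous_at_imp_continuous_on, intro ballI)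
  fix x :: "real ^ 'n" assume "x \<in> cube"
  then obtain n where n: "x \<in> V n" using ex by blast
  have "continuous_on (V n) G" using g(1)[of n] GV by (simp cong: continuous_on_cong)
  then show "isCont G x" using n oV continuous_on_eq_continuous_at by blast
 qed
 moreover have "AE x in lborel. ALL n. x \<in> V n --> u x = g n x" using g(2) unfolding AE_all_countable by blast
 then have "AE x in lborel. x \<in> cube --> u x = G x"
  by eventually_elim (use ex GV in metis)
 ultimately show ?thesis by blast
qed

text \<open>With \<open>ka\<close> equal to \<open>gv x\<close>, the increment formula brings the
  difference quotients of \<open>gu\<close> close to \<open>gv x\<close>: first at almost every base
  point near x, then by continuity at all of them.\<close>

lemma weak_pair_continuous_derivative:
 fixes u v :: "real ^ 'n::finite => real"
 assumes wp: "weak_pair i u v"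
  and gu: "continuous_on cube gu" "AE x in lborel. x \<in> cube --> u x = gu x"
  and gv: "continuous_on cube gv" "AE x in lborel. x \<in> cube --> v x = gv x"
  and x: "x \<in> cube"
 shows "((%t. gu (x + t *\<^sub>R axis i 1)) has_real_derivative gv x) (at 0)"
proof -
 let ?e = "axis i 1 :: real ^ 'n"
 have ne: "norm ?e = 1" by simp
 \<comment> \<open>Uniform in the base point x', because a negative increment at x is a positive one
   based at x + t e.\<close>
 have key: "\<exists>r>0. ALL t x'. 0 <= t --> t < r --> dist x x' < r --> x' \<in> cube & x' + t *\<^sub>R ?e \<in> cube & \<bar>gu (x' + t *\<^sub>R ?e) - gu x' - t * gv x\<bar> <= t * et" if et: "et > 0" for et
 proof -
  obtain r1 where r1: "r1 > 0" "ball x r1 <= cube" using x open_cube open_contains_ball by blast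
  have "isCont gv x" using gv(1) x open_cube continuous_on_eq_continuous_at by blast
  then obtain r2 where r2: "r2 > 0" "!!z. dist z x < r2 ==> dist (gv z) (gv x) < et"
  unfolding continuous_at_eps_delta using et by blast
  define r where "r = min r1 r2 / 2"
  have r: "r > 0" "2 * r <= r1" "2 * r <= r2" using r1 r2 by (auto simp: r_def)
  have near: "dist x (x' + s *\<^sub>R ?e) < 2 * r" if "0 <= s" "s < r" "dist x x' < r" for s x'
  proof -
  have "dist x (x' + s *\<^sub>R ?e) <= dist x x' + dist x' (x' + s *\<^sub>R ?e)" by (rule dist_triangle)
  also have "dist x' (x' + s *\<^sub>R ?e) = s" using that by (simp add: dist_norm)
  finally show ?thesis using that by simp
  qed
  have inC: "x' + s *\<^sub>R ?e \<in> cube" if "0 <= s" "s < r" "dist x x' < r" for s x'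
  using near[OF that] r r1 by auto
  have "\<bar>gu (x' + t *\<^sub>R ?e) - gu x' - t * gv x\<bar> <= t * et" if t: "0 <= t" "t < r" and x': "dist x x' < r" for t x'
  proof (rule AE_le_continuous_imp_le[where U = "ball x r" and F = "%x'. \<bar>gu (x' + t *\<^sub>R ?e) - gu x' - t * gv x\<bar>"])
  have sub: "ball x r <= cube" using inC[of 0] r by auto
  show "continuous_on (ball x r) (%x'. \<bar>gu (x' + t *\<^sub>R ?e) - gu x' - t * gv x\<bar>)"
  proof -
  have "continuous_on (ball x r) (%x'. gu (x' + t *\<^sub>R ?e))"
  by (rule continuous_on_compose2[OF gu(1)]) (auto intro!: continuous_intros inC t)
  moreover have "continuous_on (ball x r) gu" using gu(1) sub continuous_on_subset by blast
  ultimately show ?thesis by (intro continuous_intros)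
  qed
  from weak_pair_increment[OF wp t(1), of "gv x"] gu(2) AE_shift[OF gu(2), of "t *\<^sub>R ?e"] AE_AE_line[OF gv(2), of ?e]
  show "AE x' in lborel. x' \<in> ball x r --> \<bar>gu (x' + t *\<^sub>R ?e) - gu x' - t * gv x\<bar> <= t * et"
  proof eventually_elim
  case (elim y)
  show ?case
  proof
  assume "y \<in> ball x r"
  then have y: "dist x y < r" by simp
  have yc: "y \<in> cube" using inC[of 0 y] y r by simp
  have "ennreal \<bar>gu (y + t *\<^sub>R ?e) - gu y - t * gv x\<bar> <= (\<integral>\<^sup>+s. indicator {0..t} s * ennreal \<bar>v (y + s *\<^sub>R ?e) - gv x\<bar> \<partial>lborel)"
  using elim(1-3) inC[OF t y] yc by auto
  also have "... <= (\<integral>\<^sup>+s. indicator {0..t} s * ennreal et \<partial>lborel)"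
  proof (intro nn_integral_mono_AE, use elim(4) in eventually_elim)
  case (elim s)
  have "\<bar>v (y + s *\<^sub>R ?e) - gv x\<bar> <= et" if s: "0 <= s" "s <= t"
  proof -
  have sr: "s < r" using s t by simp
  have "dist (gv (y + s *\<^sub>R ?e)) (gv x) < et"
  using near[OF s(1) sr y] r by (intro r2(2)) (simp add: dist_commute)
  then show ?thesis using elim inC[OF s(1) sr y] by (simp add: dist_real_def)
  qed
  then show ?case by (auto simp: indicator_def intro!: ennreal_leI)
  qed
  also have "... = ennreal (t * et)"
  using t et by (subst nn_integral_multc) (auto simp: ennreal_mult)
  finally show "\<bar>gu (y + t *\<^sub>R ?e) - gu y - t * gv x\<bar> <= t * et" using t et by simp
  qed
  qed
  qed (use x' in auto)
  moreover have "x' \<in> cube" if "dist x x' < r" for x' using inC[of 0 x'] that r by simp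
  ultimately show ?thesis using r(1) inC by blast
 qed
 have "((%t. (gu (x + t *\<^sub>R ?e) - gu x) / t) \<longlongrightarrow> gv x) (at 0)"
  unfolding LIM_def
 proof (intro allI impI)
  fix et :: real assume "0 < et"
  then have h: "et / 2 > 0" by simp
  from key[OF h] obtain r where r: "r > 0" "!!t x'. 0 <= t ==> t < r ==> dist x x' < r ==> x' \<in> cube & x' + t *\<^sub>R ?e \<in> cube & \<bar>gu (x' + t *\<^sub>R ?e) - gu x' - t * gv x\<bar> <= t * (et / 2)"
  by blast
  have "dist ((gu (x + t *\<^sub>R ?e) - gu x) / t) (gv x) < et" if t: "t ~= 0" "\<bar>t\<bar> < r" for t
  proof -
  have "\<bar>gu (x + t *\<^sub>R ?e) - gu x - t * gv x\<bar> <= \<bar>t\<bar> * (et / 2)"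
  proof (cases "t \<ge> 0")
  case True
  then show ?thesis using r(2)[of t x] r(1) t by auto
  next
  case False
  have "\<bar>gu ((x + t *\<^sub>R ?e) + (-t) *\<^sub>R ?e) - gu (x + t *\<^sub>R ?e) - (-t) * gv x\<bar> <= (-t) * (et / 2)"
  using r(2)[of "-t" "x + t *\<^sub>R ?e"] False t by (auto simp: dist_norm)
  then show ?thesis using False by (simp add: abs_minus_commute algebra_simps)
  qed
  moreover have "(gu (x + t *\<^sub>R ?e) - gu x) / t - gv x = (gu (x + t *\<^sub>R ?e) - gu x - t * gv x) / t"
  using t by (simp add: field_simps)
  ultimately have "\<bar>(gu (x + t *\<^sub>R ?e) - gu x) / t - gv x\<bar> <= et / 2"
  using t by (simp add: field_simps abs_divide)
  then show ?thesis using \<open>0 < et\<close> by (simp add: dist_real_def)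
  qed
  then show "\<exists>s>0. ALL y. y ~= 0 & dist y 0 < s --> dist ((gu (x + y *\<^sub>R ?e) - gu x) / y) (gv x) < et"
  using r(1) by auto
 qed
 then show ?thesis by (simp add: DERIV_def)
qed

text \<open>All partial derivatives of \<open>G (%_. 0)\<close> as one indexed family, so that
  bounds and Taylor expansions can be stated for every multi-index at once.\<close>

definition smooth_family :: "(('n::finite => nat) => real ^ 'n => real) => bool" where
 "smooth_family G \<longleftrightarrow> (ALL al. continuous_on cube (G al)) \<and>
  (ALL al i. \<forall>x\<in>cube. ((%t. G al (x + t *\<^sub>R axis i 1)) has_real_derivative G (al(i := Suc (al i))) x) (at 0))"

text \<open>Local bounds for the next derivatives make every \<open>D al\<close> locally Lipschitz
  up to a null set, hence equal to a continuous function almost everywhere; a weak pair of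
  continuous functions is a classical one.\<close>

lemma weak_family_smooth:
 fixes D :: "('n::finite => nat) => real ^ 'n => real"
 assumes wp: "!!al i. weak_pair i (D al) (D (al(i := Suc (al i))))"
 shows "EX G. smooth_family G & (ALL al. AE x in lborel. x \<in> cube --> D al x = G al x)"
proof -
 have "EX g. continuous_on cube g & (AE x in lborel. x \<in> cube --> D al x = g x)" for al
 proof (rule continuous_rep_cube)
  fix a b :: "real ^ 'n" assume ab: "cbox a b <= cube" "box a b ~= {}"
  have "ALL i. \<exists>B\<ge>0. AE x in lborel. x \<in> box a b --> \<bar>D (al(i := Suc (al i))) x\<bar> <= B"
  using weak_family_AE_bounded[OF wp ab] by blast
  then obtain B where B: "!!i. B i \<ge> 0" "!!i. AE x in lborel. x \<in> box a b --> \<bar>D (al(i := Suc (al i))) x\<bar> <= B i" by metis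
  define M where "M = (\<Sum>i\<in>UNIV. B i)"
  have BM: "B i <= M" for i unfolding M_def using B(1) by (intro member_le_sum) auto
  have M0: "0 <= M" using B(1) by (auto simp: M_def intro: sum_nonneg)
  show "EX g. continuous_on (box a b) g & (AE x in lborel. x \<in> box a b --> D al x = g x)"
  proof (rule continuous_rep_box[OF M0])
  show "D al \<in> borel_measurable borel" by (rule weak_pair_measurable(1)[OF wp])
  fix i and t :: real
  show "AE x in lborel. x \<in> box a b & x + t *\<^sub>R axis i 1 \<in> box a b --> \<bar>D al (x + t *\<^sub>R axis i 1) - D al x\<bar> <= M * \<bar>t\<bar>"
  proof (rule weak_pair_AE_lipschitz_axis[OF wp _ M0])
  show "box a b <= cube" using ab box_subset_cbox by blast
  from B(2)[of i] show "AE x in lborel. x \<in> box a b --> \<bar>D (al(i := Suc (al i))) x\<bar> <= M"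
  by eventually_elim (use BM[of i] in auto)
  qed
  qed
 qed
 then obtain G where G: "!!al. continuous_on cube (G al)" "!!al. AE x in lborel. x \<in> cube --> D al x = G al x" by metis
 have "smooth_family G" unfolding smooth_family_def
  using G weak_pair_continuous_derivative[OF wp G(1) G(2) G(1) G(2)] by blast
 then show ?thesis using G(2) by blast
qed

section \<open>Distances to the corner and its edges; the decomposition of the cube\<close>

text \<open>Each line in direction w meets N in a null set of parameters; exchanging the quantifiers
  yields one t for which N shifted by t w is null. It is used for quadrics, for the kinks of the
  clamping and for the points where difference quotients diverge.\<close>

lemma AE_lines_countable:
 fixes N :: "(real ^ 'n::finite) set"
 assumes [measurable]: "N \<in> sets borel" and c: "!!x. countable {t. x + t *\<^sub>R w \<in> N}"
 shows "AE x in lborel. x ~: N"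
proof -
 have "AE x in lborel. AE t in lborel. x + t *\<^sub>R w ~: N"
 proof (rule AE_I2)
  fix x
  have "{t. x + t *\<^sub>R w \<in> N} \<in> null_sets lborel"
  by (rule countable_imp_null_set_lborel[OF c])
  then have "AE t in lborel. t ~: {t. x + t *\<^sub>R w \<in> N}" by (rule AE_not_in)
  then show "AE t in lborel. x + t *\<^sub>R w ~: N" by simp
 qed
 moreover have "{z \<in> space (lborel \<Otimes>\<^sub>M lborel). fst z + snd z *\<^sub>R w ~: N} \<in> sets (lborel \<Otimes>\<^sub>M lborel)"
  by measurable
 ultimately have "AE t in lborel. AE x in lborel. x + t *\<^sub>R w ~: N"
  by (subst (asm) lborel_pair.AE_commute)
 then have "\<exists>t::real. AE x in lborel. x + t *\<^sub>R w ~: N"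
 proof -
  have "\<not> (AE t in (lborel::real measure). False)"
  by (simp add: AE_iff_null null_sets_def)
  moreover have "AE t in (lborel::real measure). False" if "\<not> (\<exists>t::real. AE x in lborel. x + t *\<^sub>R w ~: N)"
  using \<open>AE t in lborel. AE x in lborel. x + t *\<^sub>R w ~: N\<close> by eventually_elim (use that in blast)
  ultimately show ?thesis by blast
 qed
 then obtain t :: real where "AE x in lborel. x + t *\<^sub>R w ~: N" by blast
 from AE_shift[OF this, of "- (t *\<^sub>R w)"] show ?thesis by simp
qed

definition cdist :: "real ^ 'n::finite => real ^ 'n => 'n => real" where
 "cdist c x j = \<bar>x $ j - c $ j\<bar>"

lemma r_c_eq: "r_c c x = sqrt (\<Sum>j\<in>UNIV. (cdist c x j)^2)"
 unfolding r_c_def cdist_def dist_vec_def L2_set_def by (simp add: dist_real_def)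

lemma r_e_eq:
 fixes x c :: "real ^ 'n::finite"
 assumes x: "x \<in> cube" and c: "is_corner c"
 shows "r_e c k x = sqrt (\<Sum>j\<in>UNIV - {k}. (cdist c x j)^2)"
proof -
 \<comment> \<open>The nearest point of the edge: coordinate k is kept, all others are moved to
   those of the corner.\<close>
 define z where "z = (\<chi> j. if j = k then x $ k else c $ j)"
 have z: "z \<in> edge c k" using x by (auto simp: edge_def z_def cube_def less_imp_le)
 have split: "dist x y = sqrt ((x $ k - y $ k)^2 + (\<Sum>j\<in>UNIV - {k}. (x $ j - y $ j)^2))" for y
  unfolding dist_vec_def L2_set_def by (subst sum.remove[of _ k]) (auto simp: dist_real_def)
 have dz: "dist x z = sqrt (\<Sum>j\<in>UNIV - {k}. (cdist c x j)^2)"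
  unfolding split by (auto simp: z_def cdist_def intro!: sum.cong)
 have "dist x z <= dist x y" if "y \<in> edge c k" for y
 proof -
  have "(\<Sum>j\<in>UNIV - {k}. (x $ j - y $ j)^2) = (\<Sum>j\<in>UNIV - {k}. (cdist c x j)^2)"
  using that by (intro sum.cong) (auto simp: edge_def cdist_def)
  then show ?thesis unfolding dz split[of y] by simp
 qed
 then have "dist x z <= infdist x (edge c k)"
  using z by (subst infdist_notempty) (auto intro!: cINF_greatest)
 moreover have "infdist x (edge c k) <= dist x z" by (rule infdist_le[OF z])
 ultimately show ?thesis unfolding r_e_def using dz by simp
qed

lemma cdist_bounds:
 assumes "x \<in> cube" "is_corner c" shows "0 < cdist c x j" "cdist c x j < 1"
proof -
 have "0 < x $ j & x $ j < 1" "c $ j = 0 | c $ j = 1" using assms by (auto simp: cube_def is_corner_def)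
 then show "0 < cdist c x j" "cdist c x j < 1" by (auto simp: cdist_def)
qed

lemma cdist_le_r_c: "cdist c x j <= r_c c x"
 unfolding r_c_eq by (rule real_le_rsqrt, rule member_le_sum[of j UNIV "%j. (cdist c x j)^2"]) auto

lemma cdist_le_r_e: "x \<in> cube ==> is_corner c ==> j ~= k ==> cdist c x j <= r_e c k x"
 unfolding r_e_eq by (rule real_le_rsqrt, rule member_le_sum[of j "UNIV - {k}" "%j. (cdist c x j)^2"]) auto

lemma sqrt_sum_le:
 fixes f :: "'i => real"
 assumes "finite I" "!!i. i \<in> I ==> 0 <= f i & f i <= b" "0 <= b"
 shows "sqrt (\<Sum>i\<in>I. (f i)^2) <= real (card I) * b"
proof -
 have "sqrt (\<Sum>i\<in>I. (f i)^2) <= (\<Sum>i\<in>I. \<bar>f i\<bar>)"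
  using L2_set_le_sum_abs[of f I] by (simp add: L2_set_def)
 also have "... <= (\<Sum>i\<in>I. b)" using assms by (intro sum_mono) auto
 finally show ?thesis by simp
qed

lemma continuous_r_c: "continuous_on UNIV (r_c c)"
 unfolding r_c_def by (intro continuous_intros)

lemma continuous_r_e: "continuous_on UNIV (r_e c k)"
 unfolding r_e_def by (intro continuous_intros)

lemma quadratic_roots_countable:
 fixes p q r :: real
 assumes "p ~= 0" shows "countable {t. p * (q + t)^2 = r}"
proof -
 have "{t. p * (q + t)^2 = r} <= {sqrt (r / p) - q, - sqrt (r / p) - q}"
 proof
  fix t assume "t \<in> {t. p * (q + t)^2 = r}"
  then have "(q + t)^2 = r / p" using assms by (auto simp: field_simps)
  then have "\<bar>q + t\<bar> = sqrt (r / p)" by (metis real_sqrt_abs)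
  then show "t \<in> {sqrt (r / p) - q, - sqrt (r / p) - q}" by (auto simp: abs_real_def split: if_splits)
 qed
 then show ?thesis by (rule countable_subset) auto
qed

text \<open>A line in a direction i with nonzero coefficient meets the quadric in at most two
  points.\<close>

lemma quadric_null:
 fixes c :: "real ^ 'n::finite"
 assumes "p i ~= 0"
 shows "AE x in lborel. (\<Sum>j\<in>UNIV. p j * (x $ j - c $ j)^2) ~= (s::real)"
proof -
 have "AE x in lborel. x ~: {x. (\<Sum>j\<in>UNIV. p j * (x $ j - c $ j)^2) = s}"
 proof (rule AE_lines_countable[where w = "axis i 1"])
  fix x :: "real ^ 'n"
  have "(\<Sum>j\<in>UNIV. p j * ((x + t *\<^sub>R axis i 1) $ j - c $ j)^2) = p i * ((x $ i - c $ i) + t)^2 + (\<Sum>j\<in>UNIV - {i}. p j * (x $ j - c $ j)^2)" for t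
  by (subst sum.remove[of _ i]) (auto simp: axis_def algebra_simps intro!: sum.cong)
  then have "{t. x + t *\<^sub>R axis i 1 \<in> {x. (\<Sum>j\<in>UNIV. p j * (x $ j - c $ j)^2) = s}} =
  {t. p i * ((x $ i - c $ i) + t)^2 = s - (\<Sum>j\<in>UNIV - {i}. p j * (x $ j - c $ j)^2)}"
  by (auto simp: algebra_simps)
  then show "countable {t. x + t *\<^sub>R axis i 1 \<in> {x. (\<Sum>j\<in>UNIV. p j * (x $ j - c $ j)^2) = s}}"
  using quadratic_roots_countable[OF assms] by simp
 qed measurable
 then show ?thesis by simp
qed

text \<open>The regions are cut out by strict inequalities, so only the surfaces where
  \<open>r_c\<close>, \<open>r_e\<close> or \<open>rho_ce\<close> equals \<open>eh\<close> can be
  missed; after squaring, all of them are quadrics centred at c.\<close>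

lemma AE_region:
 fixes c :: "real ^ 'n::finite"
 assumes d: "CARD('n) = 2 | CARD('n) = 3" and c: "is_corner c" and eh: "0 < eh" "eh < 1"
 shows "AE x in lborel. x \<in> cube --> x \<in> Omega_0 eh c | x \<in> Omega_c eh c | (\<exists>k\<in>edge_dirs. x \<in> Omega_e eh c k | x \<in> Omega_ce eh c k)"
proof -
 have A1: "AE x in lborel. (\<Sum>j\<in>UNIV. 1 * (x $ j - c $ j)^2) ~= eh^2"
  by (rule quadric_null[where p = "%_. 1"]) simp
 have A2: "AE x in lborel. (\<Sum>j\<in>UNIV. (if j = k then 0 else 1) * (x $ j - c $ j)^2) ~= eh^2" for k
 proof -
  have "UNIV ~= {k}" using d by (metis One_nat_def card_1_singleton_iff numeral_eq_one_iff numeral_eq_iff num.distinct(1,3) numeral_1_eq_Suc_0)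
  then obtain i where "i ~= k" by blast
  then show ?thesis by (intro quadric_null[where p = "%j. if j = k then 0 else 1" and i = i]) auto
 qed
 \<comment> \<open>The cone where \<open>r_e\<close> is \<open>eh\<close> times \<open>r_c\<close>,
   squared: coordinate k enters \<open>r_c\<close> only, which gives it the coefficient
   \<open>- (eh^2)\<close>.\<close>
 have A3: "AE x in lborel. (\<Sum>j\<in>UNIV. (if j = k then - (eh^2) else 1 - eh^2) * (x $ j - c $ j)^2) ~= 0" for k
  by (rule quadric_null[where p = "%j. if j = k then - (eh^2) else 1 - eh^2" and i = k]) (use eh in auto)
 have "AE x in lborel. \<forall>k\<in>UNIV. (\<Sum>j\<in>UNIV. (if j = k then 0 else 1) * (x $ j - c $ j)^2) ~= eh^2"
  by (rule AE_finite_allI[OF finite A2])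
 moreover have "AE x in lborel. \<forall>k\<in>UNIV. (\<Sum>j\<in>UNIV. (if j = k then - (eh^2) else 1 - eh^2) * (x $ j - c $ j)^2) ~= 0"
  by (rule AE_finite_allI[OF finite A3])
 ultimately show ?thesis using A1
 proof eventually_elim
  case (elim x)
  show ?case
  proof
  assume x: "x \<in> cube"
  have sumk: "(\<Sum>j\<in>UNIV. (if j = k then p else q) * (x $ j - c $ j)^2) = p * (cdist c x k)^2 + q * (\<Sum>j\<in>UNIV - {k}. (cdist c x j)^2)" for k p q
  by (subst sum.remove[of _ k]) (auto simp: cdist_def sum_distrib_left intro!: sum.cong)
  have rc2: "(r_c c x)^2 = (\<Sum>j\<in>UNIV. (cdist c x j)^2)" unfolding r_c_eq by (simp add: sum_nonneg)
  have rc2': "(r_c c x)^2 = (cdist c x k)^2 + (\<Sum>j\<in>UNIV - {k}. (cdist c x j)^2)" for k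
  unfolding rc2 by (subst sum.remove[of _ k]) auto
  have re2: "(r_e c k x)^2 = (\<Sum>j\<in>UNIV - {k}. (cdist c x j)^2)" for k
  unfolding r_e_eq[OF x c] by (simp add: sum_nonneg)
  have rcp: "0 < r_c c x" using cdist_bounds(1)[OF x c] cdist_le_r_c order_less_le_trans by blast
  have ne1: "r_c c x ~= eh" using elim(3) rc2 by (auto simp: cdist_def)
  have ne2: "r_e c k x ~= eh" for k using elim(1) re2[of k] sumk[of k 0 1] by auto
  have ne3: "rho_ce c k x ~= eh" for k
  proof
  assume "rho_ce c k x = eh"
  then have "r_e c k x = eh * r_c c x" using rcp by (auto simp: rho_ce_def field_simps)
  then have "(r_e c k x)^2 = eh^2 * (r_c c x)^2" by (simp add: power_mult_distrib)
  then have "- (eh^2) * (cdist c x k)^2 + (1 - eh^2) * (\<Sum>j\<in>UNIV - {k}. (cdist c x j)^2) = 0"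
  unfolding re2 rc2'[of k] by (simp add: algebra_simps)
  then show False using elim(2) sumk[of k "- (eh^2)" "1 - eh^2"] by auto
  qed
  let ?U = "Omega_c eh c Un (\<Union>k\<in>edge_dirs. Omega_e eh c k Un Omega_ce eh c k)"
  let ?E = "edge_dirs :: 'n set"
  have far: "x \<in> Omega_0 eh c" if r: "r_c c x > eh" and e: "\<forall>k\<in>?E. r_e c k x > eh"
  proof -
  \<comment> \<open>\<open>Omega_0\<close> removes a closure; an open set that avoids the union also
    avoids its closure.\<close>
  define O1 where "O1 = {z. r_c c z > eh} Int (\<Inter>k\<in>?E. {z. r_e c k z > eh})"
  have "open O1" unfolding O1_def
  by (intro open_Int open_INT ballI finite open_Collect_less continuous_intros continuous_r_c continuous_r_e)
  moreover have "O1 Int ?U = {}"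
  by (auto simp: O1_def Omega_c_def Omega_e_def Omega_ce_def split: if_splits) (meson less_asym)+
  ultimately have "O1 Int closure ?U = {}" by (rule open_Int_closure_eq_empty[THEN iffD2])
  moreover have "x \<in> O1" using that by (auto simp: O1_def)
  ultimately show ?thesis using x unfolding Omega_0_def by blast
  qed
  show "x \<in> Omega_0 eh c | x \<in> Omega_c eh c | (\<exists>k\<in>edge_dirs. x \<in> Omega_e eh c k | x \<in> Omega_ce eh c k)"
  proof (cases "r_c c x < eh")
  case True
  show ?thesis
  proof (cases "\<exists>k\<in>?E. rho_ce c k x < eh")
  case T2: True
  then show ?thesis using x True by (auto simp: Omega_ce_def)
  next
  case False
  then have "\<forall>k\<in>?E. rho_ce c k x > eh" using ne3 by (meson linorder_neqE_linordered_idom)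
  then show ?thesis using x True by (auto simp: Omega_c_def)
  qed
  next
  case False
  then have r: "r_c c x > eh" using ne1 by simp
  show ?thesis
  proof (cases "\<exists>k\<in>?E. r_e c k x < eh")
  case T2: True
  then show ?thesis using x r by (auto simp: Omega_e_def)
  next
  case False
  then have "\<forall>k\<in>?E. r_e c k x > eh" using ne2 by (meson linorder_neqE_linordered_idom)
  then show ?thesis using far[OF r] by blast
  qed
  qed
  qed
 qed
qed

section \<open>From weighted norms to L2 bounds on subsets of the cube\<close>

text \<open>W is one lower bound on K for the weights of all regions; \<open>W <= 1\<close> takes
  care of \<open>Omega_0\<close>, whose weight is 1.\<close>

definition weight_bound :: "real => real ^ 'n::finite => real => ('n => real) => ('n => nat) => (real ^ 'n) set => real => bool" where
 "weight_bound eh c gac gae be K W \<longleftrightarrow> 0 < W & W <= 1 \<and>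
  (\<forall>x\<in>K Int Omega_c eh c. W <= r_c c x powr max 0 (real (mi_abs be) - gac)) \<and>
  (\<forall>k\<in>edge_dirs. (\<forall>x\<in>K Int Omega_e eh c k. W <= r_e c k x powr max 0 (real (mi_abs be - be k) - gae k)) \<and>
  (\<forall>x\<in>K Int Omega_ce eh c k. W <= r_c c x powr max 0 (real (mi_abs be) - gac)
  * rho_ce c k x powr max 0 (real (mi_abs be - be k) - gae k)))"

lemma finite_mi_abs: "finite {al :: 'n::finite => nat. mi_abs al = k}"
proof (rule finite_subset)
 show "{al :: 'n => nat. mi_abs al = k} <= (UNIV \<rightarrow>\<^sub>E {..k})"
 proof (auto simp: PiE_iff)
  fix al :: "'n => nat" and i assume "k = mi_abs al"
  then show "al i <= mi_abs al" unfolding mi_abs_def by (intro member_le_sum) auto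
 qed
 show "finite ((UNIV :: 'n set) \<rightarrow>\<^sub>E {..k})" by (intro finite_PiE) auto
qed

lemma wbound_sqL2:
 fixes D :: "('n::finite => nat) => real ^ 'n => real"
 assumes "wbound C A \<Omega> w D" "0 <= C" "0 <= A"
 shows "sqL2 \<Omega> (%x. w be x * D be x) <= ennreal ((C * A ^ mi_abs be * fact (mi_abs be))^2)"
proof -
 let ?k = "mi_abs be"
 have fin: "sqL2 \<Omega> (%x. w be x * D be x) < \<infinity>" using assms unfolding wbound_def by blast
 have "L2n \<Omega> (%x. w be x * D be x) <= (\<Sum>al\<in>{al. mi_abs al = ?k}. L2n \<Omega> (%x. w al x * D al x))"
  by (rule member_le_sum) (auto simp: finite_mi_abs L2n_def)
 also have "... <= C * A ^ ?k * fact ?k" using assms unfolding wbound_def by blast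
 finally have "(L2n \<Omega> (%x. w be x * D be x))^2 <= (C * A ^ ?k * fact ?k)^2"
  by (intro power_mono) (auto simp: L2n_def)
 then have "enn2real (sqL2 \<Omega> (%x. w be x * D be x)) <= (C * A ^ ?k * fact ?k)^2"
  by (simp add: L2n_def)
 then have "ennreal (enn2real (sqL2 \<Omega> (%x. w be x * D be x))) <= ennreal ((C * A ^ ?k * fact ?k)^2)"
  by (rule ennreal_leI)
 moreover have "ennreal (enn2real (sqL2 \<Omega> (%x. w be x * D be x))) = sqL2 \<Omega> (%x. w be x * D be x)"
  using fin by simp
 ultimately show ?thesis by (simp only:)
qed

lemma r_c_measurable [measurable]: "r_c c \<in> borel_measurable borel"
 using continuous_r_c by (rule borel_measurable_continuous_onI)

lemma r_e_measurable [measurable]: "r_e c k \<in> borel_measurable borel"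
 using continuous_r_e by (rule borel_measurable_continuous_onI)

lemma rho_ce_measurable [measurable]: "rho_ce c k \<in> borel_measurable borel"
 unfolding rho_ce_def[abs_def] by measurable

lemma cdist_measurable [measurable]: "(%x. cdist c x j) \<in> borel_measurable borel"
 unfolding cdist_def by measurable

lemma Omega_measurable [measurable]:
 fixes c :: "real ^ 'n::finite"
 shows "Omega_c eh c \<in> sets borel" "Omega_e eh c k \<in> sets borel" "Omega_ce eh c k \<in> sets borel" "Omega_0 eh c \<in> sets borel"
proof -
 have 1: "{x \<in> cube. P x} = cube Int {x. P x}" for P :: "real ^ 'n => bool" by auto
 have "finite (edge_dirs :: 'n set)" by simp
 then have 2: "{x. \<forall>k\<in>edge_dirs. eh < rho_ce c k x} \<in> sets borel" by measurable
 show "Omega_e eh c k \<in> sets borel" "Omega_ce eh c k \<in> sets borel"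
  unfolding Omega_e_def Omega_ce_def 1 by measurable
 have "{x. r_c c x < eh} \<in> sets borel" by measurable
 then show "Omega_c eh c \<in> sets borel"
  using 2 unfolding Omega_c_def 1 by (auto simp: Collect_conj_eq intro!: sets.Int)
 show "Omega_0 eh c \<in> sets borel"
  unfolding Omega_0_def by (intro sets.Diff cube_measurable borel_closed closed_closure)
qed

lemma weak_deriv_self:
 fixes f :: "real ^ 'n::finite => real"
 assumes "loc_int cube f" shows "weak_deriv cube (%_. 0) f f"
 unfolding weak_deriv_def
proof (intro conjI allI impI assms)
 fix ph :: "real ^ 'n => real" and ds :: "'n list" assume "test_fun cube ph & (ALL i. count (mset ds) i = 0)"
 then have "ds = []" by (metis count_eq_zero_iff last_in_set set_mset_mset)
 then show "(LINT x:cube|lborel. f x * dparts ds ph x) = (- 1) ^ mi_abs (%_::'n. 0) * (LINT x:cube|lborel. f x * ph x)"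
  by (simp add: mi_abs_def)
qed

text \<open>On K every weight is at least W, and the regions cover the cube up to a null set; so W^2
  times the squared derivative is dominated by the sum of the weighted squares over all
  regions.\<close>

lemma J_class_weighted:
 fixes c :: "real ^ 'n::finite"
 assumes d: "CARD('n) = 2 | CARD('n) = 3" and c: "is_corner c" and eh: "0 < eh" "eh < 1"
  and CA: "0 < C" "0 < A" and f: "f \<in> J_class eh c gac gae C A"
 obtains D C' where "0 < C'" "D (%_. 0) = f" "!!al. weak_deriv cube al f (D al)"
  "!!be K W. K \<in> sets borel ==> K <= cube ==> weight_bound eh c gac gae be K W ==>
  (\<integral>\<^sup>+y. indicator K y * ennreal ((D be y)^2) \<partial>lborel) <= ennreal ((C' * A ^ mi_abs be * fact (mi_abs be) / W)^2)"
proof -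
 from f obtain D0 where D0: "!!al. weak_deriv cube al f (D0 al)"
  and w0: "wbound C A (Omega_0 eh c) (%al x. 1) D0"
  and wc: "wbound C A (Omega_c eh c) (%al x. r_c c x powr max 0 (real (mi_abs al) - gac)) D0"
  and we: "!!k. k \<in> edge_dirs ==> wbound C A (Omega_e eh c k) (%al x. r_e c k x powr max 0 (real (mi_abs al - al k) - gae k)) D0"
  and wce: "!!k. k \<in> edge_dirs ==> wbound C A (Omega_ce eh c k)
  (%al x. r_c c x powr max 0 (real (mi_abs al) - gac) * rho_ce c k x powr max 0 (real (mi_abs al - al k) - gae k)) D0"
  and L2: "sqL2 cube f < \<infinity>" and fm: "f \<in> borel_measurable borel"
  unfolding J_class_def by auto
 \<comment> \<open>In order 0 the class only provides some weak derivative of f; it is replaced by f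
   itself.\<close>
 define D where "D al = (if al = (%_. 0) then f else D0 al)" for al
 have li: "loc_int cube f" using D0[of "%_. 0"] by (simp add: weak_deriv_def)
 have wd: "weak_deriv cube al f (D al)" for al using D0 weak_deriv_self[OF li] by (auto simp: D_def)
 have [measurable]: "D0 al \<in> borel_measurable borel" for al using D0[of al] by (simp add: weak_deriv_def loc_int_def)
 \<comment> \<open>At most 1 + 1 + 3 * 2 = 8 regional terms contribute; the L2 norm of f serves
   order 0.\<close>
 define C' where "C' = 8 * C + L2n cube f"
 have L0: "0 <= L2n cube f" by (simp add: L2n_def)
 have C': "0 < C'" "8 * C <= C'" using CA L0 by (auto simp: C'_def)
 have main: "(\<integral>\<^sup>+y. indicator K y * ennreal ((D be y)^2) \<partial>lborel) <= ennreal ((C' * A ^ mi_abs be * fact (mi_abs be) / W)^2)"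
  if K: "K \<in> sets borel" "K <= cube" and wb: "weight_bound eh c gac gae be K W" for be K W
 proof -
  have W: "0 < W" "W <= 1" using wb by (auto simp: weight_bound_def)
  show ?thesis
  proof (cases "be = (%_. 0)")
  case True
  have "(\<integral>\<^sup>+y. indicator K y * ennreal ((f y)^2) \<partial>lborel) <= sqL2 cube f"
  unfolding sqL2_def using K by (intro nn_integral_mono) (auto simp: indicator_def)
  also have "... = ennreal ((L2n cube f)^2)" using L2 by (simp add: L2n_def)
  also have "... <= ennreal ((C' / W)^2)"
  proof (intro ennreal_leI power_mono L0)
  have "L2n cube f <= C'" using CA by (simp add: C'_def)
  also have "... <= C' / W" using W C' by (simp add: field_simps)
  finally show "L2n cube f <= C' / W" .
  qed
  finally show ?thesis using True by (simp add: D_def mi_abs_def)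
  next
  case False
  let ?B = "ennreal ((C * A ^ mi_abs be * fact (mi_abs be))^2)"
  let ?wc = "%x. r_c c x powr max 0 (real (mi_abs be) - gac)"
  let ?we = "%k x. r_e c k x powr max 0 (real (mi_abs be - be k) - gae k)"
  let ?wce = "%k x. r_c c x powr max 0 (real (mi_abs be) - gac) * rho_ce c k x powr max 0 (real (mi_abs be - be k) - gae k)"
  let ?t = "%\<Omega> w x. indicator \<Omega> x * ennreal ((w x * D0 be x)^2)"
  have CA0: "0 <= C" "0 <= A" using CA by auto
  have e0: "(\<integral>\<^sup>+x. ?t (Omega_0 eh c) (%_. 1) x \<partial>lborel) <= ?B" using wbound_sqL2[OF w0 CA0, of be] by (simp add: sqL2_def)
  have ec: "(\<integral>\<^sup>+x. ?t (Omega_c eh c) ?wc x \<partial>lborel) <= ?B" using wbound_sqL2[OF wc CA0, of be] by (simp add: sqL2_def)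
  have ee: "(\<integral>\<^sup>+x. ?t (Omega_e eh c k) (?we k) x \<partial>lborel) <= ?B" if "k \<in> edge_dirs" for k
  using wbound_sqL2[OF we[OF that] CA0, of be] by (simp add: sqL2_def)
  have ece: "(\<integral>\<^sup>+x. ?t (Omega_ce eh c k) (?wce k) x \<partial>lborel) <= ?B" if "k \<in> edge_dirs" for k
  using wbound_sqL2[OF wce[OF that] CA0, of be] by (simp add: sqL2_def)
  let ?F = "%x. ?t (Omega_0 eh c) (%_. 1) x + ?t (Omega_c eh c) ?wc x + (\<Sum>k\<in>edge_dirs. ?t (Omega_e eh c k) (?we k) x + ?t (Omega_ce eh c k) (?wce k) x)"
  have ptw: "ennreal (W^2) * (indicator K x * ennreal ((D0 be x)^2)) <= ?t \<Omega> w x" if "x \<in> K" "x \<in> \<Omega>" "W <= w x" for x \<Omega> w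
  proof -
  have "W^2 * (D0 be x)^2 <= (w x)^2 * (D0 be x)^2" using W that by (intro mult_right_mono power_mono) auto
  then show ?thesis using that by (simp add: power_mult_distrib flip: ennreal_mult)
  qed
  have "AE x in lborel. ennreal (W^2) * (indicator K x * ennreal ((D0 be x)^2)) <= ?F x"
  using AE_region[OF d c eh]
  proof eventually_elim
  case (elim x)
  show ?case
  proof (cases "x \<in> K")
  case xK: True
  consider "x \<in> Omega_0 eh c" | "x \<in> Omega_c eh c" | k where "k \<in> edge_dirs" "x \<in> Omega_e eh c k" | k where "k \<in> edge_dirs" "x \<in> Omega_ce eh c k"
  using elim xK K by blast
  then show ?thesis
  proof cases
  case 1
  then show ?thesis using ptw[OF xK 1, of "%_. 1"] W by (auto intro: order_trans simp: add_increasing2)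
  next
  case 2
  have "W <= ?wc x" using wb 2 xK by (auto simp: weight_bound_def)
  from ptw[where w = ?wc, OF xK 2 this] show ?thesis by (rule order_trans) (simp add: add_increasing add_increasing2)
  next
  case (3 k)
  have "W <= ?we k x" using wb 3 xK by (auto simp: weight_bound_def)
  from ptw[where w = "?we k", OF xK 3(2) this]
  have "ennreal (W^2) * (indicator K x * ennreal ((D0 be x)^2)) <= ?t (Omega_e eh c k) (?we k) x + ?t (Omega_ce eh c k) (?wce k) x"
  by (rule order_trans) (simp add: add_increasing2)
  also have "... <= (\<Sum>k\<in>edge_dirs. ?t (Omega_e eh c k) (?we k) x + ?t (Omega_ce eh c k) (?wce k) x)"
  using 3(1) by (intro member_le_sum) auto
  finally show ?thesis by (rule order_trans) (simp add: add_increasing)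
  next
  case (4 k)
  have "W <= ?wce k x" using wb 4 xK by (auto simp: weight_bound_def)
  from ptw[where w = "?wce k", OF xK 4(2) this]
  have "ennreal (W^2) * (indicator K x * ennreal ((D0 be x)^2)) <= ?t (Omega_e eh c k) (?we k) x + ?t (Omega_ce eh c k) (?wce k) x"
  by (rule order_trans) (simp add: add_increasing)
  also have "... <= (\<Sum>k\<in>edge_dirs. ?t (Omega_e eh c k) (?we k) x + ?t (Omega_ce eh c k) (?wce k) x)"
  using 4(1) by (intro member_le_sum) auto
  finally show ?thesis by (rule order_trans) (simp add: add_increasing)
  qed
  qed simp
  qed
  then have "(\<integral>\<^sup>+x. ennreal (W^2) * (indicator K x * ennreal ((D0 be x)^2)) \<partial>lborel) <= (\<integral>\<^sup>+x. ?F x \<partial>lborel)"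
  by (rule nn_integral_mono_AE)
  also have "... = (\<integral>\<^sup>+x. ?t (Omega_0 eh c) (%_. 1) x \<partial>lborel) + (\<integral>\<^sup>+x. ?t (Omega_c eh c) ?wc x \<partial>lborel)
  + (\<Sum>k\<in>edge_dirs. (\<integral>\<^sup>+x. ?t (Omega_e eh c k) (?we k) x \<partial>lborel) + (\<integral>\<^sup>+x. ?t (Omega_ce eh c k) (?wce k) x \<partial>lborel))"
  by (simp add: nn_integral_add nn_integral_sum)
  also have "... <= ?B + ?B + (\<Sum>k\<in>(edge_dirs::'n set). ?B + ?B)"
  by (intro add_mono sum_mono e0 ec ee ece)
  also have "... <= 8 * ?B"
  proof -
  have "card (edge_dirs :: 'n set) <= 3" using d by (auto simp: edge_dirs_def)
  then have "of_nat (card (edge_dirs :: 'n set)) * (?B + ?B) <= of_nat 3 * (?B + ?B)" by (intro mult_right_mono) auto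
  moreover have "?B + ?B + of_nat 3 * (?B + ?B) = 8 * ?B"        proof -
  have "2 * ?B + 6 * ?B = (2 + 6) * ?B" by (rule distrib_right[symmetric])
  then show ?thesis by (simp add: distrib_left flip: mult_2)
  qed
  ultimately show ?thesis by (simp add: add_left_mono flip: \<open>?B + ?B + of_nat 3 * (?B + ?B) = 8 * ?B\<close>)
  qed
  finally have *: "ennreal (W^2) * (\<integral>\<^sup>+x. indicator K x * ennreal ((D0 be x)^2) \<partial>lborel) <= 8 * ?B"
  using K(1) by (subst (asm) nn_integral_cmult) auto
  have "ennreal (1 / W^2) * (ennreal (W^2) * (\<integral>\<^sup>+x. indicator K x * ennreal ((D0 be x)^2) \<partial>lborel)) <= ennreal (1 / W^2) * (8 * ?B)"
  by (intro mult_left_mono *) auto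
  moreover have "ennreal (1 / W^2) * (ennreal (W^2) * z) = z" for z using W by (simp flip: mult.assoc ennreal_mult)
  moreover have "ennreal (1 / W^2) * (8 * ?B) <= ennreal ((C' * A ^ mi_abs be * fact (mi_abs be) / W)^2)"
  proof -
  have "ennreal (1 / W^2) * (8 * ?B) = ennreal (1 / W^2 * (8 * (C * A ^ mi_abs be * fact (mi_abs be))^2))"
  proof -
  have "8 * ?B = ennreal (8 * (C * A ^ mi_abs be * fact (mi_abs be))^2)" by (simp add: ennreal_mult)
  then show ?thesis by (simp only:) (intro ennreal_mult[symmetric], auto)
  qed
  also have "... <= ennreal ((C' * A ^ mi_abs be * fact (mi_abs be) / W)^2)"
  proof (rule ennreal_leI)
  have "8 * C^2 <= (8 * C)^2" by (simp add: power2_eq_square)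
  also have "... <= C'^2" using C' CA by (intro power_mono) auto
  finally have "8 * C^2 * (A ^ mi_abs be * fact (mi_abs be) / W)^2 <= C'^2 * (A ^ mi_abs be * fact (mi_abs be) / W)^2"
  by (intro mult_right_mono) auto
  then show "1 / W^2 * (8 * (C * A ^ mi_abs be * fact (mi_abs be))^2) <= (C' * A ^ mi_abs be * fact (mi_abs be) / W)^2"
  by (simp add: power_mult_distrib power_divide mult_ac)
  qed
  finally show ?thesis .
  qed
  ultimately show ?thesis using False by (simp add: D_def)
  qed
 qed
 show thesis by (rule that[of C' D]) (use C' wd main in \<open>auto simp: D_def\<close>)
qed

text \<open>Cauchy-Schwarz against the indicator of K.\<close>

lemma nn_integral_abs_le_L2:
 fixes g :: "real ^ 'n::finite => real"
 assumes [measurable]: "K \<in> sets borel" "g \<in> borel_measurable borel"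
  and v: "emeasure lborel K <= ennreal v" "0 <= v"
  and q: "(\<integral>\<^sup>+y. indicator K y * ennreal ((g y)^2) \<partial>lborel) <= ennreal (q^2)" "0 <= q"
 shows "(\<integral>\<^sup>+y. indicator K y * ennreal \<bar>g y\<bar> \<partial>lborel) <= ennreal (sqrt v * q)"
proof -
 have "(\<integral>\<^sup>+y. indicator K y * (indicator K y * ennreal \<bar>g y\<bar>) \<partial>lborel)^2 <= (\<integral>\<^sup>+y. (indicator K y)^2 \<partial>lborel) * (\<integral>\<^sup>+y. (indicator K y * ennreal \<bar>g y\<bar>)^2 \<partial>lborel)"
  by (rule Cauchy_Schwarz_nn_integral) auto
 also have "(\<integral>\<^sup>+y. (indicator K y)^2 \<partial>lborel) = emeasure lborel K"
 proof -
  have "(\<integral>\<^sup>+y. (indicator K y)^2 \<partial>lborel) = (\<integral>\<^sup>+y. indicator K y \<partial>lborel)"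
  by (intro nn_integral_cong) (auto simp: indicator_def)
  then show ?thesis by simp
 qed
 also have "(\<integral>\<^sup>+y. (indicator K y * ennreal \<bar>g y\<bar>)^2 \<partial>lborel) = (\<integral>\<^sup>+y. indicator K y * ennreal ((g y)^2) \<partial>lborel)"
  by (intro nn_integral_cong) (auto simp: indicator_def ennreal_power)
 also have "(\<integral>\<^sup>+y. indicator K y * (indicator K y * ennreal \<bar>g y\<bar>) \<partial>lborel) = (\<integral>\<^sup>+y. indicator K y * ennreal \<bar>g y\<bar> \<partial>lborel)"
  by (intro nn_integral_cong) (auto simp: indicator_def)
 finally have "(\<integral>\<^sup>+y. indicator K y * ennreal \<bar>g y\<bar> \<partial>lborel)^2 <= ennreal v * ennreal (q^2)"
  using v(1) q(1) by (meson mult_mono order_trans zero_le)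
 also have "... = (ennreal (sqrt v * q))^2"
  using v q by (simp add: ennreal_power power_mult_distrib flip: ennreal_mult)
 finally have le: "(\<integral>\<^sup>+y. indicator K y * ennreal \<bar>g y\<bar> \<partial>lborel)^2 <= (ennreal (sqrt v * q))^2" .
 show ?thesis
 proof (cases "\<integral>\<^sup>+y. indicator K y * ennreal \<bar>g y\<bar> \<partial>lborel" rule: ennreal_cases)
  case (real r)
  then have "r^2 <= (sqrt v * q)^2" using le v q by (simp add: ennreal_power ennreal_le_iff)
  then have "r <= sqrt v * q" by (rule power2_le_imp_le) (use v q in auto)
  then show ?thesis using real by (simp add: ennreal_leI)
 next
  case top
  then show ?thesis using le v q by (simp add: ennreal_power power2_eq_square ennreal_mult_eq_top_iff top_unique)
 qed
qed

section \<open>Pointwise bounds for the derivatives\<close>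

lemma sobolev_point:
 fixes D :: "('n::finite => nat) => real ^ 'n => real"
 assumes wp: "!!al i. weak_pair i (D al) (D (al(i := Suc (al i))))"
  and G: "continuous_on cube g" "AE x in lborel. x \<in> cube --> D al x = g x"
  and h: "!!i. 0 < h i" and s: "!!i. sg i = 1 | sg i = (-1::real)"
  and K: "K \<in> sets borel" "K <= cube"
  and V: "!!x y. x \<in> V ==> (!!i. \<exists>t\<in>{0..h i}. y $ i = x $ i + t * sg i) ==> y \<in> K"
  and Vo: "open V" "V <= cube" "x0 \<in> V"
  and b: "!!S. (\<integral>\<^sup>+y. indicator K y * ennreal \<bar>D (mi_plus al S) y\<bar> \<partial>lborel) <= ennreal (b S)" "!!S. 0 <= b S"
 shows "\<bar>g x0\<bar> <= (\<Sum>S\<in>UNIV. (\<Prod>i\<in>-S. 1 / h i) * b S)"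
proof (rule AE_le_continuous_imp_le[where U = V and F = "%x. \<bar>g x\<bar>"])
 have hp: "0 <= (\<Prod>i\<in>-S. 1 / h i)" for S using h by (auto intro!: prod_nonneg simp: less_imp_le)
 have "(\<Sum>S\<in>UNIV. ennreal (\<Prod>i\<in>-S. 1 / h i) * (\<integral>\<^sup>+y. indicator K y * ennreal \<bar>D (mi_plus al S) y\<bar> \<partial>lborel))
  <= (\<Sum>S\<in>UNIV. ennreal (\<Prod>i\<in>-S. 1 / h i) * ennreal (b S))"
  by (intro sum_mono mult_left_mono b) auto
 also have "... = ennreal (\<Sum>S\<in>UNIV. (\<Prod>i\<in>-S. 1 / h i) * b S)"
  using hp b(2) by (simp flip: ennreal_mult add: sum_ennreal)
 finally have le: "(\<Sum>S\<in>UNIV. ennreal (\<Prod>i\<in>-S. 1 / h i) * (\<integral>\<^sup>+y. indicator K y * ennreal \<bar>D (mi_plus al S) y\<bar> \<partial>lborel))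
  <= ennreal (\<Sum>S\<in>UNIV. (\<Prod>i\<in>-S. 1 / h i) * b S)" .
 have nn: "0 <= (\<Sum>S\<in>UNIV. (\<Prod>i\<in>-S. 1 / h i) * b S)" using hp b(2) by (auto intro!: sum_nonneg)
 have "AE x in lborel. x \<in> V --> ennreal \<bar>D al x\<bar> \<le>
  (\<Sum>S\<in>UNIV. ennreal (\<Prod>i\<in>-S. 1 / h i) * (\<integral>\<^sup>+y. indicator K y * ennreal \<bar>D (mi_plus al S) y\<bar> \<partial>lborel))"
  by (rule sobolev_AE_bound[OF wp h s K V]) auto
 with G(2) show "AE x in lborel. x \<in> V --> \<bar>g x\<bar> <= (\<Sum>S\<in>UNIV. (\<Prod>i\<in>-S. 1 / h i) * b S)"
 proof eventually_elim
  case (elim x)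
  show ?case
  proof
  assume x: "x \<in> V"
  then have "ennreal \<bar>D al x\<bar> <= ennreal (\<Sum>S\<in>UNIV. (\<Prod>i\<in>-S. 1 / h i) * b S)" using elim(2) le by (blast intro: order_trans)
  then show "\<bar>g x\<bar> <= (\<Sum>S\<in>UNIV. (\<Prod>i\<in>-S. 1 / h i) * b S)" using nn elim(1) x Vo by (auto simp: ennreal_le_iff)
  qed
 qed
 show "continuous_on V (%x. \<bar>g x\<bar>)" using G(1) Vo(2) by (intro continuous_intros) (rule continuous_on_subset)
qed (use Vo in auto)

lemma mi_abs_mi_plus: "mi_abs (mi_plus al S) = mi_abs al + card S"
 unfolding mi_abs_def mi_plus_def by (simp add: sum.distrib sum.If_cases)

lemma prod_power_le_split:
 fixes y :: "'n::finite => real"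
 assumes "!!j. 0 <= y j" "y k <= r" "!!j. j ~= k ==> y j <= s" "0 <= s"
 shows "(\<Prod>j\<in>UNIV. y j ^ be j) <= r ^ be k * s ^ (mi_abs be - be k)"
proof -
 have "0 <= r" using assms(1)[of k] assms(2) by linarith
 have "(\<Prod>j\<in>UNIV. y j ^ be j) = y k ^ be k * (\<Prod>j\<in>UNIV - {k}. y j ^ be j)"
  by (rule prod.remove) auto
 also have "... <= r ^ be k * (\<Prod>j\<in>UNIV - {k}. s ^ be j)"
  using assms \<open>0 <= r\<close> by (intro mult_mono power_mono prod_mono prod_nonneg conjI) auto
 also have "(\<Prod>j\<in>UNIV - {k}. s ^ be j) = s ^ (mi_abs be - be k)"
  unfolding power_sum[symmetric] mi_abs_def by (subst (2) sum.remove[of _ k]) auto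
 finally show ?thesis .
qed

lemma power_le_powr_max:
 assumes "0 < r" "r <= 1" "0 <= ga"
 shows "r ^ n <= r powr max 0 (real n - ga)"
proof -
 have "r ^ n = r powr real n" using assms by (simp add: powr_realpow)
 also have "... <= r powr max 0 (real n - ga)" using assms by (intro powr_mono') auto
 finally show ?thesis .
qed

lemma le_mi_abs: "be k <= mi_abs be"
 unfolding mi_abs_def by (rule member_le_sum) auto

lemma r_c_pos: "x \<in> cube ==> is_corner c ==> 0 < r_c c x"
 using cdist_bounds(1) cdist_le_r_c by (metis order_less_le_trans)

lemma r_e_pos:
 fixes c :: "real ^ 'n::finite"
 assumes "x \<in> cube" "is_corner c" "CARD('n) ~= 1" shows "0 < r_e c k x"
proof -
 have "UNIV ~= {k}" using assms(3) by (metis card.empty card_insert_disjoint empty_iff finite.emptyI One_nat_def)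
 then obtain j where "j ~= k" by blast
 then show ?thesis using cdist_bounds(1)[OF assms(1,2), of j] cdist_le_r_e[OF assms(1,2), of j k] by linarith
qed

text \<open>A crude bound that is valid in every region: each distance to a face is at most
  \<open>r_c\<close>, the ones perpendicular to an edge are at most \<open>r_e\<close>, and these
  radii and their ratio are below 1 in the regions concerned, where subtracting the nonnegative
  \<gamma> from an exponent only enlarges the weight.\<close>

lemma weight_bound_prod:
 fixes c :: "real ^ 'n::finite"
 assumes c: "is_corner c" and eh: "0 < eh" "eh < 1" and d: "CARD('n) ~= 1"
  and g: "0 <= gac" "!!k. k \<in> edge_dirs ==> 0 <= gae k"
  and K: "K <= cube" and W: "0 < W" "W <= 1" "!!x. x \<in> K ==> W <= (\<Prod>j\<in>UNIV. cdist c x j ^ be j)"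
 shows "weight_bound eh c gac gae be K W"
 unfolding weight_bound_def
proof (intro conjI ballI)
 fix x assume x: "x \<in> K Int Omega_c eh c"
 then have xc: "x \<in> cube" and r: "r_c c x <= 1" using K eh by (auto simp: Omega_c_def split: if_splits)
 note cb = cdist_bounds[OF xc c]
 obtain k :: 'n where True by blast
 have "W <= (\<Prod>j\<in>UNIV. cdist c x j ^ be j)" using W x by auto
 also have "... <= r_c c x ^ be k * r_c c x ^ (mi_abs be - be k)"
  by (rule prod_power_le_split) (use cb r_c_pos[OF xc c] cdist_le_r_c in \<open>auto simp: less_imp_le\<close>)
 also have "... = r_c c x ^ mi_abs be" using le_mi_abs[of be k] by (simp flip: power_add)
 also have "... <= r_c c x powr max 0 (real (mi_abs be) - gac)" by (rule power_le_powr_max) (use r_c_pos[OF xc c] r g in auto)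
 finally show "W <= r_c c x powr max 0 (real (mi_abs be) - gac)" .
next
 fix k x assume k: "k \<in> edge_dirs" and x: "x \<in> K Int Omega_e eh c k"
 then have xc: "x \<in> cube" and r: "r_e c k x <= 1" using K eh by (auto simp: Omega_e_def)
 note cb = cdist_bounds[OF xc c]
 have "W <= (\<Prod>j\<in>UNIV. cdist c x j ^ be j)" using W x by auto
 also have "... <= 1 ^ be k * r_e c k x ^ (mi_abs be - be k)"
  by (rule prod_power_le_split) (use cb r_e_pos[OF xc c d] cdist_le_r_e[OF xc c] in \<open>auto simp: less_imp_le\<close>)
 also have "... <= r_e c k x powr max 0 (real (mi_abs be - be k) - gae k)"
  using power_le_powr_max[OF r_e_pos[OF xc c d] r g(2)[OF k], of "mi_abs be - be k"] by simp
 finally show "W <= r_e c k x powr max 0 (real (mi_abs be - be k) - gae k)" .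
next
 fix k x assume k: "k \<in> edge_dirs" and x: "x \<in> K Int Omega_ce eh c k"
 then have xc: "x \<in> cube" and r: "r_c c x <= 1" "rho_ce c k x <= 1" using K eh by (auto simp: Omega_ce_def)
 note cb = cdist_bounds[OF xc c]
 have rp: "0 < r_c c x" "0 < rho_ce c k x" using r_c_pos[OF xc c] r_e_pos[OF xc c d] by (auto simp: rho_ce_def)
 have re: "r_e c k x = r_c c x * rho_ce c k x" using rp by (simp add: rho_ce_def)
 have "W <= (\<Prod>j\<in>UNIV. cdist c x j ^ be j)" using W x by auto
 also have "... <= r_c c x ^ be k * r_e c k x ^ (mi_abs be - be k)"
  by (rule prod_power_le_split) (use cb r_e_pos[OF xc c d] cdist_le_r_e[OF xc c] cdist_le_r_c in \<open>auto simp: less_imp_le\<close>)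
 also have "... = r_c c x ^ mi_abs be * rho_ce c k x ^ (mi_abs be - be k)"
  using le_mi_abs[of be k] unfolding re power_mult_distrib by (simp flip: power_add mult.assoc)
 also have "... <= r_c c x powr max 0 (real (mi_abs be) - gac) * rho_ce c k x powr max 0 (real (mi_abs be - be k) - gae k)"
  by (intro mult_mono power_le_powr_max rp r g(1) g(2)[OF k]) (use rp in auto)
 finally show "W <= r_c c x powr max 0 (real (mi_abs be) - gac) * rho_ce c k x powr max 0 (real (mi_abs be - be k) - gae k)" .
qed (use W in auto)

lemma fact_add_le: "(fact (n + d) :: real) <= fact n * fact d * 2 ^ (n + d)"
proof -
 have "(fact (n + d) :: real) = fact n * fact d * real ((n + d) choose n)"
  by (simp add: binomial_fact[of n "n + d"])
 also have "... <= fact n * fact d * 2 ^ (n + d)"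
 proof (intro mult_left_mono)
  have "real ((n + d) choose n) <= real (2 ^ (n + d))" by (rule of_nat_mono[OF binomial_le_pow2])
  then show "real ((n + d) choose n) <= 2 ^ (n + d)" by (simp only: of_nat_power of_nat_numeral)
 qed auto
 finally show ?thesis .
qed

text \<open>The inward direction along axis j: moving along it increases the distance to the face
  through c.\<close>

definition csign :: "real ^ 'n::finite => 'n => real" where
 "csign c j = (if c $ j = 0 then 1 else -1)"

lemma csign_cases: "csign c j = 1 | csign c j = -1"
 by (simp add: csign_def)

lemma cdist_move:
 assumes "is_corner c" "x \<in> cube" "y $ j = x $ j + t * (ta * csign c j)"
 shows "cdist c x j + t * ta = (if c $ j = 0 then y $ j else 1 - y $ j)"
proof -
 have "c $ j = 0 | c $ j = 1" "0 < x $ j & x $ j < 1" using assms by (auto simp: is_corner_def cube_def)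
 then show ?thesis using assms(3) by (auto simp: cdist_def csign_def)
qed

lemma cdist_move_cube:
 assumes c: "is_corner c" and x: "x \<in> cube" and y: "!!j. y $ j = x $ j + t j * (ta j * csign c j)"
  and b: "!!j. 0 < cdist c x j + t j * ta j & cdist c x j + t j * ta j < 1"
 shows "y \<in> cube" "cdist c y j = cdist c x j + t j * ta j"
proof -
 have yb: "0 < y $ j & y $ j < 1" for j
  using b[of j] cdist_move[OF c x y, of j] by (auto split: if_splits)
 then show "y \<in> cube" by (simp add: cube_def)
 show "cdist c y j = cdist c x j + t j * ta j"
  using cdist_move[OF c x y, of j] yb[of j] c by (auto simp: cdist_def is_corner_def split: if_splits dest: spec[of _ j])
qed

lemma emeasure_cbox_cart:
 fixes l u :: "real ^ 'n::finite"
 assumes "!!i. l $ i <= u $ i"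
 shows "emeasure lborel (cbox l u) = ennreal (\<Prod>i\<in>UNIV. u $ i - l $ i)"
proof -
 have "l \<in> cbox l u" using assms by (simp add: mem_box_cart)
 then have "measure lborel (cbox l u) = (\<Prod>i\<in>UNIV. u $ i - l $ i)" by (intro content_cbox_cart) blast
 moreover have "emeasure lborel (cbox l u) = ennreal (measure lborel (cbox l u))"
  using emeasure_lborel_cbox_finite[of l u] by (intro emeasure_eq_ennreal_measure) auto
 ultimately show ?thesis by simp
qed

text \<open>The Sobolev boxes have sides y j / 2 and point towards the corner, where there is always
  room; distances in them stay at least y j / 4. Each coordinate costs either one more derivative or
  a factor 1 / h, in both cases one more power of 1 / y j, whence the exponent
  \<open>al j + 1\<close>.\<close>

lemma smooth_bound_rough:
 fixes c :: "real ^ 'n::finite" and D :: "('n => nat) => real ^ 'n => real"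
 assumes c: "is_corner c" and eh: "0 < eh" "eh < 1" and d: "CARD('n) ~= 1"
  and g: "0 <= gac" "!!k. k \<in> edge_dirs ==> 0 <= gae k"
  and C: "0 < C" "0 < A"
  and wp: "!!al i. weak_pair i (D al) (D (al(i := Suc (al i))))"
  and G: "!!al. continuous_on cube (G al)" "!!al. AE x in lborel. x \<in> cube --> D al x = G al x"
  and L2: "!!be K W. K \<in> sets borel ==> K <= cube ==> weight_bound eh c gac gae be K W ==>
  (\<integral>\<^sup>+y. indicator K y * ennreal ((D be y)^2) \<partial>lborel) <= ennreal ((C * A ^ mi_abs be * fact (mi_abs be) / W)^2)"
 shows "\<exists>C1>0. \<exists>A1>0. ALL al. \<forall>x\<in>cube. \<bar>G al x\<bar> <= C1 * A1 ^ mi_abs al * fact (mi_abs al) * (\<Prod>j\<in>UNIV. (1 / cdist c x j) ^ (al j + 1))"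
proof -
 define M where "M = max 1 A"
 have M: "1 <= M" "A <= M" by (auto simp: M_def)
 let ?d = "CARD('n)"
 \<comment> \<open>The first 2^d counts the sets S; \<open>M\<close>, the factorial and the second
   2^d absorb up to d additional derivatives; 4^d stems from distances of at least y j / 4. The same
   2 and 4 per derivative give the 8 in \<open>A1\<close>.\<close>
 define C1 where "C1 = 2 ^ ?d * C * M ^ ?d * fact ?d * 2 ^ ?d * 4 ^ ?d"
 define A1 where "A1 = 8 * M"
 have "\<bar>G al x\<bar> <= C1 * A1 ^ mi_abs al * fact (mi_abs al) * (\<Prod>j\<in>UNIV. (1 / cdist c x j) ^ (al j + 1))"
  if x: "x \<in> cube" for al x
 proof -
  define y where "y j = cdist c x j" for j
  have y: "0 < y j" "y j < 1" for j unfolding y_def by (rule cdist_bounds[OF x c])+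
  define K where "K = {z \<in> cube. ALL j. y j / 4 <= cdist c z j}"
  \<comment> \<open>A neighbourhood of x, as the estimate is obtained almost everywhere first: 3/4
    of y j minus a step of at most y j / 2 leaves y j / 4.\<close>
  define V where "V = {z \<in> cube. ALL j. 3 / 4 * y j < cdist c z j}"
  define W where "W be = (\<Prod>j\<in>UNIV. (y j / 4) ^ be j)" for be :: "'n => nat"
  have Wp: "0 < W be" "W be <= 1" for be
  proof -
  have "0 < y j / 4 & y j / 4 <= 1" for j using y[of j] by simp
  then have "0 < (y j / 4) ^ be j & (y j / 4) ^ be j <= 1" for j by (metis zero_less_power power_le_one less_imp_le)
  then show "0 < W be" "W be <= 1" unfolding W_def by (auto intro!: prod_pos prod_le_1 simp: less_imp_le)
  qed
  have Km: "K \<in> sets borel"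
  proof -
  have "K = cube Int {z. ALL j. y j / 4 <= cdist c z j}" by (auto simp: K_def)
  also have "... \<in> sets borel" by measurable
  finally show ?thesis .
  qed
  have Kc: "K <= cube" by (auto simp: K_def)
  have K1: "emeasure lborel K <= ennreal 1"
  proof -
  have "emeasure lborel K <= emeasure lborel (cbox 0 1 :: (real ^ 'n) set)"
  using Kc box_subset_cbox by (intro emeasure_mono) (auto simp: cube_eq_box)
  also have "... <= ennreal 1"
  by (subst emeasure_cbox_cart) auto
  finally show ?thesis .
  qed
  have "\<bar>G al x\<bar> <= (\<Sum>S\<in>UNIV. (\<Prod>i\<in>-S. 1 / (y i / 2)) * (sqrt 1 * (C * A ^ mi_abs (mi_plus al S) * fact (mi_abs (mi_plus al S)) / W (mi_plus al S))))"
  proof (rule sobolev_point[where D = D and K = K and V = V and sg = "%j. - 1 * csign c j" and al = al and g = "G al", OF wp G])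
  show "0 < y i / 2" for i using y by simp
  show "- 1 * csign c i = 1 | - 1 * csign c i = - 1" for i using csign_cases[of c i] by auto
  show "z' \<in> K" if z: "z \<in> V" and t: "!!i. \<exists>t\<in>{0..y i / 2}. z' $ i = z $ i + t * (- 1 * csign c i)" for z z'
  proof -
  from t obtain s where s: "!!i. s i \<in> {0..y i / 2}" "!!i. z' $ i = z $ i + s i * (- 1 * csign c i)" by metis
  have zc: "z \<in> cube" using z by (auto simp: V_def)
  have bb: "0 < cdist c z j + s j * - 1 & cdist c z j + s j * - 1 < 1 & y j / 4 <= cdist c z j + s j * - 1" for j
  proof -
  have "3 / 4 * y j < cdist c z j" using z by (auto simp: V_def)
  then show ?thesis using s(1)[of j] y[of j] cdist_bounds[OF zc c, of j] by auto
  qed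
  have b1: "0 < cdist c z j + s j * - 1 & cdist c z j + s j * - 1 < 1" for j using bb by blast
  note mv = cdist_move_cube[where ta = "%_. -1", OF c zc s(2) b1]
  show ?thesis using mv bb by (auto simp: K_def)
  qed
  show "open V"
  proof -
  have "V = cube Int (\<Inter>j\<in>UNIV. {z. 3 / 4 * y j < cdist c z j})" by (auto simp: V_def)
  also have "open ..." unfolding cdist_def
  by (intro open_Int open_INT open_cube ballI finite open_Collect_less continuous_intros)
  finally show ?thesis .
  qed
  show "x \<in> V" using x y by (auto simp: V_def y_def)
  show "V <= cube" by (auto simp: V_def)
  fix S :: "'n set"
  let ?be = "mi_plus al S"
  show q: "0 <= sqrt 1 * (C * A ^ mi_abs ?be * fact (mi_abs ?be) / W ?be)" using C Wp by (auto simp: less_imp_le)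
  show "(\<integral>\<^sup>+y. indicator K y * ennreal \<bar>D ?be y\<bar> \<partial>lborel) <= ennreal (sqrt 1 * (C * A ^ mi_abs ?be * fact (mi_abs ?be) / W ?be))"
  proof (rule nn_integral_abs_le_L2[OF Km _ K1])
  show "D ?be \<in> borel_measurable borel" by (rule weak_pair_measurable(1)[OF wp])
  show "(\<integral>\<^sup>+y. indicator K y * ennreal ((D ?be y)^2) \<partial>lborel) <= ennreal ((C * A ^ mi_abs ?be * fact (mi_abs ?be) / W ?be)^2)"
  proof (rule L2[OF Km Kc weight_bound_prod[OF c eh d g Kc]])
  fix z assume "z \<in> K"
  then show "W ?be <= (\<Prod>j\<in>UNIV. cdist c z j ^ ?be j)"
  unfolding W_def K_def using y by (intro prod_mono conjI power_mono) (auto simp: less_imp_le)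
  qed (use Wp in auto)
  qed (use q in auto)
  qed (use Km Kc in auto)
  also have "... <= (\<Sum>S\<in>(UNIV :: 'n set set). C * (M ^ mi_abs al * M ^ ?d) * (fact (mi_abs al) * fact ?d * (2 ^ mi_abs al * 2 ^ ?d)) * (4 ^ mi_abs al * 4 ^ ?d * (\<Prod>j\<in>UNIV. (1 / y j) ^ (al j + 1))))"
  proof (rule sum_mono)
  fix S :: "'n set"
  let ?be = "mi_plus al S"
  have cS: "card S <= ?d" by (rule card_mono) auto
  have m: "mi_abs ?be <= mi_abs al + ?d" using cS by (simp add: mi_abs_mi_plus)
  have "A ^ mi_abs ?be <= M ^ mi_abs ?be" using M C by (intro power_mono) auto
  also have "... <= M ^ (mi_abs al + ?d)" using M m by (intro power_increasing) auto
  finally have 1: "A ^ mi_abs ?be <= M ^ mi_abs al * M ^ ?d" by (simp add: power_add)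
  have "(fact (mi_abs ?be) :: real) <= fact (mi_abs al + ?d)" using m by (intro fact_mono)
  also have "... <= fact (mi_abs al) * fact ?d * 2 ^ (mi_abs al + ?d)" by (rule fact_add_le)
  finally have 2: "(fact (mi_abs ?be) :: real) <= fact (mi_abs al) * fact ?d * (2 ^ mi_abs al * 2 ^ ?d)" by (simp add: power_add)
  have "(\<Prod>i\<in>-S. 1 / (y i / 2)) / W ?be = (\<Prod>i\<in>UNIV. if i \<in> S then 1 else 1 / (y i / 2)) * (\<Prod>j\<in>UNIV. (4 / y j) ^ ?be j)"
  proof -
  have "(\<Prod>i\<in>UNIV. if i \<in> S then 1 else 1 / (y i / 2)) = (\<Prod>i\<in>-S. 1 / (y i / 2))"
  by (simp add: prod.If_cases)
  moreover have "1 / W ?be = (\<Prod>j\<in>UNIV. (4 / y j) ^ ?be j)"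
  unfolding W_def by (simp add: power_divide prod_dividef)
  ultimately show ?thesis by (metis (no_types, lifting) mult.right_neutral times_divide_eq_right)
  qed
  also have "... = (\<Prod>j\<in>UNIV. (if j \<in> S then 1 else 1 / (y j / 2)) * (4 / y j) ^ ?be j)" by (simp add: prod.distrib)
  also have "... <= (\<Prod>j\<in>UNIV. (4 / y j) ^ (al j + 1))"
  proof (intro prod_mono conjI)
  fix j
  have p: "0 < 4 / y j" using y by simp
  show "0 <= (if j \<in> S then 1 else 1 / (y j / 2)) * (4 / y j) ^ ?be j" using y[of j] by (auto simp: less_imp_le)
  show "(if j \<in> S then 1 else 1 / (y j / 2)) * (4 / y j) ^ ?be j <= (4 / y j) ^ (al j + 1)"
  proof (cases "j \<in> S")
  case False
  have "1 / (y j / 2) * (4 / y j) ^ al j <= 4 / y j * (4 / y j) ^ al j"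
  using p y[of j] by (intro mult_right_mono) (auto simp: field_simps less_imp_le)
  then show ?thesis using False by (simp add: mi_plus_def)
  qed (simp add: mi_plus_def)
  qed
  also have "... = (\<Prod>j\<in>UNIV. 4 ^ (al j + 1) * (1 / y j) ^ (al j + 1))"
  by (simp add: power_divide)
  also have "... = 4 ^ (\<Sum>j\<in>UNIV. al j + 1) * (\<Prod>j\<in>UNIV. (1 / y j) ^ (al j + 1))"
  by (simp only: prod.distrib power_sum)
  also have "(\<Sum>j\<in>UNIV. al j + 1) = mi_abs al + ?d" by (simp only: sum.distrib mi_abs_def) simp
  finally have 3: "(\<Prod>i\<in>-S. 1 / (y i / 2)) / W ?be <= 4 ^ mi_abs al * 4 ^ ?d * (\<Prod>j\<in>UNIV. (1 / y j) ^ (al j + 1))"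
  by (simp add: power_add)
  have "(\<Prod>i\<in>-S. 1 / (y i / 2)) * (sqrt 1 * (C * A ^ mi_abs ?be * fact (mi_abs ?be) / W ?be))
  = C * A ^ mi_abs ?be * fact (mi_abs ?be) * ((\<Prod>i\<in>-S. 1 / (y i / 2)) / W ?be)" by simp
  also have "... <= C * (M ^ mi_abs al * M ^ ?d) * (fact (mi_abs al) * fact ?d * (2 ^ mi_abs al * 2 ^ ?d)) * (4 ^ mi_abs al * 4 ^ ?d * (\<Prod>j\<in>UNIV. (1 / y j) ^ (al j + 1)))"
  using C M y Wp[of ?be] by (intro mult_mono 1 2 3 order_refl) (auto intro!: prod_nonneg divide_nonneg_nonneg simp: less_imp_le)
  finally show "(\<Prod>i\<in>-S. 1 / (y i / 2)) * (sqrt 1 * (C * A ^ mi_abs ?be * fact (mi_abs ?be) / W ?be)) <= ..." .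
  qed
  also have "... = C1 * A1 ^ mi_abs al * fact (mi_abs al) * (\<Prod>j\<in>UNIV. (1 / cdist c x j) ^ (al j + 1))"
  proof -
  have c2: "real (card (UNIV :: 'n set set)) = 2 ^ ?d" using card_Pow[of "UNIV :: 'n set"] by simp
  have "A1 ^ mi_abs al = M ^ mi_abs al * 2 ^ mi_abs al * 4 ^ mi_abs al"
  proof -
  have "A1 = M * 2 * 4" by (simp add: A1_def)
  then show ?thesis by (simp only: power_mult_distrib)
  qed
  then show ?thesis unfolding sum_constant c2 C1_def y_def by (simp only: mult_ac)
  qed
  finally show ?thesis .
 qed
 moreover have "0 < C1" "0 < A1" using C M by (auto simp: C1_def A1_def)
 ultimately show ?thesis by blast
qed

text \<open>The second-order bounds involve at most 2 + 3 derivatives, so exponents do not exceed 5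
  and one constant \<open>q powr 5\<close> serves all of them.\<close>

lemma scaled_powr_le:
 assumes "0 < q" "q <= 1" "0 <= e" "e <= 5" "0 < z"
 shows "q powr 5 * z powr e <= (q * z) powr (e::real)"
proof -
 have "q powr 5 <= q powr e" using assms by (intro powr_mono') auto
 then have "q powr 5 * z powr e <= q powr e * z powr e" by (intro mult_right_mono) auto
 also have "... = (q * z) powr e" using assms by (simp add: powr_mult)
 finally show ?thesis .
qed

lemma powr_le_powr_both:
 assumes "0 < z" "z <= w" "w <= 1" "a <= e" "0 <= e"
 shows "z powr e <= w powr (a::real)"
proof -
 have "z powr e <= w powr e" using assms by (intro powr_mono2) auto
 also have "... <= w powr a" using assms by (intro powr_mono') auto
 finally show ?thesis .
qed

text \<open>Boxes of prescribed sides \<open>mm j / 8\<close>, which may exceed the distance to face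
  j. They point away from the corner, except that a coordinate with distance above 1/2 turns back to
  remain in the cube. Coordinates with \<open>cdist c x j = mm j\<close> keep at least half of this
  distance on K; they will control the weights.\<close>

lemma sobolev_max_direction:
 fixes c :: "real ^ 'n::finite" and D :: "('n => nat) => real ^ 'n => real"
 assumes c: "is_corner c"
  and C: "0 < C" "0 < A"
  and wp: "!!al i. weak_pair i (D al) (D (al(i := Suc (al i))))"
  and G: "continuous_on cube g" "AE x in lborel. x \<in> cube --> D al x = g x"
  and L2: "!!be K W. K \<in> sets borel ==> K <= cube ==> weight_bound eh c gac gae be K W ==>
  (\<integral>\<^sup>+y. indicator K y * ennreal ((D be y)^2) \<partial>lborel) <= ennreal ((C * A ^ mi_abs be * fact (mi_abs be) / W)^2)"
  and x: "x \<in> cube" and mm: "!!j. 0 < mm j" "!!j. cdist c x j <= mm j" "!!j. mm j <= 1"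
  and small: "!!j. cdist c x j > 1 / 2 ==> mm j <= 2 * cdist c x j"
  and K: "K = {z \<in> cube. ALL j. cdist c z j <= 2 * mm j & (cdist c x j = mm j --> mm j / 2 <= cdist c z j)}"
  and W: "!!S. weight_bound eh c gac gae (mi_plus al S) K (W S)"
 shows "\<bar>g x\<bar> <= (\<Sum>S\<in>UNIV. (\<Prod>i\<in>-S. 1 / (mm i / 8)) * (sqrt (\<Prod>j\<in>UNIV. 2 * mm j) * (C * A ^ mi_abs (mi_plus al S) * fact (mi_abs (mi_plus al S)) / W S)))"
proof -
 define y where "y j = cdist c x j" for j
 have y: "0 < y j" "y j < 1" for j unfolding y_def by (rule cdist_bounds[OF x c])+
 define V where "V = {z \<in> cube. ALL j. \<bar>cdist c z j - y j\<bar> < y j / 8}"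
 define ta :: "'n => real" where "ta j = (if y j <= 1 / 2 then 1 else -1)" for j
 have Wp: "0 < W S" for S using W by (auto simp: weight_bound_def)
 have Km: "K \<in> sets borel"
 proof -
  have "K = cube Int {z. ALL j. cdist c z j <= 2 * mm j & (cdist c x j = mm j --> mm j / 2 <= cdist c z j)}" by (auto simp: K)
  also have "... \<in> sets borel" by measurable
  finally show ?thesis .
 qed
 have Kc: "K <= cube" by (auto simp: K)
 \<comment> \<open>K lies in a box at the corner c with sides \<open>2 * mm j\<close>; the root of
   its volume enters through Cauchy-Schwarz.\<close>
 have KV: "emeasure lborel K <= ennreal (\<Prod>j\<in>UNIV. 2 * mm j)"
 proof -
  define l u where "l = (\<chi> j. if c $ j = 0 then 0 else 1 - 2 * mm j)" and "u = (\<chi> j. if c $ j = 0 then 2 * mm j else 1)"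
  have "K <= cbox l u"
  proof
  fix z assume z: "z \<in> K"
  have "l $ j <= z $ j & z $ j <= u $ j" for j
  proof -
  have "cdist c z j <= 2 * mm j" "0 < z $ j & z $ j < 1" using z by (auto simp: K cube_def)
  moreover have "c $ j = 0 | c $ j = 1" using c by (simp add: is_corner_def)
  ultimately show ?thesis by (auto simp: l_def u_def cdist_def)
  qed
  then show "z \<in> cbox l u" by (simp add: mem_box_cart)
  qed
  then have "emeasure lborel K <= emeasure lborel (cbox l u)" by (intro emeasure_mono) auto
  also have "... = ennreal (\<Prod>j\<in>UNIV. u $ j - l $ j)"
  by (rule emeasure_cbox_cart) (use mm(1) in \<open>auto simp: l_def u_def less_imp_le\<close>)
  also have "(\<Prod>j\<in>UNIV. u $ j - l $ j) = (\<Prod>j\<in>UNIV. 2 * mm j)"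
  by (intro prod.cong) (auto simp: l_def u_def)
  finally show ?thesis .
 qed
 show ?thesis
 proof (rule sobolev_point[where D = D and K = K and V = V and sg = "%j. ta j * csign c j" and al = al and g = g, OF wp G])
  show "0 < mm i / 8" for i using mm by simp
  show "ta i * csign c i = 1 | ta i * csign c i = - 1" for i using csign_cases[of c i] by (auto simp: ta_def)
  show "z' \<in> K" if z: "z \<in> V" and t: "!!i. \<exists>t\<in>{0..mm i / 8}. z' $ i = z $ i + t * (ta i * csign c i)" for z z'
  proof -
  from t obtain s where s: "!!i. s i \<in> {0..mm i / 8}" "!!i. z' $ i = z $ i + s i * (ta i * csign c i)" by metis
  have zc: "z \<in> cube" using z by (auto simp: V_def)
  have bb: "0 < cdist c z j + s j * ta j & cdist c z j + s j * ta j < 1 & cdist c z j + s j * ta j <= 2 * mm j & (y j = mm j --> mm j / 2 <= cdist c z j + s j * ta j)" for j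
  proof -
  have "\<bar>cdist c z j - y j\<bar> < y j / 8" using z by (auto simp: V_def)
  then have 1: "7 / 8 * y j < cdist c z j" "cdist c z j < 9 / 8 * y j" by (simp_all only: abs_less_iff) linarith+
  have 2: "0 <= s j" "s j <= mm j / 8" using s(1)[of j] by auto
  have 3: "y j <= mm j" "mm j <= 1" using mm by (auto simp: y_def)
  show ?thesis
  proof (cases "y j <= 1 / 2")
  case True
  then have "ta j = 1" by (simp add: ta_def)
  then show ?thesis using 1 2 3 y[of j] True by auto
  next
  case False
  then have "ta j = -1" "mm j <= 2 * y j" using small[of j] by (auto simp: ta_def y_def)
  moreover have "cdist c z j < 1" using cdist_bounds[OF zc c] by blast
  ultimately show ?thesis using 1 2 3 y[of j] False by auto
  qed
  qed
  have b1: "0 < cdist c z j + s j * ta j & cdist c z j + s j * ta j < 1" for j using bb by blast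
  note mv = cdist_move_cube[where ta = ta, OF c zc s(2) b1]
  show ?thesis using mv bb by (auto simp: K y_def)
  qed
  show "open V"
  proof -
  have "V = cube Int (\<Inter>j\<in>UNIV. {z. \<bar>cdist c z j - y j\<bar> < y j / 8})" by (auto simp: V_def)
  also have "open ..." unfolding cdist_def
  by (intro open_Int open_INT open_cube ballI finite open_Collect_less continuous_intros)
  finally show ?thesis .
  qed
  show "x \<in> V" using x y by (auto simp: V_def y_def)
  show "V <= cube" by (auto simp: V_def)
  fix S :: "'n set"
  let ?be = "mi_plus al S"
  have pp: "0 <= (\<Prod>j\<in>UNIV. 2 * mm j)" using mm(1) by (auto intro!: prod_nonneg simp: less_imp_le)
  have q: "0 <= C * A ^ mi_abs ?be * fact (mi_abs ?be) / W S" using C Wp[of S] by (auto simp: less_imp_le)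
  show "0 <= sqrt (\<Prod>j\<in>UNIV. 2 * mm j) * (C * A ^ mi_abs ?be * fact (mi_abs ?be) / W S)"
  by (intro mult_nonneg_nonneg[OF _ q] real_sqrt_ge_zero pp)
  show "(\<integral>\<^sup>+y. indicator K y * ennreal \<bar>D ?be y\<bar> \<partial>lborel) <= ennreal (sqrt (\<Prod>j\<in>UNIV. 2 * mm j) * (C * A ^ mi_abs ?be * fact (mi_abs ?be) / W S))"
  by (rule nn_integral_abs_le_L2[OF Km weak_pair_measurable(1)[OF wp] KV pp L2[OF Km Kc W] q])
 qed (use Km Kc in auto)
qed

text \<open>A singularity in m is shared evenly between two distances that m dominates.\<close>

lemma powr_pair_le:
 fixes m :: real
 assumes "0 < a" "0 < b" "a <= m" "b <= m" "ka <= 2"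
 shows "m powr (ka - 2) <= (a * b) powr - (1 - ka / 2)"
proof -
 have "(m * m) powr - (1 - ka / 2) <= (a * b) powr - (1 - ka / 2)"
  using assms by (intro powr_mono2' mult_mono) auto
 also have "(m * m) powr - (1 - ka / 2) = m powr (ka - 2)"
  using assms by (simp add: powr_mult flip: powr_add)
 finally show ?thesis .
qed

text \<open>A majorant for singular behaviour that does not name the small coordinates. As every
  product involves two distinct coordinates, it is square integrable over the cube for s <
  1/2.\<close>

definition pair_sum :: "real ^ 'n::finite => real ^ 'n => real => real" where
 "pair_sum c x s = (\<Sum>a\<in>UNIV. \<Sum>b\<in>UNIV - {a}. (cdist c x a * cdist c x b) powr (- s))"

lemma pair_sum_ge:
 assumes "a ~= b" shows "(cdist c x a * cdist c x b) powr (- s) <= pair_sum c x s"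
proof -
 have "(cdist c x a * cdist c x b) powr (- s) <= (\<Sum>b\<in>UNIV - {a}. (cdist c x a * cdist c x b) powr (- s))"
  using assms by (intro member_le_sum) auto
 also have "... <= pair_sum c x s" unfolding pair_sum_def
  by (intro member_le_sum[where f = "%a. \<Sum>b\<in>UNIV - {a}. (cdist c x a * cdist c x b) powr (- s)"]) (auto intro!: sum_nonneg)
 finally show ?thesis .
qed

lemma card_split: "card S = card (S - {k}) + (if k \<in> (S::'n::finite set) then 1 else 0)"
 using card_Suc_Diff1[of S k] by auto

lemma mi_plus_perp: "mi_abs (mi_plus al S) - mi_plus al S k <= mi_abs al + card (S - {k})"
 using card_split[of S k] unfolding mi_abs_mi_plus by (auto simp: mi_plus_def)

text \<open>All sides are comparable to the largest distance r. Averaging gives r the exponent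
  \<open>card S - 2\<close>, the root of the area gives 1 and the weight gives
  \<open>- (1 + card S - ka)\<close>; the total \<open>ka - 2\<close> does not depend on S.\<close>

lemma smooth_bound_second_2d:
 fixes c :: "real ^ 'n::finite" and D :: "('n => nat) => real ^ 'n => real"
 assumes c: "is_corner c" and eh: "0 < eh" "eh < 1" and d: "CARD('n) = 2"
  and ka: "0 < ka" "ka < 1 / 2" "1 + ka <= gac"
  and C: "0 < C" "0 < A"
  and wp: "!!al i. weak_pair i (D al) (D (al(i := Suc (al i))))"
  and G: "!!al. continuous_on cube (G al)" "!!al. AE x in lborel. x \<in> cube --> D al x = G al x"
  and L2: "!!be K W. K \<in> sets borel ==> K <= cube ==> weight_bound eh c gac gae be K W ==>
  (\<integral>\<^sup>+y. indicator K y * ennreal ((D be y)^2) \<partial>lborel) <= ennreal ((C * A ^ mi_abs be * fact (mi_abs be) / W)^2)"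
 shows "\<exists>C2\<ge>0. ALL al. mi_abs al = 2 --> (\<forall>x\<in>cube. \<bar>G al x\<bar> <= C2 * pair_sum c x (1 - ka / 2))"
proof -
 define c0 where "c0 = (1 / 2 :: real) powr 5"
 have c0: "0 < c0" "c0 <= 1" unfolding c0_def by (simp, rule powr_le1) auto
 define Q where "Q n = C * A ^ (2 + n) * fact (2 + n)" for n :: nat
 have Q0: "0 <= Q n" for n using C by (simp add: Q_def)
 define C2 where "C2 = (\<Sum>S\<in>(UNIV::'n set set). 128 * Q (card S) / c0)"
 have C20: "0 <= C2" unfolding C2_def using Q0 c0 by (intro sum_nonneg) auto
 have "\<bar>G al x\<bar> <= C2 * pair_sum c x (1 - ka / 2)" if al: "mi_abs al = 2" and x: "x \<in> cube" for al x
 proof -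
  note cb = cdist_bounds[OF x c]
  obtain k where k: "!!j. cdist c x j <= cdist c x k"
  proof -
  have "Max (range (cdist c x)) \<in> range (cdist c x)" by (intro Max_in) auto
  then obtain k where "Max (range (cdist c x)) = cdist c x k" by blast
  then show thesis using that[of k] by (metis Max_ge finite finite_imageI rangeI)
  qed
  define r where "r = cdist c x k"
  have r: "0 < r" "r < 1" using cb by (auto simp: r_def)
  obtain a where a: "a ~= k"
  proof -
  have "UNIV ~= {k}" using d by (metis card_1_singleton_iff One_nat_def numeral_eq_one_iff num.distinct(1))
  then show thesis using that by blast
  qed
  define K where "K = {z \<in> cube. ALL j. cdist c z j <= 2 * r & (cdist c x j = r --> r / 2 <= cdist c z j)}"
  \<comment> \<open>Since gac is at least 1 + ka, the true weight exponent
    \<open>2 + card S - gac\<close> is at most the one used here; the bases are at most 1.\<close>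
  define W where "W S = c0 * r powr (1 + real (card S) - ka)" for S :: "'n set"
  have "\<bar>G al x\<bar> <= (\<Sum>S\<in>UNIV. (\<Prod>i\<in>-S. 1 / (r / 8)) * (sqrt (\<Prod>j\<in>(UNIV::'n set). 2 * r) * (C * A ^ mi_abs (mi_plus al S) * fact (mi_abs (mi_plus al S)) / W S)))"
  proof (rule sobolev_max_direction[where mm = "%_. r" and D = D and g = "G al" and K = K, OF c C wp G L2 x])
  show "K = {z \<in> cube. ALL j. cdist c z j <= 2 * r & (cdist c x j = r --> r / 2 <= cdist c z j)}" by (rule K_def)
  fix S :: "'n set"
  have cS: "card S <= 2" using card_mono[of UNIV S] d by auto
  show "weight_bound eh c gac gae (mi_plus al S) K (W S)"
  unfolding weight_bound_def
  proof (intro conjI ballI)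
  show "0 < W S" using c0 r by (simp add: W_def)
  show "W S <= 1" unfolding W_def using c0 r ka by (intro mult_le_one powr_le1) auto
  fix z assume z: "z \<in> K Int Omega_c eh c"
  have rz: "r / 2 <= r_c c z" using z cdist_le_r_c[of c z k] by (auto simp: K_def r_def)
  have r1: "r_c c z <= 1" using z eh by (auto simp: Omega_c_def split: if_splits)
  have "W S <= (1 / 2 * r) powr (1 + real (card S) - ka)"
  unfolding W_def c0_def using cS ka r by (intro scaled_powr_le) auto
  also have "... <= r_c c z powr max 0 (real (mi_abs (mi_plus al S)) - gac)"
  using rz r r1 ka by (intro powr_le_powr_both) (auto simp: mi_abs_mi_plus al)
  finally show "W S <= r_c c z powr max 0 (real (mi_abs (mi_plus al S)) - gac)" .
  qed (use d in \<open>auto simp: edge_dirs_def\<close>)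
  qed (use r k in \<open>auto simp: r_def less_imp_le\<close>)
  also have "... <= (\<Sum>S\<in>(UNIV::'n set set). 128 * Q (card S) / c0 * r powr (ka - 2))"
  proof (rule sum_mono)
  fix S :: "'n set"
  have cS: "card S <= 2" using card_mono[of UNIV S] d by auto
  have "card (-S) = 2 - card S" using d by (simp add: Compl_eq_Diff_UNIV card_Diff_subset)
  then have 1: "(\<Prod>i\<in>-S. 1 / (r / 8)) = 8 ^ (2 - card S) * r powr (real (card S) - 2)"
  using cS r by (simp add: power_divide powr_diff powr_realpow field_simps flip: power_add)
  have 2: "sqrt (\<Prod>j\<in>(UNIV::'n set). 2 * r) = 2 * r" using d r by (simp add: real_sqrt_unique)
  have "(\<Prod>i\<in>-S. 1 / (r / 8)) * (sqrt (\<Prod>j\<in>(UNIV::'n set). 2 * r) * (C * A ^ mi_abs (mi_plus al S) * fact (mi_abs (mi_plus al S)) / W S))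
  = 8 ^ (2 - card S) * 2 * Q (card S) / c0 * (r powr (real (card S) - 2) * r / r powr (1 + real (card S) - ka))"
  unfolding 1 2 W_def mi_abs_mi_plus al Q_def by (simp add: field_simps)
  also have "r powr (real (card S) - 2) * r / r powr (1 + real (card S) - ka) = r powr (ka - 2)"
  proof -
  have "r powr (real (card S) - 2) * r powr 1 / r powr (1 + real (card S) - ka) = r powr (ka - 2)"
  unfolding powr_add[symmetric] powr_diff[symmetric] by (rule arg_cong[where f = "%e. r powr e"]) simp
  then show ?thesis using r by simp
  qed
  also have "8 ^ (2 - card S) * 2 * Q (card S) / c0 * r powr (ka - 2) <= 128 * Q (card S) / c0 * r powr (ka - 2)"
  proof (intro mult_right_mono divide_right_mono)
  have "(8::real) ^ (2 - card S) <= 8 ^ 2" by (intro power_increasing) auto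
  then show "8 ^ (2 - card S) * 2 <= (128::real)" by simp
  qed (use Q0 c0 in auto)
  finally show "(\<Prod>i\<in>-S. 1 / (r / 8)) * (sqrt (\<Prod>j\<in>(UNIV::'n set). 2 * r) * (C * A ^ mi_abs (mi_plus al S) * fact (mi_abs (mi_plus al S)) / W S)) <= 128 * Q (card S) / c0 * r powr (ka - 2)" .
  qed
  also have "... = C2 * r powr (ka - 2)" by (simp add: C2_def sum_distrib_right)
  also have "... <= C2 * (cdist c x k * cdist c x a) powr - (1 - ka / 2)"
  using cb k ka C20 by (intro mult_left_mono powr_pair_le) (auto simp: r_def)
  also have "... <= C2 * pair_sum c x (1 - ka / 2)"
  using a C20 by (intro mult_left_mono pair_sum_ge) auto
  finally show ?thesis .
 qed
 then show ?thesis using C20 by blast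
qed

text \<open>Two scales: r is the largest distance, in coordinate k, and m the second largest, so the
  edge in direction k is at a distance comparable to m. The box is of length r in direction k and of
  length m otherwise. With \<open>ro = m / r\<close> the exponents of r and of ro both add up to
  \<open>ka - 2\<close>, which leaves a power of m alone.\<close>

lemma smooth_bound_second_3d:
 fixes c :: "real ^ 'n::finite" and D :: "('n => nat) => real ^ 'n => real"
 assumes c: "is_corner c" and eh: "0 < eh" "eh < 1" and d: "CARD('n) = 3"
  and ka: "0 < ka" "ka < 1 / 2" "3 / 2 + ka <= gac" "!!k. 1 + ka <= gae k"
  and C: "0 < C" "0 < A"
  and wp: "!!al i. weak_pair i (D al) (D (al(i := Suc (al i))))"
  and G: "!!al. continuous_on cube (G al)" "!!al. AE x in lborel. x \<in> cube --> D al x = G al x"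
  and L2: "!!be K W. K \<in> sets borel ==> K <= cube ==> weight_bound eh c gac gae be K W ==>
  (\<integral>\<^sup>+y. indicator K y * ennreal ((D be y)^2) \<partial>lborel) <= ennreal ((C * A ^ mi_abs be * fact (mi_abs be) / W)^2)"
 shows "\<exists>C2\<ge>0. ALL al. mi_abs al = 2 --> (\<forall>x\<in>cube. \<bar>G al x\<bar> <= C2 * pair_sum c x (1 - ka / 2))"
proof -
 \<comment> \<open>On K, \<open>r_c\<close> lies between r/2 and 6r. In \<open>Omega_e\<close> the
   condition \<open>r_c > eh\<close> thus gives r/2 >= eh/12, while in \<open>Omega_ce\<close> the
   factors 1/2 and 1/12 occur together; \<open>eh / 24\<close> is below all of these.\<close>
 define c0 where "c0 = (eh / 24) powr 5"
 have c0: "0 < c0" "c0 <= 1" using eh unfolding c0_def by (simp, intro powr_le1) auto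
 define Q where "Q n = C * A ^ (2 + n) * fact (2 + n)" for n :: nat
 have Q0: "0 <= Q n" for n using C by (simp add: Q_def)
 define C2 where "C2 = (\<Sum>S\<in>(UNIV::'n set set). 512 * sqrt 8 * Q (card S) / c0)"
 have C20: "0 <= C2" unfolding C2_def using Q0 c0 by (intro sum_nonneg) auto
 have "\<bar>G al x\<bar> <= C2 * pair_sum c x (1 - ka / 2)" if al: "mi_abs al = 2" and x: "x \<in> cube" for al x
 proof -
  note cb = cdist_bounds[OF x c]
  obtain k where k: "!!j. cdist c x j <= cdist c x k"
  proof -
  have "Max (range (cdist c x)) \<in> range (cdist c x)" by (intro Max_in) auto
  then obtain k where "Max (range (cdist c x)) = cdist c x k" by blast
  then show thesis using that[of k] by (metis Max_ge finite finite_imageI rangeI)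
  qed
  have c2: "card (UNIV - {k}) = 2" using d by (simp add: card_Diff_singleton)
  obtain j where j: "j ~= k" "!!i. i ~= k ==> cdist c x i <= cdist c x j"
  proof -
  have ne: "cdist c x ` (UNIV - {k}) ~= {}" using c2 by (metis card.empty image_is_empty zero_neq_numeral)
  then have "Max (cdist c x ` (UNIV - {k})) \<in> cdist c x ` (UNIV - {k})" by (intro Max_in) auto
  then obtain j where "j \<in> UNIV - {k}" "Max (cdist c x ` (UNIV - {k})) = cdist c x j" by blast
  moreover have "cdist c x i <= Max (cdist c x ` (UNIV - {k}))" if "i ~= k" for i
  using that by (intro Max_ge) auto
  ultimately show thesis using that[of j] by auto
  qed
  obtain b where b: "b ~= j" "b ~= k"
  proof -
  have "card (UNIV - {k} - {j}) = 1" using c2 j by (simp add: card_Diff_singleton)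
  then obtain b where "UNIV - {k} - {j} = {b}" by (auto simp: card_1_singleton_iff)
  then show thesis using that[of b] by blast
  qed
  define r m where "r = cdist c x k" and "m = cdist c x j"
  define ro where "ro = m / r"
  have r: "0 < r" "r < 1" and m: "0 < m" "m <= r" using cb k by (auto simp: r_def m_def)
  have ro: "0 < ro" "ro <= 1" "m = ro * r" using r m by (auto simp: ro_def)
  define mm where "mm i = (if i = k then r else m)" for i
  have mmb: "0 < mm i" "mm i <= r" "cdist c x i <= mm i" for i using r m j(2)[of i] by (auto simp: mm_def r_def m_def)
  define K where "K = {z \<in> cube. ALL j. cdist c z j <= 2 * mm j & (cdist c x j = mm j --> mm j / 2 <= cdist c z j)}"
  \<comment> \<open>E bounds the weight exponent \<open>2 + card S - gac\<close>, and B bounds the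
    exponent \<open>2 + card (S - {k}) - gae k\<close> for the nearest edge.\<close>
  define E where "E S = 1 / 2 + real (card S) - ka" for S :: "'n set"
  define B where "B S = 1 + real (card (S - {k})) - ka" for S :: "'n set"
  define W where "W S = c0 * (r powr E S * ro powr B S)" for S :: "'n set"
  have cS: "card S <= 3" for S :: "'n set" using card_mono[of UNIV S] d by auto
  have cS': "card (S - {l}) <= 3" for S and l :: 'n by (rule cS)
  have EB: "0 <= E S" "E S <= 5" "0 <= B S" "B S <= 5" for S
  using cS[of S] cS'[of S k] ka by (auto simp: E_def B_def)
  have "\<bar>G al x\<bar> <= (\<Sum>S\<in>UNIV. (\<Prod>i\<in>-S. 1 / (mm i / 8)) * (sqrt (\<Prod>j\<in>(UNIV::'n set). 2 * mm j) * (C * A ^ mi_abs (mi_plus al S) * fact (mi_abs (mi_plus al S)) / W S)))"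
  proof (rule sobolev_max_direction[where mm = mm and D = D and g = "G al" and K = K, OF c C wp G L2 x])
  show "K = {z \<in> cube. ALL j. cdist c z j <= 2 * mm j & (cdist c x j = mm j --> mm j / 2 <= cdist c z j)}" by (rule K_def)
  show "mm i <= 2 * cdist c x i" if "1 / 2 < cdist c x i" for i
  using that mmb(2)[of i] r by simp
  fix S :: "'n set"
  let ?be = "mi_plus al S"
  have ae: "max 0 (real (mi_abs ?be) - gac) <= E S" using EB(1)[of S] ka by (auto simp: mi_abs_mi_plus al E_def)
  have ap: "max 0 (real (mi_abs ?be - ?be k) - gae k) <= B S"
  using EB(3)[of S] ka(4)[of k] mi_plus_perp[of al S k] unfolding al by (auto simp: B_def)
  have a5: "max 0 (real (mi_abs ?be - ?be l) - gae l) <= 5" for l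
  using ka(4)[of l] ka(1) mi_plus_perp[of al S l] cS'[of S l] unfolding al by auto
  have rE: "r powr E S <= 1" "ro powr B S <= 1" using r ro EB by (auto intro!: powr_le1)
  \<comment> \<open>Coordinates k and j attain the side lengths r and m, so on K they keep at least
    half of them; this gives all lower bounds.\<close>
  have geo: "r / 2 <= r_c c z" "r_c c z <= 6 * r" "m / 2 <= r_e c k z" "l ~= k ==> r / 2 <= r_e c l z" if z: "z \<in> K" for z l
  proof -
  have zc: "z \<in> cube" using z by (simp add: K_def)
  have kk: "cdist c x i = mm i ==> mm i / 2 <= cdist c z i" for i using z by (auto simp: K_def)
  have yk: "r / 2 <= cdist c z k" using kk[of k] by (simp add: mm_def r_def)
  have yj: "m / 2 <= cdist c z j" using kk[of j] j(1) by (simp add: mm_def m_def)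
  show "r / 2 <= r_c c z" using yk cdist_le_r_c[of c z k] by linarith
  show "m / 2 <= r_e c k z" using yj cdist_le_r_e[OF zc c j(1)] by linarith
  show "r / 2 <= r_e c l z" if "l ~= k" using yk cdist_le_r_e[OF zc c, of k l] that by auto
  have "cdist c z i <= 2 * r" for i using z mmb(2)[of i] by (auto simp: K_def intro: order_trans[of _ "2 * mm i"])
  then have "r_c c z <= real CARD('n) * (2 * r)" unfolding r_c_eq using cdist_bounds[OF zc c] r
  by (intro sqrt_sum_le) (auto simp: less_imp_le)
  then show "r_c c z <= 6 * r" using d by simp
  qed
  have rcE: "(1 / 2) powr 5 * r powr E S <= r_c c z powr max 0 (real (mi_abs ?be) - gac)" if z: "z \<in> K" "r_c c z <= 1" for z
  proof -
  have "(1 / 2) powr 5 * r powr E S <= (1 / 2 * r) powr E S" using r EB by (intro scaled_powr_le) auto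
  also have "... <= r_c c z powr max 0 (real (mi_abs ?be) - gac)"
  using geo(1)[OF z(1)] r z(2) ae EB by (intro powr_le_powr_both) auto
  finally show ?thesis .
  qed
  have c0h: "c0 <= (eh / 12) powr 5" "c0 <= (1 / 2) powr 5 * (1 / 12) powr 5" "c0 <= (1 / 2) powr 5"
  proof -
  show "c0 <= (eh / 12) powr 5" "c0 <= (1 / 2) powr 5" unfolding c0_def using eh by (auto intro!: powr_mono2)
  have "c0 <= (1 / 2 * (1 / 12)) powr 5" unfolding c0_def using eh by (intro powr_mono2) auto
  then show "c0 <= (1 / 2) powr 5 * (1 / 12) powr 5" by (subst (asm) powr_mult) auto
  qed
  show "weight_bound eh c gac gae ?be K (W S)"
  unfolding weight_bound_def
  proof (intro conjI ballI)
  show "0 < W S" using c0 r ro by (simp add: W_def)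
  show "W S <= 1" unfolding W_def using c0 rE by (intro mult_le_one) auto
  next
  fix z assume z: "z \<in> K Int Omega_c eh c"
  then have r1: "r_c c z <= 1" using eh by (auto simp: Omega_c_def split: if_splits)
  have "W S <= (1 / 2) powr 5 * (r powr E S * 1)" unfolding W_def using c0h(3) rE
  by (intro mult_mono) auto
  also have "... <= r_c c z powr max 0 (real (mi_abs ?be) - gac)" using rcE[of z] z r1 by simp
  finally show "W S <= r_c c z powr max 0 (real (mi_abs ?be) - gac)" .
  next
  fix l z assume z: "z \<in> K Int Omega_e eh c l"
  then have re1: "r_e c l z <= 1" and rc: "eh < r_c c z" using eh by (auto simp: Omega_e_def)
  have rl: "eh / 12 <= r / 2" using geo(2)[of z] z rc by auto
  show "W S <= r_e c l z powr max 0 (real (mi_abs ?be - ?be l) - gae l)"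
  proof (cases "l = k")
  case True
  have "W S <= (eh / 12) powr 5 * (1 * ro powr B S)" unfolding W_def using c0h(1) rE
  by (intro mult_mono) auto
  also have "... <= (eh / 12 * ro) powr B S" unfolding mult_1_left using eh EB ro by (intro scaled_powr_le) auto
  also have "... <= r_e c k z powr max 0 (real (mi_abs ?be - ?be k) - gae k)"
  proof (intro powr_le_powr_both ap EB)
  have "eh / 12 * ro <= r / 2 * ro" using rl ro by (intro mult_right_mono) auto
  also have "... = m / 2" using ro by simp
  also have "... <= r_e c k z" using geo(3)[of z] z by auto
  finally show "eh / 12 * ro <= r_e c k z" .
  qed (use eh ro re1 True in auto)
  finally show ?thesis using True by simp
  next
  \<comment> \<open>Coordinate k is perpendicular to any other edge l, so the distance to l is at
    least r/2, and this is at least \<open>eh / 12\<close>.\<close>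
  case False
  have "W S <= (eh / 12) powr 5 * (1 * 1)" unfolding W_def using c0h(1) rE
  by (intro mult_mono) auto
  also have "... <= r_e c l z powr max 0 (real (mi_abs ?be - ?be l) - gae l)"
  unfolding mult_1_right using geo(4)[OF _ False, of z] z rl eh re1 a5[of l] by (intro powr_le_powr_both) auto
  finally show ?thesis .
  qed
  next
  fix l z assume z: "z \<in> K Int Omega_ce eh c l"
  then have r1: "r_c c z <= 1" "rho_ce c l z <= 1" and zc: "z \<in> cube" using eh by (auto simp: Omega_ce_def)
  have rcp: "0 < r_c c z" by (rule r_c_pos[OF zc c])
  have rc6: "r_c c z <= 6 * r" using geo(2)[of z] z by auto
  show "W S <= r_c c z powr max 0 (real (mi_abs ?be) - gac) * rho_ce c l z powr max 0 (real (mi_abs ?be - ?be l) - gae l)"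
  proof (cases "l = k")
  case True
  have "W S <= ((1 / 2) powr 5 * (1 / 12) powr 5) * (r powr E S * ro powr B S)"
  unfolding W_def using c0h(2) by (intro mult_right_mono) auto
  also have "... = ((1 / 2) powr 5 * r powr E S) * ((1 / 12) powr 5 * ro powr B S)" by (simp only: mult_ac)
  also have "... <= r_c c z powr max 0 (real (mi_abs ?be) - gac) * rho_ce c k z powr max 0 (real (mi_abs ?be - ?be k) - gae k)"
  proof (intro mult_mono)
  show "(1 / 2) powr 5 * r powr E S <= r_c c z powr max 0 (real (mi_abs ?be) - gac)" using rcE[of z] z r1 by simp
  have "(1 / 12) powr 5 * ro powr B S <= (1 / 12 * ro) powr B S" using EB ro by (intro scaled_powr_le) auto
  also have "... <= rho_ce c k z powr max 0 (real (mi_abs ?be - ?be k) - gae k)"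
  proof (intro powr_le_powr_both ap EB)
  have "1 / 12 * ro * r_c c z <= 1 / 12 * ro * (6 * r)" using rc6 ro by (intro mult_left_mono) auto
  also have "... = m / 2" using ro by simp
  also have "... <= r_e c k z" using geo(3)[of z] z by auto
  finally show "1 / 12 * ro <= rho_ce c k z" using rcp by (simp add: rho_ce_def pos_le_divide_eq)
  qed (use ro r1 True in auto)
  finally show "(1 / 12) powr 5 * ro powr B S <= rho_ce c k z powr max 0 (real (mi_abs ?be - ?be k) - gae k)" .
  qed auto
  finally show ?thesis using True by simp
  next
  case False
  have "W S <= ((1 / 2) powr 5 * (1 / 12) powr 5) * (r powr E S * 1)"
  unfolding W_def using c0h(2) rE by (intro mult_mono) auto
  also have "... = ((1 / 2) powr 5 * r powr E S) * (1 / 12) powr 5" by (simp only: mult_ac mult_1_right)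
  also have "... <= r_c c z powr max 0 (real (mi_abs ?be) - gac) * rho_ce c l z powr max 0 (real (mi_abs ?be - ?be l) - gae l)"
  proof (intro mult_mono)
  show "(1 / 2) powr 5 * r powr E S <= r_c c z powr max 0 (real (mi_abs ?be) - gac)" using rcE[of z] z r1 by simp
  show "(1 / 12) powr 5 <= rho_ce c l z powr max 0 (real (mi_abs ?be - ?be l) - gae l)"
  proof (intro powr_le_powr_both a5)
  have "1 / 12 * r_c c z <= r / 2" using rc6 by simp
  also have "... <= r_e c l z" using geo(4)[OF _ False, of z] z by auto
  finally show "1 / 12 <= rho_ce c l z" using rcp by (simp add: rho_ce_def pos_le_divide_eq)
  qed (use r1 in auto)
  qed auto
  finally show ?thesis .
  qed
  qed
  show "mm i <= 1" for i using mmb(2)[of i] r by linarith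
  qed (use mmb in auto)
  also have "... <= (\<Sum>S\<in>(UNIV::'n set set). 512 * sqrt 8 * Q (card S) / c0 * m powr (ka - 2))"
  proof (rule sum_mono)
  fix S :: "'n set"
  let ?s = "real (card (S - {k}))" and ?n = "real (card S)"
  have pU: "(\<Prod>i\<in>UNIV. f (mm i)) = f r * (f m * f m)" for f :: "real => real"
  proof -
  have "(\<Prod>i\<in>UNIV. f (mm i)) = f (mm k) * (\<Prod>i\<in>UNIV - {k}. f (mm i))" by (rule prod.remove) auto
  also have "(\<Prod>i\<in>UNIV - {k}. f (mm i)) = (\<Prod>i\<in>UNIV - {k}. f m)" by (intro prod.cong) (auto simp: mm_def)
  finally show ?thesis using c2 by (simp add: mm_def power2_eq_square)
  qed
  have pS: "(\<Prod>i\<in>S. mm i) = r powr ?n * ro powr ?s"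
  proof -
  have "(\<Prod>i\<in>S. mm i) = (\<Prod>i\<in>S. r * (if i = k then 1 else ro))" using ro by (intro prod.cong) (auto simp: mm_def)
  also have "... = r ^ card S * (\<Prod>i\<in>S. if i = k then 1 else ro)" by (simp add: prod.distrib)
  also have "(\<Prod>i\<in>S. if i = k then 1 else ro) = (\<Prod>i\<in>S - {k}. ro)"
  by (rule prod.mono_neutral_cong_right) auto
  finally show ?thesis using r ro by (simp add: powr_realpow)
  qed
  have 1: "(\<Prod>i\<in>-S. 1 / (mm i / 8)) <= 512 * (r powr (?n - 3) * ro powr (?s - 2))"
  proof -
  have "(\<Prod>i\<in>-S. 1 / (mm i / 8)) = 8 ^ card (-S) * (\<Prod>i\<in>-S. 1 / mm i)"
  proof -
  have "(\<Prod>i\<in>-S. 1 / (mm i / 8)) = (\<Prod>i\<in>-S. 8 * (1 / mm i))" by (intro prod.cong) auto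
  then show ?thesis by (simp only: prod.distrib prod_constant)
  qed
  also have "... <= 8 ^ 3 * (\<Prod>i\<in>-S. 1 / mm i)"
  using cS[of "-S"] mmb(1) by (intro mult_right_mono power_increasing prod_nonneg) (auto simp: less_imp_le)
  also have "(\<Prod>i\<in>-S. 1 / mm i) = (\<Prod>i\<in>UNIV. 1 / mm i) * (\<Prod>i\<in>S. mm i)"
  proof -
  have "(\<Prod>i\<in>UNIV. 1 / mm i) = (\<Prod>i\<in>-S. 1 / mm i) * (\<Prod>i\<in>S. 1 / mm i)"
  by (subst prod.union_disjoint[symmetric]) (auto intro!: prod.cong)
  moreover have "(\<Prod>i\<in>S. 1 / mm i) * (\<Prod>i\<in>S. mm i) = 1"
  using mmb(1) by (simp add: prod.distrib[symmetric] less_imp_neq[symmetric])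
  ultimately show ?thesis by (simp add: mult.assoc)
  qed
  also have "(\<Prod>i\<in>UNIV. 1 / mm i) = r powr (-3) * ro powr (-2)"
  unfolding pU[of "%x. 1 / x"] ro(3) using r ro(1) by (simp add: powr_minus powr_numeral field_simps power2_eq_square power3_eq_cube)
  also have "(8::real) ^ 3 * (r powr (-3) * ro powr (-2) * (\<Prod>i\<in>S. mm i)) = 512 * (r powr (?n - 3) * ro powr (?s - 2))"
  unfolding pS by (simp add: powr_diff powr_minus field_simps)
  finally show ?thesis .
  qed
  have 2: "sqrt (\<Prod>j\<in>(UNIV::'n set). 2 * mm j) = sqrt 8 * (r powr (3 / 2) * ro)"
  proof -
  have "(\<Prod>j\<in>(UNIV::'n set). 2 * mm j) = 8 * ((r powr (3 / 2) * ro)^2)"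
  unfolding pU[of "%x. 2 * x"] ro(3) using r
  by (simp add: power_mult_distrib power2_eq_square flip: powr_add) (simp add: powr_numeral power3_eq_cube)
  then show ?thesis using r ro by (simp add: real_sqrt_mult)
  qed
  have "(\<Prod>i\<in>-S. 1 / (mm i / 8)) * (sqrt (\<Prod>j\<in>(UNIV::'n set). 2 * mm j) * (C * A ^ mi_abs (mi_plus al S) * fact (mi_abs (mi_plus al S)) / W S))
  <= 512 * (r powr (?n - 3) * ro powr (?s - 2)) * (sqrt 8 * (r powr (3 / 2) * ro) * (Q (card S) / W S))"
  unfolding 2 mi_abs_mi_plus al Q_def[symmetric] using r ro Q0[of "card S"] c0
  by (intro mult_right_mono 1) (auto simp: W_def)
  also have "... = 512 * sqrt 8 * Q (card S) / c0 * ((r powr (?n - 3) * r powr (3 / 2) / r powr E S) * (ro powr (?s - 2) * ro powr 1 / ro powr B S))"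
  unfolding W_def using ro(1) by (simp add: field_simps)
  also have "r powr (?n - 3) * r powr (3 / 2) / r powr E S = r powr (ka - 2)"
  unfolding powr_add[symmetric] powr_diff[symmetric] E_def by (rule arg_cong[where f = "%e. r powr e"]) simp
  also have "ro powr (?s - 2) * ro powr 1 / ro powr B S = ro powr (ka - 2)"
  unfolding powr_add[symmetric] powr_diff[symmetric] B_def by (rule arg_cong[where f = "%e. ro powr e"]) simp
  also have "r powr (ka - 2) * ro powr (ka - 2) = m powr (ka - 2)"
  unfolding ro(3) using r ro by (simp add: powr_mult)
  finally show "(\<Prod>i\<in>-S. 1 / (mm i / 8)) * (sqrt (\<Prod>j\<in>(UNIV::'n set). 2 * mm j) * (C * A ^ mi_abs (mi_plus al S) * fact (mi_abs (mi_plus al S)) / W S)) <= 512 * sqrt 8 * Q (card S) / c0 * m powr (ka - 2)" .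
  qed
  also have "... = C2 * m powr (ka - 2)" by (simp add: C2_def sum_distrib_right)
  also have "... <= C2 * (cdist c x j * cdist c x b) powr - (1 - ka / 2)"
  using cb j(2)[OF b(2)] ka C20 by (intro mult_left_mono powr_pair_le) (auto simp: m_def)
  also have "... <= C2 * pair_sum c x (1 - ka / 2)"
  using b(1) C20 by (intro mult_left_mono pair_sum_ge) auto
  finally show ?thesis .
 qed
 then show ?thesis using C20 by blast
qed

section \<open>Integrating the bounds along rays, and reflection of the corner to the origin\<close>

lemma smooth_family_line:
 assumes G: "smooth_family G" and x: "x + t *\<^sub>R axis i 1 \<in> cube"
 shows "((%s. G al (x + s *\<^sub>R axis i 1)) has_real_derivative G (al(i := Suc (al i))) (x + t *\<^sub>R axis i 1)) (at t)"
proof -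
 have "((%h. G al ((x + t *\<^sub>R axis i 1) + h *\<^sub>R axis i 1)) has_real_derivative G (al(i := Suc (al i))) (x + t *\<^sub>R axis i 1)) (at 0)"
  using G x unfolding smooth_family_def by blast
 moreover have "x + t *\<^sub>R axis i 1 + h *\<^sub>R axis i 1 = x + (h + t) *\<^sub>R axis i 1" for h by (simp add: algebra_simps)
 ultimately show ?thesis
  using DERIV_shift[of "%s. G al (x + s *\<^sub>R axis i 1)" _ 0 t] by simp
qed

text \<open>Continuous partial derivatives give total differentiability: the increment is walked one
  coordinate at a time inside a ball where all partials vary by at most \<open>et\<close>.\<close>

lemma smooth_family_has_derivative:
 fixes G :: "('n::finite => nat) => real ^ 'n => real"
 assumes G: "smooth_family G" and x: "x \<in> cube"
 shows "(G al has_derivative (%v. \<Sum>i\<in>UNIV. v $ i * G (al(i := Suc (al i))) x)) (at x)"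
 unfolding has_derivative_at_alt
proof (intro conjI allI impI)
 show "bounded_linear (%v. \<Sum>i\<in>UNIV. v $ i * G (al(i := Suc (al i))) x)"
  by (intro bounded_linear_sum bounded_linear_mult_const bounded_linear_vec_nth)
 fix e :: real assume e: "0 < e"
 define g where "g i = G (al(i := Suc (al i)))" for i
 define et where "et = e / real CARD('n)"
 have et: "0 < et" using e by (simp add: et_def)
 have "\<exists>d>0. ALL z. dist z x < d --> \<bar>g i z - g i x\<bar> <= et" for i
 proof -
  have "isCont (g i) x" using G x open_cube continuous_on_eq_continuous_at unfolding smooth_family_def g_def by blast
  then show ?thesis unfolding continuous_at_eps_delta using et by (metis dist_real_def less_imp_le)
 qed
 then obtain d0 where d0: "!!i. 0 < d0 i" "!!i z. dist z x < d0 i ==> \<bar>g i z - g i x\<bar> <= et" by metis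
 obtain d1 where d1: "0 < d1" "ball x d1 <= cube" using x open_cube open_contains_ball by blast
 define d where "d = min d1 (Min (range d0))"
 have d: "0 < d" "d <= d1" "d <= d0 i" for i using d0(1) d1(1) by (auto simp: d_def min.coboundedI2)
 show "\<exists>d>0. ALL y. norm (y - x) < d --> norm (G al y - G al x - (\<Sum>i\<in>UNIV. (y - x) $ i * G (al(i := Suc (al i))) x)) <= e * norm (y - x)"
 proof (intro exI[of _ d] conjI allI impI)
  fix y assume y: "norm (y - x) < d"
  define w where "w i = (y - x) $ i" for i
  have near: "dist (x + v) x < d" if "!!i. \<bar>v $ i\<bar> <= \<bar>w i\<bar>" for v
  using y norm_le_componentwise_cart[of v "y - x"] that by (simp add: dist_norm w_def)
  define z where "z I = (\<Sum>i\<in>I. w i *\<^sub>R axis i 1 :: real ^ 'n)" for I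
  have zc: "z I $ k = (if k \<in> I then w k else 0)" for I k
  by (simp add: z_def axis_def if_distrib cong: if_cong)
  have "\<bar>G al (x + z I) - G al x - (\<Sum>i\<in>I. w i * g i x)\<bar> <= et * (\<Sum>i\<in>I. \<bar>w i\<bar>)" for I
  using finite[of I]
  proof (induction I rule: finite_induct)
  case empty
  then show ?case by (simp add: z_def)
  next
  case (insert j I)
  define f where "f s = G al ((x + z I) + s *\<^sub>R axis j 1) - s * g j x" for s
  have f: "(f has_real_derivative g j ((x + z I) + s *\<^sub>R axis j 1) - g j x) (at s within closed_segment 0 (w j)) \<and>
  norm (g j ((x + z I) + s *\<^sub>R axis j 1) - g j x) <= et" if s: "s \<in> closed_segment 0 (w j)" for s
  proof -
  have sw: "\<bar>s\<bar> <= \<bar>w j\<bar>" using s by (auto simp: closed_segment_eq_real_ivl split: if_splits)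
  have "dist (x + (z I + s *\<^sub>R axis j 1)) x < d"
  by (rule near) (use sw insert(2) in \<open>auto simp: zc axis_def\<close>)
  then have n: "dist ((x + z I) + s *\<^sub>R axis j 1) x < d" by (simp add: add.assoc)
  then have "(x + z I) + s *\<^sub>R axis j 1 \<in> cube" using d(2) d1(2) by (auto simp: dist_commute)
  then have "((%s. G al ((x + z I) + s *\<^sub>R axis j 1)) has_real_derivative g j ((x + z I) + s *\<^sub>R axis j 1)) (at s)"
  unfolding g_def by (rule smooth_family_line[OF G])
  then have "(f has_real_derivative g j ((x + z I) + s *\<^sub>R axis j 1) - 1 * g j x) (at s)"
  unfolding f_def by (intro DERIV_diff DERIV_cmult_right DERIV_ident)
  moreover have "\<bar>g j ((x + z I) + s *\<^sub>R axis j 1) - g j x\<bar> <= et" using n d(3)[of j] by (intro d0(2)) auto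
  ultimately show ?thesis by (auto intro: has_field_derivative_at_within)
  qed
  have "norm (f (w j) - f 0) <= et * norm (w j - 0)"
  by (rule field_differentiable_bound[where S = "closed_segment 0 (w j)"]) (use f in auto)
  moreover have "x + z (insert j I) = (x + z I) + w j *\<^sub>R axis j 1"
  using insert by (simp add: z_def algebra_simps)
  ultimately have "\<bar>G al (x + z (insert j I)) - G al (x + z I) - w j * g j x\<bar> <= et * \<bar>w j\<bar>"
  by (simp add: f_def algebra_simps)
  then show ?case using insert by (simp add: distrib_left)
  qed
  from this[of UNIV] have "\<bar>G al (x + z UNIV) - G al x - (\<Sum>i\<in>UNIV. w i * g i x)\<bar> <= et * (\<Sum>i\<in>UNIV. \<bar>w i\<bar>)" .
  also have "... <= et * (\<Sum>i\<in>(UNIV::'n set). norm (y - x))"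
  using et unfolding w_def by (intro mult_left_mono sum_mono component_le_norm_cart) auto
  also have "... = e * norm (y - x)" by (simp add: et_def)
  also have "x + z UNIV = y" by (simp add: vec_eq_iff zc w_def)
  finally show "norm (G al y - G al x - (\<Sum>i\<in>UNIV. (y - x) $ i * G (al(i := Suc (al i))) x)) <= e * norm (y - x)"
  by (simp add: w_def g_def)
 qed (rule d)
qed

lemma cube_path:
 fixes x y :: "real ^ 'n::finite"
 assumes "x \<in> cube" "y \<in> cube" "0 <= t" "t <= 1" shows "x + t *\<^sub>R (y - x) \<in> cube"
 using cube_segment[of x 1 "y - x" t] assms by simp

lemma smooth_family_path:
 fixes G :: "('n::finite => nat) => real ^ 'n => real"
 assumes G: "smooth_family G" and x: "x \<in> cube" "y \<in> cube" and t: "0 <= t" "t <= 1"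
 shows "((%t. G al (x + t *\<^sub>R (y - x))) has_real_derivative (\<Sum>i\<in>UNIV. (y - x) $ i * G (al(i := Suc (al i))) (x + t *\<^sub>R (y - x)))) (at t)"
proof -
 have "((%t. x + t *\<^sub>R (y - x)) has_derivative (%h. h *\<^sub>R (y - x))) (at t)"
  by (auto intro!: derivative_eq_intros)
 then have "((%t. G al (x + t *\<^sub>R (y - x))) has_derivative (%h. \<Sum>i\<in>UNIV. (h *\<^sub>R (y - x)) $ i * G (al(i := Suc (al i))) (x + t *\<^sub>R (y - x)))) (at t)"
  by (rule has_derivative_compose[where f = "%t. x + t *\<^sub>R (y - x)" and g = "G al", OF _ smooth_family_has_derivative[OF G cube_path[OF x t]]])
 moreover have "(%h. \<Sum>i\<in>UNIV. (h *\<^sub>R (y - x)) $ i * G (al(i := Suc (al i))) (x + t *\<^sub>R (y - x))) = (*) (\<Sum>i\<in>UNIV. (y - x) $ i * G (al(i := Suc (al i))) (x + t *\<^sub>R (y - x)))"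
  by (auto simp: sum_distrib_left mult_ac fun_eq_iff)
 ultimately show ?thesis by (simp add: has_field_derivative_def)
qed

text \<open>With P a primitive of the integrable majorant \<open>M * t powr (- l)\<close>, both P -
  g and P + g are nondecreasing on (0, 1]; the value at 0 is reached by continuity.\<close>

lemma powr_derivative_bound:
 fixes g :: "real => real"
 assumes d: "!!t. 0 <= t ==> t <= 1 ==> (g has_real_derivative g' t) (at t)"
  and b: "!!t. 0 < t ==> t <= 1 ==> \<bar>g' t\<bar> <= M * t powr (- l)" and l: "l < 1" and M: "0 <= M"
 shows "\<bar>g 0\<bar> <= \<bar>g 1\<bar> + M / (1 - l)"
proof -
 define P where "P t = M / (1 - l) * t powr (1 - l)" for t
 have dP: "(P has_real_derivative M * t powr (- l)) (at t)" if "0 < t" for t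
 proof -
  have "((%t. M / (1 - l) * t powr (1 - l)) has_real_derivative M / (1 - l) * ((1 - l) * t powr (1 - l - 1))) (at t)"
  by (rule DERIV_cmult[OF has_real_derivative_powr[OF that]])
  then show ?thesis unfolding P_def using l by simp
 qed
 have "\<bar>g 1 - g e\<bar> <= M / (1 - l)" if e: "0 < e" "e <= 1" for e
 proof -
  have "P e - g e <= P 1 - g 1"
  proof (rule DERIV_nonneg_imp_nondecreasing[OF e(2)])
  fix t assume t: "e <= t" "t <= 1"
  have "((%t. P t - g t) has_real_derivative M * t powr (- l) - g' t) (at t)"
  using e t by (intro DERIV_diff dP d) auto
  then show "EX y. ((%t. P t - g t) has_real_derivative y) (at t) & 0 <= y" using b[of t] e t by force
  qed
  moreover have "P e + g e <= P 1 + g 1"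
  proof (rule DERIV_nonneg_imp_nondecreasing[OF e(2)])
  fix t assume t: "e <= t" "t <= 1"
  have "((%t. P t + g t) has_real_derivative M * t powr (- l) + g' t) (at t)"
  using e t by (intro DERIV_add dP d) auto
  then show "EX y. ((%t. P t + g t) has_real_derivative y) (at t) & 0 <= y" using b[of t] e t by force
  qed
  moreover have "0 <= P e" "P 1 = M / (1 - l)" using M l by (auto simp: P_def)
  ultimately show ?thesis by (simp add: abs_le_iff)
 qed
 then have ev: "eventually (%e. \<bar>g e\<bar> <= \<bar>g 1\<bar> + M / (1 - l)) (at_right 0)"
  unfolding eventually_at_right_field by (intro exI[of _ 1]) fastforce
 have "isCont g 0" using d[of 0] by (auto intro: DERIV_isCont)
 then have "(g \<longlongrightarrow> g 0) (at_right 0)" by (simp add: isCont_def filterlim_at_split)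
 then have "((%e. \<bar>g e\<bar>) \<longlongrightarrow> \<bar>g 0\<bar>) (at_right 0)" by (rule tendsto_rabs)
 then show ?thesis by (rule tendsto_upperbound[OF _ ev]) simp
qed

lemma center_in_cube: "(\<chi> i. 1 / 2) \<in> cube" by (simp add: cube_def)

text \<open>On the segment to the centre the distance equals
  \<open>(1 - t) * cdist c x j + t / 2\<close>.\<close>

lemma cdist_path:
 assumes x: "x \<in> cube" and c: "is_corner c" and t: "0 <= t" "t <= 1"
 defines "z \<equiv> x + t *\<^sub>R ((\<chi> i. 1 / 2) - x)"
 shows "cdist c x j / 2 <= cdist c z j" "t / 2 <= cdist c z j"
proof -
 have j: "c $ j = 0 | c $ j = 1" "0 < x $ j & x $ j < 1" using x c by (auto simp: cube_def is_corner_def)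
 have z: "z $ j = (1 - t) * x $ j + t / 2" by (simp add: z_def algebra_simps)
 have "0 <= z $ j" "z $ j <= 1" using cube_path[OF x center_in_cube t] by (auto simp: z_def[symmetric] cube_def less_imp_le)
 then have eq: "cdist c z j = (1 - t) * cdist c x j + t / 2"
  using j by (auto simp: cdist_def z algebra_simps)
 have b: "0 < cdist c x j" "cdist c x j < 1" by (rule cdist_bounds[OF x c])+
 have "t * cdist c x j <= t" using t b by (simp add: mult_left_le)
 moreover have "t * cdist c x j <= 1 * cdist c x j" using t b by (intro mult_right_mono) auto
 moreover have "(1 - t) * cdist c x j = cdist c x j - t * cdist c x j" by (simp add: algebra_simps)
 ultimately show "cdist c x j / 2 <= cdist c z j" unfolding eq by linarith
 show "t / 2 <= cdist c z j" unfolding eq using t b by simp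
qed

text \<open>The exponent q is split: s is charged to the distances of x and q - s to t, the latter
  twice because two distances are multiplied.\<close>

lemma pair_sum_path:
 assumes x: "x \<in> cube" and c: "is_corner c" and t: "0 < t" "t <= 1" and s: "0 <= s" "s <= q"
 shows "pair_sum c (x + t *\<^sub>R ((\<chi> i. 1 / 2) - x)) q <= (4 powr q * pair_sum c x s) * t powr (- (2 * (q - s)))"
proof -
 let ?z = "x + t *\<^sub>R ((\<chi> i. 1 / 2) - x)"
 have one: "cdist c ?z a powr (- q) <= 2 powr q * cdist c x a powr (- s) * t powr (- (q - s))" for a
 proof -
  have y: "0 < cdist c x a" by (rule cdist_bounds[OF x c])
  have p: "cdist c x a / 2 <= cdist c ?z a" "t / 2 <= cdist c ?z a" using cdist_path[OF x c] t by auto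
  have "cdist c ?z a powr (- q) = cdist c ?z a powr (- s) * cdist c ?z a powr (- (q - s))"
  by (simp flip: powr_add)
  also have "... <= (cdist c x a / 2) powr (- s) * (t / 2) powr (- (q - s))"
  using y t s p by (intro mult_mono powr_mono2') auto
  also have "... = 2 powr q * cdist c x a powr (- s) * t powr (- (q - s))"
  proof -
  have "(cdist c x a / 2) powr (- s) = cdist c x a powr (- s) * 2 powr s"
  using y by (simp add: powr_divide powr_minus field_simps)
  moreover have "(t / 2) powr (- (q - s)) = t powr (- (q - s)) * 2 powr (q - s)"
  proof -
  have "(t / 2) powr (- (q - s)) = t powr (- (q - s)) / 2 powr (- (q - s))" by (rule powr_divide)
  also have "(2::real) powr (- (q - s)) = 1 / 2 powr (q - s)" by (rule powr_minus_divide)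
  finally show ?thesis by simp
  qed
  moreover have "2 powr s * 2 powr (q - s) = (2::real) powr q" by (simp flip: powr_add)
  ultimately show ?thesis by (simp add: mult_ac)
  qed
  finally show ?thesis .
 qed
 have term_le: "(cdist c ?z a * cdist c ?z b) powr (- q) <= 4 powr q * (cdist c x a * cdist c x b) powr (- s) * t powr (- (2 * (q - s)))" for a b
 proof -
  have y: "0 < cdist c x a" "0 < cdist c x b" by (rule cdist_bounds[OF x c])+
  have "(cdist c ?z a * cdist c ?z b) powr (- q) = cdist c ?z a powr (- q) * cdist c ?z b powr (- q)"
  by (rule powr_mult)
  also have "... <= (2 powr q * cdist c x a powr (- s) * t powr (- (q - s))) * (2 powr q * cdist c x b powr (- s) * t powr (- (q - s)))"
  by (intro mult_mono one) auto
  also have "... = (2 powr q * 2 powr q) * (cdist c x a powr (- s) * cdist c x b powr (- s)) * (t powr (- (q - s)) * t powr (- (q - s)))"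
  by (simp only: mult_ac)
  also have "2 powr q * 2 powr q = (4::real) powr q" by (simp flip: powr_mult)
  also have "cdist c x a powr (- s) * cdist c x b powr (- s) = (cdist c x a * cdist c x b) powr (- s)"
  using y by (simp add: powr_mult)
  also have "t powr (- (q - s)) * t powr (- (q - s)) = t powr (- (2 * (q - s)))"
  by (simp flip: powr_add)
  finally show ?thesis .
 qed
 have "pair_sum c ?z q <= (\<Sum>a\<in>UNIV. \<Sum>b\<in>UNIV - {a}. 4 powr q * (cdist c x a * cdist c x b) powr (- s) * t powr (- (2 * (q - s))))"
  unfolding pair_sum_def by (intro sum_mono term_le)
 also have "... = (4 powr q * pair_sum c x s) * t powr (- (2 * (q - s)))"
  by (simp add: pair_sum_def sum_distrib_left sum_distrib_right)
 finally show ?thesis .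
qed

lemma pair_sum_nonneg: "0 <= pair_sum c x s"
 unfolding pair_sum_def by (intro sum_nonneg) auto

text \<open>Lets additive constants be absorbed into \<open>pair_sum\<close>: two distinct
  coordinates exist and their distances are below 1.\<close>

lemma pair_sum_ge_1:
 fixes c :: "real ^ 'n::finite"
 assumes x: "x \<in> cube" and c: "is_corner c" and d: "CARD('n) ~= 1" and s: "0 <= s"
 shows "1 <= pair_sum c x s"
proof -
 obtain k :: 'n where True by blast
 have "UNIV ~= {k}" using d by (metis card.empty card_insert_disjoint empty_iff finite.emptyI One_nat_def)
 then obtain j where j: "j ~= k" by blast
 note cb = cdist_bounds[OF x c]
 have "1 powr (- s) <= (cdist c x j * cdist c x k) powr (- s)"
  using cb[of j] cb[of k] s by (intro powr_mono2') (auto intro: mult_le_one)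
 also have "... <= pair_sum c x s" by (rule pair_sum_ge[OF j])
 finally show ?thesis by simp
qed

lemma center_diff_abs:
 fixes x :: "real ^ 'n::finite"
 assumes "x \<in> cube" shows "\<bar>((\<chi> i. 1 / 2) - x) $ i\<bar> <= 1"
proof -
 have "0 < x $ i & x $ i < 1" using assms by (simp add: cube_def)
 then show ?thesis by (simp add: abs_le_iff)
qed

text \<open>Integrating the gradient from the centre to x lowers the exponent from q to s as long as
  the power of t lost on the way, 2(q - s), is integrable. Two applications lead from second
  derivatives to the gradient and from the gradient to a bounded function.\<close>

lemma integrate_pair_sum_bound:
 fixes c :: "real ^ 'n::finite"
 assumes G: "smooth_family G" and c: "is_corner c" and d: "CARD('n) ~= 1"
  and b: "!!i x. x \<in> cube ==> \<bar>G (al(i := Suc (al i))) x\<bar> <= C * pair_sum c x q" and C: "0 <= C"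
  and s: "0 <= s" "s <= q" "2 * (q - s) < 1"
 shows "\<exists>C'\<ge>0. \<forall>x\<in>cube. \<bar>G al x\<bar> <= C' * pair_sum c x s"
proof -
 let ?z = "\<chi> i. 1 / 2 :: real ^ 'n"
 define l where "l = 2 * (q - s)"
 define M where "M = real CARD('n) * C * 4 powr q"
 have M: "0 <= M" using C by (simp add: M_def)
 have "\<bar>G al x\<bar> <= (\<bar>G al ?z\<bar> + M / (1 - l)) * pair_sum c x s" if x: "x \<in> cube" for x
 proof -
  have "\<bar>G al (x + 0 *\<^sub>R (?z - x))\<bar> <= \<bar>G al (x + 1 *\<^sub>R (?z - x))\<bar> + (M * pair_sum c x s) / (1 - l)"
  proof (rule powr_derivative_bound[where g = "%t. G al (x + t *\<^sub>R (?z - x))"])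
  show "((%t. G al (x + t *\<^sub>R (?z - x))) has_real_derivative (\<Sum>i\<in>UNIV. (?z - x) $ i * G (al(i := Suc (al i))) (x + t *\<^sub>R (?z - x)))) (at t)"
  if "0 <= t" "t <= 1" for t by (rule smooth_family_path[OF G x center_in_cube that])
  show "l < 1" using s by (simp add: l_def)
  show "0 <= M * pair_sum c x s" by (intro mult_nonneg_nonneg M pair_sum_nonneg)
  fix t :: real assume t: "0 < t" "t <= 1"
  let ?y = "x + t *\<^sub>R (?z - x)"
  have y: "?y \<in> cube" using cube_path[OF x center_in_cube] t by simp
  have "\<bar>\<Sum>i\<in>UNIV. (?z - x) $ i * G (al(i := Suc (al i))) ?y\<bar> <= (\<Sum>i\<in>(UNIV::'n set). 1 * (C * pair_sum c ?y q))"
  proof (rule order_trans[OF sum_abs sum_mono])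
  fix i
  show "\<bar>(?z - x) $ i * G (al(i := Suc (al i))) ?y\<bar> <= 1 * (C * pair_sum c ?y q)"
  unfolding abs_mult by (intro mult_mono center_diff_abs[OF x] b[OF y]) auto
  qed
  also have "... = real CARD('n) * C * pair_sum c ?y q" by simp
  also have "... <= real CARD('n) * C * ((4 powr q * pair_sum c x s) * t powr (- l))"
  unfolding l_def using C by (intro mult_left_mono pair_sum_path x c t s) auto
  also have "... = M * pair_sum c x s * t powr (- l)" by (simp add: M_def)
  finally show "\<bar>\<Sum>i\<in>UNIV. (?z - x) $ i * G (al(i := Suc (al i))) ?y\<bar> <= M * pair_sum c x s * t powr (- l)" .
  qed
  then have "\<bar>G al x\<bar> <= \<bar>G al ?z\<bar> * 1 + (M / (1 - l)) * pair_sum c x s" by simp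
  also have "... <= \<bar>G al ?z\<bar> * pair_sum c x s + (M / (1 - l)) * pair_sum c x s"
  by (intro add_right_mono mult_left_mono pair_sum_ge_1 x c d s) auto
  finally show ?thesis by (simp add: distrib_right)
 qed
 moreover have "0 <= \<bar>G al ?z\<bar> + M / (1 - l)" using M s by (simp add: l_def)
 ultimately show ?thesis by blast
qed

definition reflect :: "real ^ 'n::finite => real ^ 'n => real ^ 'n" where
 "reflect c y = (\<chi> j. if c $ j = 0 then y $ j else 1 - y $ j)"

lemma reflect_cube: "y \<in> cube ==> reflect c y \<in> cube"
 by (auto simp: reflect_def cube_def)

lemma reflect_reflect: "reflect c (reflect c y) = y"
 by (simp add: reflect_def vec_eq_iff)

lemma cdist_reflect: "is_corner c ==> y \<in> cube ==> cdist c (reflect c y) j = y $ j"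
 by (auto simp: cdist_def reflect_def is_corner_def cube_def less_imp_le dest: spec[of _ j])

text \<open>Each differentiation along a flipped axis changes the sign, which the product of the
  \<open>csign\<close> records.\<close>

lemma smooth_family_reflect:
 fixes G :: "('n::finite => nat) => real ^ 'n => real"
 assumes G: "smooth_family G"
 shows "smooth_family (%al y. (\<Prod>j\<in>UNIV. csign c j ^ al j) * G al (reflect c y))"
 unfolding smooth_family_def
proof (intro conjI allI ballI)
 fix al :: "'n => nat"
 have "continuous_on cube (reflect c)"
 proof -
  have "continuous_on cube (%y. if c $ j = 0 then y $ j else 1 - y $ j)" for j
  by (cases "c $ j = 0") (auto intro!: continuous_intros)
  then show ?thesis unfolding reflect_def by (intro continuous_on_vec_lambda)
 qed
 note cr = this
 have cG: "continuous_on cube (G al)" using G by (simp add: smooth_family_def)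
 have "continuous_on cube (%y. G al (reflect c y))"
  by (rule continuous_on_compose2[OF cG cr]) (use reflect_cube in blast)
 then show "continuous_on cube (%y. (\<Prod>j\<in>UNIV. csign c j ^ al j) * G al (reflect c y))" by (intro continuous_on_mult_left)
 fix i and y :: "real ^ 'n" assume y: "y \<in> cube"
 have r: "reflect c (y + t *\<^sub>R axis i 1) = reflect c y + (csign c i * t) *\<^sub>R axis i 1" for t
  by (simp add: reflect_def vec_eq_iff csign_def axis_def)
 have "((%s. G al (reflect c y + s *\<^sub>R axis i 1)) has_real_derivative G (al(i := Suc (al i))) (reflect c y)) (at (csign c i * 0))"
  using G reflect_cube[OF y] by (simp add: smooth_family_def)
 then have "((%t. G al (reflect c y + (csign c i * t) *\<^sub>R axis i 1)) has_real_derivative G (al(i := Suc (al i))) (reflect c y) * csign c i) (at 0)"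
  by (rule DERIV_chain2) (auto intro!: derivative_eq_intros)
 then have "((%t. (\<Prod>j\<in>UNIV. csign c j ^ al j) * G al (reflect c (y + t *\<^sub>R axis i 1))) has_real_derivative
  (\<Prod>j\<in>UNIV. csign c j ^ al j) * (G (al(i := Suc (al i))) (reflect c y) * csign c i)) (at 0)"
  unfolding r by (rule DERIV_cmult)
 moreover have "(\<Prod>j\<in>UNIV. csign c j ^ (al(i := Suc (al i))) j) = csign c i * (\<Prod>j\<in>UNIV. csign c j ^ al j)"
  by (subst (1 2) prod.remove[of _ i]) (auto intro!: prod.cong)
 ultimately show "((%t. (\<Prod>j\<in>UNIV. csign c j ^ al j) * G al (reflect c (y + t *\<^sub>R axis i 1))) has_real_derivative
  (\<Prod>j\<in>UNIV. csign c j ^ (al(i := Suc (al i))) j) * G (al(i := Suc (al i))) (reflect c y)) (at 0)"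
  by (simp add: mult_ac)
qed

lemma abs_csign_prod: "\<bar>\<Prod>j\<in>UNIV. csign c j ^ al j\<bar> = 1"
 by (auto simp: abs_prod power_abs csign_def intro!: prod.neutral)

lemma cdist_0: "y \<in> cube ==> cdist 0 y j = y $ j"
 by (simp add: cdist_def cube_def less_imp_le)

lemma pair_sum_reflect: "is_corner c ==> y \<in> cube ==> pair_sum c (reflect c y) s = pair_sum 0 y s"
 by (simp add: pair_sum_def cdist_reflect cdist_0)

lemma mi_abs_update: "mi_abs (al(i := Suc (al i))) = Suc (mi_abs al)"
 unfolding mi_abs_def by (subst (1 2) sum.remove[of UNIV i]) auto

text \<open>The interface between regularity and approximation: after the reflection the coordinates
  are the distances to the faces through c. The weak first derivatives D are kept because the
  Sobolev error is taken against them.\<close>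

lemma J_class_regularity:
 fixes c :: "real ^ 'n::finite"
 assumes d: "CARD('n) = 2 | CARD('n) = 3" and c: "is_corner c" and eh: "0 < eh" "eh < 1"
  and CA: "0 < Cf" "0 < Af" and f: "f \<in> J_class eh c gac gae Cf Af"
  and g: "if CARD('n) = 2 then gac > 1 else gac > 3/2 & (ALL k. gae k > 1)"
 obtains H C A s D where "smooth_family H" "0 < C" "0 < A" "0 < s" "s < 1 / 2"
  "!!al y. y \<in> cube ==> \<bar>H al y\<bar> <= C * A ^ mi_abs al * fact (mi_abs al) * (\<Prod>j\<in>UNIV. (1 / y $ j) ^ (al j + 1))"
  "!!y. y \<in> cube ==> \<bar>H (%_. 0) y\<bar> <= C"
  "!!i y. y \<in> cube ==> \<bar>H (unit_mi i) y\<bar> <= C * pair_sum 0 y s"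
  "AE x in lborel. x \<in> cube --> f x = H (%_. 0) (reflect c x)"
  "!!i. weak_deriv cube (unit_mi i) f (D i)"
  "!!i. AE x in lborel. x \<in> cube --> D i x = csign c i * H (unit_mi i) (reflect c x)"
proof -
 obtain D C' where C': "0 < C'" and D: "D (%_. 0) = f" "!!al. weak_deriv cube al f (D al)" and
  L2: "!!be K W. K \<in> sets borel ==> K <= cube ==> weight_bound eh c gac gae be K W ==>
  (\<integral>\<^sup>+y. indicator K y * ennreal ((D be y)^2) \<partial>lborel) <= ennreal ((C' * Af ^ mi_abs be * fact (mi_abs be) / W)^2)"
  by (rule J_class_weighted[OF d c eh CA f]) (rule that; assumption)
 have wp: "weak_pair i (D al) (D (al(i := Suc (al i))))" for al i
  by (rule weak_pair_weak_deriv[OF D(2) D(2)])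
 obtain G where G: "smooth_family G" "!!al. AE x in lborel. x \<in> cube --> D al x = G al x"
  using weak_family_smooth[where D = D, OF wp] by blast
 have Gc: "continuous_on cube (G al)" for al using G(1) by (simp add: smooth_family_def)
 have d1: "CARD('n) ~= 1" using d by auto
 have g0: "0 <= gac" "!!k. k \<in> edge_dirs ==> 0 <= gae k"
  using g d by (auto simp: edge_dirs_def split: if_splits intro: less_imp_le order.strict_trans[OF zero_less_one])
 obtain C1 A1 where B1: "0 < C1" "0 < A1" "!!al x. x \<in> cube ==> \<bar>G al x\<bar> <= C1 * A1 ^ mi_abs al * fact (mi_abs al) * (\<Prod>j\<in>UNIV. (1 / cdist c x j) ^ (al j + 1))"
  using smooth_bound_rough[where gae = gae and gac = gac and D = D and G = G, OF c eh d1 g0 C' CA(2) wp Gc G(2) L2] by blast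
 obtain ka C2 where ka: "0 < ka" "ka < 1 / 2" and C2: "0 <= C2" "!!al x. mi_abs al = 2 ==> x \<in> cube ==> \<bar>G al x\<bar> <= C2 * pair_sum c x (1 - ka / 2)"
 proof (cases "CARD('n) = 2")
  case True
  define ka where "ka = min (gac - 1) (1 / 4)"
  have ka: "0 < ka" "ka < 1 / 2" "1 + ka <= gac" using g True unfolding ka_def by (simp, linarith, linarith)
  show thesis using that[OF ka(1,2)] smooth_bound_second_2d[where gae = gae and gac = gac and D = D and G = G, OF c eh True ka C' CA(2) wp Gc G(2) L2] by blast
 next
  case False
  then have d3: "CARD('n) = 3" using d by simp
  define ka where "ka = min (min (gac - 3 / 2) (Min (range (%k. gae k - 1)))) (1 / 4)"
  have "Min (range (%k. gae k - 1)) \<in> range (%k. gae k - 1)" by (intro Min_in) auto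
  then have "0 < Min (range (%k. gae k - 1))" using g False by auto
  then have ka: "0 < ka" "ka < 1 / 2" "3 / 2 + ka <= gac" using g False unfolding ka_def by (simp, linarith, linarith)
  have kae: "1 + ka <= gae k" for k
  proof -
  have "Min (range (%k. gae k - 1)) <= gae k - 1" by (intro Min_le) auto
  then show ?thesis unfolding ka_def by linarith
  qed
  show thesis using that[OF ka(1,2)] smooth_bound_second_3d[where gae = gae and gac = gac and D = D and G = G, OF c eh d3 ka kae C' CA(2) wp Gc G(2) L2] by blast
 qed
 \<comment> \<open>From q = 1 - ka/2 to s one has 2(q - s) = 1 - ka/2 < 1; and s < 1/2 permits the
   second drop, to exponent 0.\<close>
 define s where "s = 1 / 2 - ka / 4"
 have s: "0 < s" "s < 1 / 2" using ka by (auto simp: s_def)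
 have u: "unit_mi i = (%_. 0)(i := Suc 0)" for i :: 'n by (auto simp: unit_mi_def)
 have mu: "mi_abs (unit_mi i :: 'n => nat) = 1" for i
  unfolding u using mi_abs_update[of "%_. 0" i] by (simp add: mi_abs_def)
 have "\<exists>C'\<ge>0. \<forall>x\<in>cube. \<bar>G (unit_mi i) x\<bar> <= C' * pair_sum c x s" for i
 proof (rule integrate_pair_sum_bound[OF G(1) c d1 _ C2(1)])
  show "\<bar>G ((unit_mi i)(j := Suc (unit_mi i j))) x\<bar> <= C2 * pair_sum c x (1 - ka / 2)" if "x \<in> cube" for j x
  by (rule C2(2)[OF _ that]) (simp add: mi_abs_update mu)
 qed (use ka in \<open>auto simp: s_def field_simps\<close>)
 then obtain C3 where C3: "!!i. 0 <= C3 i" "!!i x. x \<in> cube ==> \<bar>G (unit_mi i) x\<bar> <= C3 i * pair_sum c x s" by metis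
 define C4 where "C4 = (\<Sum>i\<in>UNIV. C3 i)"
 have C4: "0 <= C4" unfolding C4_def using C3(1) by (intro sum_nonneg) auto
 have C34: "\<bar>G (unit_mi i) x\<bar> <= C4 * pair_sum c x s" if "x \<in> cube" for i x
 proof -
  have "C3 i <= C4" unfolding C4_def using C3(1) by (intro member_le_sum) auto
  then have "C3 i * pair_sum c x s <= C4 * pair_sum c x s" by (intro mult_right_mono pair_sum_nonneg)
  with C3(2)[OF that] show ?thesis by (rule order_trans)
 qed
 have "\<exists>C'\<ge>0. \<forall>x\<in>cube. \<bar>G (%_. 0) x\<bar> <= C' * pair_sum c x 0"
 proof (rule integrate_pair_sum_bound[OF G(1) c d1 _ C4])
  show "\<bar>G ((%_. 0)(i := Suc 0)) x\<bar> <= C4 * pair_sum c x s" if "x \<in> cube" for i x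
  using C34[OF that, of i] by (simp add: u)
 qed (use s in auto)
 then obtain C5 where C5: "0 <= C5" "!!x. x \<in> cube ==> \<bar>G (%_. 0) x\<bar> <= C5 * pair_sum c x 0" by blast
 have ps0: "pair_sum c x 0 <= real CARD('n) * real CARD('n)" if "x \<in> cube" for x
 proof -
  have "pair_sum c x 0 <= (\<Sum>a\<in>(UNIV::'n set). \<Sum>b\<in>(UNIV::'n set) - {a}. 1)"
  unfolding pair_sum_def by (intro sum_mono) (simp add: powr_def)
  also have "... <= (\<Sum>a\<in>(UNIV::'n set). real CARD('n))"
  by (intro sum_mono) (auto simp: card_mono)
  finally show ?thesis by simp
 qed
 define H where "H = (%al y. (\<Prod>j\<in>UNIV. csign c j ^ al j) * G al (reflect c y))"
 have absH: "\<bar>H al y\<bar> = \<bar>G al (reflect c y)\<bar>" for al y by (simp add: H_def abs_mult abs_csign_prod)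
 define C where "C = C1 + C4 + C5 * (real CARD('n) * real CARD('n))"
 have CC: "0 < C" "C1 <= C" "C4 <= C" "C5 * (real CARD('n) * real CARD('n)) <= C"
  using B1 C4 C5 by (auto simp: C_def intro!: add_pos_nonneg add_nonneg_nonneg)
 show thesis
 proof (rule that[of H C A1 s "%i. D (unit_mi i)"])
  show "smooth_family H" unfolding H_def by (rule smooth_family_reflect[OF G(1)])
  show "0 < C" "0 < A1" "0 < s" "s < 1 / 2" using CC B1 s by auto
  show "weak_deriv cube (unit_mi i) f (D (unit_mi i))" for i by (rule D)
  show "\<bar>H al y\<bar> <= C * A1 ^ mi_abs al * fact (mi_abs al) * (\<Prod>j\<in>UNIV. (1 / y $ j) ^ (al j + 1))" if y: "y \<in> cube" for al y
  proof -
  have "\<bar>H al y\<bar> <= C1 * A1 ^ mi_abs al * fact (mi_abs al) * (\<Prod>j\<in>UNIV. (1 / y $ j) ^ (al j + 1))"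
  unfolding absH using B1(3)[OF reflect_cube[OF y, of c], of al] by (simp add: cdist_reflect[OF c y])
  also have "... <= C * A1 ^ mi_abs al * fact (mi_abs al) * (\<Prod>j\<in>UNIV. (1 / y $ j) ^ (al j + 1))"
  using CC B1 y by (intro mult_right_mono prod_nonneg) (auto simp: cube_def less_imp_le)
  finally show ?thesis .
  qed
  show "\<bar>H (%_. 0) y\<bar> <= C" if y: "y \<in> cube" for y
  proof -
  have "\<bar>H (%_. 0) y\<bar> <= C5 * pair_sum c (reflect c y) 0" unfolding absH by (rule C5(2)[OF reflect_cube[OF y]])
  also have "... <= C5 * (real CARD('n) * real CARD('n))" by (intro mult_left_mono ps0 reflect_cube y C5)
  finally show ?thesis using CC by linarith
  qed
  show "\<bar>H (unit_mi i) y\<bar> <= C * pair_sum 0 y s" if y: "y \<in> cube" for i y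
  proof -
  have "\<bar>H (unit_mi i) y\<bar> <= C4 * pair_sum 0 y s" unfolding absH using C34[OF reflect_cube[OF y, of c]] by (simp add: pair_sum_reflect[OF c y])
  also have "... <= C * pair_sum 0 y s" by (intro mult_right_mono CC pair_sum_nonneg)
  finally show ?thesis .
  qed
  show "AE x in lborel. x \<in> cube --> f x = H (%_. 0) (reflect c x)"
  using G(2)[of "%_. 0"] by eventually_elim (auto simp: H_def reflect_reflect D)
  show "AE x in lborel. x \<in> cube --> D (unit_mi i) x = csign c i * H (unit_mi i) (reflect c x)" for i
  using G(2)[of "unit_mi i"]
  proof eventually_elim
  case (elim x)
  have "(\<Prod>j\<in>UNIV. csign c j ^ unit_mi i j) = csign c i"
  by (subst prod.remove[of _ i]) (auto simp: unit_mi_def intro!: prod.neutral)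
  moreover have "csign c i * csign c i = 1" by (simp add: csign_def)
  ultimately show ?case using elim by (simp add: H_def reflect_reflect flip: mult.assoc)
  qed
 qed
qed

section \<open>Taylor polynomials and their remainders\<close>

definition mi_add :: "('n => nat) => ('n => nat) => 'n => nat" where
 "mi_add al be = (%i. al i + be i)"

definition taylor_monom :: "('n::finite => nat) => real ^ 'n => real" where
 "taylor_monom be v = (\<Prod>j\<in>UNIV. v $ j ^ be j / fact (be j))"

text \<open>Indexed by the derivative \<open>al\<close> that is expanded, so that differentiating in
  direction i just raises \<open>al i\<close> and lowers n by one; this drives the induction for the
  remainder.\<close>

definition taylor :: "(('n::finite => nat) => real ^ 'n => real) => real ^ 'n => nat => ('n => nat) => real ^ 'n => real" where
 "taylor H xi n al y = (\<Sum>be\<in>{be. mi_abs be < n}. H (mi_add al be) xi * taylor_monom be (y - xi))"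

lemma finite_mi_abs_less: "finite {be :: 'n::finite => nat. mi_abs be < n}"
proof -
 have "{be :: 'n => nat. mi_abs be < n} = (\<Union>k\<in>{..<n}. {be. mi_abs be = k})" by auto
 then show ?thesis by (simp add: finite_mi_abs)
qed

lemma taylor_monom_deriv:
 fixes v :: "real ^ 'n::finite"
 shows "((%t. taylor_monom be (v + t *\<^sub>R axis i 1)) has_real_derivative
  (if be i = 0 then 0 else taylor_monom (be(i := be i - 1)) v)) (at 0)"
proof -
 let ?R = "\<Prod>j\<in>UNIV - {i}. v $ j ^ be j / fact (be j)"
 have eq: "taylor_monom be (v + t *\<^sub>R axis i 1) = (v $ i + t) ^ be i / fact (be i) * ?R" for t
  unfolding taylor_monom_def by (subst prod.remove[of _ i]) (auto simp: axis_def intro!: prod.cong)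
 show ?thesis
 proof (cases "be i")
  case 0
  then show ?thesis unfolding eq by simp
 next
  case (Suc k)
  have "((%t. (v $ i + t) ^ Suc k) has_real_derivative (real (Suc k) * (v $ i + 0) ^ (Suc k - Suc 0)) * 1) (at 0)"
  by (rule DERIV_chain2[where g = "%t. v $ i + t", OF DERIV_pow]) (auto intro!: derivative_eq_intros)
  then have "((%t. (v $ i + t) ^ Suc k / fact (Suc k) * ?R) has_real_derivative ((real (Suc k) * (v $ i + 0) ^ (Suc k - Suc 0)) * 1 / fact (Suc k)) * ?R) (at 0)"
  by (intro DERIV_cmult_right DERIV_cdivide)
  then have "((%t. (v $ i + t) ^ Suc k / fact (Suc k) * ?R) has_real_derivative ((real (Suc k) * (v $ i + 0) ^ k) / fact (Suc k)) * ?R) (at 0)"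
  by simp
  moreover have "(real (Suc k) * (v $ i + 0) ^ k) / fact (Suc k) = v $ i ^ k / fact k"
  by (simp add: field_simps del: of_nat_Suc)
  moreover have "taylor_monom (be(i := k)) v = v $ i ^ k / fact k * ?R"
  unfolding taylor_monom_def by (subst prod.remove[of _ i]) (auto intro!: prod.cong)
  ultimately show ?thesis unfolding eq Suc by simp
 qed
qed

lemma taylor_deriv:
 fixes xi :: "real ^ 'n::finite"
 shows "((%t. taylor H xi (Suc n) al (y + t *\<^sub>R axis i 1)) has_real_derivative taylor H xi n (al(i := Suc (al i))) y) (at 0)"
proof -
 let ?B = "{be :: 'n => nat. mi_abs be < Suc n}"
 have "((%t. taylor H xi (Suc n) al (y + t *\<^sub>R axis i 1)) has_real_derivative
  (\<Sum>be\<in>?B. H (mi_add al be) xi * (if be i = 0 then 0 else taylor_monom (be(i := be i - 1)) (y - xi)))) (at 0)"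
  unfolding taylor_def
 proof (intro DERIV_sum DERIV_cmult)
  fix be :: "'n => nat"
  have "y + t *\<^sub>R axis i 1 - xi = (y - xi) + t *\<^sub>R axis i 1" for t by simp
  then show "((%t. taylor_monom be (y + t *\<^sub>R axis i 1 - xi)) has_real_derivative
  (if be i = 0 then 0 else taylor_monom (be(i := be i - 1)) (y - xi))) (at 0)"
  using taylor_monom_deriv[of be "y - xi" i] by presburger
 qed
 also have "(\<Sum>be\<in>?B. H (mi_add al be) xi * (if be i = 0 then 0 else taylor_monom (be(i := be i - 1)) (y - xi)))
  = (\<Sum>be\<in>{be\<in>?B. be i ~= 0}. H (mi_add al be) xi * taylor_monom (be(i := be i - 1)) (y - xi))"
  by (rule sum.mono_neutral_cong_right) (auto simp: finite_mi_abs_less)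
 also have "... = taylor H xi n (al(i := Suc (al i))) y"
  unfolding taylor_def
 proof (rule sum.reindex_bij_witness[where i = "%be. be(i := Suc (be i))" and j = "%be. be(i := be i - 1)"])
  fix be :: "'n => nat" assume b: "be \<in> {be\<in>?B. be i ~= 0}"
  define be' where "be' = be(i := be i - 1)"
  have bb: "be = be'(i := Suc (be' i))" using b by (auto simp: be'_def fun_eq_iff)
  then have "mi_abs be = Suc (mi_abs be')" by (metis mi_abs_update)
  then show "be(i := be i - 1) \<in> {be. mi_abs be < n}" using b by (simp add: be'_def)
  show "(be(i := be i - 1))(i := Suc ((be(i := be i - 1)) i)) = be" using bb by (simp add: be'_def)
  have "mi_add (al(i := Suc (al i))) be' = mi_add al be" by (subst bb) (auto simp: mi_add_def fun_eq_iff)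
  then show "H (mi_add (al(i := Suc (al i))) (be(i := be i - 1))) xi * taylor_monom (be(i := be i - 1)) (y - xi) =
  H (mi_add al be) xi * taylor_monom (be(i := be i - 1)) (y - xi)" by (simp add: be'_def)
 next
  fix be :: "'n => nat" assume "be \<in> {be. mi_abs be < n}"
  then show "be(i := Suc (be i)) \<in> {be\<in>?B. be i ~= 0}" by (simp add: mi_abs_update)
  show "(be(i := Suc (be i)))(i := (be(i := Suc (be i))) i - 1) = be" by (simp add: fun_eq_iff)
 qed
 finally show ?thesis .
qed

lemma taylor_center: "taylor H xi (Suc n) al xi = H al (xi :: real ^ 'n::finite)"
proof -
 have z: "mi_abs (%_::'n. 0) = 0" by (simp add: mi_abs_def)
 have nz: "taylor_monom be (xi - xi) = (if be = (%_. 0) then 1 else 0)" for be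
 proof (cases "be = (%_. 0)")
  case False
  then obtain j where "be j ~= 0" by (auto simp: fun_eq_iff)
  then have "(\<Prod>j\<in>UNIV. (xi - xi) $ j ^ be j / fact (be j)) = 0"
  by (intro prod_zero bexI[of _ j]) auto
  then show ?thesis using False by (simp add: taylor_monom_def)
 qed (simp add: taylor_monom_def)
 have "taylor H xi (Suc n) al xi = (\<Sum>be\<in>{be. mi_abs be < Suc n}. if be = (%_. 0) then H (mi_add al be) xi else 0)"
  unfolding taylor_def nz by (intro sum.cong) auto
 also have "... = H (mi_add al (%_. 0)) xi"
  using z by (subst sum.delta) (auto simp: finite_mi_abs_less)
 finally show ?thesis by (simp add: mi_add_def)
qed

lemma taylor_remainder_smooth:
 fixes H :: "('n::finite => nat) => real ^ 'n => real"
 assumes H: "smooth_family H" and y: "y \<in> cube"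
 shows "((%y. H al y - taylor H xi (Suc n) al y) has_derivative
  (%v. \<Sum>i\<in>UNIV. v $ i * (H (al(i := Suc (al i))) y - taylor H xi n (al(i := Suc (al i))) y))) (at y)"
proof -

 have "(taylor H xi (Suc n) al has_derivative (%v. \<Sum>i\<in>UNIV. v $ i * taylor H xi n (al(i := Suc (al i))) y)) (at y)"
 proof -

  have "((taylor_monom be \<circ> (%y. y - xi)) differentiable (at y))" for be
  proof -
  have "(%v::real ^ 'n. v $ j ^ be j / fact (be j)) differentiable (at z)" for j z
  proof -
  have "(%v::real ^ 'n. v $ j) differentiable (at z)"
  by (intro bounded_linear_imp_differentiable bounded_linear_vec_nth)
  then show ?thesis by (intro differentiable_divide differentiable_power differentiable_const) auto
  qed
  then have "taylor_monom be differentiable (at z)" for z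
  unfolding taylor_monom_def[abs_def] by (intro differentiable_prod_finite) auto
  then show ?thesis by (intro differentiable_chain_at) auto
  qed
  then have "taylor H xi (Suc n) al differentiable (at y)"
  unfolding taylor_def[abs_def] o_def by (intro differentiable_sum differentiable_mult) (auto simp: finite_mi_abs_less)
  then obtain f' where f': "(taylor H xi (Suc n) al has_derivative f') (at y)" unfolding differentiable_def by blast
  have lin: "linear f'" using f' has_derivative_linear by blast
  have fe: "f' (axis i 1) = taylor H xi n (al(i := Suc (al i))) y" for i
  proof -
  have "((%t. y + t *\<^sub>R axis i 1) has_derivative (%t. t *\<^sub>R axis i 1)) (at 0)" by (auto intro!: derivative_eq_intros)
  moreover have "(taylor H xi (Suc n) al has_derivative f') (at (y + 0 *\<^sub>R axis i 1))" using f' by simp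
  ultimately have "((%t. taylor H xi (Suc n) al (y + t *\<^sub>R axis i 1)) has_derivative (%t. f' (t *\<^sub>R axis i 1))) (at 0)"
  by (rule has_derivative_compose)
  moreover have "(%t. f' (t *\<^sub>R axis i 1)) = (*) (f' (axis i 1))" by (auto simp: linear_scale[OF lin])
  ultimately have "((%t. taylor H xi (Suc n) al (y + t *\<^sub>R axis i 1)) has_real_derivative f' (axis i 1)) (at 0)"
  by (simp add: has_field_derivative_def)
  then show ?thesis using taylor_deriv DERIV_unique by blast
  qed
  have "f' v = (\<Sum>i\<in>UNIV. v $ i * taylor H xi n (al(i := Suc (al i))) y)" for v
  proof -
  have "v = (\<Sum>i\<in>UNIV. v $ i *\<^sub>R axis i 1)"
  by (simp add: vec_eq_iff axis_def if_distrib cong: if_cong)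
  then have "f' v = (\<Sum>i\<in>UNIV. v $ i *\<^sub>R f' (axis i 1))"
  using lin by (metis (no_types, lifting) linear_scale linear_sum sum.cong)
  then show ?thesis by (simp add: fe)
  qed
  then have "f' = (%v. \<Sum>i\<in>UNIV. v $ i * taylor H xi n (al(i := Suc (al i))) y)" by (simp add: fun_eq_iff)
  then show ?thesis using f' by simp
 qed
 from has_derivative_diff[OF smooth_family_has_derivative[OF H y] this]
 show ?thesis by (simp add: sum_subtractf right_diff_distrib)
qed

text \<open>Induction on n along the segment from \<open>xi\<close>: the remainder vanishes at
  \<open>xi\<close>, and its gradient consists of remainders of one degree less at multi-indices one
  higher. Separate scales \<open>om j\<close> keep the estimate anisotropic.\<close>

lemma taylor_remainder_bound:
 fixes H :: "('n::finite => nat) => real ^ 'n => real"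
 assumes H: "smooth_family H" and xi: "xi \<in> cube" and om: "!!j. 0 < om j" and MA: "0 <= M" "0 <= A"
  and Q: "convex Q" "Q <= cube" "xi \<in> Q"
  and b: "!!ga y. y \<in> Q ==> \<bar>H ga y\<bar> <= M * A ^ mi_abs ga * fact (mi_abs ga) * (\<Prod>j\<in>UNIV. (1 / om j) ^ ga j)"
  and y: "y \<in> Q"
 shows "\<bar>H al y - taylor H xi n al y\<bar> <= M * A ^ (mi_abs al + n) * fact (mi_abs al + n) * (\<Prod>j\<in>UNIV. (1 / om j) ^ al j)
  * (\<Sum>j\<in>UNIV. \<bar>y $ j - xi $ j\<bar> / om j) ^ n / fact n"
 using y
proof (induction n arbitrary: al y)
 case 0
 then show ?case using b[of y al] by (simp add: taylor_def)
next
 case (Suc n)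
 define v where "v = y - xi"
 define u where "u = (\<Sum>j\<in>UNIV. \<bar>v $ j\<bar> / om j)"
 have u0: "0 <= u" unfolding u_def using om by (intro sum_nonneg) (auto simp: less_imp_le)
 define B where "B = M * A ^ (mi_abs al + Suc n) * fact (mi_abs al + Suc n) * (\<Prod>j\<in>UNIV. (1 / om j) ^ al j)"
 have B0: "0 <= B" unfolding B_def using MA om by (intro mult_nonneg_nonneg prod_nonneg) (auto simp: less_imp_le)
 define g where "g t = H al (xi + t *\<^sub>R v) - taylor H xi (Suc n) al (xi + t *\<^sub>R v)" for t
 define g' where "g' t = (\<Sum>i\<in>UNIV. v $ i * (H (al(i := Suc (al i))) (xi + t *\<^sub>R v) - taylor H xi n (al(i := Suc (al i))) (xi + t *\<^sub>R v)))" for t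
 have inQ: "xi + t *\<^sub>R v \<in> Q" if "0 <= t" "t <= 1" for t
 proof -
  have "(1 - t) *\<^sub>R xi + t *\<^sub>R y \<in> Q" using that Q Suc.prems by (intro convexD) auto
  then show ?thesis by (simp add: v_def algebra_simps)
 qed
 have dg: "(g has_real_derivative g' t) (at t)" if t: "0 <= t" "t <= 1" for t
 proof -
  have 1: "((%t. xi + t *\<^sub>R v) has_derivative (%h. h *\<^sub>R v)) (at t)" by (auto intro!: derivative_eq_intros)
  have 2: "xi + t *\<^sub>R v \<in> cube" using inQ[OF t] Q by blast
  have "(g has_derivative (%h. \<Sum>i\<in>UNIV. (h *\<^sub>R v) $ i * (H (al(i := Suc (al i))) (xi + t *\<^sub>R v) - taylor H xi n (al(i := Suc (al i))) (xi + t *\<^sub>R v)))) (at t)"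
  unfolding g_def[abs_def]
  by (rule has_derivative_compose[where f = "%t. xi + t *\<^sub>R v" and g = "%y. H al y - taylor H xi (Suc n) al y", OF 1 taylor_remainder_smooth[OF H 2]])
  moreover have "(%h. \<Sum>i\<in>UNIV. (h *\<^sub>R v) $ i * (H (al(i := Suc (al i))) (xi + t *\<^sub>R v) - taylor H xi n (al(i := Suc (al i))) (xi + t *\<^sub>R v))) = (*) (g' t)"
  unfolding g'_def by (auto simp: sum_distrib_left mult_ac fun_eq_iff)
  ultimately show ?thesis by (simp add: has_field_derivative_def)
 qed
 have bg: "\<bar>g' t\<bar> <= B * u ^ Suc n / fact n * t ^ n" if t: "0 <= t" "t <= 1" for t
 proof -
  have "\<bar>g' t\<bar> <= (\<Sum>i\<in>UNIV. \<bar>v $ i\<bar> / om i * (B * (t * u) ^ n / fact n))"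
  unfolding g'_def
  proof (rule order_trans[OF sum_abs sum_mono])
  fix i
  have p: "(\<Prod>j\<in>UNIV. (1 / om j) ^ (al(i := Suc (al i))) j) = 1 / om i * (\<Prod>j\<in>UNIV. (1 / om j) ^ al j)"
  by (subst (1 2) prod.remove[of _ i]) (auto intro!: prod.cong)
  have uu: "(\<Sum>j\<in>UNIV. \<bar>(xi + t *\<^sub>R v) $ j - xi $ j\<bar> / om j) = t * u"
  using t by (simp add: u_def sum_distrib_left abs_mult)
  have "\<bar>H (al(i := Suc (al i))) (xi + t *\<^sub>R v) - taylor H xi n (al(i := Suc (al i))) (xi + t *\<^sub>R v)\<bar>
  <= M * A ^ (Suc (mi_abs al) + n) * fact (Suc (mi_abs al) + n) * (1 / om i * (\<Prod>j\<in>UNIV. (1 / om j) ^ al j)) * (t * u) ^ n / fact n"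
  using Suc.IH[OF inQ[OF t], of "al(i := Suc (al i))"] unfolding mi_abs_update p uu .
  also have "... = 1 / om i * (B * (t * u) ^ n / fact n)" by (simp add: B_def del: fact_Suc power_Suc)
  finally have "\<bar>v $ i\<bar> * \<bar>H (al(i := Suc (al i))) (xi + t *\<^sub>R v) - taylor H xi n (al(i := Suc (al i))) (xi + t *\<^sub>R v)\<bar> <= \<bar>v $ i\<bar> * (1 / om i * (B * (t * u) ^ n / fact n))"
  by (intro mult_left_mono) auto
  then show "\<bar>v $ i * (H (al(i := Suc (al i))) (xi + t *\<^sub>R v) - taylor H xi n (al(i := Suc (al i))) (xi + t *\<^sub>R v))\<bar> <= \<bar>v $ i\<bar> / om i * (B * (t * u) ^ n / fact n)"
  by (simp add: abs_mult)
  qed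
  also have "... = u * (B * (t * u) ^ n / fact n)" unfolding sum_distrib_right[symmetric] u_def ..
  also have "... = B * u ^ Suc n / fact n * t ^ n" by (simp add: power_mult_distrib mult_ac)
  finally show ?thesis .
 qed
 \<comment> \<open>A primitive of the bound for \<open>g'\<close>; monotonicity of P - g and P + g
   replaces an integration.\<close>
 define P where "P t = B * u ^ Suc n / fact (Suc n) * t ^ Suc n" for t :: real
 have dP: "(P has_real_derivative B * u ^ Suc n / fact n * t ^ n) (at t)" for t
 proof -
  have "(P has_real_derivative B * u ^ Suc n / fact (Suc n) * (real (Suc n) * t ^ n)) (at t)"
  unfolding P_def by (auto intro!: derivative_eq_intros simp del: power_Suc fact_Suc of_nat_Suc)
  moreover have "B * u ^ Suc n / fact (Suc n) * (real (Suc n) * t ^ n) = B * u ^ Suc n / fact n * t ^ n"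
  by (simp add: field_simps del: of_nat_Suc power_Suc)
  ultimately show ?thesis by (simp only:)
 qed
 have g0: "g 0 = 0" by (simp add: g_def taylor_center)
 have "P 0 - g 0 <= P 1 - g 1"
 proof (rule DERIV_nonneg_imp_nondecreasing[where f = "%t. P t - g t" and a = 0 and b = 1])
  fix t :: real assume t: "0 <= t" "t <= 1"
  show "EX y. ((%t. P t - g t) has_real_derivative y) (at t) & 0 <= y"
  using DERIV_diff[OF dP dg[OF t]] bg[OF t] by (intro exI conjI) auto
 qed auto
 moreover have "P 0 + g 0 <= P 1 + g 1"
 proof (rule DERIV_nonneg_imp_nondecreasing[where f = "%t. P t + g t" and a = 0 and b = 1])
  fix t :: real assume t: "0 <= t" "t <= 1"
  show "EX y. ((%t. P t + g t) has_real_derivative y) (at t) & 0 <= y"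
  using DERIV_add[OF dP dg[OF t]] bg[OF t] by (intro exI conjI) auto
 qed auto
 ultimately have "\<bar>g 1\<bar> <= B * u ^ Suc n / fact (Suc n)" using g0 by (simp add: P_def abs_le_iff)
 then show ?case by (simp add: g_def B_def u_def v_def)
qed

section \<open>Hats and ramps on a geometric mesh\<close>

lemma relu_lipschitz: "\<bar>relu a - relu b\<bar> <= \<bar>a - b\<bar>"
 by (auto simp: relu_def max_def)

lemma relu_pair_lipschitz: "\<bar>(relu (z - a) - relu (z - b)) - (relu (w - a) - relu (w - b))\<bar> <= 2 * \<bar>z - w\<bar>"
proof -
 have l: "\<bar>relu (z - a) - relu (w - a)\<bar> <= \<bar>z - w\<bar>" "\<bar>relu (z - b) - relu (w - b)\<bar> <= \<bar>z - w\<bar>"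
  using relu_lipschitz[of "z - a" "w - a"] relu_lipschitz[of "z - b" "w - b"] by simp_all
 have "\<bar>(relu (z - a) - relu (w - a)) - (relu (z - b) - relu (w - b))\<bar> <= \<bar>z - w\<bar> + \<bar>z - w\<bar>"
  by (rule order_trans[OF abs_triangle_ineq4 add_mono[OF l]])
 then show ?thesis by (simp add: algebra_simps)
qed

lemma relu_nonneg: "0 <= x ==> relu x = x" and relu_nonpos: "x <= 0 ==> relu x = 0"
 by (auto simp: relu_def)

lemma relu_scale: "0 < s ==> relu (x / s - b) = relu (x - b * s) / s"
 by (auto simp: relu_def max_def field_simps)

text \<open>The hat with nodes sg, 1 and 1/sg. At \<open>t / sg ^ m\<close> the hats for consecutive
  m share nodes, which produces the geometric mesh.\<close>

definition hat :: "real => real => real" where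
 "hat sg z = (relu (z - sg) - relu (z - 1)) / (1 - sg) - (relu (z - 1) - relu (z - 1 / sg)) / (1 / sg - 1)"

text \<open>Affine on the support of the hat and constant beyond it. The factor 2 keeps the range in
  [0, 1/2], where all powers are Lipschitz with constant 1.\<close>

definition ramp :: "real => real => real" where
 "ramp sg z = (relu (z - sg) - relu (z - 1 / sg)) / (2 * (1 / sg - sg))"

context
 fixes sg :: real assumes sg: "0 < sg" "sg < 1"
begin

lemma sigma_order: "sg < 1 / sg" "1 < 1 / sg"
proof -
 show "1 < 1 / sg" using sg by (simp add: field_simps)
 then show "sg < 1 / sg" using sg by linarith
qed

lemma hat_cases:
 "z <= sg ==> hat sg z = 0"
 "sg <= z ==> z <= 1 ==> hat sg z = (z - sg) / (1 - sg)"
 "1 <= z ==> z <= 1 / sg ==> hat sg z = 1 - (z - 1) / (1 / sg - 1)"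
 "1 / sg <= z ==> hat sg z = 0"
proof -
 have d: "1 - sg ~= 0" "1 / sg - 1 ~= 0" using sg sigma_order by linarith+
 show "hat sg z = 0" if z: "z <= sg"
 proof -
  have "z - sg <= 0" "z - 1 <= 0" "z - 1 / sg <= 0" using sg sigma_order z by linarith+
  then show ?thesis by (simp only: hat_def relu_nonpos) simp
 qed
 show "hat sg z = (z - sg) / (1 - sg)" if z: "sg <= z" "z <= 1"
 proof -
  have "0 <= z - sg" "z - 1 <= 0" "z - 1 / sg <= 0" using sg sigma_order z by linarith+
  then show ?thesis by (simp only: hat_def relu_nonpos relu_nonneg) simp
 qed
 show "hat sg z = 1 - (z - 1) / (1 / sg - 1)" if z: "1 <= z" "z <= 1 / sg"
 proof -
  have "0 <= z - sg" "0 <= z - 1" "z - 1 / sg <= 0" using sg sigma_order z by linarith+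
  then have "relu (z - sg) - relu (z - 1) = 1 - sg" "relu (z - 1) - relu (z - 1 / sg) = z - 1" by (auto simp only: relu_nonpos relu_nonneg diff_zero)
  then show ?thesis using d by (simp only: hat_def) simp
 qed
 show "hat sg z = 0" if z: "1 / sg <= z"
 proof -
  have "0 <= z - sg" "0 <= z - 1" "0 <= z - 1 / sg" using sg sigma_order z by linarith+
  then have "relu (z - sg) - relu (z - 1) = 1 - sg" "relu (z - 1) - relu (z - 1 / sg) = 1 / sg - 1" by (auto simp only: relu_nonneg)
  then show ?thesis using d by (simp only: hat_def) simp
 qed
qed

lemma hat_range: "0 <= hat sg z" "hat sg z <= 1"
proof -
 consider "z <= sg" | "sg <= z" "z <= 1" | "1 <= z" "z <= 1 / sg" | "1 / sg <= z" by linarith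
 then have "0 <= hat sg z & hat sg z <= 1"
 proof cases
  case 2
  then show ?thesis using hat_cases(2)[OF 2] sg by (simp add: divide_le_eq_1)
 next
  case 3
  have "(z - 1) / (1 / sg - 1) <= 1" "0 <= (z - 1) / (1 / sg - 1)" using 3 sigma_order by (auto simp: divide_le_eq_1)
  then show ?thesis using hat_cases(3)[OF 3] by simp
 qed (auto simp: hat_cases)
 then show "0 <= hat sg z" "hat sg z <= 1" by auto
qed

lemma ramp_cases:
 "z <= sg ==> ramp sg z = 0"
 "sg <= z ==> z <= 1 / sg ==> ramp sg z = (z - sg) / (2 * (1 / sg - sg))"
 "1 / sg <= z ==> ramp sg z = 1 / 2"
proof -
 show "ramp sg z = 0" if z: "z <= sg"
 proof -
  have "z - sg <= 0" "z - 1 / sg <= 0" using sigma_order z by linarith+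
  then show ?thesis by (simp only: ramp_def relu_nonpos) simp
 qed
 show "ramp sg z = (z - sg) / (2 * (1 / sg - sg))" if z: "sg <= z" "z <= 1 / sg"
 proof -
  have "0 <= z - sg" "z - 1 / sg <= 0" using z by linarith+
  then show ?thesis by (simp only: ramp_def relu_nonpos relu_nonneg) simp
 qed
 assume z: "1 / sg <= z"
 have "0 <= z - sg" "0 <= z - 1 / sg" using sigma_order z by linarith+
 then have "relu (z - sg) - relu (z - 1 / sg) = 1 / sg - sg" by (auto simp only: relu_nonneg)
 moreover have "1 / sg - sg ~= 0" using sigma_order by linarith
 ultimately show "ramp sg z = 1 / 2" by (simp only: ramp_def) simp
qed

lemma ramp_range: "0 <= ramp sg z" "ramp sg z <= 1 / 2"
proof -
 consider "z <= sg" | "sg <= z" "z <= 1 / sg" | "1 / sg <= z" by linarith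
 then have "0 <= ramp sg z & ramp sg z <= 1 / 2"
 proof cases
  case 2
  have p: "0 < 1 / sg - sg" using sigma_order by simp
  have "(z - sg) / (2 * (1 / sg - sg)) <= (1 / sg - sg) / (2 * (1 / sg - sg))" using 2 p by (intro divide_right_mono) auto
  also have "... = 1 / 2" using p by simp
  finally show ?thesis using ramp_cases(2)[OF 2] 2 p by simp
 qed (auto simp: ramp_cases)
 then show "0 <= ramp sg z" "ramp sg z <= 1 / 2" by auto
qed

definition "pou_lip = 2 / (1 - sg) + 2 / (1 / sg - 1) + 1 / (1 / sg - sg)"

lemma pou_lip_pos: "0 < pou_lip"
 unfolding pou_lip_def using sg sigma_order by (intro add_pos_pos divide_pos_pos; linarith)

lemma hat_lipschitz: "\<bar>hat sg z - hat sg w\<bar> <= pou_lip * \<bar>z - w\<bar>"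
proof -
 let ?a = "%z. relu (z - sg) - relu (z - 1)" and ?b = "%z. relu (z - 1) - relu (z - 1 / sg)"
 have p: "0 < 1 - sg" "0 < 1 / sg - 1" "0 < 1 / sg - sg" using sg sigma_order by linarith+
 have "\<bar>?a z - ?a w\<bar> <= 2 * \<bar>z - w\<bar>" "\<bar>?b z - ?b w\<bar> <= 2 * \<bar>z - w\<bar>"
  by (rule relu_pair_lipschitz)+
 then have 1: "\<bar>(?a z - ?a w) / (1 - sg)\<bar> <= 2 * \<bar>z - w\<bar> / (1 - sg)" "\<bar>(?b z - ?b w) / (1 / sg - 1)\<bar> <= 2 * \<bar>z - w\<bar> / (1 / sg - 1)"
  using p by (auto simp: abs_divide intro!: divide_right_mono)
 have "\<bar>hat sg z - hat sg w\<bar> = \<bar>(?a z - ?a w) / (1 - sg) - (?b z - ?b w) / (1 / sg - 1)\<bar>"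
  by (simp add: hat_def diff_divide_distrib)
 also have "... <= 2 * \<bar>z - w\<bar> / (1 - sg) + 2 * \<bar>z - w\<bar> / (1 / sg - 1)" using 1 by linarith
 also have "... = (2 / (1 - sg) + 2 / (1 / sg - 1)) * \<bar>z - w\<bar>" by (simp add: distrib_right)
 also have "... <= pou_lip * \<bar>z - w\<bar>" unfolding pou_lip_def using p by (intro mult_right_mono) auto
 finally show ?thesis .
qed

lemma ramp_lipschitz: "\<bar>ramp sg z - ramp sg w\<bar> <= pou_lip * \<bar>z - w\<bar>"
proof -
 let ?a = "%z. relu (z - sg) - relu (z - 1 / sg)"
 have p: "0 < 1 - sg" "0 < 1 / sg - 1" "0 < 1 / sg - sg" using sg sigma_order by linarith+
 have "\<bar>?a z - ?a w\<bar> <= 2 * \<bar>z - w\<bar>"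
  by (rule relu_pair_lipschitz)+
 then have "\<bar>(?a z - ?a w) / (2 * (1 / sg - sg))\<bar> <= 2 * \<bar>z - w\<bar> / (2 * (1 / sg - sg))"
  using p by (auto simp: abs_divide intro!: divide_right_mono)
 also have "... = 1 / (1 / sg - sg) * \<bar>z - w\<bar>" unfolding mult_divide_mult_cancel_left[OF zero_neq_numeral[symmetric]] by simp
 also have "... <= pou_lip * \<bar>z - w\<bar>" unfolding pou_lip_def using p by (intro mult_right_mono) auto
 finally show ?thesis by (simp add: ramp_def diff_divide_distrib)
qed

text \<open>Each hat is the difference of two consecutive cut-off functions g, so the sum
  telescopes: the cut-off for \<open>Suc l\<close> is 1 above \<open>sg ^ l\<close>, and the one for
  0 vanishes below 1.\<close>

lemma hat_partition:
 assumes "sg ^ l <= t" "t <= 1"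
 shows "(\<Sum>m\<le>l. hat sg (t / sg ^ m)) = 1"
proof -
 define g where "g m = (relu (t - sg ^ m) - relu (t - sg ^ m / sg)) / (sg ^ m / sg - sg ^ m)" for m
 have "hat sg (t / sg ^ m) = g (Suc m) - g m" for m
 proof -
  have p: "0 < sg ^ m" using sg by simp
  have r: "relu (t / sg ^ m - b) = relu (t - b * sg ^ m) / sg ^ m" for b by (rule relu_scale[OF p])
  have 1: "g (Suc m) = (relu (t - sg * sg ^ m) - relu (t - 1 * sg ^ m)) / sg ^ m / (1 - sg)"
  using sg p by (simp add: g_def field_simps)
  have 2: "g m = (relu (t - 1 * sg ^ m) - relu (t - 1 / sg * sg ^ m)) / sg ^ m / (1 / sg - 1)"
  using sg p by (simp add: g_def field_simps)
  show ?thesis unfolding hat_def 1 2 r by (simp add: diff_divide_distrib)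
 qed
 then have "(\<Sum>m\<le>l. hat sg (t / sg ^ m)) = (\<Sum>m\<le>l. g (Suc m) - g m)" by simp
 also have "... = g (Suc l) - g 0" by (induction l) auto
 also have "g 0 = 0" using assms sigma_order by (simp add: g_def relu_def)
 also have "g (Suc l) = 1"
 proof -
  have p: "sg * sg ^ l < sg ^ l" "0 < sg ^ l" using sg by auto
  have "sg * sg ^ l <= t" using p assms by linarith
  then have "relu (t - sg ^ Suc l) - relu (t - sg ^ Suc l / sg) = sg ^ Suc l / sg - sg ^ Suc l"
  using assms sg relu_nonneg[of "t - sg ^ Suc l"] relu_nonneg[of "t - sg ^ l"] by auto
  moreover have "sg ^ Suc l / sg - sg ^ Suc l ~= 0" using p sg by simp
  ultimately show ?thesis by (simp add: g_def del: power_Suc)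
 qed
 finally show ?thesis by simp
qed

text \<open>The index is a pair of mesh level and degree. These are the only univariate functions
  that enter the tensor products.\<close>

definition "vfun mk t = hat sg (t / sg ^ fst mk) * ramp sg (t / sg ^ fst mk) ^ snd mk"

text \<open>On the support of the hat the ramp is affine and vanishes at the left node, so a local
  monomial is a multiple of a ramp power; off the support both sides vanish.\<close>

lemma hat_times_power:
 "hat sg (t / sg ^ m) * (t - sg ^ Suc m) ^ k = (2 * (1 / sg - sg) * sg ^ m) ^ k * vfun (m, k) t"
proof (cases "hat sg (t / sg ^ m) = 0")
 case False
 let ?z = "t / sg ^ m"
 have z: "sg <= ?z" "?z <= 1 / sg" using False hat_cases(1,4)[of ?z] by linarith+
 have p: "0 < sg ^ m" using sg by simp
 have p2: "1 / sg - sg ~= 0" using sigma_order by linarith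
 have "t - sg ^ Suc m = (?z - sg) * sg ^ m" using p sg by (simp add: field_simps)
 also have "... = 2 * (1 / sg - sg) * sg ^ m * ramp sg ?z" unfolding ramp_cases(2)[OF z] using p2 by simp
 finally show ?thesis by (simp add: vfun_def power_mult_distrib)
qed (simp add: vfun_def)

end

section \<open>Error of the partition of unity with Taylor polynomials\<close>

text \<open>Multinomial coefficients grow only exponentially. This converts the factorial of the
  order in the analytic bounds into the product of factorials in a Taylor coefficient.\<close>

lemma fact_sum_le:
 fixes be :: "'i => nat"
 assumes "finite I"
 shows "(fact (\<Sum>i\<in>I. be i) :: real) <= (\<Prod>i\<in>I. fact (be i)) * 2 ^ (card I * (\<Sum>i\<in>I. be i))"
 using assms
proof (induction I rule: finite_induct)
 case (insert j I)
 let ?s = "\<Sum>i\<in>I. be i"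
 have "(fact (be j + ?s) :: real) <= fact (be j) * fact ?s * 2 ^ (be j + ?s)" by (rule fact_add_le)
 also have "... <= fact (be j) * ((\<Prod>i\<in>I. fact (be i)) * 2 ^ (card I * ?s)) * 2 ^ (be j + ?s)"
  using insert by (intro mult_right_mono mult_left_mono) auto
 also have "... = (fact (be j) * (\<Prod>i\<in>I. fact (be i))) * 2 ^ (card I * ?s + (be j + ?s))"
  by (simp add: power_add)
 also have "... <= (fact (be j) * (\<Prod>i\<in>I. fact (be i))) * 2 ^ (Suc (card I) * (be j + ?s))"
  by (intro mult_left_mono power_increasing mult_nonneg_nonneg prod_nonneg) (auto simp: algebra_simps)
 finally show ?case using insert by simp
qed simp

lemma Suc_quarter_power_le: "real (Suc P) * (1 / 4) ^ P <= (1 / 2) ^ P"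
proof -
 have "real (Suc P) <= 2 ^ P" using of_nat_mono[where 'a = real, OF Suc_leI[OF less_exp[of P]]] by (simp only: of_nat_power of_nat_numeral)
 then have "real (Suc P) * (1 / 4) ^ P <= 2 ^ P * (1 / 4) ^ P" by (intro mult_right_mono) auto
 also have "... = (1 / 2) ^ P" by (simp flip: power_mult_distrib)
 finally show ?thesis .
qed

text \<open>Expansion at the vertex \<open>xi\<close> of the cell Q that is nearest to the origin.
  Relative to \<open>xi\<close> the cell has size \<open>1 / sg^2 - 1\<close> in each coordinate,
  and \<open>s1\<close> makes the remainders contract by 1/4. M collects the one extra power of
  every distance in the rough bound; the factor P + 1 in the gradient remainder is paid for by
  passing from 1/4 to 1/2.\<close>

lemma local_taylor_error:
 fixes H :: "('n::finite => nat) => real ^ 'n => real" and P :: nat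
 assumes sg: "0 < sg" "sg < 1" and H: "smooth_family H" and CA: "0 < C" "0 < A"
  and b: "!!al y. y \<in> cube ==> \<bar>H al y\<bar> <= C * A ^ mi_abs al * fact (mi_abs al) * (\<Prod>j\<in>UNIV. (1 / y $ j) ^ (al j + 1))"
  and s1: "A * (real CARD('n) * (1 / sg^2 - 1)) <= 1 / 4"
  and K: "!!j. K j <= l"
 defines "xi \<equiv> (\<chi> j. sg ^ Suc (K j))"
 defines "Q \<equiv> {y \<in> cube. ALL j. sg ^ Suc (K j) <= y $ j & y $ j <= sg ^ K j / sg}"
 defines "R \<equiv> %y. H (%_. 0) y - taylor H xi (Suc P) (%_. 0) y"
 defines "M \<equiv> C * (1 / sg) ^ (Suc l * CARD('n))"
 shows "y \<in> Q ==> \<bar>R y\<bar> <= M * (1 / 4) ^ Suc P"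
  and "x \<in> Q ==> y \<in> Q ==> \<bar>R x - R y\<bar> <= real CARD('n) * (M * A * (1 / sg) ^ Suc l * (1 / 2) ^ P) * dist x y"
  and "\<bar>H be xi\<bar> <= M * A ^ mi_abs be * fact (mi_abs be) * (\<Prod>j\<in>UNIV. (1 / sg ^ Suc (K j)) ^ be j)"
proof -
 let ?d = "real CARD('n)"
 define om where "om j = sg ^ Suc (K j)" for j
 have om: "0 < om j" "om j < 1" for j using sg by (auto simp: om_def simp del: power_Suc intro!: power_Suc_less_one)
 have oml: "1 / om j <= (1 / sg) ^ Suc l" for j
 proof -
  have "(1 / sg) ^ Suc (K j) <= (1 / sg) ^ Suc l" using K sg by (intro power_increasing) auto
  then show ?thesis by (simp add: om_def power_one_over)
 qed
 have xic: "xi \<in> cube" using om by (simp add: xi_def cube_def om_def del: power_Suc)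
 have xiQ: "xi \<in> Q"
 proof -
  have "sg ^ Suc (K j) <= sg ^ K j / sg" for j
  proof -
  have "sg * sg <= 1 * 1" using sg by (intro mult_mono) auto
  then have "sg ^ K j * (sg * sg) <= sg ^ K j * 1" using sg by (intro mult_left_mono) auto
  then show ?thesis using sg by (simp add: field_simps)
  qed
  then show ?thesis using xic by (simp add: Q_def xi_def del: power_Suc)
 qed
 have Qc: "convex Q"
 proof (rule convexI)
  fix x y u v assume xy: "x \<in> Q" "y \<in> Q" "0 <= u" "0 <= v" "u + v = (1::real)"
  have "convex (cube :: (real ^ 'n) set)" by (simp add: cube_eq_box convex_box)
  then have "u *\<^sub>R x + v *\<^sub>R y \<in> cube" using xy by (intro convexD) (auto simp: Q_def)
  moreover have "sg ^ Suc (K j) <= (u *\<^sub>R x + v *\<^sub>R y) $ j & (u *\<^sub>R x + v *\<^sub>R y) $ j <= sg ^ K j / sg" for j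
  proof -
  have "x $ j \<in> {sg ^ Suc (K j)..sg ^ K j / sg}" "y $ j \<in> {sg ^ Suc (K j)..sg ^ K j / sg}" using xy by (auto simp: Q_def)
  then have "u *\<^sub>R x $ j + v *\<^sub>R y $ j \<in> {sg ^ Suc (K j)..sg ^ K j / sg}" using xy by (intro convexD convex_real_interval) auto
  then show ?thesis by simp
  qed
  ultimately show "u *\<^sub>R x + v *\<^sub>R y \<in> Q" by (simp add: Q_def)
 qed
 have M0: "0 < M" using CA sg by (simp add: M_def)
 have bQ: "\<bar>H ga y\<bar> <= M * A ^ mi_abs ga * fact (mi_abs ga) * (\<Prod>j\<in>UNIV. (1 / om j) ^ ga j)" if y: "y \<in> Q" for ga y
 proof -
  have yc: "y \<in> cube" and yo: "om j <= y $ j" for j using y by (auto simp: Q_def om_def)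
  have "(\<Prod>j\<in>UNIV. (1 / y $ j) ^ (ga j + 1)) <= (\<Prod>j\<in>UNIV. (1 / om j) ^ ga j * (1 / sg) ^ Suc l)"
  proof (intro prod_mono conjI)
  fix j
  have y0: "0 < y $ j" using yc by (simp add: cube_def)
  have "1 / y $ j <= 1 / om j" using yo[of j] om[of j] by (intro divide_left_mono) auto
  then have "(1 / y $ j) ^ ga j * (1 / y $ j) <= (1 / om j) ^ ga j * (1 / sg) ^ Suc l"
  using y0 om[of j] oml[of j] sg by (intro mult_mono power_mono) auto
  then show "(1 / y $ j) ^ (ga j + 1) <= (1 / om j) ^ ga j * (1 / sg) ^ Suc l" by simp
  show "0 <= (1 / y $ j) ^ (ga j + 1)" using y0 by simp
  qed
  also have "... = (\<Prod>j\<in>UNIV. (1 / om j) ^ ga j) * (1 / sg) ^ (Suc l * CARD('n))"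
  unfolding prod.distrib prod_constant power_mult ..
  finally have "C * A ^ mi_abs ga * fact (mi_abs ga) * (\<Prod>j\<in>UNIV. (1 / y $ j) ^ (ga j + 1)) <= C * A ^ mi_abs ga * fact (mi_abs ga) * ((\<Prod>j\<in>UNIV. (1 / om j) ^ ga j) * (1 / sg) ^ (Suc l * CARD('n)))"
  using CA by (intro mult_left_mono) auto
  with b[OF yc, of ga] show ?thesis unfolding M_def by (simp add: mult_ac)
 qed
 show "\<bar>H be xi\<bar> <= M * A ^ mi_abs be * fact (mi_abs be) * (\<Prod>j\<in>UNIV. (1 / sg ^ Suc (K j)) ^ be j)"
  using bQ[OF xiQ, of be] by (simp add: om_def)
 have ub: "A * (\<Sum>j\<in>UNIV. \<bar>y $ j - xi $ j\<bar> / om j) <= 1 / 4" "0 <= (\<Sum>j\<in>UNIV. \<bar>y $ j - xi $ j\<bar> / om j)" if y: "y \<in> Q" for y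
 proof -
  have "\<bar>y $ j - xi $ j\<bar> / om j <= 1 / sg^2 - 1" for j
  proof -
  have j: "om j <= y $ j" "y $ j <= sg ^ K j / sg" using y by (auto simp: Q_def om_def)
  have "sg ^ K j / sg = om j / sg^2" using sg by (simp add: om_def power2_eq_square)
  then have "y $ j - om j <= (1 / sg^2 - 1) * om j" using j by (simp add: algebra_simps)
  then show ?thesis using j om[of j] by (simp add: xi_def om_def[symmetric] divide_le_eq del: power_Suc)
  qed
  then have "(\<Sum>j\<in>UNIV. \<bar>y $ j - xi $ j\<bar> / om j) <= (\<Sum>j\<in>(UNIV::'n set). 1 / sg^2 - 1)" by (intro sum_mono)
  then have "A * (\<Sum>j\<in>UNIV. \<bar>y $ j - xi $ j\<bar> / om j) <= A * (?d * (1 / sg^2 - 1))" using CA by (intro mult_left_mono) auto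
  then show "A * (\<Sum>j\<in>UNIV. \<bar>y $ j - xi $ j\<bar> / om j) <= 1 / 4" using s1 by linarith
  show "0 <= (\<Sum>j\<in>UNIV. \<bar>y $ j - xi $ j\<bar> / om j)" using om by (intro sum_nonneg) (auto simp: less_imp_le)
 qed
 have Qs: "Q <= cube" by (auto simp: Q_def)
 have z0: "mi_abs (%_::'n. 0) = 0" by (simp add: mi_abs_def)
 note rem = taylor_remainder_bound[where Q = Q and om = om and M = M and A = A, OF H xic om(1) less_imp_le[OF M0] less_imp_le[OF CA(2)] Qc Qs xiQ]
 show "\<bar>R y\<bar> <= M * (1 / 4) ^ Suc P" if y: "y \<in> Q"
 proof -
  have "\<bar>R y\<bar> <= M * A ^ (0 + Suc P) * fact (0 + Suc P) * (\<Prod>j\<in>(UNIV::'n set). 1) * (\<Sum>j\<in>UNIV. \<bar>y $ j - xi $ j\<bar> / om j) ^ Suc P / fact (Suc P)"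
  using rem[OF bQ y, where al = "%_. 0" and n = "Suc P"] unfolding R_def z0 by simp
  also have "... = M * (A * (\<Sum>j\<in>UNIV. \<bar>y $ j - xi $ j\<bar> / om j)) ^ Suc P"
  unfolding power_mult_distrib by (simp del: power_Suc fact_Suc)
  also have "... <= M * (1 / 4) ^ Suc P"
  using M0 ub[OF y] CA by (intro mult_left_mono power_mono mult_nonneg_nonneg) auto
  finally show ?thesis .
 qed
 show "\<bar>R x - R y\<bar> <= ?d * (M * A * (1 / sg) ^ Suc l * (1 / 2) ^ P) * dist x y" if xy: "x \<in> Q" "y \<in> Q"
 proof -
  define B where "B = M * A * (1 / sg) ^ Suc l * (1 / 2) ^ P"
  have B0: "0 <= B" unfolding B_def using M0 CA sg by (intro mult_nonneg_nonneg) auto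
  define R' where "R' y = (%v. \<Sum>i\<in>UNIV. v $ i * (H ((%_. 0)(i := Suc 0)) y - taylor H xi P ((%_. 0)(i := Suc 0)) y))" for y
  have "norm (R x - R y) <= (?d * B) * norm (x - y)"
  proof (rule differentiable_bound[OF Qc, where f' = R'])
  show "(R has_derivative R' z) (at z within Q)" if "z \<in> Q" for z
  using taylor_remainder_smooth[OF H, of z "%_. 0" xi P] that Qs unfolding R_def R'_def
  by (auto intro: has_derivative_at_withinI)
  show "onorm (R' z) <= ?d * B" if z: "z \<in> Q" for z
  proof (rule onorm_le)
  fix v :: "real ^ 'n"
  have pi: "\<bar>H ((%_. 0)(i := Suc 0)) z - taylor H xi P ((%_. 0)(i := Suc 0)) z\<bar> <= B" for i
  proof -
  have m1: "mi_abs ((%_. 0)(i := Suc 0) :: 'n => nat) = 1" using mi_abs_update[of "%_. 0" i] z0 by simp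
  have p1: "(\<Prod>j\<in>UNIV. (1 / om j) ^ ((%_. 0)(i := Suc 0)) j) = 1 / om i"
  by (subst prod.remove[of _ i]) (auto intro!: prod.neutral)
  have "\<bar>H ((%_. 0)(i := Suc 0)) z - taylor H xi P ((%_. 0)(i := Suc 0)) z\<bar> \<le>
  M * A ^ (1 + P) * fact (1 + P) * (1 / om i) * (\<Sum>j\<in>UNIV. \<bar>z $ j - xi $ j\<bar> / om j) ^ P / fact P"
  using rem[OF bQ z, where al = "(%_. 0)(i := Suc 0)" and n = P] unfolding m1 p1 .
  also have "... = M * A * (1 / om i) * (real (Suc P) * (A * (\<Sum>j\<in>UNIV. \<bar>z $ j - xi $ j\<bar> / om j)) ^ P)"
  unfolding power_mult_distrib by (simp del: of_nat_Suc)
  also have "... <= M * A * (1 / sg) ^ Suc l * (real (Suc P) * (1 / 4) ^ P)"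
  using M0 CA ub[OF z] oml[of i] om[of i] sg by (intro mult_mono power_mono mult_left_mono mult_nonneg_nonneg) auto
  also have "... <= M * A * (1 / sg) ^ Suc l * (1 / 2) ^ P"
  using M0 CA sg by (intro mult_left_mono Suc_quarter_power_le) auto
  finally show ?thesis by (simp add: B_def)
  qed
  have "norm (R' z v) <= (\<Sum>i\<in>(UNIV::'n set). norm v * B)"
  unfolding R'_def real_norm_def
  proof (rule order_trans[OF sum_abs sum_mono])
  fix i
  show "\<bar>v $ i * (H ((%_. 0)(i := Suc 0)) z - taylor H xi P ((%_. 0)(i := Suc 0)) z)\<bar> <= norm v * B"
  unfolding abs_mult by (intro mult_mono pi component_le_norm_cart) auto
  qed
  then show "norm (R' z v) <= ?d * B * norm v" by (simp add: mult_ac)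
  qed
  qed (use xy in auto)
  then show ?thesis by (simp add: B_def dist_norm)
 qed
qed

text \<open>R is controlled on Q only. If y leaves Q while x does not, then \<open>ph y = 0\<close>
  and the difference is \<open>(ph x - ph y) * R x\<close>, where R is again evaluated in Q.\<close>

lemma lipschitz_product_on_support:
 fixes ph R :: "real ^ 'n::finite => real"
 assumes ph: "!!x. 0 <= ph x & ph x <= 1" "!!x y. \<bar>ph x - ph y\<bar> <= L * dist x y" "0 <= L"
  and supp: "!!x. x \<in> S ==> ph x ~= 0 ==> x \<in> Q"
  and R: "!!x. x \<in> Q ==> \<bar>R x\<bar> <= e0" "!!x y. x \<in> Q ==> y \<in> Q ==> \<bar>R x - R y\<bar> <= e1 * dist x y" "0 <= e0" "0 <= e1"
  and xy: "x \<in> S" "y \<in> S"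
 shows "\<bar>ph x * R x - ph y * R y\<bar> <= (L * e0 + e1) * dist x y"
proof -
 have half: "\<bar>ph x * R x - ph y * R y\<bar> <= (L * e0 + e1) * dist x y" if "x \<in> Q" "x \<in> S" "y \<in> S" for x y
 proof (cases "y \<in> Q")
  case True
  have "ph x * R x - ph y * R y = (ph x - ph y) * R x + ph y * (R x - R y)" by (simp add: algebra_simps)
  also have "\<bar>...\<bar> <= \<bar>ph x - ph y\<bar> * \<bar>R x\<bar> + \<bar>ph y\<bar> * \<bar>R x - R y\<bar>"
  by (simp add: abs_mult order_trans[OF abs_triangle_ineq])
  also have "... <= (L * dist x y) * e0 + 1 * (e1 * dist x y)"
  using ph R that True by (intro add_mono mult_mono) (auto intro!: mult_nonneg_nonneg simp: abs_of_nonneg)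
  finally show ?thesis by (simp add: algebra_simps)
 next
  case False
  then have y0: "ph y = 0" using supp that by blast
  have "\<bar>ph x * R x - ph y * R y\<bar> = \<bar>ph x - ph y\<bar> * \<bar>R x\<bar>" using y0 by (simp add: abs_mult)
  also have "... <= (L * dist x y) * e0" using ph R that by (intro mult_mono) (auto intro!: mult_nonneg_nonneg)
  also have "... <= (L * e0 + e1) * dist x y" using R(4) by (simp add: algebra_simps)
  finally show ?thesis .
 qed
 show ?thesis
 proof (cases "x \<in> Q")
  case True
  then show ?thesis using half xy by blast
 next
  case F: False
  show ?thesis
  proof (cases "y \<in> Q")
  case True
  then show ?thesis using half[of y x] xy by (simp add: abs_minus_commute dist_commute)
  next
  case False
  then have "ph x = 0" "ph y = 0" using F supp xy by blast+
  then show ?thesis using ph(3) R(3,4) by simp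
  qed
 qed
qed

lemma PiE_pair_sum:
 fixes F :: "('n::finite => nat) => ('n => nat) => real"
 shows "(\<Sum>b\<in>PiE UNIV (%_. {..l} \<times> {..P}). F (fst \<circ> b) (snd \<circ> b)) = (\<Sum>K\<in>PiE UNIV (%_. {..l}). \<Sum>be\<in>PiE UNIV (%_. {..P}). F K be)"
 unfolding sum.cartesian_product
 by (rule sum.reindex_bij_witness[where i = "%(K, be) j. (K j, be j)" and j = "%b. (fst \<circ> b, snd \<circ> b)"])
  (auto simp: PiE_iff o_def mem_Times_iff)

text \<open>The error is a sum of hat products times local Taylor remainders. Its bounds may grow
  like a fixed power of \<open>(1 / sg) ^ l\<close>, since \<open>(1 / 2) ^ P\<close> will
  compensate with P proportional to l.\<close>

lemma taylor_pou_approx: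
 fixes H :: "('n::finite => nat) => real ^ 'n => real"
 assumes H: "smooth_family H" and CA: "0 < C" "0 < A"
  and b: "!!al y. y \<in> cube ==> \<bar>H al y\<bar> <= C * A ^ mi_abs al * fact (mi_abs al) * (\<Prod>j\<in>UNIV. (1 / y $ j) ^ (al j + 1))"
 obtains sg C' where "0 < sg" "sg < 1" "0 < C'"
  "!!l P. EX cf. (ALL b. \<bar>cf b\<bar> <= C' * (1 / sg) ^ (l * CARD('n))) \<and>
  (\<forall>x\<in>cube. \<forall>y\<in>cube. (ALL j. sg ^ l <= x $ j) --> (ALL j. sg ^ l <= y $ j) -->
  (let E = (%x. H (%_. 0) x - (\<Sum>b\<in>PiE UNIV (%_. {..l} \<times> {..P}). cf b * (\<Prod>j\<in>UNIV. vfun sg (b j) (x $ j))));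
  et = C' * real (l + 1) ^ CARD('n) * (1 / sg) ^ (l * (CARD('n) + 1)) * (1 / 2) ^ P
  in \<bar>E x\<bar> <= et & \<bar>E x - E y\<bar> <= et * dist x y))"
proof -
 let ?n = "CARD('n)" and ?d = "real CARD('n)"
 \<comment> \<open>q becomes \<open>1 / sg^2 - 1\<close>. Its first bound makes the Taylor
   remainders contract, the second keeps the coefficients bounded uniformly in the degree.\<close>
 define q where "q = min (1 / (4 * A * ?d)) (1 / (2 * A * 2 ^ ?n))"
 have dp: "0 < ?d" by simp
 have q: "0 < q" "A * (?d * q) <= 1 / 4" "A * (2 * q) * 2 ^ ?n <= 1"
 proof -
  show "0 < q" using CA dp by (simp add: q_def)
  have "q <= 1 / (4 * A * ?d)" by (simp add: q_def)
  then have "A * ?d * q <= A * ?d * (1 / (4 * A * ?d))" using CA by (intro mult_left_mono) auto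
  then show "A * (?d * q) <= 1 / 4" using CA dp by simp
  have "q <= 1 / (2 * A * 2 ^ ?n)" by (simp add: q_def)
  then have "(2 * A * 2 ^ ?n) * q <= (2 * A * 2 ^ ?n) * (1 / (2 * A * 2 ^ ?n))" using CA by (intro mult_left_mono) auto
  also have "... = 1" using CA by simp
  finally show "A * (2 * q) * 2 ^ ?n <= 1" by (simp add: mult_ac)
 qed
 define sg where "sg = 1 / sqrt (1 + q)"
 have sg: "0 < sg" "sg < 1" using q(1) by (auto simp: sg_def)
 have s2: "1 / sg^2 - 1 = q" using q(1) by (simp add: sg_def power_divide)
 define L where "L = pou_lip sg"
 have L: "0 < L" unfolding L_def by (rule pou_lip_pos[OF sg])
 define C0 where "C0 = C * (1 / sg) ^ ?n"
 have C0: "0 < C0" using CA sg by (simp add: C0_def)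
 define C' where "C' = C0 * (1 + ?d * (L + A / sg))"
 have C'1: "C0 <= C'" "C0 * (?d * (L + A / sg)) <= C'" "0 < C'"
 proof -
  have nn: "0 <= ?d * (L + A / sg)" using L CA sg by simp
  show "C0 <= C'" unfolding C'_def using C0 nn by simp
  show "C0 * (?d * (L + A / sg)) <= C'" unfolding C'_def using C0 by simp
  show "0 < C'" unfolding C'_def using C0 nn by (intro mult_pos_pos) auto
 qed
 define kk where "kk = 2 * (1 / sg - sg)"
 have s1: "A * (?d * (1 / sg^2 - 1)) <= 1 / 4" using q(2) s2 by simp
 have main: "EX cf. (ALL b. \<bar>cf b\<bar> <= C' * (1 / sg) ^ (l * CARD('n))) \<and>
  (\<forall>x\<in>cube. \<forall>y\<in>cube. (ALL j. sg ^ l <= x $ j) --> (ALL j. sg ^ l <= y $ j) -->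
  (let E = (%x. H (%_. 0) x - (\<Sum>b\<in>PiE UNIV (%_. {..l} \<times> {..P}). cf b * (\<Prod>j\<in>UNIV. vfun sg (b j) (x $ j))));
  et = C' * real (l + 1) ^ CARD('n) * (1 / sg) ^ (l * (CARD('n) + 1)) * (1 / 2) ^ P
  in \<bar>E x\<bar> <= et & \<bar>E x - E y\<bar> <= et * dist x y))" for l P
 proof -
  define xi where "xi K = (\<chi> j. sg ^ Suc (K j))" for K :: "'n => nat"
  define Q where "Q K = {y \<in> cube. ALL j. sg ^ Suc (K j) <= y $ j & y $ j <= sg ^ K j / sg}" for K :: "'n => nat"
  define R where "R K y = H (%_. 0) y - taylor H (xi K) (Suc P) (%_. 0) y" for K y
  define M where "M = C * (1 / sg) ^ (Suc l * ?n)"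
  have M: "M = C0 * (1 / sg) ^ (l * ?n)" by (simp add: M_def C0_def power_add add.commute)
  have M0: "0 < M" using CA sg by (simp add: M_def)
  define ph where "ph K x = (\<Prod>j\<in>UNIV. hat sg (x $ j / sg ^ K j))" for K and x :: "real ^ 'n"
  define KK where "KK = PiE (UNIV :: 'n set) (%_. {..l})"
  have KKl: "K j <= l" if "K \<in> KK" for K j using that by (auto simp: KK_def PiE_iff)
  have KKf: "finite KK" "card KK = (l + 1) ^ ?n"
  unfolding KK_def by (auto intro!: finite_PiE simp: card_PiE)
  note loc = local_taylor_error(1,2)[where C = C and A = A and P = P and l = l, OF sg H CA b s1, folded M_def]
  local_taylor_error(3)[where C = C and A = A and l = l, OF sg H CA b s1, folded M_def]
  have loc1: "\<bar>R K y\<bar> <= M * (1 / 4) ^ Suc P" if "K \<in> KK" "y \<in> Q K" for K y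
  using loc(1)[where K = K and y = y] KKl[OF that(1)] that(2) unfolding R_def xi_def Q_def by blast
  have loc2: "\<bar>R K x - R K y\<bar> <= ?d * (M * A * (1 / sg) ^ Suc l * (1 / 2) ^ P) * dist x y" if "K \<in> KK" "x \<in> Q K" "y \<in> Q K" for K x y
  using loc(2)[where K = K and y = y and x = x] KKl[OF that(1)] that(2,3) unfolding R_def xi_def Q_def by blast
  have loc3: "\<bar>H be (xi K)\<bar> <= M * A ^ mi_abs be * fact (mi_abs be) * (\<Prod>j\<in>UNIV. (1 / sg ^ Suc (K j)) ^ be j)" if "K \<in> KK" for K be
  using loc(3)[where K = K and be = be] KKl[OF that] unfolding xi_def by blast
  \<comment> \<open>Taylor coefficients, rescaled from monomials to ramp powers. The index set is a
    full tensor grid of degrees, so entries of total degree above P are set to 0.\<close>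
  define cf where "cf b = (if fst \<circ> b \<in> KK & mi_abs (snd \<circ> b) < Suc P then H (snd \<circ> b) (xi (fst \<circ> b)) * (\<Prod>j\<in>UNIV. (kk * sg ^ fst (b j)) ^ snd (b j) / fact (snd (b j))) else 0)" for b :: "'n => nat \<times> nat"
  have cfb: "\<bar>cf b\<bar> <= C' * (1 / sg) ^ (l * ?n)" for b
  proof (cases "fst \<circ> b \<in> KK & mi_abs (snd \<circ> b) < Suc P")
  case True
  define K be where "K = fst \<circ> b" and "be = snd \<circ> b"
  have kk0: "0 <= kk" using sigma_order(1)[OF sg] by (simp add: kk_def)
  \<comment> \<open>The scale of the ramp against the scale of the derivative bound: the mesh level
    cancels.\<close>
  have rat: "1 / sg ^ Suc m * (kk * sg ^ m) = 2 * q" for m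
  unfolding s2[symmetric] kk_def using sg by (simp add: field_simps power2_eq_square)
  have fp: "0 < (\<Prod>j\<in>UNIV. fact (be j) :: real)" by (intro prod_pos) auto
  have "\<bar>cf b\<bar> = \<bar>H be (xi K)\<bar> * (\<Prod>j\<in>UNIV. (kk * sg ^ K j) ^ be j / fact (be j))"
  using True kk0 sg by (simp add: cf_def K_def be_def abs_mult abs_prod)
  also have "... <= (M * A ^ mi_abs be * fact (mi_abs be) * (\<Prod>j\<in>UNIV. (1 / sg ^ Suc (K j)) ^ be j)) * (\<Prod>j\<in>UNIV. (kk * sg ^ K j) ^ be j / fact (be j))"
  using loc3[of K be] True kk0 sg by (intro mult_right_mono prod_nonneg) (auto simp: K_def)
  also have "... = M * A ^ mi_abs be * fact (mi_abs be) * (\<Prod>j\<in>UNIV. (2 * q) ^ be j / fact (be j))"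
  proof -
  have "(\<Prod>j\<in>UNIV. (1 / sg ^ Suc (K j)) ^ be j) * (\<Prod>j\<in>UNIV. (kk * sg ^ K j) ^ be j / fact (be j)) = (\<Prod>j\<in>UNIV. (2 * q) ^ be j / fact (be j))"
  unfolding prod.distrib[symmetric] times_divide_eq_right power_mult_distrib[symmetric] rat ..
  then show ?thesis by (simp only: mult.assoc)
  qed
  also have "... = M * A ^ mi_abs be * fact (mi_abs be) * ((2 * q) ^ mi_abs be / (\<Prod>j\<in>UNIV. fact (be j)))"
  by (simp add: prod_dividef mi_abs_def power_sum)
  also have "... <= M * A ^ mi_abs be * ((\<Prod>j\<in>UNIV. fact (be j)) * 2 ^ (?n * mi_abs be)) * ((2 * q) ^ mi_abs be / (\<Prod>j\<in>UNIV. fact (be j)))"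
  using fact_sum_le[of UNIV be] M0 CA q(1) fp by (intro mult_right_mono mult_left_mono) (auto simp: mi_abs_def)
  also have "... = M * (A * (2 * q) * 2 ^ ?n) ^ mi_abs be"
  using fp by (simp add: power_mult_distrib power_mult)
  also have "... <= M * 1" using q CA M0 by (intro mult_left_mono power_le_one) auto
  also have "... <= C' * (1 / sg) ^ (l * ?n)" unfolding M mult_1_right using C'1 sg by (intro mult_right_mono) auto
  finally show ?thesis .
  next
  case False
  then show ?thesis using C'1 sg by (auto simp: cf_def)
  qed
  define E where "E x = H (%_. 0) x - (\<Sum>b\<in>PiE UNIV (%_. {..l} \<times> {..P}). cf b * (\<Prod>j\<in>UNIV. vfun sg (b j) (x $ j)))" for x
  \<comment> \<open>Regrouped by cells K: the sum over the degrees is the Taylor polynomial at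
    \<open>xi K\<close>, and the hats sum to 1 because all coordinates are at least
    \<open>sg ^ l\<close>.\<close>
  have Eeq: "E x = (\<Sum>K\<in>KK. ph K x * R K x)" if x: "x \<in> cube" "ALL j. sg ^ l <= x $ j" for x
  proof -
  have "(\<Sum>b\<in>PiE UNIV (%_. {..l} \<times> {..P}). cf b * (\<Prod>j\<in>UNIV. vfun sg (b j) (x $ j)))
  = (\<Sum>b\<in>PiE UNIV (%_. {..l} \<times> {..P}). (%K be. if mi_abs be < Suc P then H be (xi K) * (ph K x * taylor_monom be (x - xi K)) else 0) (fst \<circ> b) (snd \<circ> b))"
  proof (rule sum.cong[OF refl])
  fix b :: "'n => nat \<times> nat" assume bb: "b \<in> PiE UNIV (%_. {..l} \<times> {..P})"
  define K be where "K = fst \<circ> b" and "be = snd \<circ> b"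
  have KK: "K \<in> KK" using bb by (auto simp: K_def KK_def PiE_iff mem_Times_iff)
  have "(\<Prod>j\<in>UNIV. (kk * sg ^ fst (b j)) ^ snd (b j) / fact (snd (b j))) * (\<Prod>j\<in>UNIV. vfun sg (b j) (x $ j)) = ph K x * taylor_monom be (x - xi K)"
  unfolding ph_def taylor_monom_def prod.distrib[symmetric]
  proof (rule prod.cong[OF refl])
  fix j
  have "hat sg (x $ j / sg ^ K j) * (x $ j - sg ^ Suc (K j)) ^ be j = (kk * sg ^ K j) ^ be j * vfun sg (K j, be j) (x $ j)"
  unfolding kk_def by (rule hat_times_power[OF sg])
  then show "(kk * sg ^ fst (b j)) ^ snd (b j) / fact (snd (b j)) * vfun sg (b j) (x $ j) = hat sg (x $ j / sg ^ K j) * ((x - xi K) $ j ^ be j / fact (be j))"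
  by (simp add: K_def be_def xi_def del: power_Suc)
  qed
  then show "cf b * (\<Prod>j\<in>UNIV. vfun sg (b j) (x $ j)) = (%K be. if mi_abs be < Suc P then H be (xi K) * (ph K x * taylor_monom be (x - xi K)) else 0) (fst \<circ> b) (snd \<circ> b)"
  using KK unfolding cf_def K_def[symmetric] be_def[symmetric] by (simp add: mult.assoc)
  qed
  also have "... = (\<Sum>K\<in>KK. \<Sum>be\<in>PiE UNIV (%_. {..P}). if mi_abs be < Suc P then H be (xi K) * (ph K x * taylor_monom be (x - xi K)) else 0)"
  unfolding KK_def by (rule PiE_pair_sum)
  also have "... = (\<Sum>K\<in>KK. ph K x * taylor H (xi K) (Suc P) (%_. 0) x)"
  proof (rule sum.cong[OF refl])
  fix K assume "K \<in> KK"
  have "(\<Sum>be\<in>PiE UNIV (%_. {..P}). if mi_abs be < Suc P then H be (xi K) * (ph K x * taylor_monom be (x - xi K)) else 0)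
  = (\<Sum>be\<in>{be. mi_abs be < Suc P}. H be (xi K) * (ph K x * taylor_monom be (x - xi K)))"
  proof (rule sum.mono_neutral_cong_right)
  show "finite (PiE (UNIV :: 'n set) (%_. {..P}))" by (intro finite_PiE) auto
  show "{be. mi_abs be < Suc P} <= PiE (UNIV :: 'n set) (%_. {..P})"
  proof
  fix be :: "'n => nat" assume "be \<in> {be. mi_abs be < Suc P}"
  then have "be j <= P" for j using le_mi_abs[of be j] by simp
  then show "be \<in> PiE UNIV (%_. {..P})" by (simp add: PiE_iff)
  qed
  qed auto
  then show "(\<Sum>be\<in>PiE UNIV (%_. {..P}). if mi_abs be < Suc P then H be (xi K) * (ph K x * taylor_monom be (x - xi K)) else 0) = ph K x * taylor H (xi K) (Suc P) (%_. 0) x"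
  by (simp add: taylor_def sum_distrib_left mi_add_def mult_ac)
  qed
  finally have 1: "(\<Sum>b\<in>PiE UNIV (%_. {..l} \<times> {..P}). cf b * (\<Prod>j\<in>UNIV. vfun sg (b j) (x $ j))) = (\<Sum>K\<in>KK. ph K x * taylor H (xi K) (Suc P) (%_. 0) x)" .
  have "(\<Sum>K\<in>KK. ph K x) = (\<Prod>j\<in>UNIV. \<Sum>m\<in>{..l}. hat sg (x $ j / sg ^ m))"
  unfolding KK_def ph_def by (rule prod_sum_PiE[symmetric]) auto
  also have "... = 1"
  proof (rule prod.neutral, rule ballI)
  fix j :: 'n
  show "(\<Sum>m\<in>{..l}. hat sg (x $ j / sg ^ m)) = 1"
  by (rule hat_partition[OF sg]) (use x in \<open>auto simp: cube_def less_imp_le\<close>)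
  qed
  finally have 2: "H (%_. 0) x = (\<Sum>K\<in>KK. ph K x * H (%_. 0) x)" by (simp flip: sum_distrib_right)
  show ?thesis unfolding E_def 1 by (subst 2) (simp add: R_def right_diff_distrib sum_subtractf)
  qed
  have phr: "0 <= ph K x & ph K x <= 1" for K x
  unfolding ph_def by (intro conjI prod_nonneg prod_le_1) (auto simp: hat_range[OF sg])
  define q1 where "q1 = (1 / sg) ^ l"
  have q1: "1 <= q1" using sg by (simp add: q1_def one_le_power)
  have phl: "\<bar>ph K x - ph K y\<bar> <= (?d * (L * q1)) * dist x y" if "K \<in> KK" for K x y
  proof -
  have "norm (ph K x - ph K y) <= (\<Sum>j\<in>UNIV. norm (hat sg (x $ j / sg ^ K j) - hat sg (y $ j / sg ^ K j)))"
  unfolding ph_def by (rule norm_prod_diff) (auto simp: hat_range[OF sg])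
  also have "... <= (\<Sum>j\<in>(UNIV::'n set). L * q1 * dist x y)"
  proof (rule sum_mono)
  fix j
  have "\<bar>hat sg (x $ j / sg ^ K j) - hat sg (y $ j / sg ^ K j)\<bar> <= L * \<bar>x $ j / sg ^ K j - y $ j / sg ^ K j\<bar>"
  unfolding L_def by (rule hat_lipschitz[OF sg])
  also have "\<bar>x $ j / sg ^ K j - y $ j / sg ^ K j\<bar> = (1 / sg) ^ K j * \<bar>(x - y) $ j\<bar>"
  using sg by (simp add: abs_divide power_one_over flip: diff_divide_distrib)
  also have "... <= q1 * dist x y"
  unfolding q1_def dist_norm using sg KKl[OF that] by (intro mult_mono power_increasing component_le_norm_cart) auto
  finally show "norm (hat sg (x $ j / sg ^ K j) - hat sg (y $ j / sg ^ K j)) <= L * q1 * dist x y"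
  using L by (simp add: mult.assoc)
  qed
  finally show ?thesis by simp
  qed
  have supp: "x \<in> Q K" if x: "x \<in> cube" "ph K x ~= 0" for x K
  proof -
  have "sg ^ Suc (K j) <= x $ j & x $ j <= sg ^ K j / sg" for j
  proof -
  have "hat sg (x $ j / sg ^ K j) ~= 0" using x(2) unfolding ph_def by (metis UNIV_I finite prod_zero)
  then have "sg <= x $ j / sg ^ K j" "x $ j / sg ^ K j <= 1 / sg"
  using hat_cases(1,4)[OF sg, of "x $ j / sg ^ K j"] by linarith+
  then show ?thesis using sg by (simp add: field_simps)
  qed
  then show ?thesis using x(1) by (simp add: Q_def)
  qed
  define et where "et = C' * real (l + 1) ^ ?n * (1 / sg) ^ (l * (?n + 1)) * (1 / 2) ^ P"
  have qn: "(1 / sg) ^ (l * (?n + 1)) = (1 / sg) ^ (l * ?n) * q1" by (simp add: q1_def power_add)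
  have p4: "(1 / 4) ^ Suc P <= ((1 / 2) ^ P :: real)"
  proof -
  have "(1 / 4 :: real) ^ Suc P <= 1 * (1 / 4) ^ P" unfolding power_Suc by (intro mult_right_mono) auto
  also have "... <= (1 / 2) ^ P" unfolding mult_1_left by (intro power_mono) auto
  finally show ?thesis .
  qed
  have "\<bar>E x\<bar> <= et & \<bar>E x - E y\<bar> <= et * dist x y" if xy: "x \<in> cube" "y \<in> cube" "ALL j. sg ^ l <= x $ j" "ALL j. sg ^ l <= y $ j" for x y
  proof
  have "\<bar>E x\<bar> <= (\<Sum>K\<in>KK. M * (1 / 2) ^ P)"
  unfolding Eeq[OF xy(1,3)]
  proof (rule order_trans[OF sum_abs sum_mono])
  fix K assume K: "K \<in> KK"
  show "\<bar>ph K x * R K x\<bar> <= M * (1 / 2) ^ P"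
  proof (cases "x \<in> Q K")
  case True
  have "\<bar>ph K x * R K x\<bar> <= 1 * (M * (1 / 4) ^ Suc P)"
  unfolding abs_mult using phr[of K x] loc1[OF K True] by (intro mult_mono) auto
  also have "... <= M * (1 / 2) ^ P" unfolding mult_1_left using M0 p4 by (intro mult_left_mono) auto
  finally show ?thesis .
  next
  case False
  then have "ph K x = 0" using supp xy by blast
  then show ?thesis using M0 by simp
  qed
  qed
  also have "... = real (l + 1) ^ ?n * (C0 * (1 / sg) ^ (l * ?n)) * (1 / 2) ^ P" by (simp add: KKf M)
  also have "... <= real (l + 1) ^ ?n * (C' * ((1 / sg) ^ (l * ?n) * q1)) * (1 / 2) ^ P"
  proof (intro mult_right_mono mult_left_mono)
  have "C0 * (1 / sg) ^ (l * ?n) <= C' * (1 / sg) ^ (l * ?n)" using C'1 sg by (intro mult_right_mono) auto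
  also have "... <= (C' * (1 / sg) ^ (l * ?n)) * q1" by (rule mult_left_mono[OF q1, unfolded mult_1_right]) (use C'1 sg in simp)
  finally show "C0 * (1 / sg) ^ (l * ?n) <= C' * ((1 / sg) ^ (l * ?n) * q1)" by (simp add: mult.assoc)
  qed auto
  also have "... = et" unfolding et_def qn by (simp add: mult_ac)
  finally show "\<bar>E x\<bar> <= et" .
  let ?e1 = "?d * (M * A * (1 / sg) ^ Suc l * (1 / 2) ^ P)" and ?e0 = "M * (1 / 4) ^ Suc P"
  have "\<bar>E x - E y\<bar> <= (\<Sum>K\<in>KK. (?d * (L * q1) * ?e0 + ?e1) * dist x y)"
  unfolding Eeq[OF xy(1,3)] Eeq[OF xy(2,4)] sum_subtractf[symmetric]
  proof (rule order_trans[OF sum_abs sum_mono])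
  fix K assume K: "K \<in> KK"
  show "\<bar>ph K x * R K x - ph K y * R K y\<bar> <= (?d * (L * q1) * ?e0 + ?e1) * dist x y"
  proof (rule lipschitz_product_on_support[where S = cube and Q = "Q K"])
  show "\<bar>ph K x - ph K y\<bar> <= ?d * (L * q1) * dist x y" for x y by (rule phl[OF K])
  show "\<bar>R K x\<bar> <= ?e0" if "x \<in> Q K" for x by (rule loc1[OF K that])
  show "\<bar>R K x - R K y\<bar> <= ?e1 * dist x y" if "x \<in> Q K" "y \<in> Q K" for x y by (rule loc2[OF K that])
  qed (use phr L q1 M0 CA sg supp xy in auto)
  qed
  also have "... = real (l + 1) ^ ?n * (?d * (L * q1) * ?e0 + ?e1) * dist x y" by (simp add: KKf)
  also have "... <= et * dist x y"
  proof (rule mult_right_mono)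
  have e1: "?e1 = ?d * (M * A * (q1 / sg) * (1 / 2) ^ P)" by (simp add: q1_def)
  have "?d * (L * q1) * ?e0 + ?e1 <= ?d * (L * q1) * (M * (1 / 2) ^ P) + ?d * (M * A * (q1 / sg) * (1 / 2) ^ P)"
  unfolding e1 using M0 L q1 p4 by (intro add_right_mono mult_left_mono) auto
  also have "?d * (L * q1) * (M * (1 / 2) ^ P) + ?d * (M * A * (q1 / sg) * (1 / 2) ^ P) = (C0 * (?d * (L + A / sg))) * ((1 / sg) ^ (l * ?n) * q1 * (1 / 2) ^ P)"
  unfolding M by (simp add: algebra_simps)
  also have "... <= C' * ((1 / sg) ^ (l * ?n) * q1 * (1 / 2) ^ P)"
  using C'1 sg q1 by (intro mult_right_mono) auto
  finally have "real (l + 1) ^ ?n * (?d * (L * q1) * ?e0 + ?e1) <= real (l + 1) ^ ?n * (C' * ((1 / sg) ^ (l * ?n) * q1 * (1 / 2) ^ P))"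
  by (intro mult_left_mono) auto
  then show "real (l + 1) ^ ?n * (?d * (L * q1) * ?e0 + ?e1) <= et" unfolding et_def qn by (simp only: mult_ac)
  qed auto
  finally show "\<bar>E x - E y\<bar> <= et * dist x y" .
  qed
  then show ?thesis using cfb unfolding E_def et_def Let_def by blast
 qed
 show thesis by (rule that[OF sg C'1(3) main])
qed

section \<open>Lipschitz functions with countably many kinks per line, and their weak
  derivatives\<close>

text \<open>Holds for all realizations, being stable under affine combinations and
  \<open>relu\<close>. Piecewise linearity is weakened to what a weak derivative needs: a Lipschitz
  bound and countably many kinks on each line parallel to an axis.\<close>

definition pl_fun :: "(real ^ 'n::finite => real) => bool" where
 "pl_fun g \<longleftrightarrow> (EX L. ALL x y. \<bar>g x - g y\<bar> <= L * dist x y) \<and>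
  (ALL x i. countable {t. \<not> (%t. g (x + t *\<^sub>R axis i 1)) differentiable (at t)})"

lemma pl_fun_const: "pl_fun (%x. c)"
 unfolding pl_fun_def by (auto intro!: exI[of _ 0])

lemma pl_fun_coord: "pl_fun (%x :: real ^ 'n::finite. x $ k)"
proof -
 have "\<bar>x $ k - y $ k\<bar> <= 1 * dist x y" for x y :: "real ^ 'n"
  using component_le_norm_cart[of "x - y" k] by (simp add: dist_norm)
 moreover have "(%t. (x + t *\<^sub>R axis i 1) $ k) differentiable (at t)" for x :: "real ^ 'n" and i t
  unfolding vector_add_component vector_scaleR_component by (intro derivative_intros)
 ultimately show ?thesis unfolding pl_fun_def by (auto intro!: exI[of _ 1])
qed

lemma pl_fun_add_scaled:
 assumes "pl_fun g" "pl_fun h" shows "pl_fun (%x. w * g x + h x)"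
proof -
 obtain L where L: "!!x y. \<bar>g x - g y\<bar> <= L * dist x y" using assms unfolding pl_fun_def by auto
 obtain M where M: "!!x y. \<bar>h x - h y\<bar> <= M * dist x y" using assms unfolding pl_fun_def by auto
 have "\<bar>(w * g x + h x) - (w * g y + h y)\<bar> <= (\<bar>w\<bar> * L + M) * dist x y" for x y
 proof -
  have "\<bar>(w * g x + h x) - (w * g y + h y)\<bar> = \<bar>w * (g x - g y) + (h x - h y)\<bar>" by (simp add: algebra_simps)
  also have "... <= \<bar>w\<bar> * \<bar>g x - g y\<bar> + \<bar>h x - h y\<bar>" by (simp add: order_trans[OF abs_triangle_ineq] abs_mult)
  also have "... <= \<bar>w\<bar> * (L * dist x y) + M * dist x y" using L M by (intro add_mono mult_left_mono) auto
  finally show ?thesis by (simp add: algebra_simps)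
 qed
 moreover have "countable {t. \<not> (%t. w * g (x + t *\<^sub>R axis i 1) + h (x + t *\<^sub>R axis i 1)) differentiable (at t)}" for x i
 proof (rule countable_subset)
  show "{t. \<not> (%t. w * g (x + t *\<^sub>R axis i 1) + h (x + t *\<^sub>R axis i 1)) differentiable (at t)}
  <= {t. \<not> (%t. g (x + t *\<^sub>R axis i 1)) differentiable (at t)} Un {t. \<not> (%t. h (x + t *\<^sub>R axis i 1)) differentiable (at t)}"
  by (auto intro!: differentiable_add differentiable_mult differentiable_const)
  show "countable ..." using assms unfolding pl_fun_def by (intro countable_Un) auto
 qed
 ultimately show ?thesis unfolding pl_fun_def by auto
qed

text \<open>Such zeros are isolated; an isolating interval can be given rational endpoints, and
  these determine the zero.\<close>

lemma countable_isolated_zeros: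
 fixes h :: "real => real"
 shows "countable {t. h t = 0 & (EX D. (h has_real_derivative D) (at t) & D ~= 0)}" (is "countable ?Z")
proof -
 define W where "W t r \<longleftrightarrow> fst r \<in> \<rat> & snd r \<in> \<rat> & fst r < t & t < snd r & (\<forall>s\<in>{fst r<..<snd r}. h s = 0 --> s = t)" for t and r :: "real \<times> real"
 have "EX r. W t r" if "t \<in> ?Z" for t
 proof -
  obtain D where D: "h t = 0" "(h has_real_derivative D) (at t)" "D ~= 0" using \<open>t \<in> ?Z\<close> by blast
  have "\<forall>\<^sub>F s in at t. (h s - h t) / (s - t) ~= 0"
  using D(2)[unfolded has_field_derivative_iff] D(3) by (rule tendsto_imp_eventually_ne)
  then obtain d where d: "0 < d" "!!s. s ~= t ==> dist s t < d ==> h s ~= 0"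
  using D(1) unfolding eventually_at by auto
  obtain p where p: "p \<in> \<rat>" "t - d < p" "p < t" using Rats_dense_in_real[of "t - d" t] d by auto
  obtain q where q: "q \<in> \<rat>" "t < q" "q < t + d" using Rats_dense_in_real[of t "t + d"] d by auto
  have iso: "s = t" if s: "p < s" "s < q" "h s = 0" for s
  proof (rule ccontr)
  assume "s ~= t"
  moreover have "dist s t < d" using s p q by (auto simp: dist_real_def abs_if)
  ultimately show False using d(2) s(3) by blast
  qed
  show ?thesis
  unfolding W_def
  proof (rule exI[of _ "(p, q)"], unfold fst_conv snd_conv, intro conjI ballI impI)
  show "s = t" if "s \<in> {p<..<q}" "h s = 0" for s by (rule iso) (use that in auto)
  qed (fact p q)+
 qed
 then obtain r where r: "!!t. t \<in> ?Z ==> W t (r t)" using bchoice[of ?Z W] by blast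
 have "inj_on r ?Z"
 proof (rule inj_onI)
  fix s t assume st: "s \<in> ?Z" "t \<in> ?Z" "r s = r t"
  then have "s \<in> {fst (r t)<..<snd (r t)}" "h s = 0" using r[OF st(1)] by (auto simp: W_def)
  then show "s = t" using r[OF st(2)] unfolding W_def by blast
 qed
 moreover have "r ` ?Z <= \<rat> \<times> \<rat>"
  by (rule image_subsetI, drule r) (unfold W_def mem_Times_iff, blast)
 then have "countable (r ` ?Z)" by (rule countable_subset) (simp add: countable_rat)
 ultimately show ?thesis by (rule countable_image_inj_on[rotated])
qed

text \<open>A kink of \<open>relu \<circ> h\<close> at a differentiability point of \<open>h\<close> is an isolated zero of \<open>h\<close>.\<close>
lemma relu_differentiable:
 fixes h :: "real => real"
 assumes h: "h differentiable (at t)" and nz: "\<not> (h t = 0 & (EX D. (h has_real_derivative D) (at t) & D ~= 0))"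
 shows "(%t. relu (h t)) differentiable (at t)"
proof -
 obtain D where D: "(h has_real_derivative D) (at t)" using h by (auto simp: real_differentiable_def)
 have hc: "(h \<longlongrightarrow> h t) (at t)" using DERIV_isCont[OF D] by (simp add: isCont_def)
 consider "0 < h t" | "h t < 0" | "h t = 0" by linarith
 then have "EX D. ((%t. relu (h t)) has_real_derivative D) (at t)"
 proof cases
  case 1
  have "\<forall>\<^sub>F s in at t. h s = relu (h s)" using order_tendstoD(1)[OF hc 1] by (auto elim!: eventually_mono simp: relu_def)
  then have "\<forall>\<^sub>F s in nhds t. h s = relu (h s)" using 1 by (simp add: eventually_nhds_conv_at relu_def)
  then show ?thesis using D DERIV_cong_ev[OF refl, of h "%t. relu (h t)" t D D] by auto
 next
  case 2
  have "\<forall>\<^sub>F s in at t. 0 = relu (h s)" using order_tendstoD(2)[OF hc 2] by (auto elim!: eventually_mono simp: relu_def)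
  then have "\<forall>\<^sub>F s in nhds t. 0 = relu (h s)" using 2 by (simp add: eventually_nhds_conv_at relu_def)
  then show ?thesis using DERIV_cong_ev[OF refl, of "%_. 0" "%t. relu (h t)" t 0 0] by auto
 next
  case 3
  then have "D = 0" using nz D by blast
  then have l: "((%s. (h s - h t) / (s - t)) \<longlongrightarrow> 0) (at t)" using D by (simp add: has_field_derivative_iff)
  have "((%s. (relu (h s) - relu (h t)) / (s - t)) \<longlongrightarrow> 0) (at t)"
  proof (rule Lim_null_comparison[OF _ tendsto_rabs_zero[OF l]])
  show "\<forall>\<^sub>F s in at t. norm ((relu (h s) - relu (h t)) / (s - t)) <= \<bar>(h s - h t) / (s - t)\<bar>"
  using relu_lipschitz by (auto simp: abs_divide intro!: divide_right_mono always_eventually)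
  qed
  then show ?thesis by (auto simp: has_field_derivative_iff)
 qed
 then show ?thesis by (simp add: real_differentiable_def)
qed

lemma pl_fun_relu:
 assumes "pl_fun g" shows "pl_fun (%x. relu (g x))"
proof -
 obtain L where L: "!!x y. \<bar>g x - g y\<bar> <= L * dist x y" using assms unfolding pl_fun_def by auto
 have "\<bar>relu (g x) - relu (g y)\<bar> <= L * dist x y" for x y
  using relu_lipschitz[of "g x" "g y"] L[of x y] by linarith
 moreover have "countable {t. \<not> (%t. relu (g (x + t *\<^sub>R axis i 1))) differentiable (at t)}" for x i
 proof (rule countable_subset)
  let ?h = "%t. g (x + t *\<^sub>R axis i 1)"
  show "{t. \<not> (%t. relu (?h t)) differentiable (at t)}
  <= {t. \<not> ?h differentiable (at t)} Un {t. ?h t = 0 & (EX D. (?h has_real_derivative D) (at t) & D ~= 0)}"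
  using relu_differentiable[of ?h] by blast
  show "countable ..." using assms unfolding pl_fun_def by (intro countable_Un countable_isolated_zeros) auto
 qed
 ultimately show ?thesis unfolding pl_fun_def by auto
qed

lemma pl_fun_continuous: "pl_fun g ==> continuous_on S g"
proof -
 assume "pl_fun g"
 then obtain L where L: "!!x y. \<bar>g x - g y\<bar> <= L * dist x y" unfolding pl_fun_def by auto
 have "lipschitz_on (max L 0) S g"
  unfolding lipschitz_on_def
 proof (intro conjI ballI)
  fix x y :: "real ^ 'a"
  have "L * dist x y <= max L 0 * dist x y" by (intro mult_right_mono) auto
  then show "dist (g x) (g y) <= max L 0 * dist x y" using L[of x y] by (simp add: dist_real_def)
 qed simp
 then show ?thesis by (rule lipschitz_on_continuous_on)
qed

definition diff_quot :: "(real ^ 'n::finite => real) => 'n => nat => real ^ 'n => real" where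
 "diff_quot u i n x = real (Suc n) * (u (x + (1 / real (Suc n)) *\<^sub>R axis i 1) - u x)"

lemma diff_quot_tendsto:
 assumes "((%t. u (x + t *\<^sub>R axis i 1)) has_real_derivative D) (at 0)"
 shows "(%n. diff_quot u i n x) \<longlonglongrightarrow> D"
proof -
 have "((%h. (u (x + h *\<^sub>R axis i 1) - u x) / h) \<longlongrightarrow> D) (at 0)" using assms by (simp add: DERIV_def)
 moreover have "filterlim (%n. 1 / real (Suc n)) (at 0) sequentially"
  unfolding filterlim_at using LIMSEQ_inverse_real_of_nat by (simp add: inverse_eq_divide)
 ultimately have "((%n. (u (x + (1 / real (Suc n)) *\<^sub>R axis i 1) - u x) / (1 / real (Suc n))) \<longlonglongrightarrow> D)"
  by (rule filterlim_compose)
 moreover have "(u (x + (1 / real (Suc n)) *\<^sub>R axis i 1) - u x) / (1 / real (Suc n)) = diff_quot u i n x" for n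
  unfolding diff_quot_def by (simp add: mult.commute)
 ultimately show ?thesis by simp
qed

lemma test_fun_difference_le:
 fixes ph :: "real ^ 'n::finite => real"
 assumes "test_fun U ph" "!!x. \<bar>dpart i ph x\<bar> <= B"
 shows "\<bar>ph (x + s *\<^sub>R axis i 1) - ph (x + t *\<^sub>R axis i 1)\<bar> <= B * \<bar>s - t\<bar>"
proof -
 have "norm (ph (x + s *\<^sub>R axis i 1) - ph (x + t *\<^sub>R axis i 1)) <= B * norm (s - t)"
  by (rule field_differentiable_bound[where S = UNIV and f' = "%t. dpart i ph (x + t *\<^sub>R axis i 1)"])
  (use assms differentiable_line[OF test_fun_differentiable[OF assms(1)]] in \<open>auto simp: has_field_derivative_at_within\<close>)
 then show ?thesis by simp
qed

lemma continuous_times_bounded_integrable: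
 fixes u v :: "real ^ 'n::finite => real"
 assumes u: "continuous_on UNIV u" and [measurable]: "v \<in> borel_measurable borel"
  and v: "!!x. \<bar>v x\<bar> <= B * indicator (cbox a b) x"
 shows "integrable lborel (%x. u x * v x)"
proof (rule Bochner_Integration.integrable_bound)
 have [measurable]: "u \<in> borel_measurable borel" by (rule borel_measurable_continuous_onI[OF u])
 show "integrable lborel (%x. indicator (cbox a b) x *\<^sub>R (B * \<bar>u x\<bar>))"
  by (rule borel_integrable_compact) (use u in \<open>auto intro!: continuous_intros intro: continuous_on_subset\<close>)
 show "(%x. u x * v x) \<in> borel_measurable lborel" by measurable
 have "\<bar>u x * v x\<bar> <= \<bar>indicator (cbox a b) x * (B * \<bar>u x\<bar>)\<bar>" for x
 proof -
  have "\<bar>u x * v x\<bar> <= \<bar>u x\<bar> * (B * indicator (cbox a b) x)" unfolding abs_mult by (intro mult_left_mono v) auto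
  then show ?thesis by (simp add: mult_ac)
 qed
 then show "AE x in lborel. norm (u x * v x) <= norm (indicator (cbox a b) x *\<^sub>R (B * \<bar>u x\<bar>))" by simp
qed

text \<open>Difference quotients are bounded by the Lipschitz constant and converge almost
  everywhere; moving them onto the test function and dominated convergence give the weak derivative.
  The limit is part of the conclusion because the gradient error is later read off from difference
  quotients.\<close>

lemma pl_fun_weak_deriv:
 fixes u :: "real ^ 'n::finite => real"
 assumes pl: "pl_fun u"
 obtains g where "weak_deriv cube (unit_mi i) u g" "AE x in lborel. (%n. diff_quot u i n x) \<longlonglongrightarrow> g x"
proof -
 let ?e = "axis i 1 :: real ^ 'n"
 obtain L where L: "!!x y. \<bar>u x - u y\<bar> <= L * dist x y" using pl unfolding pl_fun_def by auto
 have uc: "continuous_on UNIV u" by (rule pl_fun_continuous[OF pl])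
 have [measurable]: "u \<in> borel_measurable borel" by (rule borel_measurable_continuous_onI[OF uc])
 have [measurable]: "(%x. diff_quot u i n x) \<in> borel_measurable borel" for n unfolding diff_quot_def by measurable
 have qL: "\<bar>diff_quot u i n x\<bar> <= L" for n x
 proof -
  have "\<bar>diff_quot u i n x\<bar> <= real (Suc n) * (L * (1 / real (Suc n)))"
  unfolding diff_quot_def abs_mult abs_of_nat using L[of "x + (1 / real (Suc n)) *\<^sub>R ?e" x]
  by (intro mult_left_mono) (auto simp: dist_norm norm_axis_1)
  then show ?thesis by simp
 qed
 \<comment> \<open>Clipped to [-L, L], so that g is bounded also where the quotients
   diverge.\<close>
 define g where "g x = max (- L) (min L (lim (%n. diff_quot u i n x)))" for x
 have [measurable]: "g \<in> borel_measurable borel" unfolding g_def by measurable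
 have L0: "0 <= L" using qL[of 0 0] by linarith
 have gL: "\<bar>g x\<bar> <= L" for x using L0 by (auto simp: g_def)
 define N where "N = {x. \<not> Cauchy (%n. diff_quot u i n x)}"
 have [measurable]: "N \<in> sets borel" unfolding N_def by measurable
 have "AE x in lborel. x ~: N"
 proof (rule AE_lines_countable[where w = ?e])
  fix x
  have "{t. x + t *\<^sub>R ?e \<in> N} <= {t. \<not> (%t. u (x + t *\<^sub>R ?e)) differentiable (at t)}"
  proof (rule Collect_mono, rule impI, rule notI)
  fix t assume t: "x + t *\<^sub>R ?e \<in> N" "(%t. u (x + t *\<^sub>R ?e)) differentiable (at t)"
  then obtain D where "((%t. u (x + t *\<^sub>R ?e)) has_real_derivative D) (at t)" by (auto simp: real_differentiable_def)
  then have "((%s. u ((x + t *\<^sub>R ?e) + s *\<^sub>R ?e)) has_real_derivative D) (at 0)"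
  by (simp add: DERIV_def scaleR_left_distrib add.assoc)
  from diff_quot_tendsto[OF this] show False using t(1) by (auto simp: N_def intro: LIMSEQ_imp_Cauchy)
  qed
  then show "countable {t. x + t *\<^sub>R ?e \<in> N}" using pl unfolding pl_fun_def by (meson countable_subset)
 qed simp
 then have lim: "AE x in lborel. (%n. diff_quot u i n x) \<longlonglongrightarrow> g x"
 proof (eventually_elim)
  case (elim x)
  then have c: "(%n. diff_quot u i n x) \<longlonglongrightarrow> lim (%n. diff_quot u i n x)"
  by (simp add: N_def Cauchy_convergent_iff convergent_LIMSEQ_iff)
  have "\<bar>lim (%n. diff_quot u i n x)\<bar> <= L"
  by (rule tendsto_upperbound[OF tendsto_rabs[OF c]]) (auto simp: qL)
  then have "g x = lim (%n. diff_quot u i n x)" by (auto simp: g_def)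
  then show ?case using c by simp
 qed
 have "weak_deriv cube (unit_mi i) u g"
  unfolding weak_deriv_def
 proof (intro conjI allI impI)
  show "loc_int cube u" unfolding loc_int_def set_integrable_def
  by (intro conjI allI impI borel_integrable_compact continuous_on_subset[OF uc]) auto
  have "integrable lborel (%x. indicator K x *\<^sub>R g x)" if K: "compact K" for K
  proof (rule Bochner_Integration.integrable_bound)
  show "integrable lborel (%x. indicator K x *\<^sub>R L)" using K by (intro borel_integrable_compact) auto
  have [measurable]: "K \<in> sets borel" using K by (simp add: borel_compact)
  show "(%x. indicator K x *\<^sub>R g x) \<in> borel_measurable lborel" by measurable
  show "AE x in lborel. norm (indicator K x *\<^sub>R g x) <= norm (indicator K x *\<^sub>R L)"
  using gL L0 by (auto simp: indicator_def)
  qed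
  then show "loc_int cube g" unfolding loc_int_def set_integrable_def by auto
  fix ph :: "real ^ 'n => real" and ds assume a: "test_fun cube ph & (ALL j. count (mset ds) j = unit_mi i j)"
  then have ph: "test_fun cube ph" by simp
  have "mset ds = {#i#}" using a by (intro multiset_eqI) (auto simp: unit_mi_def)
  then have ds: "ds = [i]" by simp
  have s0: "ph x = 0" if "x ~: cube" for x using ph that closure_subset[of "{x. ph x ~= 0}"] unfolding test_fun_def by blast
  have s1: "dpart i ph x = 0" if "x ~: cube" for x
  by (rule dpart_eq_0_outside) (use ph that in \<open>auto simp: test_fun_def\<close>)
  obtain B where B: "B > 0" "!!x. \<bar>ph x\<bar> <= B" by (rule test_fun_bounded[OF ph]) (rule that; assumption)
  obtain B' where B': "B' > 0" "!!x. \<bar>dpart i ph x\<bar> <= B'" by (rule test_fun_bounded[OF test_fun_dpart[OF ph, of i]]) (rule that; assumption)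
  have [measurable]: "ph \<in> borel_measurable borel" by (rule test_fun_measurable[OF ph])
  have [measurable]: "dpart i ph \<in> borel_measurable borel" by (rule test_fun_measurable[OF test_fun_dpart[OF ph]])
  \<comment> \<open>Contains the cube enlarged by 1, hence the supports of all shifted test
    functions.\<close>
  let ?Q = "cbox (\<chi> _. -2) (\<chi> _. 2) :: (real ^ 'n) set"
  let ?w = "%n. (1 / real (Suc n)) *\<^sub>R ?e"
  have w1: "\<bar>?w n $ j\<bar> <= 1" for n j by (auto simp: axis_def divide_le_eq_1)
  have sQ: "ph (x - ?w n) = 0" "ph x = 0" if xQ: "x ~: ?Q" for x n
  proof -
  obtain j where j: "x $ j < -2 | 2 < x $ j" using xQ by (auto simp: mem_box_cart not_le)
  then have "\<not> (0 < (x - ?w n) $ j & (x - ?w n) $ j < 1)" "\<not> (0 < x $ j & x $ j < 1)"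
  using w1[of n j] by (auto simp del: vector_scaleR_component)
  then have "x - ?w n ~: cube" "x ~: cube" unfolding cube_def by blast+
  then show "ph (x - ?w n) = 0" "ph x = 0" by (auto intro: s0)
  qed
  have b1: "\<bar>ph x\<bar> <= B * indicator ?Q x" "\<bar>ph (x - ?w n)\<bar> <= B * indicator ?Q x" for x n
  using B sQ[of x] by (auto simp: indicator_def simp del: vector_scaleR_component)
  define p where "p n x = real (Suc n) * (ph x - ph (x - ?w n))" for n x
  have [measurable]: "p n \<in> borel_measurable borel" for n unfolding p_def by measurable
  have pb: "\<bar>p n x\<bar> <= B' * indicator ?Q x" for n x
  proof (cases "x \<in> ?Q")
  case True
  have "\<bar>ph (x + 0 *\<^sub>R ?e) - ph (x + (- (1 / real (Suc n))) *\<^sub>R ?e)\<bar> <= B' * \<bar>0 - (- (1 / real (Suc n)))\<bar>"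
  by (rule test_fun_difference_le[OF ph B'(2)])
  then have d: "\<bar>ph x - ph (x - ?w n)\<bar> <= B' * (1 / real (Suc n))" unfolding scaleR_minus_left by simp
  have "\<bar>p n x\<bar> <= real (Suc n) * (B' * (1 / real (Suc n)))"
  unfolding p_def abs_mult abs_of_nat by (intro mult_left_mono d) simp
  then show ?thesis using True by simp
  next
  case False
  then show ?thesis using sQ(1)[of x n] sQ(2)[of x] unfolding p_def by simp
  qed
  have pl: "(%n. p n x) \<longlonglongrightarrow> dpart i ph x" for x
  proof -
  have "((%s. ph (x + s *\<^sub>R ?e)) has_real_derivative dpart i ph (x + 0 *\<^sub>R ?e)) (at 0)"
  by (rule differentiable_line[OF test_fun_differentiable[OF ph]])
  then have "((%h. (ph (x + h *\<^sub>R ?e) - ph x) / h) \<longlongrightarrow> dpart i ph x) (at 0)" by (simp add: DERIV_def)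
  moreover have "filterlim (%n. - (1 / real (Suc n))) (at 0) sequentially"
  unfolding filterlim_at using tendsto_minus[OF LIMSEQ_inverse_real_of_nat] by (simp add: inverse_eq_divide)
  ultimately have "(%n. (ph (x + (- (1 / real (Suc n))) *\<^sub>R ?e) - ph x) / (- (1 / real (Suc n)))) \<longlonglongrightarrow> dpart i ph x"
  by (rule filterlim_compose)
  moreover have "(ph (x + (- (1 / real (Suc n))) *\<^sub>R ?e) - ph x) / (- (1 / real (Suc n))) = p n x" for n
  unfolding p_def scaleR_minus_left by (simp add: algebra_simps)
  ultimately show ?thesis by simp
  qed
  have I1: "(%n. LINT x|lborel. u x * p n x) \<longlonglongrightarrow> (LINT x|lborel. u x * dpart i ph x)"
  proof (rule integral_dominated_convergence[where w = "%x. \<bar>u x\<bar> * (B' * indicator ?Q x)"])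
  show "integrable lborel (%x. \<bar>u x\<bar> * (B' * indicator ?Q x))"
  by (rule continuous_times_bounded_integrable[where B = B' and a = "\<chi> _. -2" and b = "\<chi> _. 2"])
  (use uc B' in \<open>auto intro!: continuous_intros\<close>)
  show "AE x in lborel. (%n. u x * p n x) \<longlonglongrightarrow> u x * dpart i ph x" using pl by (intro AE_I2 tendsto_intros) auto
  show "AE x in lborel. norm (u x * p n x) <= \<bar>u x\<bar> * (B' * indicator ?Q x)" for n
  using pb by (auto simp: abs_mult intro!: AE_I2 mult_left_mono)
  qed measurable
  have iu: "integrable lborel (%x. u x * ph x)" "integrable lborel (%x. u x * ph (x - ?w n))" for n
  by (rule continuous_times_bounded_integrable[OF uc _ b1(1)], measurable)
  (rule continuous_times_bounded_integrable[OF uc _ b1(2)], measurable)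
  \<comment> \<open>Summation by parts: a translation in the integral moves the difference quotient
    from \<open>ph\<close> to u.\<close>
  have eq: "(LINT x|lborel. u x * p n x) = - (LINT x|lborel. diff_quot u i n x * ph x)" for n
  proof -
  have sh: "(LINT x|lborel. u x * ph (x - ?w n)) = (LINT x|lborel. u (x + ?w n) * ph x)"
  using integral_shift[where g = "%x. u x * ph (x - ?w n)" and w = "?w n"] by simp
  have ish: "integrable lborel (%x. u (x + ?w n) * ph x)" using integrable_shift[OF iu(2)[of n], where w = "?w n"] by simp
  have "(LINT x|lborel. u x * p n x) = (LINT x|lborel. real (Suc n) * (u x * ph x) - real (Suc n) * (u x * ph (x - ?w n)))"
  unfolding p_def by (intro Bochner_Integration.integral_cong refl) (simp only: algebra_simps)
  also have "... = real (Suc n) * (LINT x|lborel. u x * ph x) - real (Suc n) * (LINT x|lborel. u x * ph (x - ?w n))"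
  using iu by (simp only: integral_mult_right_zero integrable_mult_right Bochner_Integration.integral_diff)
  also have "... = - (real (Suc n) * (LINT x|lborel. u (x + ?w n) * ph x) - real (Suc n) * (LINT x|lborel. u x * ph x))"
  unfolding sh by simp
  also have "... = - (LINT x|lborel. real (Suc n) * (u (x + ?w n) * ph x) - real (Suc n) * (u x * ph x))"
  using iu(1) ish by (simp only: integral_mult_right_zero integrable_mult_right Bochner_Integration.integral_diff)
  also have "... = - (LINT x|lborel. diff_quot u i n x * ph x)"
  unfolding diff_quot_def by (intro arg_cong[of _ _ uminus] Bochner_Integration.integral_cong refl) (simp only: algebra_simps)
  finally show ?thesis .
  qed
  have I2: "(%n. LINT x|lborel. diff_quot u i n x * ph x) \<longlonglongrightarrow> (LINT x|lborel. g x * ph x)"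
  proof (rule integral_dominated_convergence[where w = "%x. L * (B * indicator ?Q x)"])
  show "integrable lborel (%x. L * (B * indicator ?Q x))"
  by (rule continuous_times_bounded_integrable[where B = B and a = "\<chi> _. -2" and b = "\<chi> _. 2"])
  (use B in \<open>auto intro!: continuous_intros\<close>)
  show "AE x in lborel. (%n. diff_quot u i n x * ph x) \<longlonglongrightarrow> g x * ph x"
  using lim by eventually_elim (intro tendsto_intros)
  show "AE x in lborel. norm (diff_quot u i n x * ph x) <= L * (B * indicator ?Q x)" for n
  unfolding real_norm_def abs_mult using qL b1(1) L0 by (intro AE_I2 mult_mono) auto
  qed measurable
  have "(LINT x|lborel. u x * dpart i ph x) = - (LINT x|lborel. g x * ph x)"
  by (rule LIMSEQ_unique[OF I1]) (unfold eq, rule tendsto_minus[OF I2])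
  moreover have "(LINT x:cube|lborel. u x * dpart i ph x) = (LINT x|lborel. u x * dpart i ph x)"
  unfolding set_lebesgue_integral_def using s1 by (intro Bochner_Integration.integral_cong) (auto simp: indicator_def)
  moreover have "(LINT x:cube|lborel. g x * ph x) = (LINT x|lborel. g x * ph x)"
  unfolding set_lebesgue_integral_def using s0 by (intro Bochner_Integration.integral_cong) (auto simp: indicator_def)
  moreover have "mi_abs (unit_mi i) = 1" by (simp add: mi_abs_def unit_mi_def)
  ultimately show "(LINT x:cube|lborel. u x * dparts ds ph x) = (- 1) ^ mi_abs (unit_mi i) * (LINT x:cube|lborel. g x * ph x)"
  unfolding ds by simp
 qed
 then show thesis using lim by (rule that)
qed

section \<open>Approximate squares and products by sawtooth functions\<close>

definition tent :: "real => real" where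
 "tent t = 2 * relu t - 4 * relu (t - 1 / 2)"

lemma tent_low: "0 <= t ==> t <= 1 / 2 ==> tent t = 2 * t"
 and tent_high: "1 / 2 <= t ==> tent t = 2 - 2 * t"
 and tent_range: "0 <= t ==> t <= 1 ==> 0 <= tent t & tent t <= 1"
 by (auto simp: tent_def relu_def max_def)

lemma tent_lipschitz: "0 <= s ==> 0 <= t ==> \<bar>tent s - tent t\<bar> <= 2 * \<bar>s - t\<bar>"
 by (cases "s <= 1 / 2"; cases "t <= 1 / 2") (auto simp: tent_low tent_high abs_if)

lemma funpow_tent_range: "0 <= t ==> t <= 1 ==> 0 <= (tent ^^ k) t & (tent ^^ k) t <= 1"
 by (induction k) (use tent_range in auto)

text \<open>On [0, 1] this is the piecewise linear interpolant of the square at the dyadic points of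
  level m: each sawtooth corrects the midpoints of the previous level.\<close>

definition sqa :: "nat => real => real" where
 "sqa m x = x - (\<Sum>i<m. (tent ^^ Suc i) x / 4 ^ Suc i)"

text \<open>Self-similarity, splitting off the first sawtooth: estimates at level
  \<open>Suc m\<close> reduce to level m at the point \<open>tent x\<close>.\<close>

lemma sqa_Suc: "sqa (Suc m) x = x - tent x / 2 + sqa m (tent x) / 4"
proof -
 have "(\<Sum>i<Suc m. (tent ^^ Suc i) x / 4 ^ Suc i) = tent x / 4 + (\<Sum>i<m. (tent ^^ Suc i) (tent x) / 4 ^ Suc i) / 4"
  unfolding sum.lessThan_Suc_shift sum_divide_distrib by (simp add: funpow_swap1 field_simps)
 then show ?thesis unfolding sqa_def diff_divide_distrib by linarith
qed

text \<open>On either half of [0, 1] the tent map is affine and the claim reduces to level m; across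
  1/2 the two estimates add. Monotonicity keeps \<open>mul\<close> in [0, 1] and its partial results
  nonnegative.\<close>

lemma sqa_mono:
 assumes "0 <= v" "v <= u" "u <= 1"
 shows "0 <= sqa m u - sqa m v & sqa m u - sqa m v <= 2 * (u - v)"
 using assms
proof (induction m arbitrary: u v)
 case 0
 then show ?case by (simp add: sqa_def)
next
 case (Suc m)
 have low: "sqa (Suc m) x = sqa m (2 * x) / 4" if "0 <= x" "x <= 1 / 2" for x
  using that by (simp add: sqa_Suc tent_low)
 have high: "sqa (Suc m) x = 2 * x - 1 + sqa m (2 - 2 * x) / 4" if "1 / 2 <= x" for x
  using that by (simp add: sqa_Suc tent_high diff_divide_distrib)
 have L: "0 <= sqa (Suc m) u - sqa (Suc m) v & sqa (Suc m) u - sqa (Suc m) v <= 2 * (u - v)"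
  if "0 <= v" "v <= u" "u <= 1 / 2" for u v
  using Suc.IH[of "2 * v" "2 * u"] that by (simp add: low)
 have H: "0 <= sqa (Suc m) u - sqa (Suc m) v & sqa (Suc m) u - sqa (Suc m) v <= 2 * (u - v)"
  if "1 / 2 <= v" "v <= u" "u <= 1" for u v
  using Suc.IH[of "2 - 2 * u" "2 - 2 * v"] that by (simp add: high)
 consider "u <= 1 / 2" | "1 / 2 <= v" | "v <= 1 / 2" "1 / 2 <= u" by linarith
 then show ?case
 proof cases
  case 3
  show ?thesis using L[OF Suc.prems(1) 3(1) order_refl] H[OF order_refl 3(2) Suc.prems(3)]
  unfolding right_diff_distrib by safe linarith+
 qed (use L H Suc.prems in auto)
qed

lemma sqa_0: "sqa m 0 = 0"
 by (induction m) (auto simp: sqa_Suc tent_low, simp add: sqa_def)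

lemma sqa_1: "sqa m 1 = 1"
 by (cases m) (auto simp: sqa_Suc tent_high sqa_0, simp add: sqa_def)

text \<open>The error reproduces itself under the tent map with factor 1/4; as the tent map has
  slope 2, its Lipschitz constant still halves from level to level.\<close>

lemma sqa_Suc_error:
 assumes "0 <= x" "x <= 1" shows "sqa (Suc m) x - x^2 = (sqa m (tent x) - (tent x)^2) / 4"
 by (cases "x <= 1 / 2") (use assms in \<open>auto simp: sqa_Suc tent_low tent_high power2_eq_square field_simps\<close>)

lemma sqa_error: "0 <= x ==> x <= 1 ==> \<bar>sqa m x - x^2\<bar> <= (1 / 4) ^ Suc m"
proof (induction m arbitrary: x)
 case 0
 have "0 <= (x - 1 / 2)^2" by simp
 moreover have "x^2 <= x" using 0 by (simp add: power2_eq_square mult_left_le)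
 ultimately show ?case by (simp add: sqa_def power2_eq_square algebra_simps)
next
 case (Suc m)
 have "\<bar>sqa m (tent x) - (tent x)^2\<bar> <= (1 / 4) ^ Suc m" using tent_range[OF Suc.prems] by (intro Suc.IH) auto
 then show ?case unfolding sqa_Suc_error[OF Suc.prems] abs_divide by simp
qed

lemma sqa_error_lipschitz:
 "0 <= x ==> x <= 1 ==> 0 <= y ==> y <= 1 ==> \<bar>(sqa m x - x^2) - (sqa m y - y^2)\<bar> <= (1 / 2) ^ m * \<bar>x - y\<bar>"
proof (induction m arbitrary: x y)
 case 0
 have "(x - x^2) - (y - y^2) = (1 - x - y) * (x - y)" by (simp add: power2_eq_square algebra_simps)
 moreover have "\<bar>(1 - x - y) * (x - y)\<bar> <= 1 * \<bar>x - y\<bar>" unfolding abs_mult using 0 by (intro mult_right_mono) auto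
 ultimately show ?case by (simp add: sqa_def)
next
 case (Suc m)
 have "\<bar>(sqa (Suc m) x - x^2) - (sqa (Suc m) y - y^2)\<bar> = \<bar>(sqa m (tent x) - (tent x)^2) - (sqa m (tent y) - (tent y)^2)\<bar> / 4"
  using Suc.prems by (simp add: sqa_Suc_error flip: diff_divide_distrib)
 also have "... <= ((1 / 2) ^ m * \<bar>tent x - tent y\<bar>) / 4"
  using Suc.prems tent_range by (intro divide_right_mono Suc.IH) auto
 also have "... <= ((1 / 2) ^ m * (2 * \<bar>x - y\<bar>)) / 4"
  using Suc.prems by (intro divide_right_mono mult_left_mono tent_lipschitz) auto
 finally show ?case by (simp add: mult.commute)
qed

text \<open>Polarization: both arguments of \<open>sqa\<close> lie in [0, 1] whenever a and b
  do.\<close>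

definition mul :: "nat => real => real => real" where
 "mul m a b = sqa m ((a + b) / 2) - sqa m (\<bar>a - b\<bar> / 2)"

lemma mul_range:
 assumes "0 <= a" "a <= 1" "0 <= b" "b <= 1" shows "0 <= mul m a b & mul m a b <= 1"
proof -
 have "0 <= mul m a b"
  unfolding mul_def using sqa_mono[of "\<bar>a - b\<bar> / 2" "(a + b) / 2" m] assms by (auto simp: abs_if)
 moreover have "sqa m ((a + b) / 2) <= 1" using sqa_mono[of "(a + b) / 2" 1 m] assms by (simp add: sqa_1)
 moreover have "0 <= sqa m (\<bar>a - b\<bar> / 2)" using sqa_mono[of 0 "\<bar>a - b\<bar> / 2" m] assms by (auto simp: sqa_0 abs_if)
 ultimately show ?thesis unfolding mul_def by linarith
qed

lemma mul_minus_product: "mul m a b - a * b = (sqa m ((a + b) / 2) - ((a + b) / 2)^2) - (sqa m (\<bar>a - b\<bar> / 2) - (\<bar>a - b\<bar> / 2)^2)"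
 by (simp add: mul_def power2_eq_square field_simps abs_if)

lemma mul_error:
 assumes "0 <= a" "a <= 1" "0 <= b" "b <= 1" shows "\<bar>mul m a b - a * b\<bar> <= (1 / 2) ^ m"
proof -
 have "\<bar>mul m a b - a * b\<bar> <= (1 / 4) ^ Suc m + (1 / 4) ^ Suc m"
  unfolding mul_minus_product using sqa_error[of "(a + b) / 2" m] sqa_error[of "\<bar>a - b\<bar> / 2" m] assms by (auto simp: abs_if split: if_splits)
 also have "... <= 1 * (1 / 4) ^ m" by simp
 also have "... <= (1 / 2) ^ m" unfolding mult_1_left by (intro power_mono) auto
 finally show ?thesis .
qed

lemma mul_error_lipschitz:
 assumes "0 <= a" "a <= 1" "0 <= b" "b <= 1" "0 <= a'" "a' <= 1" "0 <= b'" "b' <= 1"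
 shows "\<bar>(mul m a b - a * b) - (mul m a' b' - a' * b')\<bar> <= (1 / 2) ^ m * (\<bar>a - a'\<bar> + \<bar>b - b'\<bar>)"
proof -
 let ?e = "%x. sqa m x - x^2"
 have "\<bar>?e ((a + b) / 2) - ?e ((a' + b') / 2)\<bar> <= (1 / 2) ^ m * \<bar>(a + b) / 2 - (a' + b') / 2\<bar>"
  by (rule sqa_error_lipschitz) (use assms in auto)
 moreover have "\<bar>?e (\<bar>a - b\<bar> / 2) - ?e (\<bar>a' - b'\<bar> / 2)\<bar> <= (1 / 2) ^ m * \<bar>\<bar>a - b\<bar> / 2 - \<bar>a' - b'\<bar> / 2\<bar>"
  by (rule sqa_error_lipschitz) (use assms in auto)
 moreover have "(1 / 2) ^ m * \<bar>(a + b) / 2 - (a' + b') / 2\<bar> <= (1 / 2) ^ m * ((\<bar>a - a'\<bar> + \<bar>b - b'\<bar>) / 2)"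
 proof (rule mult_left_mono)
  have "(a + b) / 2 - (a' + b') / 2 = ((a - a') + (b - b')) / 2" by (simp add: field_simps)
  then have "\<bar>(a + b) / 2 - (a' + b') / 2\<bar> = \<bar>(a - a') + (b - b')\<bar> / 2" by (simp only: abs_divide abs_numeral)
  also have "... <= (\<bar>a - a'\<bar> + \<bar>b - b'\<bar>) / 2" by (intro divide_right_mono abs_triangle_ineq) simp
  finally show "\<bar>(a + b) / 2 - (a' + b') / 2\<bar> <= (\<bar>a - a'\<bar> + \<bar>b - b'\<bar>) / 2" .
 qed simp
 moreover have "(1 / 2) ^ m * \<bar>\<bar>a - b\<bar> / 2 - \<bar>a' - b'\<bar> / 2\<bar> <= (1 / 2) ^ m * ((\<bar>a - a'\<bar> + \<bar>b - b'\<bar>) / 2)"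
 proof (rule mult_left_mono)
  have "\<bar>\<bar>a - b\<bar> / 2 - \<bar>a' - b'\<bar> / 2\<bar> = \<bar>\<bar>a - b\<bar> - \<bar>a' - b'\<bar>\<bar> / 2" by (simp flip: diff_divide_distrib)
  also have "... <= (\<bar>a - a'\<bar> + \<bar>b - b'\<bar>) / 2" by (intro divide_right_mono) (linarith, simp)
  finally show "\<bar>\<bar>a - b\<bar> / 2 - \<bar>a' - b'\<bar> / 2\<bar> <= (\<bar>a - a'\<bar> + \<bar>b - b'\<bar>) / 2" .
 qed simp
 moreover have "(1 / 2) ^ m * ((\<bar>a - a'\<bar> + \<bar>b - b'\<bar>) / 2) + (1 / 2) ^ m * ((\<bar>a - a'\<bar> + \<bar>b - b'\<bar>) / 2) = (1 / 2) ^ m * (\<bar>a - a'\<bar> + \<bar>b - b'\<bar>)" by simp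
 moreover have "\<bar>X - X'\<bar> <= u ==> \<bar>Y - Y'\<bar> <= v ==> u <= w ==> v <= w ==> w + w = z ==> \<bar>(X - Y) - (X' - Y')\<bar> <= z"
  for X X' Y Y' u v w z :: real by linarith
 ultimately show ?thesis unfolding mul_minus_product by blast
qed

section \<open>Building networks layer by layer\<close>

text \<open>A network without its output layer: \<open>relu\<close> acts after every layer, so that
  layers can be appended at the end.\<close>

fun heval :: "nn => real list => real list" where
 "heval [] x = x"
| "heval ((A, b) # L) x = heval L (map relu (map2 (+) (matvec A x) b))"

fun hwf :: "nat => nn => nat => bool" where
 "hwf n [] k = (n = k)"
| "hwf n ((A, b) # L) k = (length b = length A & (\<forall>row\<in>set A. length row = n) & hwf (length A) L k)"

lemma heval_snoc: "heval (L @ [(A, b)]) x = map relu (map2 (+) (matvec A (heval L x)) b)"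
 by (induction L arbitrary: x) auto

lemma hwf_snoc: "hwf n L p ==> length b = length A ==> (\<forall>row\<in>set A. length row = p) ==> hwf n (L @ [(A, b)]) (length A)"
 by (induction L arbitrary: n) auto

lemma nn_eval_snoc: "nn_eval (L @ [(A, b)]) x = map2 (+) (matvec A (heval L x)) b"
proof (induction L arbitrary: x)
 case (Cons a L)
 obtain A' b' where a: "a = (A', b')" by fastforce
 have "nn_eval ((A', b') # (L @ [(A, b)])) x = nn_eval (L @ [(A, b)]) (map relu (map2 (+) (matvec A' x) b'))"
  by (cases "L @ [(A, b)]") auto
 then show ?case using Cons by (simp add: a)
qed simp

lemma nn_wf_from_snoc: "hwf n L p ==> length A = 1 ==> length b = 1 ==> (\<forall>row\<in>set A. length row = p) ==> nn_wf_from n (L @ [(A, b)])"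
proof (induction L arbitrary: n)
 case (Cons a L)
 obtain A' b' where a: "a = (A', b')" by fastforce
 have "nn_wf_from n ((A', b') # (L @ [(A, b)])) = (length b' = length A' & (\<forall>row\<in>set A'. length row = n) & nn_wf_from (length A') (L @ [(A, b)]))"
  by (cases "L @ [(A, b)]") auto
 then show ?case using Cons by (simp add: a)
qed simp

text \<open>\<open>affc E K g\<close>: \<open>g\<close> is an affine combination of members of \<open>E\<close> with fewer than \<open>K\<close> terms,
 so that a neuron computing it has at most \<open>K\<close> nonzero weights including the bias.\<close>
definition affc :: "('a => real) set => nat => ('a => real) => bool" where
 "affc E K g \<longleftrightarrow> (EX ws b. (\<forall>(e, w)\<in>set ws. e \<in> E) & length ws < K & g = (%x. (\<Sum>(e, w)\<leftarrow>ws. w * e x) + b))"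

text \<open>Terms with the same function share a matrix entry, so there are at most as many nonzero
  entries as terms.\<close>

lemma sparse_row:
 assumes "\<forall>(e, w)\<in>set ws. e \<in> set es"
 shows "EX row. length row = length es & length (filter (%a. a ~= 0) row) <= length ws \<and>
  (ALL x. sum_list (map2 (*) row (map (%e. e x) es)) = (\<Sum>(e, w)\<leftarrow>ws. w * e x :: real))"
proof -
 have dot: "sum_list (map2 (*) row (map (%e. e x) es)) = (\<Sum>k<length es. row ! k * (es ! k) x)" if "length row = length es" for row :: "real list" and x
  using that by (simp add: sum_list_sum_nth atLeast0LessThan)
 show ?thesis using assms
 proof (induction ws)
  case Nil
  show ?case by (rule exI[of _ "replicate (length es) 0"]) (simp add: dot)
 next
  case (Cons p ws)
  obtain e w where p: "p = (e, w)" by fastforce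
  obtain row where row: "length row = length es" "length (filter (%a. a ~= 0) row) <= length ws"
  "!!x. (\<Sum>k<length es. row ! k * (es ! k) x) = (\<Sum>(e, w)\<leftarrow>ws. w * e x)"
  using Cons dot by auto
  obtain k where k: "k < length es" "es ! k = e" using Cons.prems p by (auto simp: in_set_conv_nth)
  define row' where "row' = row[k := row ! k + w]"
  have len: "length row' = length es" by (simp add: row'_def row)
  have "{i. i < length row' & row' ! i ~= 0} <= insert k {i. i < length row & row ! i ~= 0}"
  by (auto simp: row'_def nth_list_update split: if_splits)
  from card_mono[OF _ this] have "length (filter (%a. a ~= 0) row') <= card (insert k {i. i < length row & row ! i ~= 0})"
  by (simp add: length_filter_conv_card)
  also have "... <= Suc (length (filter (%a. a ~= 0) row))" unfolding length_filter_conv_card by (rule card_insert_le_m1[THEN order_trans]) auto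
  also have "... <= length (p # ws)" using row by simp
  finally have 1: "length (filter (%a. a ~= 0) row') <= length (p # ws)" .
  have "sum_list (map2 (*) row' (map (%e. e x) es)) = (\<Sum>(e, w)\<leftarrow>p # ws. w * e x)" for x
  proof -
  have "sum_list (map2 (*) row' (map (%e. e x) es)) = (\<Sum>i<length es. row ! i * (es ! i) x + (if i = k then w * e x else 0))"
  unfolding dot[OF len] using k row by (intro sum.cong) (auto simp: row'_def algebra_simps)
  also have "... = w * e x + (\<Sum>(e, w)\<leftarrow>ws. w * e x)" using k by (simp add: sum.distrib row(3))
  finally show ?thesis by (simp add: p)
  qed
  then show ?case using 1 len by blast
 qed
qed

text \<open>The functions available after L hidden layers. The inclusion in \<open>set es\<close>
  hides order and multiplicity of the neurons, and \<open>pl_fun\<close> travels along so that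
  realizations are weakly differentiable in the end.\<close>

definition net :: "(real ^ 'n::finite => real) set => nat => nat => bool" where
 "net E L s \<longleftrightarrow> (EX es Ls. E <= set es & length Ls = L & nn_size Ls <= s & hwf CARD('n) Ls (length es)
  & (\<forall>x :: real ^ 'n. heval Ls (vec_to_list x) = map (%e. e x) es) & (\<forall>e\<in>E. pl_fun e))"

lemma net_mono: "net E L s ==> E' <= E ==> s <= s' ==> net E' L s'"
proof -
 assume a: "net E L s" "E' <= E" "s <= s'"
 obtain es Ls where "E <= set es" "length Ls = L" "nn_size Ls <= s" "hwf CARD('a) Ls (length es)"
  "\<forall>x :: real ^ 'a. heval Ls (vec_to_list x) = map (%e. e x) es" "\<forall>e\<in>E. pl_fun e"
  using a(1) unfolding net_def by blast
 then show ?thesis unfolding net_def using a(2,3) by (intro exI[of _ es] exI[of _ Ls]) auto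
qed

lemma bij_coord_enum: "bij_betw (coord_enum :: nat => 'n::finite) {..<CARD('n)} UNIV"
proof -
 have "EX e. bij_betw e {..<CARD('n)} (UNIV :: 'n set)"
  using ex_bij_betw_nat_finite[of "UNIV :: 'n set"] by (simp add: atLeast0LessThan)
 from someI_ex[OF this] show ?thesis unfolding coord_enum_def .
qed

lemma net_coords: "net (range (%k x. (x :: real ^ 'n::finite) $ k)) 0 0"
proof -
 let ?es = "map (%k x. (x :: real ^ 'n) $ coord_enum k) [0..<CARD('n)]"
 have "range (%k x. (x :: real ^ 'n) $ k) = set ?es"
  by (subst bij_betw_imp_surj_on[OF bij_coord_enum[where 'n = 'n], symmetric]) (simp add: atLeast0LessThan image_image)
 then show ?thesis unfolding net_def
  by (intro exI[of _ ?es] exI[of _ "[]"]) (auto simp: nn_size_def vec_to_list_def pl_fun_coord)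
qed

lemma affc_pl_fun:
 assumes "affc E K h" "\<forall>e\<in>E. pl_fun e" shows "pl_fun h"
proof -
 obtain ws b where ws: "\<forall>(e, w)\<in>set ws. e \<in> E" "h = (%x. (\<Sum>(e, w)\<leftarrow>ws. w * e x) + b)" using assms(1) unfolding affc_def by blast
 have "pl_fun (%x. (\<Sum>(e, w)\<leftarrow>ws. w * e x) + b)" using ws(1)
 proof (induction ws)
  case (Cons p ws)
  obtain e w where p: "p = (e, w)" by fastforce
  then have "pl_fun (%x. w * e x + ((\<Sum>(e, w)\<leftarrow>ws. w * e x) + b))" using Cons assms(2) by (intro pl_fun_add_scaled) auto
  then show ?case by (simp add: p add.assoc)
 qed (simp add: pl_fun_const)
 then show ?thesis by (simp add: ws(2))
qed

text \<open>The strict inequality for the rows leaves room for one bias per row.\<close>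

lemma nonzeros_concat_le:
 assumes "!!row. row \<in> set A ==> length (filter (%a. a ~= 0) row) < (K::nat)" "length b = length A"
 shows "length (filter (%a. a ~= 0) (concat A)) + length (filter (%a. a ~= (0::real)) b) <= K * length A"
 using assms
proof (induction A arbitrary: b)
 case (Cons row A)
 then obtain c b' where b: "b = c # b'" by (cases b) auto
 have "length (filter (%a. a ~= 0) (concat A)) + length (filter (%a. a ~= (0::real)) b') <= K * length A" using Cons b by simp
 moreover have "length (filter (%a. a ~= 0) row) < K" using Cons.prems(1) by simp
 ultimately show ?case by (simp add: b)
qed simp

lemma affine_layer:
 assumes "!!g. g \<in> set gs ==> affc (set es) K (h g)"
 obtains A b where "length A = length gs" "length b = length gs" "\<forall>row\<in>set A. length row = length es"
  "length (filter (%a. a ~= 0) (concat A)) + length (filter (%a. a ~= 0) b) <= K * length gs"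
  "!!x. map2 (+) (matvec A (map (%e. e x) es)) b = map (%g. h g x) gs"
proof -
 have "EX rb. length (fst rb) = length es & length (filter (%a. a ~= 0) (fst rb)) < K \<and>
  (ALL x. sum_list (map2 (*) (fst rb) (map (%e. e x) es)) + snd rb = h g x)" if g: "g \<in> set gs" for g
 proof -
  obtain ws b where ws: "\<forall>(e, w)\<in>set ws. e \<in> set es" "length ws < K" "h g = (%x. (\<Sum>(e, w)\<leftarrow>ws. w * e x) + b)"
  using assms[OF g] unfolding affc_def by blast
  obtain row where row: "length row = length es" "length (filter (%a. a ~= 0) row) <= length ws"
  "ALL x. sum_list (map2 (*) row (map (%e. e x) es)) = (\<Sum>(e, w)\<leftarrow>ws. w * e x)" using sparse_row[OF ws(1)] by blast
  show ?thesis by (rule exI[of _ "(row, b)"]) (use ws row in auto)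
 qed
 then obtain rb where rb: "!!g. g \<in> set gs ==> length (fst (rb g)) = length es"
  "!!g. g \<in> set gs ==> length (filter (%a. a ~= 0) (fst (rb g))) < K"
  "!!g x. g \<in> set gs ==> sum_list (map2 (*) (fst (rb g)) (map (%e. e x) es)) + snd (rb g) = h g x" by metis
 show thesis
 proof (rule that[of "map (fst \<circ> rb) gs" "map (snd \<circ> rb) gs"])
  show "length (filter (%a. a ~= 0) (concat (map (fst \<circ> rb) gs))) + length (filter (%a. a ~= 0) (map (snd \<circ> rb) gs)) <= K * length gs"
  using nonzeros_concat_le[of "map (fst \<circ> rb) gs" K "map (snd \<circ> rb) gs"] rb(2) by auto
  show "map2 (+) (matvec (map (fst \<circ> rb) gs) (map (%e. e x) es)) (map (snd \<circ> rb) gs) = map (%g. h g x) gs" for x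
  unfolding matvec_def using rb(3) by (auto simp: zip_map1 zip_map2 zip_same_conv_map)
 qed (use rb(1) in auto)
qed

lemma affc_mono: "affc E K h ==> E <= E' ==> affc E' K h"
 unfolding affc_def by fast

text \<open>Only the functions in G remain available; one that is to be carried on must be listed
  again, which is possible for nonnegative functions because \<open>relu\<close> fixes them.\<close>

lemma net_layer:
 assumes "net E L s" "finite G" and G: "!!g. g \<in> G ==> EX h. affc E K h & g = (%x. relu (h x))"
 shows "net G (Suc L) (s + K * card G)"
proof -
 obtain es Ls where E: "E <= set es" "length Ls = L" "nn_size Ls <= s" "hwf CARD('a) Ls (length es)"
  "!!x :: real ^ 'a. heval Ls (vec_to_list x) = map (%e. e x) es" "\<forall>e\<in>E. pl_fun e"
  using assms(1) unfolding net_def by blast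
 obtain gs where gs: "set gs = G" "distinct gs" using finite_distinct_list[OF assms(2)] by blast
 obtain h where h: "!!g. g \<in> G ==> affc E K (h g)" "!!g. g \<in> G ==> g = (%x. relu (h g x))" using G by metis
 obtain A b where Ab: "length A = length gs" "length b = length gs" "\<forall>row\<in>set A. length row = length es"
  "length (filter (%a. a ~= 0) (concat A)) + length (filter (%a. a ~= 0) b) <= K * length gs"
  "!!x. map2 (+) (matvec A (map (%e. e x) es)) b = map (%g. h g x) gs"
  by (rule affine_layer[of gs es K h]) (use h(1) gs affc_mono[OF _ E(1)] in auto)
 have "heval (Ls @ [(A, b)]) (vec_to_list x) = map (%g. g x) gs" for x :: "real ^ 'a"
 proof -
  have "relu (h g x) = g x" if "g \<in> set gs" for g using fun_cong[OF h(2)[of g], of x] that gs by simp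
  then show ?thesis by (simp add: heval_snoc E(5) Ab(5))
 qed
 moreover have "nn_size (Ls @ [(A, b)]) <= s + K * card G"
  using E(3) Ab(4) distinct_card[OF gs(2)] gs(1) by (simp add: nn_size_def)
 moreover have "pl_fun g" if "g \<in> G" for g
  using h(2)[OF that] pl_fun_relu[OF affc_pl_fun[OF h(1)[OF that] E(6)]] by simp
 moreover have "hwf CARD('a) (Ls @ [(A, b)]) (length gs)" using hwf_snoc[OF E(4), of b A] Ab by simp
 ultimately show ?thesis unfolding net_def
  by (intro exI[of _ gs] exI[of _ "Ls @ [(A, b)]"]) (use gs E(2) in auto)
qed

text \<open>The last layer applies no \<open>relu\<close>, so any affine combination can be output,
  whatever its sign.\<close>

lemma net_output:
 assumes "net E L s" "affc E K (h :: real ^ 'n::finite => real)"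
 obtains Ph where "nn_wf CARD('n) Ph" "nn_depth Ph = Suc L" "nn_size Ph <= s + K" "nn_real Ph = h" "pl_fun h"
proof -
 obtain es Ls where E: "E <= set es" "length Ls = L" "nn_size Ls <= s" "hwf CARD('n) Ls (length es)"
  "!!x :: real ^ 'n. heval Ls (vec_to_list x) = map (%e. e x) es" "\<forall>e\<in>E. pl_fun e"
  using assms(1) unfolding net_def by blast
 obtain A b where Ab: "length A = length [h]" "length b = length [h]" "\<forall>row\<in>set A. length row = length es"
  "length (filter (%a. a ~= 0) (concat A)) + length (filter (%a. a ~= 0) b) <= K * length [h]"
  "!!x. map2 (+) (matvec A (map (%e. e x) es)) b = map (%g. g x) [h]"
  by (rule affine_layer[of "[h]" es K "%g. g"]) (use assms(2) affc_mono[OF _ E(1)] in auto)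
 show thesis
 proof (rule that[of "Ls @ [(A, b)]"])
  show "nn_wf CARD('n) (Ls @ [(A, b)])" unfolding nn_wf_def by (rule nn_wf_from_snoc[OF E(4)]) (use Ab in auto)
  show "nn_size (Ls @ [(A, b)]) <= s + K" using E(3) Ab(4) by (simp add: nn_size_def)
  show "nn_real (Ls @ [(A, b)]) = h" unfolding nn_real_def by (simp add: nn_eval_snoc E(5) Ab(5))
 qed (use E(2) affc_pl_fun[OF assms(2) E(6)] in \<open>auto simp: nn_depth_def\<close>)
qed

text \<open>Neurons with fewer inputs are padded with zero weights, so each one counts at most 6:
  five weights and a bias.\<close>

lemma neuron5:
 assumes "e1 \<in> E" "e2 \<in> E" "e3 \<in> E" "e4 \<in> E" "e5 \<in> E"
  and "!!x. g x = relu (w1 * e1 x + w2 * e2 x + w3 * e3 x + w4 * e4 x + w5 * e5 x + b)"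
 shows "EX h. affc E 6 h & g = (%x. relu (h x))"
 unfolding affc_def
 by (rule exI[of _ "%x. (\<Sum>(e, w)\<leftarrow>[(e1, w1), (e2, w2), (e3, w3), (e4, w4), (e5, w5)]. w * e x) + b"], rule conjI,
  rule exI[of _ "[(e1, w1), (e2, w2), (e3, w3), (e4, w4), (e5, w5)]"], rule exI[of _ b])
  (use assms in \<open>auto simp: fun_eq_iff add.assoc\<close>)

lemma affc_sum:
 assumes "finite B" "!!b. b \<in> B ==> e b \<in> E"
 shows "affc E (Suc (card B)) (%x. \<Sum>b\<in>B. w b * e b x)"
proof -
 obtain bs where bs: "set bs = B" "distinct bs" using finite_distinct_list[OF assms(1)] by blast
 have "(\<Sum>b\<in>B. w b * e b x) = (\<Sum>(e, w)\<leftarrow>map (%b. (e b, w b)) bs. w * e x) + 0" for x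
  using sum_list_distinct_conv_sum_set[OF bs(2), of "%b. w b * e b x"] bs(1) by (simp add: comp_def)
 then show ?thesis unfolding affc_def
  by (intro exI[of _ "map (%b. (e b, w b)) bs"] exI[of _ 0]) (use assms(2) bs distinct_card[OF bs(2)] in auto)
qed

text \<open>All products run in parallel. Per pair each layer keeps five functions: the sawtooth
  iterates p and q of the half sum and the half difference, their parts above 1/2, and the running
  difference r of the approximate squares. This is 6 * 5 = 30 weights per layer, after 18 for the
  preparation.\<close>

lemma net_mul:
 fixes E :: "(real ^ 'n::finite => real) set"
 assumes net: "net E L s" and E: "!!e x. e \<in> E ==> 0 <= e x & e x <= 1"
  and J: "finite J" "!!j. j \<in> J ==> fst j \<in> E & snd j \<in> E"
 shows "net ((%j x. mul m (fst j x) (snd j x)) ` J) (L + m + 2) (s + 48 * (m + 1) * card J)"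
proof -
 define S D where "S j x = (fst j x + snd j x) / 2" and "D j x = \<bar>fst j x - snd j x\<bar> / 2" for j :: "(real ^ 'n => real) \<times> (real ^ 'n => real)" and x :: "real ^ 'n"
 have SD: "0 <= D j x" "D j x <= S j x" "S j x <= 1" "0 <= S j x" "D j x <= 1" if "j \<in> J" for j x
  using E[of "fst j" x] E[of "snd j" x] J(2)[OF that] unfolding S_def D_def by (auto simp: abs_if)
 \<comment> \<open>Positive and negative part of the half difference; the absolute value is their
   sum and is formed in the next layer.\<close>
 define d1 d2 where "d1 j x = relu ((fst j x - snd j x) / 2)" and "d2 j x = relu ((snd j x - fst j x) / 2)" for j :: "(real ^ 'n => real) \<times> (real ^ 'n => real)" and x :: "real ^ 'n"
 have Dd: "D j x = d1 j x + d2 j x" for j x by (auto simp: D_def d1_def d2_def relu_def max_def abs_if)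
 define G1 where "G1 = S ` J Un d1 ` J Un d2 ` J"
 have "net G1 (Suc L) (s + 6 * card G1)"
 proof (rule net_layer[OF net])
  show "finite G1" using J by (simp add: G1_def)
  fix g assume "g \<in> G1"
  then consider j where "j \<in> J" "g = S j" | j where "j \<in> J" "g = d1 j" | j where "j \<in> J" "g = d2 j" unfolding G1_def by blast
  then show "EX h. affc E 6 h & g = (%x. relu (h x))"
  proof cases
  case 1
  have "g x = relu (1 / 2 * fst j x + 1 / 2 * snd j x + 0 * fst j x + 0 * fst j x + 0 * fst j x + 0)" for x
  using SD(4)[OF 1(1), of x] unfolding 1(2) S_def by (simp add: relu_nonneg add_divide_distrib)
  then show ?thesis by (rule neuron5[rotated 5]) (use J(2)[OF 1(1)] in auto)
  next
  case 2
  have "g x = relu (1 / 2 * fst j x + (- 1 / 2) * snd j x + 0 * fst j x + 0 * fst j x + 0 * fst j x + 0)" for x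
  unfolding 2(2) d1_def by (simp add: diff_divide_distrib)
  then show ?thesis by (rule neuron5[rotated 5]) (use J(2)[OF 2(1)] in auto)
  next
  case 3
  have "g x = relu (1 / 2 * snd j x + (- 1 / 2) * fst j x + 0 * fst j x + 0 * fst j x + 0 * fst j x + 0)" for x
  unfolding 3(2) d2_def by (simp add: diff_divide_distrib)
  then show ?thesis by (rule neuron5[rotated 5]) (use J(2)[OF 3(1)] in auto)
  qed
 qed
 moreover have "card G1 <= 3 * card J"
  unfolding G1_def using card_Un_le[of "S ` J Un d1 ` J" "d2 ` J"] card_Un_le[of "S ` J" "d1 ` J"]
  card_image_le[OF J(1), of S] card_image_le[OF J(1), of d1] card_image_le[OF J(1), of d2] by linarith
 ultimately have n1: "net G1 (Suc L) (s + 18 * card J)" by (elim net_mono) auto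
 define p where "p k j x = (tent ^^ k) (S j x)" for k j x
 define q where "q k j x = (tent ^^ k) (D j x)" for k j x
 define p' where "p' k j x = relu (p k j x - 1 / 2)" for k j x
 define q' where "q' k j x = relu (q k j x - 1 / 2)" for k j x
 define r where "r k j x = sqa k (S j x) - sqa k (D j x)" for k j x
 have pq: "0 <= p k j x" "0 <= q k j x" if "j \<in> J" for k j x
  unfolding p_def q_def using funpow_tent_range SD[OF that] by auto
 \<comment> \<open>Nonnegativity lets r pass through \<open>relu\<close> unchanged.\<close>
 have r0: "0 <= r k j x" if "j \<in> J" for k j x
  unfolding r_def using sqa_mono SD[OF that] by auto
 have pS: "p (Suc k) j x = 2 * p k j x - 4 * p' k j x" "q (Suc k) j x = 2 * q k j x - 4 * q' k j x" if "j \<in> J" for k j x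
 proof -
  have "p (Suc k) j x = tent (p k j x)" "q (Suc k) j x = tent (q k j x)" by (simp_all add: p_def q_def)
  then show "p (Suc k) j x = 2 * p k j x - 4 * p' k j x" "q (Suc k) j x = 2 * q k j x - 4 * q' k j x"
  using pq[OF that] by (simp_all add: tent_def p'_def q'_def relu_nonneg)
 qed
 have rS: "r (Suc k) j x = r k j x - (p (Suc k) j x - q (Suc k) j x) / 4 ^ Suc k" for k j x
  unfolding r_def sqa_def p_def q_def by (simp add: diff_divide_distrib)
 define St where "St k = p k ` J Un p' k ` J Un q k ` J Un q' k ` J Un r k ` J" for k
 have Stf: "finite (St k)" for k using J by (simp add: St_def)
 have Stc: "card (St k) <= 5 * card J" for k
  unfolding St_def using card_Un_le[of "p k ` J Un p' k ` J Un q k ` J Un q' k ` J" "r k ` J"]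
  card_Un_le[of "p k ` J Un p' k ` J Un q k ` J" "q' k ` J"] card_Un_le[of "p k ` J Un p' k ` J" "q k ` J"] card_Un_le[of "p k ` J" "p' k ` J"]
  card_image_le[OF J(1), of "p k"] card_image_le[OF J(1), of "p' k"] card_image_le[OF J(1), of "q k"] card_image_le[OF J(1), of "q' k"] card_image_le[OF J(1), of "r k"] by linarith
 have "net (St k) (L + k + 2) (s + 18 * card J + 30 * (k + 1) * card J)" for k
 proof (induction k)
  case 0
  have "net (St 0) (Suc (Suc L)) (s + 18 * card J + 6 * card (St 0))"
  proof (rule net_layer[OF n1 Stf])
  fix g assume "g \<in> St 0"
  then obtain j where j: "j \<in> J" "g = p 0 j | g = p' 0 j | g = q 0 j | g = q' 0 j | g = r 0 j" unfolding St_def by blast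
  have m: "S j \<in> G1" "d1 j \<in> G1" "d2 j \<in> G1" using j by (auto simp: G1_def)
  have "EX a b c. ALL x. g x = relu (a * S j x + b * d1 j x + b * d2 j x + 0 * S j x + 0 * S j x + c)"
  using j(2)
  proof (elim disjE)
  assume "g = p 0 j" then show ?thesis using pq(1)[OF j(1), of 0]
  by (intro exI[of _ 1] exI[of _ 0]) (simp add: p_def relu_nonneg)
  next
  assume "g = p' 0 j" then show ?thesis
  by (intro exI[of _ 1] exI[of _ 0] exI[of _ "- 1 / 2"]) (simp add: p'_def p_def)
  next
  assume "g = q 0 j" then show ?thesis using pq(2)[OF j(1), of 0]
  by (intro exI[of _ 0] exI[of _ 1] exI[of _ 0]) (simp add: q_def relu_nonneg Dd)
  next
  assume "g = q' 0 j" then show ?thesis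
  by (intro exI[of _ 0] exI[of _ 1] exI[of _ "- 1 / 2"]) (simp add: q'_def q_def Dd)
  next
  assume "g = r 0 j" then show ?thesis using r0[OF j(1), of 0]
  by (intro exI[of _ 1] exI[of _ "-1"] exI[of _ 0]) (simp add: r_def relu_nonneg Dd sqa_def diff_diff_eq)
  qed
  then obtain a b c where g: "!!x. g x = relu (a * S j x + b * d1 j x + b * d2 j x + 0 * S j x + 0 * S j x + c)" by blast
  show "EX h. affc G1 6 h & g = (%x. relu (h x))" by (rule neuron5[OF m m(1) m(1) g])
  qed
  note * = net_mono[OF this order_refl, of "s + 18 * card J + 30 * (0 + 1) * card J"]
  have l: "L + 0 + 2 = Suc (Suc L)" by simp
  show ?case unfolding l by (rule *) (use Stc[of 0] in simp)
 next
  case (Suc k)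
  have "net (St (Suc k)) (Suc (L + k + 2)) (s + 18 * card J + 30 * (k + 1) * card J + 6 * card (St (Suc k)))"
  proof (rule net_layer[OF Suc Stf])
  fix g assume "g \<in> St (Suc k)"
  then obtain j where j: "j \<in> J" "g = p (Suc k) j | g = p' (Suc k) j | g = q (Suc k) j | g = q' (Suc k) j | g = r (Suc k) j" unfolding St_def by blast
  have m: "p k j \<in> St k" "p' k j \<in> St k" "q k j \<in> St k" "q' k j \<in> St k" "r k j \<in> St k" using j by (auto simp: St_def)
  have "EX a b c d. ALL x. g x = relu (2 * a * p k j x + (- 4) * a * p' k j x + 2 * b * q k j x + (- 4) * b * q' k j x + c * r k j x + d)"
  using j(2)
  proof (elim disjE)
  assume "g = p (Suc k) j" then show ?thesis using pq(1)[OF j(1), of "Suc k"]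
  by (intro exI[of _ 1] exI[of _ 0] exI[of _ 0] exI[of _ 0]) (simp add: relu_nonneg pS[OF j(1)])
  next
  assume "g = p' (Suc k) j" then show ?thesis
  by (intro exI[of _ 1] exI[of _ 0] exI[of _ 0] exI[of _ "- 1 / 2"]) (simp add: p'_def[of "Suc k"] pS[OF j(1)])
  next
  assume "g = q (Suc k) j" then show ?thesis using pq(2)[OF j(1), of "Suc k"]
  by (intro exI[of _ 0] exI[of _ 1] exI[of _ 0] exI[of _ 0]) (simp add: relu_nonneg pS[OF j(1)])
  next
  assume "g = q' (Suc k) j" then show ?thesis
  by (intro exI[of _ 0] exI[of _ 1] exI[of _ 0] exI[of _ "- 1 / 2"]) (simp add: q'_def[of "Suc k"] pS[OF j(1)])
  next
  assume g: "g = r (Suc k) j"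
  have "r (Suc k) j x = relu (2 * (- 1 / 4 ^ Suc k) * p k j x + (- 4) * (- 1 / 4 ^ Suc k) * p' k j x + 2 * (1 / 4 ^ Suc k) * q k j x + (- 4) * (1 / 4 ^ Suc k) * q' k j x + 1 * r k j x + 0)" (is "_ = relu ?y") for x
  proof -
  have "r (Suc k) j x = ?y" unfolding rS pS[OF j(1)] by (simp add: field_simps)
  then show ?thesis using r0[OF j(1), of "Suc k" x] by (metis relu_nonneg)
  qed
  then show ?thesis unfolding g by blast
  qed
  then obtain a b c d where g: "!!x. g x = relu (2 * a * p k j x + (- 4) * a * p' k j x + 2 * b * q k j x + (- 4) * b * q' k j x + c * r k j x + d)" by blast
  show "EX h. affc (St k) 6 h & g = (%x. relu (h x))" by (rule neuron5[OF m g])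
  qed
  note * = net_mono[OF this order_refl, of "s + 18 * card J + 30 * (Suc k + 1) * card J"]
  have l: "L + Suc k + 2 = Suc (L + k + 2)" by simp
  show ?case unfolding l by (rule *) (use Stc[of "Suc k"] in \<open>simp add: algebra_simps\<close>)
 qed
 note n2 = this
 have "(%j x. mul m (fst j x) (snd j x)) = r m" by (simp add: fun_eq_iff r_def S_def D_def mul_def)
 then have e: "(%j x. mul m (fst j x) (snd j x)) ` J = r m ` J" by (simp only:)
 show ?thesis unfolding e by (intro net_mono[OF n2[of m]]) (simp_all add: St_def algebra_simps)
qed

section \<open>Propagation of errors through products\<close>

definition exf :: "real => (real ^ 'n::finite => real) => bool" where
 "exf La f \<longleftrightarrow> (ALL x. 0 <= f x & f x <= 1) & (ALL x y. \<bar>f x - f y\<bar> <= La * dist x y)"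

text \<open>The Lipschitz error is measured relative to \<open>La\<close>, so that a single number e
  governs both errors and passes through products.\<close>

definition appx :: "real => real => (real ^ 'n::finite => real) => (real ^ 'n => real) => bool" where
 "appx La e g f \<longleftrightarrow> (ALL x. 0 <= g x & g x <= 1) & (ALL x. \<bar>g x - f x\<bar> <= e)
  & (ALL x y. \<bar>(g x - f x) - (g y - f y)\<bar> <= e * La * dist x y)"

text \<open>\<open>appnet La F L s e\<close>: some network of depth \<open>L\<close> and size \<open>s\<close> computes, for each exact function
 in \<open>F\<close>, an approximation with error \<open>e\<close> in the sup norm and \<open>e * La\<close> in the Lipschitz seminorm.\<close>
definition appnet :: "real => (real ^ 'n::finite => real) set => nat => nat => real => bool" where
 "appnet La F L s e \<longleftrightarrow> (EX A. net (A ` F) L s & (\<forall>f\<in>F. appx La e (A f) f))"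

text \<open>For the Lipschitz error, the multiplication unit contributes 4, as each input has
  Lipschitz constant at most \<open>2 * La\<close>, and the product rule contributes 5; the sup
  error is at most 3 e. The constant 10 covers both.\<close>

lemma appx_mul:
 fixes a b a0 b0 :: "real ^ 'n::finite => real"
 assumes a: "appx La e a a0" and b: "appx La e b b0" and a0: "exf La a0" and b0: "exf La b0"
  and m: "(1 / 2) ^ m <= e" "e <= 1" and La: "0 <= La"
 shows "appx La (10 * e) (%x. mul m (a x) (b x)) (%x. a0 x * b0 x)"
proof -
 have e0: "0 <= e" using m(1) by (meson order_trans zero_le_divide_1_iff zero_le_numeral zero_le_power)
 have r: "0 <= a x" "a x <= 1" "0 <= b x" "b x <= 1" "0 <= a0 x" "a0 x <= 1" "0 <= b0 x" "b0 x <= 1" for x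
  using a b a0 b0 unfolding appx_def exf_def by auto
 have err: "\<bar>a x - a0 x\<bar> <= e" "\<bar>b x - b0 x\<bar> <= e" for x using a b unfolding appx_def by auto
 have lerr: "\<bar>(a x - a0 x) - (a y - a0 y)\<bar> <= e * La * dist x y" "\<bar>(b x - b0 x) - (b y - b0 y)\<bar> <= e * La * dist x y"
  "\<bar>a0 x - a0 y\<bar> <= La * dist x y" "\<bar>b0 x - b0 y\<bar> <= La * dist x y" for x y using a b a0 b0 unfolding appx_def exf_def by auto
 have Lad: "0 <= La * dist x y" "e * La * dist x y <= La * dist x y" "0 <= e * La * dist x y" for x y :: "real ^ 'n"
  using La m(2) e0 by (auto intro!: mult_right_mono simp: mult_le_cancel_right1 mult_left_le_one_le)
 have lip: "\<bar>a x - a y\<bar> <= 2 * (La * dist x y)" "\<bar>b x - b y\<bar> <= 2 * (La * dist x y)" for x y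
  using lerr[of x y] Lad[of x y] by linarith+
 show ?thesis unfolding appx_def
 proof (intro conjI allI)
  fix x y
  show "0 <= mul m (a x) (b x)" "mul m (a x) (b x) <= 1" using mul_range r by auto
  have "\<bar>a x * b x - a0 x * b0 x\<bar> = \<bar>(a x - a0 x) * b x + a0 x * (b x - b0 x)\<bar>" by (simp add: algebra_simps)
  also have "... <= \<bar>a x - a0 x\<bar> * \<bar>b x\<bar> + \<bar>a0 x\<bar> * \<bar>b x - b0 x\<bar>" by (simp add: abs_mult order_trans[OF abs_triangle_ineq])
  also have "... <= e * 1 + 1 * e" using r err e0 by (intro add_mono mult_mono) auto
  finally show "\<bar>mul m (a x) (b x) - a0 x * b0 x\<bar> <= 10 * e"
  using mul_error[of "a x" "b x" m] r m e0 by (simp add: abs_le_iff)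
  have 1: "\<bar>(mul m (a x) (b x) - a x * b x) - (mul m (a y) (b y) - a y * b y)\<bar> <= 4 * (e * La * dist x y)"
  proof -
  have "\<bar>(mul m (a x) (b x) - a x * b x) - (mul m (a y) (b y) - a y * b y)\<bar> <= (1 / 2) ^ m * (\<bar>a x - a y\<bar> + \<bar>b x - b y\<bar>)"
  by (rule mul_error_lipschitz) (use r in auto)
  also have "... <= e * (2 * (La * dist x y) + 2 * (La * dist x y))"
  using lip m e0 by (intro mult_mono add_mono) auto
  finally show ?thesis by (simp add: mult.assoc)
  qed
  have 2: "\<bar>(a x * b x - a0 x * b0 x) - (a y * b y - a0 y * b0 y)\<bar> <= 5 * (e * La * dist x y)"
  proof -
  have "(a x * b x - a0 x * b0 x) - (a y * b y - a0 y * b0 y)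
  = ((a x - a0 x) - (a y - a0 y)) * b x + (a y - a0 y) * (b x - b y) + (a0 x - a0 y) * (b x - b0 x) + a0 y * ((b x - b0 x) - (b y - b0 y))"
  by (simp add: algebra_simps)
  also have "\<bar>...\<bar> <= \<bar>(a x - a0 x) - (a y - a0 y)\<bar> * \<bar>b x\<bar> + \<bar>a y - a0 y\<bar> * \<bar>b x - b y\<bar> + \<bar>a0 x - a0 y\<bar> * \<bar>b x - b0 x\<bar> + \<bar>a0 y\<bar> * \<bar>(b x - b0 x) - (b y - b0 y)\<bar>"
  unfolding abs_mult[symmetric] by linarith
  also have "... <= (e * La * dist x y) * 1 + e * (2 * (La * dist x y)) + (La * dist x y) * e + 1 * (e * La * dist x y)"
  using r err lerr lip e0 Lad by (intro add_mono mult_mono) auto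
  finally show ?thesis by (simp add: algebra_simps)
  qed
  have "\<bar>(mul m (a x) (b x) - a0 x * b0 x) - (mul m (a y) (b y) - a0 y * b0 y)\<bar> <= 10 * (e * La * dist x y)"
  using 1 2 Lad(3)[of x y] by linarith
  then show "\<bar>(mul m (a x) (b x) - a0 x * b0 x) - (mul m (a y) (b y) - a0 y * b0 y)\<bar> <= 10 * e * La * dist x y"
  by (simp only: mult.assoc)
 qed
qed

text \<open>One stage of simultaneous multiplications: the depth grows by m + 2 regardless of the
  number of products, which only affects the size.\<close>

lemma appnet_products:
 assumes F: "appnet La F L s e" "!!f. f \<in> F ==> exf La f"
  and F': "finite F'" "!!f. f \<in> F' ==> \<exists>g\<in>F. \<exists>h\<in>F. f = (%x. g x * h x)"
  and m: "(1 / 2) ^ m <= e" "e <= 1" and La: "0 <= La"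
 shows "appnet La F' (L + m + 2) (s + 48 * (m + 1) * card F') (10 * e)"
proof -
 obtain A where A: "net (A ` F) L s" "!!f. f \<in> F ==> appx La e (A f) f" using F(1) unfolding appnet_def by blast
 obtain g h where gh: "!!f. f \<in> F' ==> g f \<in> F & h f \<in> F & f = (%x. g f x * h f x)" using F'(2) by metis
 define J where "J = (%f. (A (g f), A (h f))) ` F'"
 have J: "finite J" "card J <= card F'" using F'(1) by (auto simp: J_def card_image_le)
 have n0: "net ((%j x. mul m (fst j x) (snd j x)) ` J) (L + m + 2) (s + 48 * (m + 1) * card J)"
 proof (rule net_mul[OF A(1) _ J(1)])
  show "0 <= e x & e x <= 1" if "e \<in> A ` F" for e x using that A(2) unfolding appx_def by auto
  show "fst j \<in> A ` F & snd j \<in> A ` F" if "j \<in> J" for j using that gh unfolding J_def by auto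
 qed
 have eqJ: "(%j x. mul m (fst j x) (snd j x)) ` J = (%f x. mul m (A (g f) x) (A (h f) x)) ` F'" by (simp add: J_def image_image)
 have leJ: "s + 48 * (m + 1) * card J <= s + 48 * (m + 1) * card F'" by (intro add_left_mono mult_le_mono2 J)
 have n: "net ((%f x. mul m (A (g f) x) (A (h f) x)) ` F') (L + m + 2) (s + 48 * (m + 1) * card F')"
  by (rule net_mono[OF n0[unfolded eqJ] order_refl leJ])
 have "appx La (10 * e) (%x. mul m (A (g f) x) (A (h f) x)) f" if f: "f \<in> F'" for f
  using appx_mul[OF A(2) A(2) F(2) F(2) m La, of "g f" "h f"] gh[OF f] by simp
 then show ?thesis unfolding appnet_def using n by blast
qed

lemma appnet_weaken: "appnet La F L s e ==> L = L' ==> s <= s' ==> e = e' ==> appnet La F L' s' e'"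
 unfolding appnet_def using net_mono[OF _ order_refl, of _ L s s'] by blast

section \<open>Networks for tensor products of hats and ramp powers\<close>

text \<open>With \<open>de = sg ^ l\<close>, the network only sees distances in the range where the
  hats sum to 1.\<close>

definition tclamp :: "real ^ 'n::finite => real => 'n => real ^ 'n => real" where
 "tclamp c de j x = max (reflect c x $ j) de"

lemma tclamp_lipschitz: "\<bar>tclamp c de j x - tclamp c de j y\<bar> <= dist x y"
proof -
 have "\<bar>tclamp c de j x - tclamp c de j y\<bar> <= \<bar>reflect c x $ j - reflect c y $ j\<bar>" unfolding tclamp_def by linarith
 also have "... = \<bar>(x - y) $ j\<bar>" by (simp add: reflect_def abs_minus_commute)
 also have "... <= dist x y" unfolding dist_norm by (rule component_le_norm_cart)
 finally show ?thesis .
qed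

text \<open>The derivative of the power is at most \<open>a / 2 ^ (a - 1)\<close>, hence at most 1
  in every degree; this is why ramps stop at 1/2.\<close>

lemma half_power_lipschitz:
 fixes u v :: real
 assumes "0 <= u" "u <= 1 / 2" "0 <= v" "v <= 1 / 2"
 shows "\<bar>u ^ a - v ^ a\<bar> <= \<bar>u - v\<bar>"
proof (cases a)
 case (Suc k)
 have "\<bar>(2 * u) ^ a - (2 * v) ^ a\<bar> <= real a * \<bar>2 * u - 2 * v\<bar>"
  using norm_power_diff[of "2 * u" "2 * v" a] assms by simp
 moreover have "\<bar>(2 * u) ^ a - (2 * v) ^ a\<bar> = 2 ^ a * \<bar>u ^ a - v ^ a\<bar>"
  by (simp add: power_mult_distrib abs_mult flip: right_diff_distrib)
 moreover have "real a * \<bar>2 * u - 2 * v\<bar> = 2 * real a * \<bar>u - v\<bar>" unfolding right_diff_distrib[symmetric] abs_mult abs_numeral by (simp only: mult_ac)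
 moreover have "2 * real a * \<bar>u - v\<bar> <= 2 ^ a * \<bar>u - v\<bar>"
 proof (rule mult_right_mono)
  have "Suc k <= 2 ^ k" by (simp add: Suc_leI)
  then have "real (Suc k) <= 2 ^ k" by (metis of_nat_le_iff of_nat_numeral of_nat_power)
  then show "2 * real a <= 2 ^ a" by (simp add: Suc)
 qed simp
 ultimately have "2 ^ a * \<bar>u ^ a - v ^ a\<bar> <= 2 ^ a * \<bar>u - v\<bar>" by linarith
 then show ?thesis by (rule mult_left_le_imp_le) simp
qed simp

context
 fixes sg :: real and l :: nat and c :: "real ^ 'n::finite"
 assumes sg: "0 < sg" "sg < 1"
begin

definition "tc = tclamp c (sg ^ l)"

text \<open>\<open>a\<close> counts the ramp factors, and \<open>be\<close>, which is 0 or 1 in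
  \<open>HR\<close>, tells whether the hat is already a factor.\<close>

definition "hr j m a be x = hat sg (tc j x / sg ^ m) ^ be * ramp sg (tc j x / sg ^ m) ^ a"

text \<open>One Lipschitz constant for all univariate functions and, through the factor
  \<open>CARD('n)\<close>, for their tensor products.\<close>

definition "Lam = real CARD('n) * (2 * (pou_lip sg * (1 / sg) ^ l))"

lemma Lam_nonneg: "0 <= Lam"
 using sg pou_lip_pos[OF sg] by (simp add: Lam_def)

lemma hr_range: "0 <= hr j m a be x & hr j m a be x <= 1"
proof -
 have "ramp sg z <= 1" for z using ramp_range(2)[OF sg, of z] by linarith
 then show ?thesis unfolding hr_def using hat_range[OF sg] ramp_range(1)[OF sg]
  by (intro conjI mult_nonneg_nonneg mult_le_one zero_le_power power_le_one) auto
qed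

lemma hr_lipschitz:
 assumes "m <= l" "be <= 1"
 shows "\<bar>hr j m a be x - hr j m a be y\<bar> <= 2 * (pou_lip sg * (1 / sg) ^ l) * dist x y"
proof -
 let ?z = "%x. tc j x / sg ^ m" and ?L = "pou_lip sg * (1 / sg) ^ l"
 have "\<bar>?z x - ?z y\<bar> = (1 / sg) ^ m * \<bar>tc j x - tc j y\<bar>"
  using sg by (simp add: abs_divide power_one_over flip: diff_divide_distrib)
 also have "... <= (1 / sg) ^ l * dist x y"
  unfolding tc_def using sg assms by (intro mult_mono power_increasing tclamp_lipschitz) auto
 finally have z: "pou_lip sg * \<bar>?z x - ?z y\<bar> <= ?L * dist x y"
  using pou_lip_pos[OF sg] by (simp add: mult.assoc)
 have h: "\<bar>hat sg (?z x) ^ be - hat sg (?z y) ^ be\<bar> <= ?L * dist x y"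
 proof (cases "be = 0")
  case True
  then show ?thesis using pou_lip_pos[OF sg] sg by simp
 next
  case False
  then have "be = 1" using assms by simp
  then show ?thesis using hat_lipschitz[OF sg, of "?z x" "?z y"] z by simp
 qed
 have w: "\<bar>ramp sg (?z x) ^ a - ramp sg (?z y) ^ a\<bar> <= ?L * dist x y"
  using half_power_lipschitz[of "ramp sg (?z x)" "ramp sg (?z y)" a] ramp_range[OF sg] ramp_lipschitz[OF sg, of "?z x" "?z y"] z
  by fastforce
 have r1: "\<bar>ramp sg z ^ a\<bar> <= 1" "\<bar>hat sg z ^ be\<bar> <= 1" for z
  using hat_range[OF sg, of z] ramp_range[OF sg, of z] by (auto simp: power_abs intro!: power_le_one)
 have eq: "hr j m a be x - hr j m a be y = (hat sg (?z x) ^ be - hat sg (?z y) ^ be) * ramp sg (?z x) ^ a + hat sg (?z y) ^ be * (ramp sg (?z x) ^ a - ramp sg (?z y) ^ a)"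
  by (simp add: hr_def algebra_simps)
 have "\<bar>hr j m a be x - hr j m a be y\<bar> <= \<bar>hat sg (?z x) ^ be - hat sg (?z y) ^ be\<bar> * \<bar>ramp sg (?z x) ^ a\<bar> + \<bar>hat sg (?z y) ^ be\<bar> * \<bar>ramp sg (?z x) ^ a - ramp sg (?z y) ^ a\<bar>"
  unfolding eq abs_mult[symmetric] by (rule abs_triangle_ineq)
 also have "... <= (?L * dist x y) * 1 + 1 * (?L * dist x y)"
  by (rule add_mono[OF mult_mono[OF h r1(1)] mult_mono[OF r1(2) w]]) (rule order_trans[OF abs_ge_zero h] abs_ge_zero zero_le_one)+
 finally show ?thesis by (simp add: mult_ac)
qed

lemma hr_exf: "m <= l ==> be <= 1 ==> exf Lam (hr j m a be)"
 unfolding exf_def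
proof (intro conjI allI)
 fix x y assume m: "m <= l" "be <= 1"
 have "\<bar>hr j m a be x - hr j m a be y\<bar> <= 1 * (2 * (pou_lip sg * (1 / sg) ^ l)) * dist x y"
  using hr_lipschitz[OF m] by simp
 also have "... <= Lam * dist x y" unfolding Lam_def using pou_lip_pos[OF sg] sg
  by (intro mult_right_mono) (auto simp: Suc_le_eq)
 finally show "\<bar>hr j m a be x - hr j m a be y\<bar> <= Lam * dist x y" .
qed (use hr_range in auto)

text \<open>The functions with total exponent at most \<open>2 ^ s\<close>: products of two members
  of stage s make up stage s + 1, so degrees of order N are reached after about log N
  stages.\<close>

definition "HR s = (%(j, m, a, be). hr j m a be) ` {(j, m, a, be). m <= l & be <= 1 & a + be <= 2 ^ s}"

lemma hr_in_HR: "m <= l ==> be <= 1 ==> a + be <= 2 ^ s ==> hr j m a be \<in> HR s"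
 unfolding HR_def by (rule image_eqI[where x = "(j, m, a, be)"]) auto

lemma finite_HR: "finite (HR s)" and card_HR: "card (HR s) <= CARD('n) * ((l + 1) * ((2 ^ s + 1) * 2))"
proof -
 let ?I = "(UNIV :: 'n set) \<times> {..l} \<times> {..2 ^ s :: nat} \<times> {..1::nat}"
 have sub: "HR s <= (%(j, m, a, be). hr j m a be) ` ?I" unfolding HR_def by (intro image_mono) auto
 have fin: "finite ?I" by simp
 show "finite (HR s)" by (rule finite_subset[OF sub finite_imageI[OF fin]])
 have "card (HR s) <= card ?I"
  by (rule order_trans[OF card_mono[OF finite_imageI[OF fin] sub] card_image_le[OF fin]])
 also have "card ?I = CARD('n) * ((l + 1) * ((2 ^ s + 1) * 2))" by (simp add: card_cartesian_product)
 finally show "card (HR s) <= CARD('n) * ((l + 1) * ((2 ^ s + 1) * 2))" .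
qed

lemma HR_exf: "f \<in> HR s ==> exf Lam f"
 unfolding HR_def using hr_exf by auto

text \<open>A high ramp power splits off a factor of exponent \<open>2 ^ s\<close>. Otherwise the
  function already belongs to stage s and is multiplied by the constant 1, which is
  \<open>hr j m 0 0\<close>, so that all functions advance in step.\<close>

lemma HR_mult:
 assumes "f \<in> HR (Suc s)" shows "\<exists>g\<in>HR s. \<exists>h\<in>HR s. f = (%x. g x * h x)"
proof -
 obtain j m a be where f: "f = hr j m a be" "m <= l" "be <= 1" "a + be <= 2 ^ Suc s" using assms unfolding HR_def by auto
 show ?thesis
 proof (cases "2 ^ s <= a")
  case True
  have "f = (%x. hr j m (2 ^ s) 0 x * hr j m (a - 2 ^ s) be x)"
  unfolding f(1) hr_def using True by (simp add: fun_eq_iff mult_ac flip: power_add)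
  moreover have "hr j m (2 ^ s) 0 \<in> HR s" "hr j m (a - 2 ^ s) be \<in> HR s" using f True by (auto intro!: hr_in_HR)
  ultimately show ?thesis by blast
 next
  case False
  have "f = (%x. hr j m a be x * hr j m 0 0 x)" unfolding f(1) hr_def by simp
  moreover have "hr j m a be \<in> HR s" "hr j m 0 0 \<in> HR s" using f False by (auto intro!: hr_in_HR)
  ultimately show ?thesis by blast
 qed
qed

text \<open>Three layers: the clamped coordinates, then shifted \<open>relu\<close> at the three
  nodes of every level, then hats and ramps, which are affine in the latter and nonnegative.\<close>

lemma net_HR_0: "net (HR 0) 3 (6 * CARD('n) + 18 * CARD('n) * (l + 1) + 6 * card (HR 0))"
proof -
 let ?X = "range (%k x. (x :: real ^ 'n) $ k)"
 define t where "t j x = relu (reflect c x $ j - sg ^ l)" for j and x :: "real ^ 'n"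
 have "net (range t) (Suc 0) (0 + 6 * card (range t))"
 proof (rule net_layer[OF net_coords])
  fix g assume "g \<in> range t"
  then obtain j where g: "g = t j" by blast
  have X: "(%x. x $ j) \<in> ?X" by blast
  have "g x = relu ((if c $ j = 0 then 1 else - 1) * x $ j + 0 * x $ j + 0 * x $ j + 0 * x $ j + 0 * x $ j + (if c $ j = 0 then - (sg ^ l) else 1 - sg ^ l))" for x
  unfolding g t_def by (simp add: reflect_def algebra_simps)
  then show "EX h. affc ?X 6 h & g = (%x. relu (h x))" by (rule neuron5[OF X X X X X])
 qed simp
 moreover have "card (range t) <= CARD('n)" by (rule card_image_le) simp
 ultimately have n1: "net (range t) (Suc 0) (6 * CARD('n))" by (elim net_mono[OF _ order_refl]) simp
 have tc: "tc j x = sg ^ l + t j x" for j x unfolding tc_def tclamp_def t_def relu_def by simp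
 define u where "u = (%(j, m, th) x. relu (tc j x / sg ^ m - th))"
 let ?I = "(UNIV :: 'n set) \<times> {..l} \<times> {sg, 1, 1 / sg}"
 have "net (u ` ?I) (Suc (Suc 0)) (6 * CARD('n) + 6 * card (u ` ?I))"
 proof (rule net_layer[OF n1])
  fix g assume "g \<in> u ` ?I"
  then obtain j m th where g: "g = u (j, m, th)" by blast
  have X: "t j \<in> range t" by blast
  have "g x = relu (1 / sg ^ m * t j x + 0 * t j x + 0 * t j x + 0 * t j x + 0 * t j x + (sg ^ l / sg ^ m - th))" for x
  unfolding g u_def tc by (simp add: add_divide_distrib algebra_simps)
  then show "EX h. affc (range t) 6 h & g = (%x. relu (h x))" by (rule neuron5[OF X X X X X])
 qed simp
 moreover have "card (u ` ?I) <= CARD('n) * (3 * (l + 1))"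
 proof -
  have "card (u ` ?I) <= card ?I" by (rule card_image_le) simp
  also have "... = CARD('n) * ((l + 1) * card {sg, 1, 1 / sg})" by (simp add: card_cartesian_product)
  also have "... <= CARD('n) * ((l + 1) * 3)" by (intro mult_le_mono2) (auto simp: card_insert_if)
  finally show ?thesis by (simp add: mult_ac)
 qed
 ultimately have n2: "net (u ` ?I) (Suc (Suc 0)) (6 * CARD('n) + 18 * CARD('n) * (l + 1))" by (elim net_mono[OF _ order_refl]) (simp add: algebra_simps)
 have "net (HR 0) (Suc (Suc (Suc 0))) (6 * CARD('n) + 18 * CARD('n) * (l + 1) + 6 * card (HR 0))"
 proof (rule net_layer[OF n2 finite_HR])
  fix g assume "g \<in> HR 0"
  then obtain j m a be where g: "g = hr j m a be" "m <= l" "a + be <= 1" unfolding HR_def by auto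
  have X: "u (j, m, sg) \<in> u ` ?I" "u (j, m, 1) \<in> u ` ?I" "u (j, m, 1 / sg) \<in> u ` ?I" using g by auto
  note N = neuron5[OF X X(1) X(1)]
  consider "a = 0" "be = 0" | "a = 1" "be = 0" | "a = 0" "be = 1" using g(3) by linarith
  then have "EX p q r b. ALL x. g x = relu (p * u (j, m, sg) x + q * u (j, m, 1) x + r * u (j, m, 1 / sg) x + 0 * u (j, m, sg) x + 0 * u (j, m, sg) x + b)"
  proof cases
  case 1
  show ?thesis by (rule exI[of _ 0], rule exI[of _ 0], rule exI[of _ 0], rule exI[of _ 1]) (simp add: g(1) 1 hr_def relu_def)
  next
  case 2
  have "hr j m 1 0 x = relu (1 / (2 * (1 / sg - sg)) * u (j, m, sg) x + 0 * u (j, m, 1) x + (- 1 / (2 * (1 / sg - sg))) * u (j, m, 1 / sg) x + 0 * u (j, m, sg) x + 0 * u (j, m, sg) x + 0)" (is "_ = relu ?y") for x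
  proof -
  have "hr j m 1 0 x = ?y" unfolding hr_def u_def ramp_def by (simp add: diff_divide_distrib)
  then show ?thesis using hr_range[of j m 1 0 x] relu_nonneg by metis
  qed
  then show ?thesis unfolding g(1) 2 by blast
  next
  case 3
  have "hr j m 0 1 x = relu (1 / (1 - sg) * u (j, m, sg) x + (- 1 / (1 - sg) - 1 / (1 / sg - 1)) * u (j, m, 1) x + 1 / (1 / sg - 1) * u (j, m, 1 / sg) x + 0 * u (j, m, sg) x + 0 * u (j, m, sg) x + 0)" (is "_ = relu ?y") for x
  proof -
  have "hr j m 0 1 x = ?y" unfolding hr_def u_def hat_def by (simp add: diff_divide_distrib left_diff_distrib)
  then show ?thesis using hr_range[of j m 0 1 x] relu_nonneg by metis
  qed
  then show ?thesis unfolding g(1) 3 by blast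
  qed
  then obtain p q r b where N': "!!x. g x = relu (p * u (j, m, sg) x + q * u (j, m, 1) x + r * u (j, m, 1 / sg) x + 0 * u (j, m, sg) x + 0 * u (j, m, sg) x + b)" by blast
  show "EX h. affc (u ` ?I) 6 h & g = (%x. relu (h x))" by (rule neuron5[OF X X(1) X(1) N'])
 qed
 then show ?thesis by (simp add: numeral_3_eq_3)
qed

text \<open>Each stage is one round of multiplications and loses a factor 10 in the error. The
  stages are nested, so K bounds the number of functions in each of them.\<close>

lemma appnet_HR:
 assumes "10 ^ s * (1 / 2) ^ m <= (1 :: real)" "s <= S" "card (HR S) <= K"
 shows "appnet Lam (HR s) (3 + s * (m + 2)) (6 * CARD('n) + 18 * CARD('n) * (l + 1) + 6 * K + s * (48 * (m + 1) * K)) (10 ^ s * (1 / 2) ^ m)"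
proof -
 have cK: "card (HR s) <= K" if "s <= S" for s
 proof -
  have "HR s <= HR S" unfolding HR_def using power_increasing[OF that, of "2::nat"]
  by (intro image_mono subsetI) (auto intro: order_trans)
  from card_mono[OF finite_HR this] show ?thesis using assms(3) by simp
 qed
 show ?thesis using assms(1,2)
 proof (induction s)
  case 0
  have "appx Lam ((1 / 2) ^ m) f f" if "f \<in> HR 0" for f
  using HR_exf[OF that] Lam_nonneg unfolding appx_def exf_def by auto
  moreover have "net ((%f. f) ` HR 0) 3 (6 * CARD('n) + 18 * CARD('n) * (l + 1) + 6 * K)"
  using net_mono[OF net_HR_0 order_refl] cK[OF 0(2)] by simp
  ultimately show ?case unfolding appnet_def by (intro exI[of _ "%f. f"]) auto
 next
  case (Suc s)
  have e: "10 ^ s * (1 / 2) ^ m <= (1::real)" "(1 / 2) ^ m <= 10 ^ s * ((1 / 2) ^ m :: real)"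
  using Suc.prems(1) by (auto simp: mult_le_cancel_right1)
  have *: "appnet Lam (HR (Suc s)) (3 + s * (m + 2) + m + 2) (6 * CARD('n) + 18 * CARD('n) * (l + 1) + 6 * K + s * (48 * (m + 1) * K) + 48 * (m + 1) * card (HR (Suc s))) (10 * (10 ^ s * (1 / 2) ^ m))"
  by (rule appnet_products[OF Suc.IH[OF e(1)] HR_exf finite_HR HR_mult e(2,1) Lam_nonneg]) (use Suc.prems in auto)
  have "48 * (m + 1) * card (HR (Suc s)) <= 48 * (m + 1) * K" by (intro mult_le_mono2 cK Suc.prems)
  then show ?case by (intro appnet_weaken[OF *]) simp_all
 qed
qed

definition "FB k b x = (\<Prod>i<k. vfun sg (b (coord_enum i)) (tc (coord_enum i) x))" for k and b :: "'n => nat \<times> nat"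

lemma vfun_hr: "vfun sg mk (tc j x) = hr j (fst mk) (snd mk) 1 x"
 by (simp add: vfun_def[OF sg] hr_def)

lemma FB_exf:
 assumes "!!j. fst (b j) <= l" "k <= CARD('n)" shows "exf Lam (FB k b)"
 unfolding exf_def
proof (intro conjI allI)
 fix x y
 show "0 <= FB k b x" "FB k b x <= 1" unfolding FB_def vfun_hr using hr_range by (auto intro!: prod_nonneg prod_le_1)
 have "norm (FB k b x - FB k b y) <= (\<Sum>i<k. norm (vfun sg (b (coord_enum i)) (tc (coord_enum i) x) - vfun sg (b (coord_enum i)) (tc (coord_enum i) y)))"
  unfolding FB_def by (rule norm_prod_diff) (use hr_range in \<open>auto simp: vfun_hr\<close>)
 also have "... <= (\<Sum>i<k. 2 * (pou_lip sg * (1 / sg) ^ l) * dist x y)"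
  unfolding vfun_hr real_norm_def by (intro sum_mono hr_lipschitz assms) simp
 also have "... = real k * (2 * (pou_lip sg * (1 / sg) ^ l)) * dist x y" by simp
 also have "... <= Lam * dist x y" unfolding Lam_def using assms(2) pou_lip_pos[OF sg] sg by (intro mult_right_mono) auto
 finally show "\<bar>FB k b x - FB k b y\<bar> <= Lam * dist x y" by simp
qed

text \<open>One coordinate is multiplied in per stage. The univariate functions are carried along,
  multiplied by the constant 1, because later coordinates still need them.\<close>

lemma appnet_FB:
 assumes "10 ^ (S + k) * (1 / 2) ^ m <= (1 :: real)" "card (HR S) <= K" "k <= CARD('n)"
  and B: "finite B" "!!b j. b \<in> B ==> fst (b j) <= l & snd (b j) < 2 ^ S"
 shows "appnet Lam (FB k ` B Un HR S) (3 + (S + k) * (m + 2))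
  (6 * CARD('n) + 18 * CARD('n) * (l + 1) + 6 * K + S * (48 * (m + 1) * K) + k * (48 * (m + 1) * (card B + K))) (10 ^ (S + k) * (1 / 2) ^ m)"
 using assms(1,3)
proof (induction k)
 case 0
 have "(%x. 1) \<in> HR S" using hr_in_HR[of 0 0 0 S undefined] by (simp add: hr_def[abs_def])
 then have "FB 0 ` B Un HR S = HR S" by (auto simp: FB_def[abs_def])
 then show ?case using appnet_HR[of S m S K] 0 assms(2) by simp
next
 case (Suc k)
 have e: "10 ^ (S + k) * (1 / 2) ^ m <= (1::real)" "(1 / 2) ^ m <= 10 ^ (S + k) * ((1 / 2) ^ m :: real)"
  using Suc.prems(1) by (auto simp: mult_le_cancel_right1)
 let ?F = "FB k ` B Un HR S" and ?F' = "FB (Suc k) ` B Un HR S"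
 have one: "(%x. 1) \<in> HR S" using hr_in_HR[of 0 0 0 S undefined] by (simp add: hr_def[abs_def])
 have pr: "\<exists>g\<in>?F. \<exists>h\<in>?F. f = (%x. g x * h x)" if "f \<in> ?F'" for f
  using that
 proof
  assume "f \<in> HR S"
  then show ?thesis using one by (intro bexI[where x = f] bexI[where x = "%x. 1"]) simp_all
 next
  assume "f \<in> FB (Suc k) ` B"
  then obtain b where b: "b \<in> B" "f = FB (Suc k) b" by blast
  let ?j = "coord_enum k :: 'n"
  have "f = (%x. FB k b x * hr ?j (fst (b ?j)) (snd (b ?j)) 1 x)" unfolding b(2) FB_def vfun_hr by (simp add: fun_eq_iff)
  moreover have "hr ?j (fst (b ?j)) (snd (b ?j)) 1 \<in> HR S" using B(2)[OF b(1), of ?j] by (intro hr_in_HR) auto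
  ultimately show ?thesis using b(1) by blast
 qed
 have fin: "finite ?F'" using B(1) finite_HR by simp
 have ex: "exf Lam f" if "f \<in> ?F" for f using that HR_exf FB_exf B(2) Suc.prems(2) by auto
 have *: "appnet Lam ?F' (3 + (S + k) * (m + 2) + m + 2)
  (6 * CARD('n) + 18 * CARD('n) * (l + 1) + 6 * K + S * (48 * (m + 1) * K) + k * (48 * (m + 1) * (card B + K)) + 48 * (m + 1) * card ?F') (10 * (10 ^ (S + k) * (1 / 2) ^ m))"
  by (rule appnet_products[OF Suc.IH[OF e(1)] ex fin pr e(2,1) Lam_nonneg]) (use Suc.prems in auto)
 have "48 * (m + 1) * card ?F' <= 48 * (m + 1) * (card B + K)"
  using card_Un_le[of "FB (Suc k) ` B" "HR S"] card_image_le[OF B(1), of "FB (Suc k)"] assms(2) by (intro mult_le_mono2) linarith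
 then show ?case by (intro appnet_weaken[OF *]) simp_all
qed

text \<open>The output layer forms the linear combination. The errors of the tensor products add up
  with the weights |cf b|, so m must later compensate for the size of the coefficients.\<close>

lemma vfun_network:
 fixes cf :: "('n => nat \<times> nat) => real"
 assumes e: "10 ^ (S + CARD('n)) * (1 / 2) ^ m <= (1 :: real)" and K: "card (HR S) <= K"
  and B: "finite B" "!!b j. b \<in> B ==> fst (b j) <= l & snd (b j) < 2 ^ S"
 obtains Ph where "nn_wf CARD('n) Ph" "nn_depth Ph = 4 + (S + CARD('n)) * (m + 2)"
  "nn_size Ph <= 6 * CARD('n) + 18 * CARD('n) * (l + 1) + 6 * K + S * (48 * (m + 1) * K) + CARD('n) * (48 * (m + 1) * (card B + K)) + Suc (card B)"
  "pl_fun (nn_real Ph :: real ^ 'n => real)"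
  "!!x. \<bar>nn_real Ph x - (\<Sum>b\<in>B. cf b * (\<Prod>j\<in>UNIV. vfun sg (b j) (tclamp c (sg ^ l) j x)))\<bar> <= (\<Sum>b\<in>B. \<bar>cf b\<bar>) * (10 ^ (S + CARD('n)) * (1 / 2) ^ m)"
  "!!x y. \<bar>(nn_real Ph x - (\<Sum>b\<in>B. cf b * (\<Prod>j\<in>UNIV. vfun sg (b j) (tclamp c (sg ^ l) j x))))
  - (nn_real Ph y - (\<Sum>b\<in>B. cf b * (\<Prod>j\<in>UNIV. vfun sg (b j) (tclamp c (sg ^ l) j y))))\<bar>
  <= (\<Sum>b\<in>B. \<bar>cf b\<bar>) * (10 ^ (S + CARD('n)) * (1 / 2) ^ m) * (real CARD('n) * (2 * (pou_lip sg * (1 / sg) ^ l))) * dist x y"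
proof -
 let ?F = "FB CARD('n) ` B Un HR S" and ?e = "10 ^ (S + CARD('n)) * (1 / 2 :: real) ^ m"
 let ?s = "6 * CARD('n) + 18 * CARD('n) * (l + 1) + 6 * K + S * (48 * (m + 1) * K) + CARD('n) * (48 * (m + 1) * (card B + K))"
 have ap: "appnet Lam ?F (3 + (S + CARD('n)) * (m + 2)) ?s ?e"
  by (rule appnet_FB[OF e K order_refl B(1)]) (rule B(2))
 obtain A where A: "net (A ` ?F) (3 + (S + CARD('n)) * (m + 2)) ?s" "\<forall>f\<in>?F. appx Lam ?e (A f) f"
  using ap unfolding appnet_def by blast
 have FB: "FB CARD('n) b x = (\<Prod>j\<in>UNIV. vfun sg (b j) (tclamp c (sg ^ l) j x))" for b x
  unfolding FB_def tc_def using prod.reindex_bij_betw[OF bij_coord_enum[where 'n = 'n], of "%j. vfun sg (b j) (tclamp c (sg ^ l) j x)"] by simp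
 define h where "h x = (\<Sum>b\<in>B. cf b * A (FB CARD('n) b) x)" for x
 have aff: "affc (A ` ?F) (Suc (card B)) h" unfolding h_def by (rule affc_sum[OF B(1)]) auto
 have ap: "\<bar>A (FB CARD('n) b) x - FB CARD('n) b x\<bar> <= ?e"
  "\<bar>(A (FB CARD('n) b) x - FB CARD('n) b x) - (A (FB CARD('n) b) y - FB CARD('n) b y)\<bar> <= ?e * Lam * dist x y" if "b \<in> B" for b x y
  using A(2) that unfolding appx_def by auto
 obtain Ph where Ph: "nn_wf CARD('n) Ph" "nn_depth Ph = Suc (3 + (S + CARD('n)) * (m + 2))" "nn_size Ph <= ?s + Suc (card B)" "nn_real Ph = h" "pl_fun h"
  by (rule net_output[OF A(1) aff]) (rule that; assumption)
 show thesis
 proof (rule that[of Ph])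
  fix x y
  have d: "nn_real Ph x - (\<Sum>b\<in>B. cf b * (\<Prod>j\<in>UNIV. vfun sg (b j) (tclamp c (sg ^ l) j x))) = (\<Sum>b\<in>B. cf b * (A (FB CARD('n) b) x - FB CARD('n) b x))" for x
  unfolding Ph(4) h_def FB[symmetric] by (simp add: right_diff_distrib sum_subtractf)
  show "\<bar>nn_real Ph x - (\<Sum>b\<in>B. cf b * (\<Prod>j\<in>UNIV. vfun sg (b j) (tclamp c (sg ^ l) j x)))\<bar> <= (\<Sum>b\<in>B. \<bar>cf b\<bar>) * ?e"
  unfolding d sum_distrib_right
  by (rule order_trans[OF sum_abs sum_mono]) (unfold abs_mult, intro mult_left_mono ap, auto)
  show "\<bar>(nn_real Ph x - (\<Sum>b\<in>B. cf b * (\<Prod>j\<in>UNIV. vfun sg (b j) (tclamp c (sg ^ l) j x))))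
  - (nn_real Ph y - (\<Sum>b\<in>B. cf b * (\<Prod>j\<in>UNIV. vfun sg (b j) (tclamp c (sg ^ l) j y))))\<bar>
  <= (\<Sum>b\<in>B. \<bar>cf b\<bar>) * ?e * (real CARD('n) * (2 * (pou_lip sg * (1 / sg) ^ l))) * dist x y"
  unfolding d Lam_def[symmetric] sum_distrib_right sum_subtractf[symmetric] right_diff_distrib[symmetric] mult.assoc
  by (rule order_trans[OF sum_abs sum_mono]) (unfold abs_mult, intro mult_left_mono ap(2)[unfolded mult.assoc], auto)
 qed (use Ph in auto)
qed

end

section \<open>Sobolev norm of the error caused by clamping and approximation\<close>

lemma csign_square: "csign c i * csign c i = 1"
 using csign_cases[of c i] by auto

lemma nn_integral_prod_reflect:
 fixes c :: "real ^ 'n::finite" and h :: "real => ennreal"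
 assumes c: "is_corner c" and [measurable]: "h \<in> borel_measurable borel"
 shows "(\<integral>\<^sup>+x. (\<Prod>j\<in>UNIV. h (reflect c x $ j)) \<partial>lborel) = (\<integral>\<^sup>+t. h t \<partial>lborel) ^ CARD('n)"
proof -
 let ?F = "%f. c + (\<Sum>i\<in>UNIV. f i *\<^sub>R (csign c i *\<^sub>R axis i 1))"
 have comp: "?F f $ j = c $ j + f j * csign c j" for f j
  by (simp add: axis_def if_distrib cong: if_cong)
 have F: "reflect c (?F f) $ j = f j" for f j
 proof -
  have "c $ j = 0 | c $ j = 1" using c by (simp add: is_corner_def)
  then show ?thesis unfolding reflect_def vec_lambda_beta comp by (auto simp: csign_def)
 qed
 have [measurable]: "(%x. reflect c x $ j) \<in> borel_measurable borel" for j unfolding reflect_def by simp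
 have "(\<integral>\<^sup>+x. (\<Prod>j\<in>UNIV. h (reflect c x $ j)) \<partial>lborel) = (\<integral>\<^sup>+x. (\<Prod>j\<in>UNIV. h (reflect c x $ j)) \<partial>distr (PiM UNIV (%_. lborel)) borel ?F)"
  using lborel_eq_distr_signed[where sg = "csign c" and x = c, OF csign_cases] by simp
 also have "... = (\<integral>\<^sup>+f. (\<Prod>j\<in>UNIV. h (reflect c (?F f) $ j)) \<partial>PiM UNIV (%_. lborel))"
  by (rule nn_integral_distr) measurable
 also have "... = (\<integral>\<^sup>+f. (\<Prod>j\<in>(UNIV :: 'n set). h (f j)) \<partial>PiM UNIV (%_. lborel))" unfolding F ..
 also have "... = (\<Prod>j\<in>(UNIV :: 'n set). (\<integral>\<^sup>+t. h t \<partial>lborel))"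
  by (rule lborel_product.product_nn_integral_prod) auto
 finally show ?thesis by simp
qed

lemma nn_integral_powr_unit:
 assumes "q < 1"
 shows "(\<integral>\<^sup>+t. indicator {0<..<1} t * ennreal (t powr (- q)) \<partial>lborel) <= ennreal (1 / (1 - q))"
proof -
 have "((%t. t powr (- q)) has_integral (1 powr (- q + 1) / (- q + 1))) {0..1}"
  by (rule has_integral_powr_from_0) (use assms in auto)
 then have "(\<integral>\<^sup>+t. ennreal (indicator {0..1} t * t powr (- q)) \<partial>lborel) = ennreal (1 / (1 - q))"
  by (intro nn_integral_has_integral_lebesgue) auto
 moreover have "(\<integral>\<^sup>+t. indicator {0<..<1} t * ennreal (t powr (- q)) \<partial>lborel) <= (\<integral>\<^sup>+t. ennreal (indicator {0..1} t * t powr (- q)) \<partial>lborel)"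
  by (intro nn_integral_mono) (auto simp: indicator_def)
 ultimately show ?thesis by simp
qed

text \<open>Every factor \<open>y $ j powr (- q)\<close> is at least 1 on the cube, so including the
  remaining coordinates only increases the product.\<close>

lemma powr_prod_ge:
 fixes y :: "real ^ 'n::finite"
 assumes y: "y \<in> cube" and q: "0 <= q" and J: "J <= UNIV"
 shows "(\<Prod>j\<in>J. y $ j) powr (- q) <= (\<Prod>j\<in>UNIV. y $ j powr (- q))"
proof -
 have y': "0 < y $ j" "y $ j <= 1" for j using y by (auto simp: cube_def less_imp_le)
 have "(\<Prod>j\<in>J. y $ j) powr (- q) = (\<Prod>j\<in>J. y $ j powr (- q))"
  by (rule prod_powr_distrib)
 also have "... <= (\<Prod>j\<in>UNIV. y $ j powr (- q))"
 proof (rule prod_mono2)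
  show "1 <= y $ j powr (- q)" for j
  using powr_mono2'[of "- q" "y $ j" 1] y'[of j] q by simp
 qed auto
 finally show ?thesis .
qed

lemma pair_sum_le_prod:
 fixes y :: "real ^ 'n::finite"
 assumes y: "y \<in> cube" and s: "0 <= s"
 shows "pair_sum 0 y s <= real (CARD('n) * CARD('n)) * (\<Prod>j\<in>UNIV. y $ j powr (- s))"
proof -
 let ?P = "\<Prod>j\<in>UNIV. y $ j powr (- s)"
 have "pair_sum 0 y s <= (\<Sum>a\<in>(UNIV :: 'n set). \<Sum>b\<in>UNIV - {a}. ?P)"
  unfolding pair_sum_def
 proof (intro sum_mono)
  fix a b :: 'n assume "b \<in> UNIV - {a}"
  then show "(cdist 0 y a * cdist 0 y b) powr (- s) <= ?P"
  using powr_prod_ge[OF y s, of "{a, b}"] by (simp add: cdist_0[OF y])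
 qed
 also have "... <= (\<Sum>a\<in>(UNIV :: 'n set). \<Sum>b\<in>(UNIV :: 'n set). ?P)"
  by (intro sum_mono sum_mono2) (auto intro: prod_nonneg)
 finally show ?thesis by (simp add: mult_ac)
qed

text \<open>In the layer some y j is below \<open>de\<close>, so 1 is at most
  \<open>(de / y j) powr (1 / 2 - s)\<close>. This trades integrability for smallness: the exponent
  of the square grows from 2s to s + 1/2, still below 1, and a positive power of \<open>de\<close>
  appears.\<close>

lemma layer_square_bound:
 fixes y :: "real ^ 'n::finite"
 assumes y: "y \<in> cube" and s: "0 < s" "s < 1 / 2" and de: "0 < de" and et: "0 <= et" and M: "0 <= M"
  and w: "\<bar>w\<bar> <= et + (if EX j. y $ j < de then M * pair_sum 0 y s else 0)"
 shows "w^2 <= (2 * et^2 + 2 * M^2 * real CARD('n) ^ 4 * de powr (1 / 2 - s)) * (\<Prod>j\<in>UNIV. y $ j powr (- (s + 1 / 2)))"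
proof -
 let ?P = "%q. \<Prod>j\<in>UNIV. y $ j powr (- q)" and ?L = "if EX j. y $ j < de then M * pair_sum 0 y s else 0"
 have P1: "1 <= ?P (s + 1 / 2)" using powr_prod_ge[OF y, of "s + 1 / 2" "{}"] s by simp
 have L0: "0 <= ?L" by (auto intro: mult_nonneg_nonneg[OF M pair_sum_nonneg])
 have "w^2 <= (et + ?L)^2" using w et L0 by (intro iffD1[OF abs_le_square_iff]) simp
 also have "... <= 2 * et^2 + 2 * ?L^2" using zero_le_power2[of "et - ?L"] by (simp only: power2_sum power2_diff)
 also have "?L^2 <= M^2 * real CARD('n) ^ 4 * de powr (1 / 2 - s) * ?P (s + 1 / 2)"
 proof (cases "EX j. y $ j < de")
  case True
  then obtain j where j: "y $ j < de" by blast
  have y0: "0 < y $ j" "!!j. 0 <= y $ j" using y by (auto simp: cube_def less_imp_le)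
  have "1 <= (de / y $ j) powr (1 / 2 - s)" using j y0 s by (intro ge_one_powr_ge_zero) auto
  also have "... = de powr (1 / 2 - s) * (y $ j) powr (- (1 / 2 - s))"
  using y0 de unfolding powr_minus_divide by (simp add: powr_divide)
  also have "... <= de powr (1 / 2 - s) * ?P (1 / 2 - s)"
  using powr_prod_ge[OF y, of "1 / 2 - s" "{j}"] s by (intro mult_left_mono) auto
  finally have 1: "1 <= de powr (1 / 2 - s) * ?P (1 / 2 - s)" .
  have PP: "?P a * ?P b = ?P (a + b)" for a b
  unfolding prod.distrib[symmetric] powr_add[symmetric] by simp
  have P0: "0 <= ?P a" for a by (intro prod_nonneg) auto
  have "?L^2 = M^2 * (pair_sum 0 y s)^2" using True by (simp add: power_mult_distrib)
  also have "... <= M^2 * (real (CARD('n) * CARD('n)) * ?P s)^2"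
  using pair_sum_le_prod[OF y, of s] s pair_sum_nonneg by (intro mult_left_mono power_mono) auto
  also have "... = M^2 * (real CARD('n) ^ 4 * ?P (s + s)) * 1"
  unfolding PP[symmetric] by (simp add: power_mult_distrib power2_eq_square power4_eq_xxxx)
  also have "... <= M^2 * (real CARD('n) ^ 4 * ?P (s + s)) * (de powr (1 / 2 - s) * ?P (1 / 2 - s))"
  using P0 by (intro mult_left_mono 1) auto
  also have "... = M^2 * real CARD('n) ^ 4 * de powr (1 / 2 - s) * (?P (s + s) * ?P (1 / 2 - s))" by (simp only: mult_ac)
  also have "?P (s + s) * ?P (1 / 2 - s) = ?P (s + 1 / 2)" unfolding PP by simp
  finally show ?thesis .
 next
  case False
  then show ?thesis using P1 by simp
 qed
 also have "2 * et^2 + 2 * (M^2 * real CARD('n) ^ 4 * de powr (1 / 2 - s) * ?P (s + 1 / 2)) <= 2 * et^2 * ?P (s + 1 / 2) + 2 * (M^2 * real CARD('n) ^ 4 * de powr (1 / 2 - s) * ?P (s + 1 / 2))"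
  using mult_left_mono[OF P1, of "2 * et^2"] by simp
 finally show ?thesis by (simp add: distrib_right mult.assoc)
qed

lemma test_fun_dparts: "test_fun U ph ==> test_fun U (dparts ds ph)"
 by (induction ds) (auto intro: test_fun_dpart)

lemma loc_int_test_fun_integrable:
 fixes v :: "real ^ 'n::finite => real"
 assumes v: "loc_int U v" and ph: "test_fun U ph"
 shows "set_integrable lborel U (%x. v x * ph x)"
proof -
 let ?K = "closure {x. ph x ~= 0}"
 have K: "compact ?K" "?K <= U" using ph by (auto simp: test_fun_def)
 obtain B where B: "B > 0" "!!x. \<bar>ph x\<bar> <= B" by (rule test_fun_bounded[OF ph]) (rule that; assumption)
 have [measurable]: "ph \<in> borel_measurable borel" "v \<in> borel_measurable borel" "?K \<in> sets borel"
  using test_fun_measurable[OF ph] v by (auto simp: loc_int_def)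
 have s0: "ph x = 0" if "x ~: ?K" for x using that closure_subset[of "{x. ph x ~= 0}"] by blast
 have vK: "integrable lborel (%x. indicator ?K x *\<^sub>R v x)" using v K unfolding loc_int_def set_integrable_def by blast
 have "integrable lborel (%x. indicator ?K x *\<^sub>R v x * ph x)"
 proof (rule Bochner_Integration.integrable_bound[OF integrable_mult_right[OF vK, of B]])
  show "AE x in lborel. norm (indicator ?K x *\<^sub>R v x * ph x) <= norm (B * indicator ?K x *\<^sub>R v x)"
  proof (rule AE_I2)
  fix x
  have "norm (indicator ?K x *\<^sub>R v x * ph x) <= \<bar>indicator ?K x *\<^sub>R v x\<bar> * B"
  unfolding real_norm_def abs_mult[of _ "ph x"] by (intro mult_left_mono B) simp
  then show "norm (indicator ?K x *\<^sub>R v x * ph x) <= norm (B * indicator ?K x *\<^sub>R v x)" using B(1) by (simp add: abs_mult mult_ac)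
  qed
 qed measurable
 moreover have "(%x. indicator ?K x *\<^sub>R v x * ph x) = (%x. indicator U x *\<^sub>R (v x * ph x))"
 proof
  fix x show "indicator ?K x *\<^sub>R v x * ph x = indicator U x *\<^sub>R (v x * ph x)"
  by (cases "x \<in> ?K") (use K(2) s0[of x] in auto)
 qed
 ultimately show ?thesis unfolding set_integrable_def by (simp only:)
qed

lemma weak_deriv_diff:
 assumes "weak_deriv U al u v" "weak_deriv U al u' v'"
 shows "weak_deriv U al (%x. u x - u' x) (%x. v x - v' x)"
proof -
 have l: "loc_int U u" "loc_int U v" "loc_int U u'" "loc_int U v'" using assms unfolding weak_deriv_def by auto
 have ld: "loc_int U (%x. g x - h x)" if "loc_int U g" "loc_int U h" for g h
  using that unfolding loc_int_def by (auto intro!: borel_measurable_diff set_integral_diff(1))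
 show ?thesis unfolding weak_deriv_def
 proof (intro conjI allI impI ld l)
  fix ph ds assume a: "test_fun U ph & (ALL i. count (mset ds) i = al i)"
  then have ph: "test_fun U ph" by simp
  have 1: "(LINT x:U|lborel. u x * dparts ds ph x) = (- 1) ^ mi_abs al * (LINT x:U|lborel. v x * ph x)"
  "(LINT x:U|lborel. u' x * dparts ds ph x) = (- 1) ^ mi_abs al * (LINT x:U|lborel. v' x * ph x)"
  using assms a unfolding weak_deriv_def by auto
  show "(LINT x:U|lborel. (u x - u' x) * dparts ds ph x) = (- 1) ^ mi_abs al * (LINT x:U|lborel. (v x - v' x) * ph x)"
  unfolding left_diff_distrib
  unfolding set_integral_diff(2)[OF loc_int_test_fun_integrable[OF l(1) test_fun_dparts[OF ph]] loc_int_test_fun_integrable[OF l(3) test_fun_dparts[OF ph]]]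
  set_integral_diff(2)[OF loc_int_test_fun_integrable[OF l(2) ph] loc_int_test_fun_integrable[OF l(4) ph]] 1
  by (simp add: right_diff_distrib)
 qed
qed

text \<open>The majorant of the square is a product of univariate powers with exponent s + 1/2 < 1,
  so its integral factorizes and each coordinate contributes \<open>1 / (1 / 2 - s)\<close>.\<close>

lemma sqL2_bound:
 fixes c :: "real ^ 'n::finite"
 assumes c: "is_corner c" and s: "0 < s" "s < 1 / 2" and de: "0 < de" and et: "0 <= et" and M: "0 <= M"
  and w: "AE x in lborel. x \<in> cube --> \<bar>w x\<bar> <= et + (if EX j. reflect c x $ j < de then M * pair_sum 0 (reflect c x) s else 0)"
 shows "sqL2 cube w <= ennreal ((2 * et^2 + 2 * M^2 * real CARD('n) ^ 4 * de powr (1 / 2 - s)) * (1 / (1 / 2 - s)) ^ CARD('n))"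
proof -
 let ?m = "2 * et^2 + 2 * M^2 * real CARD('n) ^ 4 * de powr (1 / 2 - s)"
 let ?h = "%t. indicator {0<..<1} t * ennreal (t powr (- (s + 1 / 2)))"
 have m0: "0 <= ?m" by simp
 have [measurable]: "(%x. reflect c x $ j) \<in> borel_measurable borel" for j unfolding reflect_def by simp
 have "sqL2 cube w <= (\<integral>\<^sup>+x. ennreal ?m * (\<Prod>j\<in>UNIV. ?h (reflect c x $ j)) \<partial>lborel)"
  unfolding sqL2_def
 proof (rule nn_integral_mono_AE, use w in eventually_elim)
  case (elim x)
  show ?case
  proof (cases "x \<in> cube")
  case True
  then have y: "reflect c x \<in> cube" by (rule reflect_cube)
  have "(w x)^2 <= ?m * (\<Prod>j\<in>UNIV. reflect c x $ j powr (- (s + 1 / 2)))"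
  by (rule layer_square_bound[OF y s de et M]) (use elim True in blast)
  then have "ennreal ((w x)^2) <= ennreal (?m * (\<Prod>j\<in>UNIV. reflect c x $ j powr (- (s + 1 / 2))))" by (rule ennreal_leI)
  also have "... = ennreal ?m * (\<Prod>j\<in>UNIV. ennreal (reflect c x $ j powr (- (s + 1 / 2))))"
  using m0 by (simp add: ennreal_mult prod_nonneg prod_ennreal)
  also have "(\<Prod>j\<in>UNIV. ennreal (reflect c x $ j powr (- (s + 1 / 2)))) = (\<Prod>j\<in>UNIV. ?h (reflect c x $ j))"
  using y by (intro prod.cong) (auto simp: cube_def)
  finally show ?thesis using True by simp
  qed simp
 qed
 also have "... = ennreal ?m * (\<integral>\<^sup>+x. (\<Prod>j\<in>UNIV. ?h (reflect c x $ j)) \<partial>lborel)" by (rule nn_integral_cmult) measurable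
 also have "(\<integral>\<^sup>+x. (\<Prod>j\<in>UNIV. ?h (reflect c x $ j)) \<partial>lborel) = (\<integral>\<^sup>+t. ?h t \<partial>lborel) ^ CARD('n)"
  by (rule nn_integral_prod_reflect[OF c]) measurable
 also have "ennreal ?m * (\<integral>\<^sup>+t. ?h t \<partial>lborel) ^ CARD('n) <= ennreal ?m * ennreal (1 / (1 / 2 - s)) ^ CARD('n)"
  using nn_integral_powr_unit[of "s + 1 / 2"] s by (intro mult_left_mono power_mono) auto
 also have "... = ennreal (?m * (1 / (1 / 2 - s)) ^ CARD('n))"
 proof -
  have p: "0 <= 1 / (1 / 2 - s)" using s by simp
  show ?thesis unfolding ennreal_power[OF p] using m0 p by (intro ennreal_mult[symmetric]) auto
 qed
 finally show ?thesis .
qed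

lemma pair_sum_antimono:
 fixes y z :: "real ^ 'n::finite"
 assumes y: "y \<in> cube" and z: "z \<in> cube" and yz: "!!j. y $ j <= z $ j" and s: "0 <= s"
 shows "pair_sum 0 z s <= pair_sum 0 y s"
 unfolding pair_sum_def
proof (intro sum_mono)
 fix a b :: 'n
 have p: "0 < y $ a" "0 < y $ b" using y by (auto simp: cube_def)
 have "y $ a * y $ b <= z $ a * z $ b" using p yz[of a] yz[of b] by (intro mult_mono) linarith+
 moreover have "0 < y $ a * y $ b" using p by simp
 ultimately have "(z $ a * z $ b) powr (- s) <= (y $ a * y $ b) powr (- s)" using s by (intro powr_mono2') auto
 then show "(cdist 0 z a * cdist 0 z b) powr (- s) <= (cdist 0 y a * cdist 0 y b) powr (- s)"
  by (simp only: cdist_0[OF y] cdist_0[OF z])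
qed

lemma reflect_shift: "reflect c (x + t *\<^sub>R axis i 1) = reflect c x + (csign c i * t) *\<^sub>R axis i 1"
 by (simp add: vec_eq_iff reflect_def csign_def axis_def)

definition vclamp :: "real ^ 'n::finite => real => real ^ 'n => real ^ 'n" where
 "vclamp c de x = (\<chi> j. tclamp c de j x)"

lemma vclamp_nth: "vclamp c de x $ j = max (reflect c x $ j) de"
 by (simp add: vclamp_def tclamp_def)

lemma vclamp_cube: "x \<in> cube ==> 0 < de ==> de < 1 ==> vclamp c de x \<in> cube"
 using reflect_cube[of x c] by (auto simp: cube_def vclamp_nth)

lemma dist_vclamp_le: "dist (vclamp c de x) (vclamp c de y) <= dist x y"
 unfolding dist_norm
proof (rule norm_le_componentwise_cart)
 fix i
 have "\<bar>vclamp c de x $ i - vclamp c de y $ i\<bar> <= \<bar>reflect c x $ i - reflect c y $ i\<bar>" unfolding vclamp_nth by linarith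
 also have "... = \<bar>x $ i - y $ i\<bar>" by (simp add: reflect_def abs_minus_commute)
 finally show "norm ((vclamp c de x - vclamp c de y) $ i) <= norm ((x - y) $ i)" by simp
qed

lemma AE_reflect_neq:
 fixes c :: "real ^ 'n::finite"
 shows "AE x in lborel. reflect c x $ i ~= de"
proof -
 let ?N = "{x. reflect c x $ i = de}"
 have [measurable]: "(%x. reflect c x $ i) \<in> borel_measurable borel" unfolding reflect_def by simp
 have [measurable]: "?N \<in> sets borel" by measurable
 have "AE x in lborel. x ~: ?N"
 proof (rule AE_lines_countable[where w = "axis i 1"])
  fix x
  have "{t. x + t *\<^sub>R axis i 1 \<in> ?N} <= {csign c i * (de - reflect c x $ i)}"
  proof (rule subsetI)
  fix t assume "t \<in> {t. x + t *\<^sub>R axis i 1 \<in> ?N}"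
  then have "reflect c x $ i + csign c i * t = de" by (simp add: reflect_shift)
  then have e: "de - reflect c x $ i = csign c i * t" by simp
  show "t \<in> {csign c i * (de - reflect c x $ i)}" unfolding e mult.assoc[symmetric] csign_square by simp
  qed
  then show "countable {t. x + t *\<^sub>R axis i 1 \<in> ?N}" by (rule countable_subset) simp
 qed simp
 then show ?thesis by simp
qed

lemma clamped_diff_quot_tendsto:
 fixes H :: "('n::finite => nat) => real ^ 'n => real"
 assumes H: "smooth_family H" and x: "x \<in> cube" and de: "0 < de" "de < 1" and ne: "reflect c x $ i ~= de"
 shows "(%n. diff_quot (%x. H (%_. 0) (vclamp c de x)) i n x) \<longlonglongrightarrow>
  (if de < reflect c x $ i then csign c i * H (unit_mi i) (vclamp c de x) else 0)"
proof (rule diff_quot_tendsto)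
 let ?z = "vclamp c de x" and ?y = "reflect c x" and ?e = "axis i 1 :: real ^ 'n"
 \<comment> \<open>The speed of the clamped coordinate near x: the sign of the reflection above
   \<open>de\<close>, and 0 below.\<close>
 define k where "k = (if de < ?y $ i then csign c i else 0)"
 have u: "unit_mi i = (%_. 0)(i := Suc 0)" by (auto simp: unit_mi_def)
 have "((%r. H (%_. 0) (?z + r *\<^sub>R ?e)) has_real_derivative H (unit_mi i) ?z) (at (k * 0))"
  using smooth_family_line[OF H, of ?z 0 i "%_. 0"] vclamp_cube[OF x de, of c] unfolding u by simp
 moreover have "((%t. k * t) has_real_derivative k) (at 0)" using DERIV_cmult_Id[of k 0] by simp
 ultimately have d: "((%t. H (%_. 0) (?z + (k * t) *\<^sub>R ?e)) has_real_derivative H (unit_mi i) ?z * k) (at 0)"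
  by (rule DERIV_chain2[where f = "%r. H (%_. 0) (?z + r *\<^sub>R ?e)" and g = "%t. k * t"])
 have eq: "vclamp c de (x + t *\<^sub>R ?e) = ?z + (k * t) *\<^sub>R ?e" if t: "\<bar>t\<bar> < \<bar>?y $ i - de\<bar>" for t
 proof -
  have "vclamp c de (x + t *\<^sub>R ?e) $ j = (?z + (k * t) *\<^sub>R ?e) $ j" for j
  proof (cases "j = i")
  case True
  have "\<bar>csign c i * t\<bar> = \<bar>t\<bar>" using csign_cases[of c i] by (auto simp: abs_mult)
  then have "max (?y $ i + csign c i * t) de = max (?y $ i) de + k * t" using t by (auto simp: k_def)
  then show ?thesis by (simp add: True vclamp_nth reflect_shift)
  next
  case False
  then show ?thesis unfolding reflect_shift vclamp_nth vector_add_component vector_scaleR_component by (simp add: axis_def)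
  qed
  then show ?thesis unfolding vec_eq_iff by blast
 qed
 have "\<forall>\<^sub>F t in nhds 0. H (%_. 0) (?z + (k * t) *\<^sub>R ?e) = H (%_. 0) (vclamp c de (x + t *\<^sub>R ?e))"
  unfolding eventually_nhds_metric using ne eq by (intro exI[of _ "\<bar>?y $ i - de\<bar>"]) (auto simp: dist_real_def)
 from DERIV_cong_ev[OF refl this refl] d
 have "((%t. H (%_. 0) (vclamp c de (x + t *\<^sub>R ?e))) has_real_derivative H (unit_mi i) ?z * k) (at 0)" by blast
 moreover have "H (unit_mi i) ?z * k = (if de < ?y $ i then csign c i * H (unit_mi i) ?z else 0)" by (simp add: k_def)
 ultimately show "((%t. H (%_. 0) (vclamp c de (x + t *\<^sub>R ?e))) has_real_derivative (if de < ?y $ i then csign c i * H (unit_mi i) ?z else 0)) (at 0)"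
  by (simp only:)
qed

text \<open>Outside the layer where some coordinate is below \<open>de\<close>, the clamping does nothing and the error is \<open>et\<close>;
 inside the layer one pays the singular weight, whose square integral is of order \<open>de powr (1 / 2 - s)\<close>.\<close>
lemma clamped_H1_error:
 fixes c :: "real ^ 'n::finite" and u :: "real ^ 'n => real"
 assumes c: "is_corner c" and d1: "CARD('n) ~= 1" and H: "smooth_family H" and C: "0 < C" and s: "0 < s" "s < 1 / 2"
  and H0: "!!y. y \<in> cube ==> \<bar>H (%_. 0) y\<bar> <= C"
  and H1: "!!i y. y \<in> cube ==> \<bar>H (unit_mi i) y\<bar> <= C * pair_sum 0 y s"
  and f: "AE x in lborel. x \<in> cube --> f x = H (%_. 0) (reflect c x)"
  and D: "!!i. weak_deriv cube (unit_mi i) f (D i)"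
  and DH: "!!i. AE x in lborel. x \<in> cube --> D i x = csign c i * H (unit_mi i) (reflect c x)"
  and pl: "pl_fun u" and de: "0 < de" "de < 1" and et: "0 <= et"
  and E0: "!!x. x \<in> cube ==> \<bar>u x - H (%_. 0) (vclamp c de x)\<bar> <= et"
  and E1: "!!x y. x \<in> cube ==> y \<in> cube ==>
  \<bar>(u x - H (%_. 0) (vclamp c de x)) - (u y - H (%_. 0) (vclamp c de y))\<bar> <= et * dist x y"
  and ep: "(real CARD('n) + 1) * ((2 * et^2 + 2 * (2 * C)^2 * real CARD('n) ^ 4 * de powr (1 / 2 - s)) * (1 / (1 / 2 - s)) ^ CARD('n)) <= ep^2"
 shows "H1_le (%x. f x - u x) ep"
proof -
 define P where "P i g \<longleftrightarrow> weak_deriv cube (unit_mi i) u g & (AE x in lborel. (%n. diff_quot u i n x) \<longlonglongrightarrow> g x)" for i g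
 have ex: "EX g. P i g" for i
  by (rule pl_fun_weak_deriv[OF pl, of i]) (unfold P_def, blast)
 define g where "g i = (SOME g. P i g)" for i
 have g: "P i (g i)" for i unfolding g_def by (rule someI_ex[OF ex])
 let ?B = "(2 * et^2 + 2 * (2 * C)^2 * real CARD('n) ^ 4 * de powr (1 / 2 - s)) * (1 / (1 / 2 - s)) ^ CARD('n)"
 let ?u = "%x. H (%_. 0) (vclamp c de x)"
 have C0: "0 <= 2 * C" using C by simp
 have c0: "is_corner (0 :: real ^ 'n)" by (simp add: is_corner_def)
 have "AE x in lborel. x \<in> cube --> \<bar>f x - u x\<bar> <= et + (if EX j. reflect c x $ j < de then 2 * C * pair_sum 0 (reflect c x) s else 0)"
  using f
 proof eventually_elim
  case (elim x)
  show ?case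
  proof
  assume x: "x \<in> cube"
  let ?y = "reflect c x" and ?z = "vclamp c de x"
  have y: "?y \<in> cube" by (rule reflect_cube[OF x])
  have fx: "f x = H (%_. 0) ?y" using elim x by blast
  show "\<bar>f x - u x\<bar> <= et + (if EX j. ?y $ j < de then 2 * C * pair_sum 0 ?y s else 0)"
  proof (cases "EX j. ?y $ j < de")
  case True
  have "1 <= pair_sum 0 ?y s" by (rule pair_sum_ge_1[OF y c0 d1]) (use s in simp)
  \<comment> \<open>In the layer the difference is merely bounded; as \<open>pair_sum\<close> is at
    least 1, it takes the same form as the gradient error.\<close>
  then have "2 * C * 1 <= 2 * C * pair_sum 0 ?y s" by (intro mult_left_mono C0)
  then have "\<bar>f x - u x\<bar> <= et + 2 * C * pair_sum 0 ?y s"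
  using E0[OF x] H0[OF y] H0[OF vclamp_cube[OF x de, of c]] unfolding fx by linarith
  then show ?thesis using True by simp
  next
  case False
  then have "?z = ?y" unfolding vec_eq_iff vclamp_nth by (simp add: not_less)
  then show ?thesis using E0[OF x] False unfolding fx by (simp add: abs_minus_commute)
  qed
  qed
 qed
 then have b0: "sqL2 cube (%x. f x - u x) <= ennreal ?B" by (rule sqL2_bound[OF c s de(1) et C0])
 have b1: "sqL2 cube (%x. D i x - g i x) <= ennreal ?B" for i
 proof (rule sqL2_bound[OF c s de(1) et C0])
  have "AE x in lborel. (%n. diff_quot u i n x) \<longlonglongrightarrow> g i x" using g[of i] unfolding P_def by blast
  then show "AE x in lborel. x \<in> cube --> \<bar>D i x - g i x\<bar> <= et + (if EX j. reflect c x $ j < de then 2 * C * pair_sum 0 (reflect c x) s else 0)"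
  using DH[of i] AE_reflect_neq[of c i de]
  proof eventually_elim
  case (elim x)
  show ?case
  proof
  assume x: "x \<in> cube"
  let ?y = "reflect c x" and ?z = "vclamp c de x" and ?e = "axis i 1 :: real ^ 'n"
  define v where "v = (if de < ?y $ i then csign c i * H (unit_mi i) ?z else 0)"
  have y: "?y \<in> cube" and z: "?z \<in> cube" using reflect_cube[OF x] vclamp_cube[OF x de] by auto
  have lim: "(%n. diff_quot ?u i n x) \<longlonglongrightarrow> v"
  unfolding v_def by (rule clamped_diff_quot_tendsto[OF H x de elim(3)])
  have limE: "(%n. \<bar>diff_quot u i n x - diff_quot ?u i n x\<bar>) \<longlonglongrightarrow> \<bar>g i x - v\<bar>"
  by (intro tendsto_rabs tendsto_diff elim(1) lim)
  have "(%n. x + (1 / real (Suc n)) *\<^sub>R ?e) \<longlonglongrightarrow> x + 0 *\<^sub>R ?e"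
  by (intro tendsto_add tendsto_const tendsto_scaleR LIMSEQ_inverse_real_of_nat[unfolded inverse_eq_divide])
  then have "\<forall>\<^sub>F n in sequentially. x + (1 / real (Suc n)) *\<^sub>R ?e \<in> cube"
  using x by (intro topological_tendstoD[OF _ open_cube]) simp_all
  \<comment> \<open>The Lipschitz bound of the error passes to its difference quotients as soon as
    the shifted point lies in the cube, and from there to the limit.\<close>
  then have "\<forall>\<^sub>F n in sequentially. \<bar>diff_quot u i n x - diff_quot ?u i n x\<bar> <= et"
  proof eventually_elim
  case (elim n)
  let ?x = "x + (1 / real (Suc n)) *\<^sub>R ?e"
  have "diff_quot u i n x - diff_quot ?u i n x = real (Suc n) * ((u ?x - ?u ?x) - (u x - ?u x))"
  unfolding diff_quot_def by (simp only: algebra_simps)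
  then have "\<bar>diff_quot u i n x - diff_quot ?u i n x\<bar> = real (Suc n) * \<bar>(u ?x - ?u ?x) - (u x - ?u x)\<bar>"
  by (simp only: abs_mult abs_of_nat)
  also have "... <= real (Suc n) * (et * dist ?x x)" by (intro mult_left_mono E1 elim x) simp
  also have "dist ?x x = 1 / real (Suc n)" by (simp add: dist_norm norm_axis_1)
  finally show ?case by simp
  qed
  from tendsto_upperbound[OF limE this] have gv: "\<bar>g i x - v\<bar> <= et" by simp
  have Dx: "D i x = csign c i * H (unit_mi i) ?y" using elim(2) x by blast
  have cs: "\<bar>csign c i * r\<bar> = \<bar>r\<bar>" for r using csign_cases[of c i] by (auto simp: abs_mult)
  show "\<bar>D i x - g i x\<bar> <= et + (if EX j. ?y $ j < de then 2 * C * pair_sum 0 ?y s else 0)"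
  proof (cases "EX j. ?y $ j < de")
  case True
  \<comment> \<open>Clamping moves away from the faces, where the singular weight is smaller, so the
    gradient at the clamped point obeys the bound at y.\<close>
  have "C * pair_sum 0 ?z s <= C * pair_sum 0 ?y s"
  using C s by (intro mult_left_mono pair_sum_antimono[OF y z]) (auto simp: vclamp_nth)
  from order_trans[OF H1[OF z, of i] this] have zb: "\<bar>H (unit_mi i) ?z\<bar> <= C * pair_sum 0 ?y s" .
  have "\<bar>v\<bar> <= C * pair_sum 0 ?y s"
  using zb order_trans[OF abs_ge_zero zb] unfolding v_def by (simp add: cs)
  moreover have "\<bar>D i x\<bar> <= C * pair_sum 0 ?y s" unfolding Dx cs by (rule H1[OF y])
  ultimately have "\<bar>D i x - g i x\<bar> <= et + 2 * (C * pair_sum 0 ?y s)" using gv by linarith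
  then show ?thesis using True by (simp add: mult.assoc)
  next
  case False
  then have "?z = ?y" unfolding vec_eq_iff vclamp_nth by (simp add: not_less)
  moreover have "de < ?y $ i" using False elim(3) by (metis linorder_neqE_linordered_idom)
  ultimately have "v = D i x" by (simp add: v_def Dx)
  then show ?thesis using gv False by (simp add: abs_minus_commute)
  qed
  qed
  qed
 qed
 have B0: "0 <= ?B" using s by (intro mult_nonneg_nonneg add_nonneg_nonneg) auto
 have "sqL2 cube (%x. f x - u x) + (\<Sum>i\<in>UNIV. sqL2 cube (%x. D i x - g i x)) <= ennreal ?B + (\<Sum>i\<in>(UNIV :: 'n set). ennreal ?B)"
  by (intro add_mono sum_mono b0 b1)
 also have "... = ennreal (?B + (\<Sum>i\<in>(UNIV :: 'n set). ?B))"
  using B0 by (simp only: sum_ennreal ennreal_plus sum_nonneg)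
 also have "?B + (\<Sum>i\<in>(UNIV :: 'n set). ?B) = (real CARD('n) + 1) * ?B" by (simp add: algebra_simps)
 also have "ennreal ((real CARD('n) + 1) * ?B) <= ennreal (ep^2)" by (rule ennreal_leI[OF ep])
 finally have "sqL2 cube (%x. f x - u x) + (\<Sum>i\<in>UNIV. sqL2 cube (%x. D i x - g i x)) <= ennreal (ep^2)" .
 moreover have "weak_deriv cube (unit_mi i) (%x. f x - u x) (%x. D i x - g i x)" for i
  using weak_deriv_diff[OF D[of i]] g[of i] unfolding P_def by blast
 ultimately show ?thesis unfolding H1_le_def by (intro exI[of _ "%i x. D i x - g i x"]) blast
qed

section \<open>Choice of the parameters and conclusion\<close>

lemma eventually_power_exp_le:
 assumes "0 < (th::real)" shows "\<forall>\<^sub>F N in sequentially. A * real N ^ p * exp (- real N) <= th"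
proof -
 have "((%N. A * (real N ^ p / exp (real N))) \<longlongrightarrow> A * 0) sequentially"
  by (intro tendsto_mult tendsto_const filterlim_compose[OF tendsto_power_div_exp_0 filterlim_real_sequentially])
 then have "\<forall>\<^sub>F N in sequentially. A * (real N ^ p / exp (real N)) < th" using assms by (intro order_tendstoD) auto
 then show ?thesis by (rule eventually_mono) (simp add: exp_minus divide_inverse mult.assoc)
qed

text \<open>The doubling stages cost of order N^4 and the tensor products N^(2n+1); the latter
  dominate because n is at least 2.\<close>

lemma network_size_bound:
 fixes N n k1 k2 k3 h b :: nat
 assumes N: "1 <= N" and n: "2 <= n" and S: "S <= k2 * N" and K: "K <= h * N^2" and cB: "cB <= b * N ^ (2 * n)"
 shows "6 * n + 18 * n * (k1 * N + 1) + 6 * K + S * (48 * (k3 * N + 1) * K) + n * (48 * (k3 * N + 1) * (cB + K)) + Suc cB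
  <= (6 * n + 18 * n * (k1 + 1) + 6 * h + 48 * k2 * (k3 + 1) * h + 48 * n * (k3 + 1) * (b + h) + 1 + b) * N ^ (2 * n + 1)"
proof -
 let ?M = "N ^ (2 * n + 1)"
 have pw: "N ^ i <= ?M" if "i <= 2 * n + 1" for i using N that by (intro power_increasing) auto
 have M: "1 <= ?M" "N <= ?M" "N^2 <= ?M" "N ^ (2 * n) <= ?M" "N ^ 3 <= ?M" "N ^ 4 <= ?M"
  using pw[of 0] pw[of 1] pw[of 2] pw[of "2 * n"] pw[of 3] pw[of 4] n by auto
 have l: "k1 * N + 1 <= (k1 + 1) * N" "k3 * N + 1 <= (k3 + 1) * N" using N by auto
 have 1: "6 * n <= 6 * n * ?M" using M(1) by simp
 have 2: "18 * n * (k1 * N + 1) <= 18 * n * (k1 + 1) * ?M"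
  unfolding mult.assoc by (intro mult_le_mono2 order_trans[OF l(1)] M)
 have 3: "6 * K <= 6 * h * ?M" unfolding mult.assoc by (intro mult_le_mono2 order_trans[OF K] M)
 have 4: "S * (48 * (k3 * N + 1) * K) <= 48 * k2 * (k3 + 1) * h * ?M"
 proof -
  have "S * (48 * (k3 * N + 1) * K) <= (k2 * N) * (48 * ((k3 + 1) * N) * (h * N^2))"
  by (intro mult_le_mono S l K order_refl)
  also have "... = 48 * k2 * (k3 + 1) * h * N ^ 4" by (simp add: power4_eq_xxxx power2_eq_square algebra_simps)
  also have "... <= 48 * k2 * (k3 + 1) * h * ?M" by (intro mult_le_mono2 M)
  finally show ?thesis .
 qed
 have 5: "n * (48 * (k3 * N + 1) * (cB + K)) <= 48 * n * (k3 + 1) * (b + h) * ?M"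
 proof -
  have "cB + K <= (b + h) * N ^ (2 * n)"
  proof -
  have "N^2 <= N ^ (2 * n)" using N n by (intro power_increasing) auto
  then have "h * N^2 <= h * N ^ (2 * n)" by (rule mult_le_mono2)
  from add_mono[OF cB order_trans[OF K this]] show ?thesis by (simp only: distrib_right)
  qed
  then have "n * (48 * (k3 * N + 1) * (cB + K)) <= n * (48 * ((k3 + 1) * N) * ((b + h) * N ^ (2 * n)))"
  by (intro mult_le_mono l order_refl)
  also have "... = 48 * n * (k3 + 1) * (b + h) * ?M" by (simp add: algebra_simps)
  finally show ?thesis .
 qed
 have 6: "Suc cB <= (1 + b) * ?M"
 proof -
  have "b * N ^ (2 * n) <= b * ?M" by (intro mult_le_mono2 M)
  from order_trans[OF cB this] show ?thesis using M(1) unfolding distrib_right by linarith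
 qed
 show ?thesis using add_mono[OF add_mono[OF add_mono[OF add_mono[OF add_mono[OF 1 2] 3] 4] 5] 6]
  by (simp only: distrib_right add.assoc)
qed

text \<open>Parameters for accuracy exp(-N): mesh depth \<open>l = k1 * N\<close>, degrees below
  \<open>2 ^ S\<close>, which lies between \<open>2 ^ k2 * N\<close> and twice that, and sawtooth
  depth \<open>m = k3 * N\<close>.\<close>

lemma J_class_network:
 fixes c :: "real ^ 'n::finite"
 assumes d: "CARD('n) = 2 | CARD('n) = 3" and c: "is_corner c" and eh: "0 < eh" "eh < 1"
  and CA: "0 < Cf" "0 < Af" and f: "f \<in> J_class eh c gac gae Cf Af"
  and g: "if CARD('n) = 2 then gac > 1 else gac > 3/2 & (ALL k. gae k > 1)"
 shows "\<exists>K::real. \<forall>\<^sub>F N in sequentially. EX Ph. nn_wf CARD('n) Ph & H1_le (%x. f x - nn_real Ph x) (exp (- real N)) \<and>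
  (\<forall>x\<in>(cube :: (real ^ 'n) set). \<bar>nn_real Ph x\<bar> <= K) \<and>
  real (nn_size Ph) <= K * real N ^ (2 * CARD('n) + 1) & real (nn_depth Ph) <= K * (real N * ln (real N))" (is "EX K. \<forall>\<^sub>F N in sequentially. ?good K N")
proof -
 let ?n = "CARD('n)" and ?d = "real CARD('n)"
 have n2: "2 <= ?n" and d1: "?n ~= 1" using d by auto
 obtain H C A s D where H: "smooth_family H" and C: "0 < C" "0 < A" and s: "0 < s" "s < 1 / 2"
  and Hb: "!!al y. y \<in> cube ==> \<bar>H al y\<bar> <= C * A ^ mi_abs al * fact (mi_abs al) * (\<Prod>j\<in>UNIV. (1 / y $ j) ^ (al j + 1))"
  and H0: "!!y. y \<in> cube ==> \<bar>H (%_. 0) y\<bar> <= C"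
  and H1: "!!i y. y \<in> cube ==> \<bar>H (unit_mi i) y\<bar> <= C * pair_sum 0 y s"
  and fH: "AE x in lborel. x \<in> cube --> f x = H (%_. 0) (reflect c x)"
  and D: "!!i. weak_deriv cube (unit_mi i) f (D i)"
  and DH: "!!i. AE x in lborel. x \<in> cube --> D i x = csign c i * H (unit_mi i) (reflect c x)"
  by (rule J_class_regularity[OF d c eh CA f g]) (rule that; assumption)
 obtain sg C' where sg: "0 < sg" "sg < 1" and C': "0 < C'" and
  T: "!!l P. EX cf. (ALL b. \<bar>cf b\<bar> <= C' * (1 / sg) ^ (l * ?n)) \<and>
  (\<forall>x\<in>cube. \<forall>y\<in>cube. (ALL j. sg ^ l <= x $ j) --> (ALL j. sg ^ l <= y $ j) -->
  (let E = (%x. H (%_. 0) x - (\<Sum>b\<in>PiE UNIV (%_. {..l} \<times> {..P}). cf b * (\<Prod>j\<in>UNIV. vfun sg (b j) (x $ j))));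
  et = C' * real (l + 1) ^ ?n * (1 / sg) ^ (l * (?n + 1)) * (1 / 2) ^ P
  in \<bar>E x\<bar> <= et & \<bar>E x - E y\<bar> <= et * dist x y))"
  by (rule taylor_pou_approx[OF H C Hb]) (assumption, (rule that; assumption))
 define L where "L = ln (1 / sg)"
 have L: "0 < L" unfolding L_def using sigma_order(2)[OF sg] by (rule ln_gt_zero)
 have rho: "(1 / sg) ^ k = exp (real k * L)" for k
  unfolding L_def using sg by (simp add: exp_of_nat_mult)
 define mx where "mx = 1 / 2 - s"
 have mx: "0 < mx" using s by (simp add: mx_def)
 \<comment> \<open>Makes \<open>de powr mx\<close> at most exp(-3N): exp(-2N) is the squared
   accuracy, and the remaining exp(-N) beats the constants.\<close>
 define k1 where "k1 = nat \<lceil>3 / (L * mx)\<rceil>"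
 have k1: "3 <= real k1 * L * mx"
 proof -
  have "3 / (L * mx) <= real k1" unfolding k1_def by (rule real_nat_ceiling_ge)
  then show ?thesis using L mx by (simp add: field_simps)
 qed
 \<comment> \<open>The numerator is the growth rate in N of \<open>(1 / sg) ^ (l * (d + 1))\<close>
   plus 2, to be beaten by powers of 1/2. Of the resulting exp(-2N) one factor exp(-N) is the
   accuracy, and the other absorbs polynomials in N.\<close>
 define q where "q = (real k1 * (?d + 1) * L + 2) / ln 2"
 have l2: "0 < ln (2::real)" by simp
 define k2 where "k2 = nat \<lceil>q\<rceil>"
 have k2q: "q <= real k2" unfolding k2_def by (rule real_nat_ceiling_ge)
 have k2: "q <= 2 ^ k2"
 proof -
  have "real k2 <= real (2 ^ k2)" by (rule of_nat_mono[OF less_imp_le[OF less_exp]])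
  from order_trans[OF k2q this] show ?thesis by simp
 qed
 define k3 where "k3 = k2"
 have half: "(1 / 2 :: real) ^ k = exp (- (real k * ln 2))" for k
  by (simp add: exp_minus exp_of_nat_mult power_one_over inverse_eq_divide)
 define a where "a = (2::nat) ^ Suc k2"
 \<comment> \<open>The stages lose 10^S <= 16^S = (2^S)^4 in accuracy, and 2^S is at most
   \<open>a * N\<close>; so the loss is polynomial in N.\<close>
 define Ae where "Ae = (10::real) ^ ?n * real a ^ 4"
 define Aw where "Aw = 1 + 2 * ?d * pou_lip sg"
 define A1 where "A1 = 2 * C' * real (k1 + 1) ^ ?n + (real (k1 + 1) * real a) ^ ?n * C' * Aw * Ae"
 define R where "R = (?d + 1) * (1 / mx) ^ ?n"
 have R: "0 < R" using mx by (simp add: R_def)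
 \<comment> \<open>Makes the part of the squared error that comes from \<open>et\<close> at most
   half of the squared accuracy; the layer takes the other half.\<close>
 define th where "th = min 1 (1 / (4 * R))"
 have th: "0 < th" "th <= 1" "2 * R * th^2 <= 1 / 2"
 proof -
  show t: "0 < th" "th <= 1" using R by (auto simp: th_def)
  have "2 * R * th^2 = (2 * R * th) * th" by (simp add: power2_eq_square)
  also have "... <= (2 * R * th) * 1" using R t by (intro mult_left_mono) auto
  also have "... <= 2 * R * (1 / (4 * R))" unfolding mult_1_right using R by (intro mult_left_mono) (auto simp: th_def)
  also have "... = 1 / 2" using R by simp
  finally show "2 * R * th^2 <= 1 / 2" .
 qed
 define h where "h = ?n * ((k1 + 1) * ((a + 1) * 2))"
 define b where "b = ((k1 + 1) * a) ^ ?n"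
 define Ks where "Ks = 6 * ?n + 18 * ?n * (k1 + 1) + 6 * h + 48 * a * (k3 + 1) * h + 48 * ?n * (k3 + 1) * (b + h) + 1 + b"
 define Kd where "Kd = 4 + (real (Suc k2) + 1 / ln 2 + ?d) * (real k3 + 2)"
 define K where "K = max (C + 1) (max (real Ks) Kd)"
 have plp: "0 < pou_lip sg" by (rule pou_lip_pos[OF sg])
 have pos: "0 <= Aw" "0 <= Ae" "0 <= A1" "1 <= Aw" using plp C' by (auto simp: Aw_def Ae_def A1_def)
 have main: "?good K N"
  if N3: "3 <= N" and e1: "Ae * real N ^ 4 * exp (- real N) <= 1"
  and e2: "A1 * real N ^ (2 * ?n + 4) * exp (- real N) <= th"
  and e3: "R * (2 * (2 * C)^2 * ?d ^ 4) * real N ^ 0 * exp (- real N) <= 1 / 2" for N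
 proof -
  have N1: "1 <= real N" "1 <= N" using N3 by auto
  define l m where "l = k1 * N" and "m = k3 * N"
  \<comment> \<open>A power of 2 between N and 2N, so that the number of doubling stages is about
    log N.\<close>
  obtain S0 where S0: "N <= 2 ^ S0" "2 ^ S0 <= 2 * N"
  proof -
  obtain j where j: "2 ^ j <= N" "N < 2 ^ (j + 1)" using ex_power_ivl1[of 2 N] N1 by auto
  show thesis by (rule that[of "Suc j"]) (use j in auto)
  qed
  define S where "S = S0 + k2"
  have S: "2 ^ k2 * N <= 2 ^ S" "2 ^ S <= a * N"
  using mult_le_mono2[OF S0(1), of "2 ^ k2"] mult_le_mono2[OF S0(2), of "2 ^ k2"] by (auto simp: S_def a_def power_add mult_ac)
  have Sr: "2 ^ S <= real a * real N" using of_nat_mono[OF S(2), where 'a = real] by simp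
  \<comment> \<open>A hat times a ramp power of degree at most P has total exponent at most
    \<open>2 ^ S\<close> and thus belongs to the last doubling stage.\<close>
  define P where "P = 2 ^ S - (1::nat)"
  have P: "Suc P = 2 ^ S" by (simp add: P_def)
  define B where "B = PiE (UNIV :: 'n set) (%_. {..l} \<times> {..P})"
  have l1: "real (l + 1) <= real (k1 + 1) * real N" using N1 by (simp add: l_def algebra_simps)
  have l1n: "l + 1 <= (k1 + 1) * N" using N1 by (simp add: l_def)
  have Bf: "finite B" unfolding B_def by (intro finite_PiE) auto
  have cB: "card B = ((l + 1) * 2 ^ S) ^ ?n" unfolding B_def using P by (simp add: card_PiE card_cartesian_product)
  have cBn: "card B <= b * N ^ (2 * ?n)"
  proof -
  have "card B <= (((k1 + 1) * N) * (a * N)) ^ ?n" unfolding cB by (intro power_mono mult_le_mono l1n S) auto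
  also have "... = b * N ^ (2 * ?n)" unfolding b_def power_mult_distrib mult_2 power_add by (simp only: mult_ac)
  finally show ?thesis .
  qed
  have cBr: "real (card B) <= (real (k1 + 1) * real a) ^ ?n * real N ^ (2 * ?n)"
  proof -
  have "real (card B) <= real (b * N ^ (2 * ?n))" using cBn by (rule of_nat_mono)
  also have "... = (real (k1 + 1) * real a) ^ ?n * real N ^ (2 * ?n)" unfolding b_def of_nat_mult of_nat_power ..
  finally show ?thesis .
  qed
  obtain cf where cf: "!!b. \<bar>cf b\<bar> <= C' * (1 / sg) ^ (l * ?n)" and
  E: "\<forall>x\<in>cube. \<forall>y\<in>cube. (ALL j. sg ^ l <= x $ j) --> (ALL j. sg ^ l <= y $ j) -->
  (let E = (%x. H (%_. 0) x - (\<Sum>b\<in>B. cf b * (\<Prod>j\<in>UNIV. vfun sg (b j) (x $ j))));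
  et = C' * real (l + 1) ^ ?n * (1 / sg) ^ (l * (?n + 1)) * (1 / 2) ^ P
  in \<bar>E x\<bar> <= et & \<bar>E x - E y\<bar> <= et * dist x y)"
  using T[of l P] unfolding B_def by blast
  define etT where "etT = C' * real (l + 1) ^ ?n * (1 / sg) ^ (l * (?n + 1)) * (1 / 2) ^ P"
  define e where "e = 10 ^ (S + ?n) * (1 / 2 :: real) ^ m"
  define Q where "Q x = (\<Sum>b\<in>B. cf b * (\<Prod>j\<in>UNIV. vfun sg (b j) (tclamp c (sg ^ l) j x)))" for x
  \<comment> \<open>Coefficients grow like \<open>(1 / sg) ^ (l * d)\<close> and Lipschitz constants
    like \<open>(1 / sg) ^ l\<close>; the sawtooth error has to beat their product.\<close>
  have halfm: "exp (real k1 * (?d + 1) * L * real N) * (1 / 2) ^ m <= exp (- (2 * real N))"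
  proof -
  have "real k1 * (?d + 1) * L + 2 <= real k3 * ln 2" using k2q l2 by (simp add: q_def k3_def field_simps)
  then have "(real k1 * (?d + 1) * L + 2) * real N <= (real k3 * ln 2) * real N" by (intro mult_right_mono) auto
  then have "real k1 * (?d + 1) * L * real N - real m * ln 2 <= - (2 * real N)" by (simp add: m_def algebra_simps)
  then show ?thesis unfolding half exp_add[symmetric] by simp
  qed
  have ge1: "1 <= exp (real k1 * (?d + 1) * L * real N)" using L by simp
  have e10: "10 ^ (S + ?n) <= Ae * real N ^ 4"
  proof -
  have "(10::real) ^ S <= 16 ^ S" by (intro power_mono) auto
  also have "(16::real) ^ S = (2 ^ S) ^ 4"
  proof -
  have 16: "(16::real) = 2 ^ 4" by simp
  show ?thesis unfolding 16 power_mult[symmetric] mult.commute[of 4] ..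
  qed
  also have "... <= (real a * real N) ^ 4" by (intro power_mono Sr) auto
  finally have "(10::real) ^ S * 10 ^ ?n <= (real a * real N) ^ 4 * 10 ^ ?n" by (intro mult_right_mono) auto
  then show ?thesis by (simp add: Ae_def power_add power_mult_distrib mult_ac)
  qed
  have eN: "e <= 1"
  proof -
  have "(1 / 2) ^ m <= exp (real k1 * (?d + 1) * L * real N) * (1 / 2 :: real) ^ m"
  using mult_right_mono[OF ge1, of "(1 / 2) ^ m"] by simp
  also have "... <= exp (- (2 * real N))" by (rule halfm)
  also have "... <= exp (- real N)" by simp
  finally have "e <= Ae * real N ^ 4 * exp (- real N)" unfolding e_def by (intro mult_mono e10) (auto simp: pos)
  then show ?thesis using e1 by linarith
  qed
  define Kc where "Kc = ?n * ((l + 1) * ((2 ^ S + 1) * 2))"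
  have Kc: "Kc <= h * N^2"
  proof -
  have "Kc <= ?n * (((k1 + 1) * N) * (((a + 1) * N) * 2))"
  unfolding Kc_def using S(2) N1 by (intro mult_le_mono l1n order_refl) simp
  also have "... = h * N^2" by (simp add: h_def power2_eq_square algebra_simps)
  finally show ?thesis .
  qed
  have v1: "10 ^ (S + ?n) * (1 / 2 :: real) ^ m <= 1" using eN by (simp add: e_def)
  have v2: "card (HR sg l c S) <= Kc" unfolding Kc_def by (rule card_HR[OF sg])
  have v3: "fst (b j) <= l & snd (b j) < 2 ^ S" if "b \<in> B" for b j
  using that P by (auto simp: B_def PiE_iff mem_Times_iff less_Suc_eq_le[symmetric])
  obtain Ph where Ph: "nn_wf ?n Ph" "nn_depth Ph = 4 + (S + ?n) * (m + 2)"
  "nn_size Ph <= 6 * ?n + 18 * ?n * (l + 1) + 6 * Kc + S * (48 * (m + 1) * Kc) + ?n * (48 * (m + 1) * (card B + Kc)) + Suc (card B)"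
  "pl_fun (nn_real Ph :: real ^ 'n => real)"
  "!!x. \<bar>nn_real Ph x - Q x\<bar> <= (\<Sum>b\<in>B. \<bar>cf b\<bar>) * e"
  "!!x y. \<bar>(nn_real Ph x - Q x) - (nn_real Ph y - Q y)\<bar> <= (\<Sum>b\<in>B. \<bar>cf b\<bar>) * e * (?d * (2 * (pou_lip sg * (1 / sg) ^ l))) * dist x y"
  by (rule vfun_network[OF sg, where S = S and m = m and l = l and K = Kc and B = B and c = c and cf = cf, OF v1 v2 Bf])
  (rule v3, assumption, (rule that[unfolded Q_def e_def]; assumption))
  define de where "de = sg ^ l"
  have k1p: "0 < k1" using k1 by (cases k1) auto
  have de: "0 < de" "de < 1" using sg k1p N1 by (auto simp: de_def l_def intro!: power_Suc_less_one power_less_one_iff[THEN iffD2])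
  \<comment> \<open>Taylor error plus emulation error. The factor \<open>Aw * (1 / sg) ^ l\<close>
    is at least 1 and dominates the Lipschitz constant, so \<open>et\<close> serves both
    norms.\<close>
  define et where "et = etT + (\<Sum>b\<in>B. \<bar>cf b\<bar>) * e * (Aw * (1 / sg) ^ l)"
  have etT0: "0 <= etT" using C' sg by (simp add: etT_def)
  have e0: "0 <= e" by (simp add: e_def)
  have s0: "0 <= (\<Sum>b\<in>B. \<bar>cf b\<bar>) * e" using e0 by (intro mult_nonneg_nonneg sum_nonneg) auto
  have w1: "1 <= (1 / sg) ^ l" using sg by (intro one_le_power) simp
  have w2: "1 <= Aw * (1 / sg) ^ l" using mult_mono[OF pos(4) w1] pos by simp
  have w3: "?d * (2 * (pou_lip sg * (1 / sg) ^ l)) <= Aw * (1 / sg) ^ l"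
  unfolding Aw_def using w1 by (simp add: distrib_right mult_ac)
  have et0: "0 <= et" unfolding et_def using etT0 s0 w2 by (intro add_nonneg_nonneg mult_nonneg_nonneg[OF s0]) auto
  \<comment> \<open>At clamped points all coordinates are at least \<open>sg ^ l\<close>, as the
    Taylor estimate demands, and clamping does not increase distances.\<close>
  have TE: "\<bar>H (%_. 0) (vclamp c de x) - Q x\<bar> <= etT \<and>
  \<bar>(H (%_. 0) (vclamp c de x) - Q x) - (H (%_. 0) (vclamp c de y) - Q y)\<bar> <= etT * dist x y" if xy: "x \<in> cube" "y \<in> cube" for x y
  proof -
  have q: "Q x = (\<Sum>b\<in>B. cf b * (\<Prod>j\<in>UNIV. vfun sg (b j) (vclamp c de x $ j)))" for x
  by (simp add: Q_def vclamp_def de_def)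
  have ge: "ALL j. sg ^ l <= vclamp c de x $ j" for x by (simp add: vclamp_nth de_def)
  have r: "\<bar>H (%_. 0) (vclamp c de x) - Q x\<bar> <= etT \<and>
  \<bar>(H (%_. 0) (vclamp c de x) - Q x) - (H (%_. 0) (vclamp c de y) - Q y)\<bar> <= etT * dist (vclamp c de x) (vclamp c de y)"
  using E[rule_format, OF vclamp_cube[OF xy(1) de, of c] vclamp_cube[OF xy(2) de, of c]] ge
  unfolding q Let_def etT_def by blast
  then show ?thesis using mult_left_mono[OF dist_vclamp_le[of c de x y] etT0] by linarith
  qed
  have ER0: "\<bar>nn_real Ph x - H (%_. 0) (vclamp c de x)\<bar> <= et" if "x \<in> cube" for x
  using Ph(5)[of x] TE[OF that that] mult_left_mono[OF w2 s0] unfolding et_def by linarith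
  have ER1: "\<bar>(nn_real Ph x - H (%_. 0) (vclamp c de x)) - (nn_real Ph y - H (%_. 0) (vclamp c de y))\<bar> <= et * dist x y" if "x \<in> cube" "y \<in> cube" for x y
  using Ph(6)[of x y] TE[OF that] mult_right_mono[OF mult_left_mono[OF w3 s0] zero_le_dist[of x y]]
  unfolding et_def distrib_right by linarith
  have etb: "et <= th * exp (- real N)"
  proof -
  have x1: "etT <= 2 * C' * real (k1 + 1) ^ ?n * real N ^ (2 * ?n + 4) * exp (- (2 * real N))"
  proof -
  have "(1 / 2 :: real) ^ P = 2 * (1 / 2) ^ 2 ^ S" unfolding P[symmetric] by simp
  also have "... <= 2 * (1 / 2) ^ (2 ^ k2 * N)" by (intro mult_left_mono power_decreasing S) auto
  also have "... = 2 * exp (- (2 ^ k2 * ln 2 * real N))" by (simp add: half mult_ac)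
  finally have "(1 / sg) ^ (l * (?n + 1)) * (1 / 2) ^ P <= exp (real (l * (?n + 1)) * L) * (2 * exp (- (2 ^ k2 * ln 2 * real N)))"
  unfolding rho by (intro mult_left_mono) auto
  also have "... = 2 * exp (real (l * (?n + 1)) * L - 2 ^ k2 * ln 2 * real N)" by (simp add: exp_diff exp_minus divide_inverse)
  also have "... <= 2 * exp (- (2 * real N))"
  proof -
  have "real k1 * (?d + 1) * L + 2 <= 2 ^ k2 * ln 2" using k2 l2 by (simp add: q_def field_simps)
  then have "(real k1 * (?d + 1) * L + 2) * real N <= (2 ^ k2 * ln 2) * real N" by (intro mult_right_mono) auto
  then show ?thesis by (simp add: l_def algebra_simps)
  qed
  finally have y1: "(1 / sg) ^ (l * (?n + 1)) * (1 / 2) ^ P <= 2 * exp (- (2 * real N))" .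
  have "real (l + 1) ^ ?n <= (real (k1 + 1) * real N) ^ ?n" by (intro power_mono l1) auto
  also have "... <= real (k1 + 1) ^ ?n * real N ^ (2 * ?n + 4)"
  unfolding power_mult_distrib using N1 by (intro mult_left_mono power_increasing) auto
  finally have z1: "real (l + 1) ^ ?n <= real (k1 + 1) ^ ?n * real N ^ (2 * ?n + 4)" .
  have "C' * (real (l + 1) ^ ?n * ((1 / sg) ^ (l * (?n + 1)) * (1 / 2) ^ P)) <= C' * ((real (k1 + 1) ^ ?n * real N ^ (2 * ?n + 4)) * (2 * exp (- (2 * real N))))"
  by (rule mult_left_mono[OF mult_mono[OF z1 y1]]) (use C' sg in auto)
  then show ?thesis unfolding etT_def by (simp only: mult_ac)
  qed
  have x2: "(\<Sum>b\<in>B. \<bar>cf b\<bar>) * e * (Aw * (1 / sg) ^ l) <= (real (k1 + 1) * real a) ^ ?n * C' * Aw * Ae * real N ^ (2 * ?n + 4) * exp (- (2 * real N))"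
  proof -
  have "(\<Sum>b\<in>B. \<bar>cf b\<bar>) <= (\<Sum>b\<in>B. C' * (1 / sg) ^ (l * ?n))" by (intro sum_mono cf)
  also have "... = real (card B) * (C' * (1 / sg) ^ (l * ?n))" by simp
  also have "... <= ((real (k1 + 1) * real a) ^ ?n * real N ^ (2 * ?n)) * (C' * (1 / sg) ^ (l * ?n))"
  using C' sg by (intro mult_right_mono cBr) auto
  finally have y1: "(\<Sum>b\<in>B. \<bar>cf b\<bar>) <= ((real (k1 + 1) * real a) ^ ?n * real N ^ (2 * ?n)) * (C' * (1 / sg) ^ (l * ?n))" .
  have y2: "e <= (Ae * real N ^ 4) * (1 / 2) ^ m" unfolding e_def by (intro mult_right_mono e10) auto
  have "(\<Sum>b\<in>B. \<bar>cf b\<bar>) * e * (Aw * (1 / sg) ^ l) \<le>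
  (((real (k1 + 1) * real a) ^ ?n * real N ^ (2 * ?n)) * (C' * (1 / sg) ^ (l * ?n))) * ((Ae * real N ^ 4) * (1 / 2) ^ m) * (Aw * (1 / sg) ^ l)"
  using C' sg e0 pos by (intro mult_right_mono mult_mono y1 y2) auto
  also have "... = ((real (k1 + 1) * real a) ^ ?n * C' * Aw * Ae * (real N ^ (2 * ?n) * real N ^ 4)) * (((1 / sg) ^ (l * ?n) * (1 / sg) ^ l) * (1 / 2) ^ m)"
  by (simp only: mult_ac)
  also have "(1 / sg) ^ (l * ?n) * (1 / sg) ^ l = exp (real k1 * (?d + 1) * L * real N)"
  unfolding rho exp_add[symmetric] by (simp add: l_def algebra_simps)
  also have "real N ^ (2 * ?n) * real N ^ 4 = real N ^ (2 * ?n + 4)" by (rule power_add[symmetric])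
  also have "((real (k1 + 1) * real a) ^ ?n * C' * Aw * Ae * real N ^ (2 * ?n + 4)) * (exp (real k1 * (?d + 1) * L * real N) * (1 / 2) ^ m)
  <= ((real (k1 + 1) * real a) ^ ?n * C' * Aw * Ae * real N ^ (2 * ?n + 4)) * exp (- (2 * real N))"
  using C' pos by (intro mult_left_mono halfm) auto
  finally show ?thesis .
  qed
  have "et <= A1 * real N ^ (2 * ?n + 4) * exp (- (2 * real N))"
  using add_mono[OF x1 x2] unfolding et_def A1_def by (simp only: distrib_right)
  also have "exp (- (2 * real N)) = exp (- real N) * exp (- real N)" by (simp flip: exp_add)
  also have "A1 * real N ^ (2 * ?n + 4) * (exp (- real N) * exp (- real N)) <= th * exp (- real N)"
  unfolding mult.assoc[symmetric] using e2 by (intro mult_right_mono) auto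
  finally show ?thesis .
  qed
  have ex1: "exp (- real N) <= 1" by simp
  have et1: "et <= 1"
  proof -
  have "th * exp (- real N) <= 1 * 1" using th ex1 by (intro mult_mono) auto
  then show ?thesis using etb by linarith
  qed
  have db: "de powr mx <= exp (- (3 * real N))"
  proof -
  have "de powr mx = exp (mx * ln de)" using de by (simp add: powr_def)
  also have "ln de = - (real l * L)" using sg by (simp add: de_def L_def ln_realpow ln_div)
  also have "mx * - (real l * L) = - ((real k1 * L * mx) * real N)" by (simp add: l_def)
  also have "exp ... <= exp (- (3 * real N))" using mult_right_mono[OF k1, of "real N"] by simp
  finally show ?thesis .
  qed
  have "H1_le (%x. f x - nn_real Ph x) (exp (- real N))"
  proof (rule clamped_H1_error[OF c d1 H C(1) s H0 H1 fH D DH Ph(4) de et0 ER0 ER1])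
  let ?W = "2 * (2 * C)^2 * ?d ^ 4"
  have "2 * et^2 <= 2 * (th * exp (- real N))^2" by (intro mult_left_mono power_mono etb et0) auto
  then have a1: "R * (2 * et^2) <= (2 * R * th^2) * (exp (- real N))^2"
  using mult_left_mono[of "2 * et^2" "2 * (th * exp (- real N))^2" R] R by (simp add: power_mult_distrib mult_ac)
  have a2: "(2 * R * th^2) * (exp (- real N))^2 <= 1 / 2 * (exp (- real N))^2" by (intro mult_right_mono th(3)) auto
  have x3: "exp (- (3 * real N)) = exp (- real N) * (exp (- real N))^2" by (simp add: power2_eq_square flip: exp_add)
  have "R * (?W * de powr mx) <= R * (?W * exp (- (3 * real N)))" using R by (intro mult_left_mono db) auto
  also have "... = (R * ?W * real N ^ 0 * exp (- real N)) * (exp (- real N))^2" unfolding x3 by simp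
  also have "... <= 1 / 2 * (exp (- real N))^2" by (intro mult_right_mono e3) auto
  finally have a3: "R * (?W * de powr mx) <= 1 / 2 * (exp (- real N))^2" .
  have "(?d + 1) * ((2 * et^2 + ?W * de powr mx) * (1 / mx) ^ ?n) = R * (2 * et^2) + R * (?W * de powr mx)"
  unfolding R_def by (simp only: distrib_left distrib_right mult_ac)
  then show "(?d + 1) * ((2 * et^2 + ?W * de powr (1 / 2 - s)) * (1 / (1 / 2 - s)) ^ ?n) <= (exp (- real N))^2"
  unfolding mx_def[symmetric] using a1 a2 a3 by linarith
  qed
  moreover have "\<bar>nn_real Ph x\<bar> <= K" if x: "x \<in> cube" for x :: "real ^ 'n"
  proof -
  have "\<bar>nn_real Ph x\<bar> <= C + 1" using ER0[OF x] H0[OF vclamp_cube[OF x de, of c]] et1 by linarith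
  then show ?thesis by (simp add: K_def)
  qed
  moreover have "real (nn_size Ph) <= K * real N ^ (2 * ?n + 1)"
  proof -
  have Sa: "S <= a * N" using less_exp[of S] S(2) by linarith
  have "nn_size Ph <= Ks * N ^ (2 * ?n + 1)"
  using Ph(3) network_size_bound[OF N1(2) n2 Sa Kc cBn, of k1 k3] unfolding Ks_def l_def m_def by linarith
  then have "real (nn_size Ph) <= real (Ks * N ^ (2 * ?n + 1))" by (rule of_nat_mono)
  also have "... = real Ks * real N ^ (2 * ?n + 1)" by (simp only: of_nat_mult of_nat_power)
  also have "... <= K * real N ^ (2 * ?n + 1)" by (intro mult_right_mono) (auto simp: K_def)
  finally show ?thesis .
  qed
  moreover have "real (nn_depth Ph) <= K * (real N * ln (real N))"
  proof -
  \<comment> \<open>N is at least 3, hence at least e; constants in the depth can then be absorbed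
    by the logarithm.\<close>
  have lnN: "1 <= ln (real N)"
  proof -
  have "exp 1 <= real N" using exp_le N3 by linarith
  then have "ln (exp 1) <= ln (real N)" using N1 by (subst ln_le_cancel_iff) auto
  then show ?thesis by simp
  qed
  have "real S * ln 2 = ln (2 ^ S)" by (simp add: ln_realpow)
  also have "... <= ln (real a * real N)" using Sr N1 by (subst ln_le_cancel_iff) (auto simp: a_def)
  also have "... = real (Suc k2) * ln 2 + ln (real N)" using N1 unfolding a_def of_nat_power of_nat_numeral by (subst ln_mult) (auto simp del: power_Suc simp: ln_realpow)
  finally have "real S <= (real (Suc k2) * ln 2 + ln (real N)) / ln 2" using l2 by (simp add: pos_le_divide_eq)
  also have "... = real (Suc k2) + 1 / ln 2 * ln (real N)" using l2 by (simp add: add_divide_distrib)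
  finally have Sb: "real S <= real (Suc k2) + 1 / ln 2 * ln (real N)" .
  have sb: "real S + ?d <= (real (Suc k2) + 1 / ln 2 + ?d) * ln (real N)"
  proof -
  have "real (Suc k2) * 1 <= real (Suc k2) * ln (real N)" "?d * 1 <= ?d * ln (real N)" by (intro mult_left_mono lnN; simp)+
  then show ?thesis using Sb by (simp only: distrib_right mult_1_right)
  qed
  have mb: "real m + 2 <= (real k3 + 2) * real N" using N1 by (simp add: m_def distrib_right)
  have "real (nn_depth Ph) = 4 + (real S + ?d) * (real m + 2)" unfolding Ph(2) by (simp add: algebra_simps)
  also have "... <= 4 * (real N * ln (real N)) + ((real (Suc k2) + 1 / ln 2 + ?d) * ln (real N)) * ((real k3 + 2) * real N)"
  proof (rule add_mono)
  show "4 <= 4 * (real N * ln (real N))" using mult_mono[OF N1(1) lnN] by simp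
  show "(real S + ?d) * (real m + 2) <= ((real (Suc k2) + 1 / ln 2 + ?d) * ln (real N)) * ((real k3 + 2) * real N)"
  using sb by (intro mult_mono sb mb) auto
  qed
  also have "... = Kd * (real N * ln (real N))" unfolding Kd_def distrib_right[of 4] by (simp only: mult_ac)
  also have "... <= K * (real N * ln (real N))" using lnN by (intro mult_right_mono) (auto simp: K_def)
  finally show ?thesis .
  qed
  ultimately show ?thesis using Ph(1) by blast
 qed
 have "\<forall>\<^sub>F N in sequentially. ?good K N"
  using eventually_ge_at_top[of 3] eventually_power_exp_le[of 1 Ae 4, OF zero_less_one] eventually_power_exp_le[OF th(1), of A1 "2 * ?n + 4"]
  eventually_power_exp_le[of "1 / 2" "R * (2 * (2 * C)^2 * ?d ^ 4)" 0, OF half_gt_zero[OF zero_less_one]]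
  by eventually_elim (rule main)
 then show ?thesis by (rule exI)
qed

lemma H1_le_mono: "H1_le u ep ==> 0 <= ep ==> ep <= ep' ==> H1_le u ep'"
proof -
 assume a: "H1_le u ep" "0 <= ep" "ep <= ep'"
 then have "ennreal (ep^2) <= ennreal (ep'^2)" by (intro ennreal_leI power_mono)
 then show ?thesis using a(1) unfolding H1_le_def by (blast intro: order_trans)
qed

theorem theorem4p3:
  assumes "CARD('n::finite) = 2 \<or> CARD('n) = 3"
  shows "\<exists>\<epsilon>0>0. \<forall>eh (c :: real ^ 'n) \<gamma>c \<gamma>e Cf Af f.
     0 < eh \<and> eh < \<epsilon>0 \<and> is_corner c \<and> 0 < Cf \<and> 0 < Af \<and>
     (if CARD('n) = 2 then \<gamma>c > 1 else \<gamma>c > 3/2 \<and> (\<forall>k. \<gamma>e k > 1)) \<and>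
     f \<in> J_class eh c \<gamma>c \<gamma>e Cf Af
     \<longrightarrow> (\<exists>\<Phi> :: real \<Rightarrow> nn.
           (\<forall>\<epsilon>. 0 < \<epsilon> \<and> \<epsilon> < 1 \<longrightarrow>
              nn_wf CARD('n) (\<Phi> \<epsilon>) \<and> H1_le (\<lambda>x. f x - nn_real (\<Phi> \<epsilon>) x) \<epsilon>) \<and>
           (\<lambda>\<epsilon>. Sup ((\<lambda>x. \<bar>nn_real (\<Phi> \<epsilon>) (x :: real ^ 'n)\<bar>) ` cube))
              \<in> O[at_right 0](\<lambda>\<epsilon>. \<bar>ln \<epsilon>\<bar> ^ (2 * CARD('n))) \<and>
           (\<lambda>\<epsilon>. real (nn_size (\<Phi> \<epsilon>)))
              \<in> O[at_right 0](\<lambda>\<epsilon>. \<bar>ln \<epsilon>\<bar> ^ (2 * CARD('n) + 1)) \<and>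
           (\<lambda>\<epsilon>. real (nn_depth (\<Phi> \<epsilon>)))
              \<in> O[at_right 0](\<lambda>\<epsilon>. \<bar>ln \<epsilon>\<bar> * ln \<bar>ln \<epsilon>\<bar>))"
\<comment> \<open>The threshold 1 suffices: smallness of \<open>eh\<close> serves to keep the radii
  and ratios that occur as weights below 1.\<close>
proof (intro exI[of _ 1] conjI allI impI)
 fix eh :: real and c :: "real ^ 'n" and gac :: real and gae :: "'n => real" and Cf Af :: real and f :: "real ^ 'n => real"
 assume a: "0 < eh & eh < 1 & is_corner c & 0 < Cf & 0 < Af \<and>
  (if CARD('n) = 2 then gac > 1 else gac > 3/2 & (ALL k. gae k > 1)) & f \<in> J_class eh c gac gae Cf Af"
 define good where "good K N Ph \<longleftrightarrow> nn_wf CARD('n) Ph & H1_le (%x. f x - nn_real Ph x) (exp (- real N)) \<and>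
  (\<forall>x\<in>(cube :: (real ^ 'n) set). \<bar>nn_real Ph x\<bar> <= K) \<and>
  real (nn_size Ph) <= K * real N ^ (2 * CARD('n) + 1) & real (nn_depth Ph) <= K * (real N * ln (real N))" for K :: real and N Ph
 have "EX K. \<forall>\<^sub>F N in sequentially. EX Ph. good K N Ph"
  unfolding good_def by (rule J_class_network[where eh = eh and c = c and gac = gac and gae = gae and Cf = Cf and Af = Af]) (use assms a in auto)
 then obtain K N0 where N0: "!!N. N0 <= N ==> EX Ph. good K N Ph" unfolding eventually_sequentially by blast
 define net' where "net' N = (SOME Ph. good K N Ph)" for N
 have net': "good K N (net' N)" if "N0 <= N" for N unfolding net'_def by (rule someI_ex[OF N0[OF that]])
 \<comment> \<open>exp(-NN) is at most ep whenever ep is positive. For ep that is not small the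
   network of index \<open>N0\<close> is used, which is at least as accurate as required.\<close>
 define NN where "NN ep = max N0 (nat \<lceil>- ln ep\<rceil>)" for ep :: real
 define Ph where "Ph ep = net' (NN ep)" for ep
 have Ph: "good K (NN ep) (Ph ep)" for ep unfolding Ph_def by (rule net') (simp add: NN_def)
 let ?half = "(1 / 2) *\<^sub>R (\<chi> _. 1) :: real ^ 'n"
 have half: "?half \<in> cube" by (simp add: cube_def)
 have "\<forall>x\<in>(cube :: (real ^ 'n) set). \<bar>nn_real (Ph 1) x\<bar> <= K" using Ph[of 1] unfolding good_def by blast
 then have "\<bar>nn_real (Ph 1) ?half\<bar> <= K" using half by (rule bspec)
 then have K0: "0 <= K" by linarith
 have wf: "nn_wf CARD('n) (Ph ep) & H1_le (%x. f x - nn_real (Ph ep) x) ep" if ep: "0 < ep & ep < 1" for ep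
 proof
  have "- ln ep <= real (NN ep)" using real_nat_ceiling_ge[of "- ln ep"] unfolding NN_def by (simp add: max_def)
  then have "exp (- real (NN ep)) <= exp (ln ep)" by simp
  then have "exp (- real (NN ep)) <= ep" using ep by simp
  then show "H1_le (%x. f x - nn_real (Ph ep) x) ep" using Ph[of ep] H1_le_mono[OF _ exp_ge_zero] unfolding good_def by blast
 qed (use Ph in \<open>auto simp: good_def\<close>)
 \<comment> \<open>In this range \<open>NN\<close> is the ceiling alone, and |ln ep| is at least 3,
   so that the rounding and the term ln 2 can be absorbed.\<close>
 have ev: "\<forall>\<^sub>F ep in at_right 0. ln ep <= - (real N0 + 3)"
  using ln_at_0 unfolding filterlim_at_bot by blast
 have X: "3 <= \<bar>ln ep\<bar>" "real (NN ep) <= 2 * \<bar>ln ep\<bar>" "1 <= real (NN ep)" if "ln ep <= - (real N0 + 3)" for ep :: real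
 proof -
  show 3: "3 <= \<bar>ln ep\<bar>" using that by linarith
  have "real (nat \<lceil>- ln ep\<rceil>) <= - ln ep + 1" using that of_int_ceiling_le_add_one[of "- ln ep"] by (simp add: of_nat_ceiling)
  then show "real (NN ep) <= 2 * \<bar>ln ep\<bar>" using that unfolding NN_def by (simp add: max_def)
  have "- ln ep <= real (NN ep)" using real_nat_ceiling_ge[of "- ln ep"] unfolding NN_def by (simp add: max_def)
  then show "1 <= real (NN ep)" using that by linarith
 qed
 have "(%ep. Sup ((%x. \<bar>nn_real (Ph ep) (x :: real ^ 'n)\<bar>) ` cube)) \<in> O[at_right 0](%ep. \<bar>ln ep\<bar> ^ (2 * CARD('n)))"
 proof (rule bigoI[of _ K], rule eventually_mono[OF ev])
  fix ep :: real assume "ln ep <= - (real N0 + 3)"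
  note X = X[OF this]
  let ?S = "(%x. \<bar>nn_real (Ph ep) (x :: real ^ 'n)\<bar>) ` cube"
  have b: "\<bar>nn_real (Ph ep) x\<bar> <= K" if "x \<in> cube" for x :: "real ^ 'n" using Ph[of ep] that unfolding good_def by blast
  \<comment> \<open>A real \<open>Sup\<close> is meaningful only for a bounded set; here K bounds
    the realizations uniformly in ep.\<close>
  have bd: "bdd_above ?S" using b by (intro bdd_aboveI2[where M = K]) auto
  have "Sup ?S <= K" by (rule cSUP_least) (use half b in auto)
  moreover have "0 <= Sup ?S" by (rule order_trans[OF abs_ge_zero cSUP_upper[OF half bd]])
  moreover have "1 <= \<bar>ln ep\<bar> ^ (2 * CARD('n))" using X(1) by (intro one_le_power) linarith
  then have "K * 1 <= K * \<bar>ln ep\<bar> ^ (2 * CARD('n))" by (intro mult_left_mono K0)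
  ultimately show "norm (Sup ?S) <= K * norm (\<bar>ln ep\<bar> ^ (2 * CARD('n)))" by (simp add: power_abs)
 qed
 moreover have "(%ep. real (nn_size (Ph ep))) \<in> O[at_right 0](%ep. \<bar>ln ep\<bar> ^ (2 * CARD('n) + 1))"
 proof (rule bigoI[of _ "K * 2 ^ (2 * CARD('n) + 1)"], rule eventually_mono[OF ev])
  fix ep :: real assume "ln ep <= - (real N0 + 3)"
  note X = X[OF this]
  have "real (nn_size (Ph ep)) <= K * real (NN ep) ^ (2 * CARD('n) + 1)" using Ph[of ep] unfolding good_def by blast
  also have "... <= K * (2 * \<bar>ln ep\<bar>) ^ (2 * CARD('n) + 1)" using X K0 by (intro mult_left_mono power_mono) auto
  also have "... = K * 2 ^ (2 * CARD('n) + 1) * \<bar>ln ep\<bar> ^ (2 * CARD('n) + 1)" by (simp only: power_mult_distrib mult.assoc)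
  finally show "norm (real (nn_size (Ph ep))) <= K * 2 ^ (2 * CARD('n) + 1) * norm (\<bar>ln ep\<bar> ^ (2 * CARD('n) + 1))"
  by (simp only: real_norm_def power_abs abs_idempotent abs_of_nat)
 qed
 moreover have "(%ep. real (nn_depth (Ph ep))) \<in> O[at_right 0](%ep. \<bar>ln ep\<bar> * ln \<bar>ln ep\<bar>)"
 proof (rule bigoI[of _ "K * 4"], rule eventually_mono[OF ev])
  fix ep :: real assume "ln ep <= - (real N0 + 3)"
  note X = X[OF this]
  have ln0: "0 <= ln \<bar>ln ep\<bar>" using X(1) by (intro ln_ge_zero) linarith
  have "ln (real (NN ep)) <= ln (2 * \<bar>ln ep\<bar>)" using X by (subst ln_le_cancel_iff) auto
  also have "... = ln 2 + ln \<bar>ln ep\<bar>" by (rule ln_mult_pos) (use X(1) in auto)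
  also have "ln 2 <= ln \<bar>ln ep\<bar>" using X(1) by (subst ln_le_cancel_iff) auto
  finally have l: "ln (real (NN ep)) <= 2 * ln \<bar>ln ep\<bar>" by simp
  have "real (nn_depth (Ph ep)) <= K * (real (NN ep) * ln (real (NN ep)))" using Ph[of ep] unfolding good_def by blast
  also have "... <= K * ((2 * \<bar>ln ep\<bar>) * (2 * ln \<bar>ln ep\<bar>))"
  using X ln0 K0 l by (intro mult_left_mono mult_mono ln_ge_zero) auto
  also have "... = K * 4 * (\<bar>ln ep\<bar> * ln \<bar>ln ep\<bar>)" by simp
  finally show "norm (real (nn_depth (Ph ep))) <= K * 4 * norm (\<bar>ln ep\<bar> * ln \<bar>ln ep\<bar>)"
  using ln0 by (simp add: abs_mult)
 qed
 ultimately show "\<exists>Ph :: real => nn.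
  (ALL ep. 0 < ep & ep < 1 -->
  nn_wf CARD('n) (Ph ep) & H1_le (%x. f x - nn_real (Ph ep) x) ep) \<and>
  (%ep. Sup ((%x. \<bar>nn_real (Ph ep) (x :: real ^ 'n)\<bar>) ` cube))
  \<in> O[at_right 0](%ep. \<bar>ln ep\<bar> ^ (2 * CARD('n))) \<and>
  (%ep. real (nn_size (Ph ep)))
  \<in> O[at_right 0](%ep. \<bar>ln ep\<bar> ^ (2 * CARD('n) + 1)) \<and>
  (%ep. real (nn_depth (Ph ep)))
  \<in> O[at_right 0](%ep. \<bar>ln ep\<bar> * ln \<bar>ln ep\<bar>)"
  using wf by (intro exI[of _ Ph]) blast
qed simp

end
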